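(* There exist an ellipsoid $B\subset \mathbb{C}^2$ and a real analytic, Levi-flat hypersurface $M\subset\mathbb{C}^2$ intersecting the boundary $bB$ of $B$ transversely such that the Levi foliation of $M$ has trivial holonomy and the set $A=M\cap B$ satisfies the following: (i) the closure $\overline{A}$ is diffeomorphic to the (closed) three-ball and admits a Stein neighborhood basis in $\mathbb{C}^2$; (ii) any real analytic function on $A$ which is constant on every leaf of the Levi foliation of $A$ is constant; (iii) any pluriharmonic function in a connected open neighborhood of $A$ in $\mathbb{C}^2$ which vanishes on $A$ is identically zero.
   Context: A real hypersurface $M$ in an $n$-dimensional complex manifold is called Levi-flat if it is foliated by complex manifolds of dimension $n-1$ (so by Riemann surfaces when $n=2$); this foliation is called the Levi foliation of $M$, its leaves are called Levi leaves, and it is as smooth as $M$ itself (real analytic if $M$ is real analytic). The Levi foliation of $A=M\cap B$, which is an open subset of $M$, is the restriction to $A$ of the Levi foliation of $M$; its leaves are the connected components of the intersections of the leaves of $M$ with $A$ (components with respect to the leaf topology). The ellipsoid $B$ is understood as an open solid ellipsoid in $\mathbb{C}^2=\mathbb{R}^4$, with boundary $bB$. A real function $v$ on an open set is pluriharmonic if $dd^c v = 2i\,\partial\overline{\partial} v=0$. A compact set admits a Stein neighborhood basis if every open neighborhood of it contains an open Stein neighborhood of it. *)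

theory Defs
  imports "HOL-Complex_Analysis.Complex_Analysis"
begin

text \<open>
  Complex Euclidean 2-space is \<open>complex ^ 2\<close>; as a real Euclidean space it is 4-dimensional, and
  its norm is the Euclidean one. Multiplication by a complex scalar is \<open>*s\<close>.
\<close>

section \<open>Smooth and real analytic maps\<close>

text \<open>Multi-indices are the extensional functions from \<open>Basis\<close> to the natural numbers.\<close>

definition real_analytic_at ::
  "('a::euclidean_space \<Rightarrow> 'b::real_normed_vector) \<Rightarrow> 'a \<Rightarrow> bool" where
  "real_analytic_at f x \<longleftrightarrow>
    (\<exists>c r. 0 < r \<and>
      (\<forall>y\<in>ball x r.
        ((\<lambda>\<alpha>. (\<Prod>b\<in>Basis. ((y - x) \<bullet> b) ^ \<alpha> b) *\<^sub>R c \<alpha>) has_sum f y)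
          (Basis \<rightarrow>\<^sub>E (UNIV :: nat set))))"

text \<open>On a subset that is not open, such as a submanifold, real analyticity and smoothness mean
  local extendability to a map of that class on an open set of the ambient space.\<close>

definition real_analytic_map_on ::
  "('a::euclidean_space \<Rightarrow> 'b::real_normed_vector) \<Rightarrow> 'a set \<Rightarrow> bool" where
  "real_analytic_map_on f S \<longleftrightarrow>
    (\<forall>x\<in>S. \<exists>U F. open U \<and> x \<in> U \<and> (\<forall>y\<in>U. real_analytic_at F y) \<and> (\<forall>y\<in>S \<inter> U. F y = f y))"

text \<open>Class \<open>C\<^sup>k\<close> on an open set \<open>U\<close>.\<close>

primrec Ck_on ::
  "nat \<Rightarrow> ('a::euclidean_space \<Rightarrow> 'b::real_normed_vector) \<Rightarrow> 'a set \<Rightarrow> bool" where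
  "Ck_on 0 f U \<longleftrightarrow> continuous_on U f"
| "Ck_on (Suc k) f U \<longleftrightarrow>
    (\<forall>x\<in>U. f differentiable (at x)) \<and>
    (\<forall>v. Ck_on k (\<lambda>x. frechet_derivative f (at x) v) U)"

definition smooth_map_on ::
  "('a::euclidean_space \<Rightarrow> 'b::real_normed_vector) \<Rightarrow> 'a set \<Rightarrow> bool" where
  "smooth_map_on f S \<longleftrightarrow>
    (\<forall>x\<in>S. \<exists>U F. open U \<and> x \<in> U \<and> (\<forall>k. Ck_on k F U) \<and> (\<forall>y\<in>S \<inter> U. F y = f y))"

definition diffeomorphic ::
  "'a::euclidean_space set \<Rightarrow> 'b::euclidean_space set \<Rightarrow> bool" where
  "diffeomorphic S T \<longleftrightarrow>
    (\<exists>f g. smooth_map_on f S \<and> smooth_map_on g T \<and> f ` S = T \<and> g ` T = S \<and>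
      (\<forall>x\<in>S. g (f x) = x) \<and> (\<forall>y\<in>T. f (g y) = y))"

section \<open>Ellipsoids, hypersurfaces and transversality\<close>

definition open_ellipsoid :: "'a::euclidean_space set \<Rightarrow> bool" where
  "open_ellipsoid B \<longleftrightarrow> (\<exists>c (L :: 'a \<Rightarrow> 'a). linear L \<and> bij L \<and> B = (\<lambda>x. c + L x) ` ball 0 1)"

definition real_analytic_hypersurface :: "'a::euclidean_space set \<Rightarrow> bool" where
  "real_analytic_hypersurface M \<longleftrightarrow>
    (\<forall>p\<in>M. \<exists>U (\<rho> :: 'a \<Rightarrow> real). open U \<and> p \<in> U \<and>
      (\<forall>x\<in>U. real_analytic_at \<rho> x \<and> frechet_derivative \<rho> (at x) \<noteq> (\<lambda>_. 0)) \<and>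
      M \<inter> U = {x \<in> U. \<rho> x = 0})"

text \<open>Velocities at \<open>p\<close> of curves in \<open>S\<close>.\<close>

definition tangent_space :: "'a::euclidean_space set \<Rightarrow> 'a \<Rightarrow> 'a set" where
  "tangent_space S p =
    {v. \<exists>\<gamma> e. 0 < (e::real) \<and> \<gamma> 0 = p \<and> (\<forall>t\<in>{-e<..<e}. \<gamma> t \<in> S) \<and>
      (\<gamma> has_vector_derivative v) (at 0)}"

definition intersects_transversely :: "'a::euclidean_space set \<Rightarrow> 'a set \<Rightarrow> bool" where
  "intersects_transversely M N \<longleftrightarrow>
    (\<forall>p\<in>M \<inter> N. {u + v |u v. u \<in> tangent_space M p \<and> v \<in> tangent_space N p} = UNIV)"

section \<open>The Levi foliation\<close>

text \<open>
  A real analytic parametrization, by (unit disc) \<open>\<times>\<close> \<open>(-1,1)\<close>, of an open piece of the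
  hypersurface \<open>M\<close>, whose plaques (the images of disc \<open>\<times>\<close> point) are holomorphically immersed
  discs. No compatibility of different charts has to be imposed: every plaque is an integral
  surface of the field of complex tangent lines of \<open>M\<close>, so two plaques always meet in a set that
  is open in both.
\<close>

definition levi_chart :: "(complex ^ 2) set \<Rightarrow> (complex \<times> real \<Rightarrow> complex ^ 2) \<Rightarrow> bool" where
  "levi_chart M \<Phi> \<longleftrightarrow>
    (let V = ball 0 1 \<times> {-1<..<1} in
      (\<forall>x\<in>V. real_analytic_at \<Phi> x \<and> inj (frechet_derivative \<Phi> (at x))) \<and>
      (\<exists>\<Psi>. homeomorphism V (\<Phi> ` V) \<Phi> \<Psi>) \<and>
      openin (top_of_set M) (\<Phi> ` V) \<and>
      (\<forall>t\<in>{-1<..<1}. \<forall>j. (\<lambda>\<zeta>. \<Phi> (\<zeta>, t) $ j) holomorphic_on ball 0 1))"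

definition levi_flat :: "(complex ^ 2) set \<Rightarrow> bool" where
  "levi_flat M \<longleftrightarrow> (\<forall>p\<in>M. \<exists>\<Phi>. levi_chart M \<Phi> \<and> p \<in> \<Phi> ` (ball 0 1 \<times> {-1<..<1}))"

definition leaf_topology :: "(complex ^ 2) set \<Rightarrow> (complex ^ 2) topology" where
  "leaf_topology M =
    topology_generated_by {\<Phi> ` (ball 0 1 \<times> {t}) |\<Phi> t. levi_chart M \<Phi> \<and> t \<in> {-1<..<1}}"

definition levi_leaves :: "(complex ^ 2) set \<Rightarrow> (complex ^ 2) set set" where
  "levi_leaves M = connected_components_of (leaf_topology M)"

text \<open>The leaves of the restriction to \<open>A\<close> of the Levi foliation of \<open>M\<close>.\<close>

definition restricted_leaves :: "(complex ^ 2) set \<Rightarrow> (complex ^ 2) set \<Rightarrow> (complex ^ 2) set set" where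
  "restricted_leaves M A =
    (\<Union>L\<in>levi_leaves M. connected_components_of (subtopology (leaf_topology M) (L \<inter> A)))"

text \<open>
  \<open>h\<close> represents the holonomy germ of the leafwise loop \<open>\<gamma>\<close>, computed on the transversal
  \<open>t \<mapsto> \<Phi> (0, t)\<close> through the base point: each nearby point \<open>\<Phi> (0, t)\<close> is carried to \<open>\<Phi> (0, h t)\<close>
  along a path \<open>H (_, t)\<close> in its own leaf, with \<open>H\<close> continuous and \<open>H (_, 0) = \<gamma>\<close>.
  The germ of \<open>h\<close> at 0 does not depend on \<open>H\<close>.
\<close>

definition holonomy_of_loop ::
  "(complex ^ 2) set \<Rightarrow> (real \<Rightarrow> complex ^ 2) \<Rightarrow> (complex \<times> real \<Rightarrow> complex ^ 2) \<Rightarrow> (real \<Rightarrow> real) \<Rightarrow> bool"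
where
  "holonomy_of_loop M \<gamma> \<Phi> h \<longleftrightarrow>
    pathin (leaf_topology M) \<gamma> \<and> \<gamma> 1 = \<gamma> 0 \<and> levi_chart M \<Phi> \<and> \<Phi> (0, 0) = \<gamma> 0 \<and>
    (\<exists>e H. 0 < e \<and> e \<le> 1 \<and> continuous_on ({0..1} \<times> {-e<..<e}) H \<and>
      (\<forall>s\<in>{0..1}. H (s, 0) = \<gamma> s) \<and>
      (\<forall>t\<in>{-e<..<e}. pathin (leaf_topology M) (\<lambda>s. H (s, t)) \<and>
        H (0, t) = \<Phi> (0, t) \<and> h t \<in> {-1<..<1} \<and> H (1, t) = \<Phi> (0, h t)))"

definition trivial_holonomy :: "(complex ^ 2) set \<Rightarrow> bool" where
  "trivial_holonomy M \<longleftrightarrow>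
    (\<forall>\<gamma> \<Phi> h. holonomy_of_loop M \<gamma> \<Phi> h \<longrightarrow> (\<forall>\<^sub>F t in nhds 0. h t = t))"

section \<open>Stein neighborhoods and pluriharmonic functions\<close>

definition holomorphic_on_C2 :: "(complex ^ 2 \<Rightarrow> complex) \<Rightarrow> (complex ^ 2) set \<Rightarrow> bool" where
  "holomorphic_on_C2 f U \<longleftrightarrow>
    (\<forall>x\<in>U. \<exists>D. (f has_derivative D) (at x) \<and> (\<forall>c v. D (c *s v) = c * D v))"

definition holomorphic_hull :: "(complex ^ 2) set \<Rightarrow> (complex ^ 2) set \<Rightarrow> (complex ^ 2) set" where
  "holomorphic_hull U K =
    {x \<in> U. \<forall>f. holomorphic_on_C2 f U \<longrightarrow>
      (\<forall>c. (\<forall>y\<in>K. norm (f y) \<le> c) \<longrightarrow> norm (f x) \<le> c)}"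

definition stein_open :: "(complex ^ 2) set \<Rightarrow> bool" where
  "stein_open U \<longleftrightarrow> open U \<and>
    (\<forall>K. compact K \<and> K \<subseteq> U \<longrightarrow> compact (holomorphic_hull U K)) \<and>
    (\<forall>x\<in>U. \<forall>y\<in>U. x \<noteq> y \<longrightarrow> (\<exists>f. holomorphic_on_C2 f U \<and> f x \<noteq> f y))"

definition has_stein_neighborhood_basis :: "(complex ^ 2) set \<Rightarrow> bool" where
  "has_stein_neighborhood_basis K \<longleftrightarrow>
    (\<forall>U. open U \<and> K \<subseteq> U \<longrightarrow> (\<exists>V. stein_open V \<and> K \<subseteq> V \<and> V \<subseteq> U))"

text \<open>The 1-form \<open>d\<^sup>c v = \<i> (\<partial>\<bar> - \<partial>) v\<close>, where \<open>\<partial>\<bar>\<close> is the Cauchy-Riemann operator, at the point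
  \<open>x\<close>; then \<open>d d\<^sup>c v = 2 \<i> \<partial> \<partial>\<bar> v\<close>.\<close>

definition dc_form :: "(complex ^ 2 \<Rightarrow> real) \<Rightarrow> complex ^ 2 \<Rightarrow> complex ^ 2 \<Rightarrow> real" where
  "dc_form v x a = - frechet_derivative v (at x) (\<i> *s a)"

definition ddc_form :: "(complex ^ 2 \<Rightarrow> real) \<Rightarrow> complex ^ 2 \<Rightarrow> complex ^ 2 \<Rightarrow> complex ^ 2 \<Rightarrow> real" where
  "ddc_form v x a b =
    frechet_derivative (\<lambda>y. dc_form v y b) (at x) a - frechet_derivative (\<lambda>y. dc_form v y a) (at x) b"

definition pluriharmonic_on :: "(complex ^ 2 \<Rightarrow> real) \<Rightarrow> (complex ^ 2) set \<Rightarrow> bool" where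
  "pluriharmonic_on v U \<longleftrightarrow> Ck_on 2 v U \<and> (\<forall>x\<in>U. \<forall>a b. ddc_form v x a b = 0)"

end

theory Submission
  imports Defs
begin

text \<open>
  Fix an irrational \<open>\<lambda>\<close> slightly larger than 1 and let \<open>M\<close> be swept out, inside a ball around \<open>(1, 1)\<close>, by
  the rotated real planes \<open>(x\<^sub>1 e\<^bsup>it\<^esup>, x\<^sub>2 e\<^bsup>-i\<lambda>t\<^esup>)\<close>. This is the locus where \<open>z\<^bsup>\<lambda>\<^esup> w\<close>, or equivalently
  \<open>z w\<^bsup>1/\<lambda>\<^esup>\<close>, is real; these functions are constant on the Levi leaves and separate them locally, which
  excludes holonomy. Let \<open>B\<close> be a concentric, slightly smaller ball.

  For (ii), restrict a leafwise constant function \<open>u\<close> to a chord \<open>x\<^sub>1 + x\<^sub>2 = m\<close>, \<open>t = 0\<close>. A leaf near its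
  tangency with the chord meets the chord twice; continuing the resulting functional equation
  analytically along the chord, up to its ends on the two separatrices, gives
  \<open>u(\<xi>) = u(\<xi>')\<close>, where \<open>\<xi>\<close> and \<open>m - \<xi>'\<close> tend to 0 with \<open>m - \<xi>' \<sim> C \<xi>\<^bsup>\<lambda>\<^esup>\<close>. If \<open>u\<close> were not constant, its finite
  orders of contact \<open>k\<close>, \<open>l\<close> at the two ends would satisfy \<open>k = \<lambda> l\<close>. So \<open>u\<close> is constant on chords, which all
  meet a common separatrix, hence on the slice \<open>t = 0\<close> by analyticity along lines; varying \<open>t\<close> moves points
  within their leaves, so the other slices follow.

  For (iii), let \<open>v\<close> vanish on \<open>A\<close>, let \<open>\<eta>\<^sub>j\<close> be its derivatives in the directions \<open>i e\<^sub>j\<close> on the slice \<open>t = 0\<close>.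
  Differentiating along the sweep gives \<open>x\<^sub>1 \<eta>\<^sub>1 = \<lambda> x\<^sub>2 \<eta>\<^sub>2\<close>, and \<open>dd\<^sup>c v = 0\<close> gives \<open>\<partial>\<^sub>2 \<eta>\<^sub>1 = \<partial>\<^sub>1 \<eta>\<^sub>2\<close>. Together
  they say that \<open>x\<^sub>2 \<eta>\<^sub>2\<close> is a first integral of the foliation, and it vanishes at both ends of the
  chords. Thus the gradient of \<open>v\<close> vanishes on a maximally totally real plane, hence everywhere.

  For the Stein neighborhoods, a point outside \<open>K = closure A\<close> is separated from \<open>K\<close> by a polyhedron
  \<open>{P \<in> N}\<close>, where \<open>P\<close> approximates \<open>z w\<^bsup>1/\<lambda>\<^esup>\<close> and \<open>N\<close> is a neighborhood of \<open>P(K)\<close>; planar open sets are Stein,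
  and finitely many such polyhedra suffice.
\<close>

text \<open>The radii are squeezed from both sides. A ball around \<open>(1, 1)\<close> needs radius
  more than 1 to reach both separatrices, where the chords end, and less than \<open>sqrt 2\<close>
  to avoid the origin, the singular point of the foliation. \<open>1 < lam\<close> makes the squared
  inner radius exceed 1, and \<open>lam < 4 / 3\<close> keeps it below the squared outer radius
  \<open>5 / 4\<close>, which in turn is small enough to exclude unwanted points of the real locus
  at large times.

  The coordinates \<open>x\<close> also take nonpositive values in the ball, so neither invariant
  has a good branch of its power on all of \<open>M\<close>. Local statements are therefore made for
  an ordered pair \<open>i\<close>, \<open>j\<close> of coordinates with
  \<open>Re (p $ j) > 0\<close>, where only coordinate \<open>j\<close> carries the noninteger
  power; every point of the ball admits such a pair.

  Leaves and holonomy are defined through arbitrary Levi charts, not only convenient ones. The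
  bridge is \<open>chart_transverse\<close>: in any chart the invariant is locally constant on
  plaques and injective across them. For (i), the slices of the cap at fixed time are round discs,
  whose radii are rescaled to those of the slices of a ball.\<close>

no_notation fps_nth (infixl "$" 75)

section \<open>Absolutely convergent multi-variable power series\<close>

definition monomial_value :: "'a::euclidean_space \<Rightarrow> ('a \<Rightarrow> nat) \<Rightarrow> real" where
  "monomial_value y \<alpha> = (\<Prod>b\<in>Basis. (y \<bullet> b) ^ \<alpha> b)"

definition multi_deg :: "('a::euclidean_space \<Rightarrow> nat) \<Rightarrow> nat" where
  "multi_deg \<alpha> = (\<Sum>b\<in>Basis. \<alpha> b)"

abbreviation multi_indices :: "('a::euclidean_space \<Rightarrow> nat) set" where
  "multi_indices \<equiv> Basis \<rightarrow>\<^sub>E UNIV"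

text \<open>The bound \<open>K\<close> on the weighted sum of coefficient norms is part of the
  notion because it makes infinite series of such functions summable;
  \<open>real_analytic_at\<close> alone carries no size that could be added up.\<close>

definition has_ps_bound :: "real \<Rightarrow> real \<Rightarrow> ('a::euclidean_space \<Rightarrow> 'b::banach) \<Rightarrow> bool" where
  "has_ps_bound r K f \<longleftrightarrow> (\<exists>c S. ((\<lambda>\<alpha>. norm (c \<alpha>) * r ^ multi_deg \<alpha>) has_sum S) multi_indices \<and> S \<le> K \<and>
     (\<forall>y\<in>ball 0 r. ((\<lambda>\<alpha>. monomial_value y \<alpha> *\<^sub>R c \<alpha>) has_sum f y) multi_indices))"

lemma abs_monomial_value_le:
  assumes "norm y \<le> r"
  shows "\<bar>monomial_value y \<alpha>\<bar> \<le> r ^ multi_deg \<alpha>"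
proof -
  have "\<bar>monomial_value y \<alpha>\<bar> = (\<Prod>b\<in>Basis. \<bar>y \<bullet> b\<bar> ^ \<alpha> b)"
    by (simp add: monomial_value_def abs_prod power_abs)
  also have "\<dots> \<le> (\<Prod>b\<in>(Basis::'a set). r ^ \<alpha> b)"
    using assms by (intro prod_mono conjI power_mono) (auto intro: order_trans[OF Basis_le_norm])
  finally show ?thesis
    by (simp add: multi_deg_def power_sum)
qed

lemma has_ps_bound_imp_real_analytic_at:
  assumes "has_ps_bound r K (\<lambda>y. f (x + y))" "0 < r"
  shows "real_analytic_at f x"
proof -
  obtain c where c: "\<And>y. y \<in> ball 0 r \<Longrightarrow>
      ((\<lambda>\<alpha>. monomial_value y \<alpha> *\<^sub>R c \<alpha>) has_sum f (x + y)) multi_indices"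
    using assms(1) unfolding has_ps_bound_def by blast
  show ?thesis
    unfolding real_analytic_at_def
  proof (intro exI[of _ c] exI[of _ r] conjI ballI assms)
    fix y assume "y \<in> ball x r"
    then have "y - x \<in> ball 0 r" by (simp add: dist_norm norm_minus_commute)
    from c[OF this] show "((\<lambda>\<alpha>. (\<Prod>b\<in>Basis. ((y - x) \<bullet> b) ^ \<alpha> b) *\<^sub>R c \<alpha>) has_sum f y) multi_indices"
      by (simp add: monomial_value_def)
  qed
qed

lemma has_ps_bound_const:
  assumes "r > 0"
  shows "has_ps_bound r (norm k) (\<lambda>_::'a::euclidean_space. k::'b::banach)"
proof -
  define z where "z = (\<lambda>b\<in>(Basis::'a set). 0::nat)"
  have z: "z \<in> multi_indices" "multi_deg z = 0" "\<And>y. monomial_value y z = 1"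
    by (auto simp: z_def multi_deg_def monomial_value_def)
  define c where "c = (\<lambda>\<alpha>. if \<alpha> = z then k else 0)"
  have 1: "((\<lambda>\<alpha>. norm (c \<alpha>) * r ^ multi_deg \<alpha>) has_sum norm k) multi_indices"
    by (rule has_sum_finite_neutralI[of "{z}"]) (auto simp: z c_def)
  have 2: "((\<lambda>\<alpha>. monomial_value y \<alpha> *\<^sub>R c \<alpha>) has_sum k) multi_indices" for y
    by (rule has_sum_finite_neutralI[of "{z}"]) (auto simp: z c_def)
  show ?thesis unfolding has_ps_bound_def using 1 2 by blast
qed

lemma has_ps_bound_bounded_linear:
  assumes f: "has_ps_bound r K f" and L: "bounded_linear L" and le: "\<And>x. norm (L x) \<le> C * norm x"
    and "r > 0" "C \<ge> 0"
  shows "has_ps_bound r (C * K) (\<lambda>y. L (f y))"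
proof -
  obtain c S where c: "((\<lambda>\<alpha>. norm (c \<alpha>) * r ^ multi_deg \<alpha>) has_sum S) multi_indices" "S \<le> K"
      "\<And>y. y \<in> ball 0 r \<Longrightarrow> ((\<lambda>\<alpha>. monomial_value y \<alpha> *\<^sub>R c \<alpha>) has_sum f y) multi_indices"
    using f unfolding has_ps_bound_def by blast
  have s: "((\<lambda>\<alpha>. C * (norm (c \<alpha>) * r ^ multi_deg \<alpha>)) has_sum (C * S)) multi_indices"
    using c(1) by (rule has_sum_cmult_right)
  have le': "norm (norm (L (c \<alpha>)) * r ^ multi_deg \<alpha>) \<le> C * (norm (c \<alpha>) * r ^ multi_deg \<alpha>)" for \<alpha>
    using le[of "c \<alpha>"] \<open>r > 0\<close> by (simp add: abs_mult flip: mult.assoc)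
  have sm: "(\<lambda>\<alpha>. norm (L (c \<alpha>)) * r ^ multi_deg \<alpha>) summable_on multi_indices"
    by (rule summable_on_comparison_test[OF has_sum_imp_summable[OF s]])
       (use le' \<open>r > 0\<close> in \<open>auto intro: order_trans[OF abs_ge_self]\<close>)
  then obtain S' where S': "((\<lambda>\<alpha>. norm (L (c \<alpha>)) * r ^ multi_deg \<alpha>) has_sum S') multi_indices"
    by (auto simp: summable_on_def)
  have "S' \<le> C * S"
    by (rule has_sum_mono[OF S' s]) (use le' in \<open>auto intro: order_trans[OF abs_ge_self]\<close>)
  also have "\<dots> \<le> C * K" using c(2) \<open>C \<ge> 0\<close> by (rule mult_left_mono)
  finally have S'K: "S' \<le> C * K" .
  have "((\<lambda>\<alpha>. monomial_value y \<alpha> *\<^sub>R L (c \<alpha>)) has_sum L (f y)) multi_indices" if "y \<in> ball 0 r" for y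
    using has_sum_bounded_linear[OF L c(3)[OF that]]
    by (simp add: o_def linear_scale[OF bounded_linear.linear[OF L]])
  then show ?thesis unfolding has_ps_bound_def using S' S'K by (intro exI[of _ "\<lambda>\<alpha>. L (c \<alpha>)"]) blast
qed

text \<open>The coefficients of all the \<open>f n\<close>, weighted by
  \<open>r ^ multi_deg \<alpha>\<close>, form an absolutely summable double family. Fubini then
  allows summing over \<open>n\<close> first, both for the coefficients and for the values at each
  point.\<close>

lemma has_ps_bound_series:
  assumes f: "\<And>n::nat. has_ps_bound r (K n) (f n)" and K: "summable K" and r: "r > 0"
  shows "has_ps_bound r (suminf K) (\<lambda>y. \<Sum>n. f n y)"
proof -
  have "\<forall>n. \<exists>c S. ((\<lambda>\<alpha>. norm (c \<alpha>) * r ^ multi_deg \<alpha>) has_sum S) multi_indices \<and> S \<le> K n \<and>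
     (\<forall>y\<in>ball 0 r. ((\<lambda>\<alpha>. monomial_value y \<alpha> *\<^sub>R c \<alpha>) has_sum f n y) multi_indices)"
    using f unfolding has_ps_bound_def by blast
  from choice[OF this] obtain c where
    "\<forall>n. \<exists>S. ((\<lambda>\<alpha>. norm (c n \<alpha>) * r ^ multi_deg \<alpha>) has_sum S) multi_indices \<and> S \<le> K n \<and>
     (\<forall>y\<in>ball 0 r. ((\<lambda>\<alpha>. monomial_value y \<alpha> *\<^sub>R c n \<alpha>) has_sum f n y) multi_indices)"
    by blast
  from choice[OF this] obtain S where c: "\<And>n. ((\<lambda>\<alpha>. norm (c n \<alpha>) * r ^ multi_deg \<alpha>) has_sum S n) multi_indices"
      "\<And>n. S n \<le> K n"
      "\<And>n y. y \<in> ball 0 r \<Longrightarrow> ((\<lambda>\<alpha>. monomial_value y \<alpha> *\<^sub>R c n \<alpha>) has_sum f n y) multi_indices"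
    by blast
  have S0: "S n \<ge> 0" for n
    by (rule has_sum_nonneg[OF c(1)]) (use r in auto)
  have Ssum: "summable S"
    by (rule summable_comparison_test'[OF K]) (use S0 c(2) in auto)
  have Son: "S summable_on UNIV"
    using norm_summable_imp_summable_on[of S] Ssum S0 by simp
  let ?w = "\<lambda>(n, \<alpha>). norm (c n \<alpha>) * r ^ multi_deg \<alpha>"
  have w: "?w summable_on (UNIV \<times> multi_indices)"
    by (rule summable_on_SigmaI[where g = S]) (use c(1) Son r in auto)
  have wsw: "(\<lambda>(\<alpha>, n). norm (c n \<alpha>) * r ^ multi_deg \<alpha>) summable_on (multi_indices \<times> UNIV)"
    using iffD1[OF summable_on_swap w] by (simp add: case_prod_unfold)
  have cn: "(\<lambda>n. norm (c n \<alpha>) * r ^ multi_deg \<alpha>) summable_on UNIV" if "\<alpha> \<in> multi_indices" for \<alpha>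
    using summable_on_SigmaD1[OF wsw that] by simp
  have cn': "(\<lambda>n. norm (c n \<alpha>)) summable_on UNIV" if "\<alpha> \<in> multi_indices" for \<alpha>
    using summable_on_cmult_left[OF cn[OF that], of "inverse (r ^ multi_deg \<alpha>)"] r by (simp add: mult.assoc)
  define C where "C = (\<lambda>\<alpha>. infsum (\<lambda>n. c n \<alpha>) UNIV)"
  have C: "((\<lambda>n. c n \<alpha>) has_sum C \<alpha>) UNIV" if "\<alpha> \<in> multi_indices" for \<alpha>
    unfolding C_def by (rule has_sum_infsum[OF abs_summable_summable[OF cn'[OF that]]])
  let ?T = "\<lambda>\<alpha>. infsum (\<lambda>n. norm (c n \<alpha>) * r ^ multi_deg \<alpha>) UNIV"
  have T: "((\<lambda>(\<alpha>, n). norm (c n \<alpha>) * r ^ multi_deg \<alpha>) has_sum suminf S) (multi_indices \<times> UNIV)"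
  proof -
    have "(?w has_sum infsum S UNIV) (UNIV \<times> multi_indices)"
      by (rule has_sum_SigmaI[where g = S]) (use c(1) has_sum_infsum[OF Son] w in simp_all)
    from iffD1[OF has_sum_swap this]
    have "((\<lambda>(\<alpha>, n). norm (c n \<alpha>) * r ^ multi_deg \<alpha>) has_sum infsum S UNIV) (multi_indices \<times> UNIV)"
      by (simp add: case_prod_unfold)
    moreover have "infsum S UNIV = suminf S"
      using sums_unique[OF has_sum_imp_sums[OF has_sum_infsum[OF Son]]] by simp
    ultimately show ?thesis by simp
  qed
  have Tsum: "(?T has_sum suminf S) multi_indices"
    by (rule has_sum_SigmaD[OF T]) (use has_sum_infsum[OF cn] in simp)
  have le: "norm (C \<alpha>) * r ^ multi_deg \<alpha> \<le> ?T \<alpha>" if "\<alpha> \<in> multi_indices" for \<alpha>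
  proof -
    have "norm (C \<alpha>) \<le> infsum (\<lambda>n. norm (c n \<alpha>)) UNIV"
      unfolding C_def by (rule norm_infsum_bound) (rule cn'[OF that])
    then have "norm (C \<alpha>) * r ^ multi_deg \<alpha> \<le> infsum (\<lambda>n. norm (c n \<alpha>)) UNIV * r ^ multi_deg \<alpha>"
      using r by (intro mult_right_mono) auto
    also have "\<dots> = ?T \<alpha>" using r by (simp add: infsum_cmult_left')
    finally show ?thesis .
  qed
  have sm: "(\<lambda>\<alpha>. norm (C \<alpha>) * r ^ multi_deg \<alpha>) summable_on multi_indices"
    by (rule summable_on_comparison_test[OF has_sum_imp_summable[OF Tsum]]) (use le r in auto)
  then obtain S' where S': "((\<lambda>\<alpha>. norm (C \<alpha>) * r ^ multi_deg \<alpha>) has_sum S') multi_indices"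
    by (auto simp: summable_on_def)
  have "S' \<le> suminf S" by (rule has_sum_mono[OF S' Tsum le])
  also have "\<dots> \<le> suminf K" by (rule suminf_le[OF c(2) Ssum K])
  finally have S'K: "S' \<le> suminf K" .
  have val: "((\<lambda>\<alpha>. monomial_value y \<alpha> *\<^sub>R C \<alpha>) has_sum (\<Sum>n. f n y)) multi_indices" if y: "y \<in> ball 0 r" for y
  proof -
    have yr: "norm y \<le> r" using y by simp
    have abs: "(\<lambda>(n,\<alpha>). monomial_value y \<alpha> *\<^sub>R c n \<alpha>) summable_on (UNIV \<times> multi_indices)"
    proof (rule abs_summable_summable, rule summable_on_comparison_test[OF w])
      fix p :: "nat \<times> ('a \<Rightarrow> nat)"
      obtain n \<alpha> where p: "p = (n, \<alpha>)" by (cases p)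
      have "\<bar>monomial_value y \<alpha>\<bar> * norm (c n \<alpha>) \<le> r ^ multi_deg \<alpha> * norm (c n \<alpha>)"
        by (rule mult_right_mono[OF abs_monomial_value_le[OF yr]]) simp
      then show "norm (case p of (n, \<alpha>) \<Rightarrow> monomial_value y \<alpha> *\<^sub>R c n \<alpha>) \<le> ?w p"
        by (simp add: p mult.commute)
    qed simp
    then obtain X where X: "((\<lambda>(n,\<alpha>). monomial_value y \<alpha> *\<^sub>R c n \<alpha>) has_sum X) (UNIV \<times> multi_indices)"
      by (auto simp: summable_on_def)
    have "((\<lambda>n. f n y) has_sum X) UNIV"
      by (rule has_sum_SigmaD[OF X]) (use c(3)[OF y] in simp)
    then have "X = (\<Sum>n. f n y)" using sums_unique[OF has_sum_imp_sums] by blast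
    moreover have "((\<lambda>(\<alpha>,n). monomial_value y \<alpha> *\<^sub>R c n \<alpha>) has_sum X) (multi_indices \<times> UNIV)"
      using iffD1[OF has_sum_swap X] by (simp add: case_prod_unfold)
    then have "((\<lambda>\<alpha>. monomial_value y \<alpha> *\<^sub>R C \<alpha>) has_sum X) multi_indices"
      by (rule has_sum_SigmaD) (simp add: has_sum_scaleR[OF C])
    ultimately show ?thesis by simp
  qed
  show ?thesis unfolding has_ps_bound_def using S' S'K val by blast
qed

lemma has_ps_bound_add:
  assumes f: "has_ps_bound r K f" and g: "has_ps_bound r L g" and r: "r > 0"
  shows "has_ps_bound r (K + L) (\<lambda>y. f y + g y)"
proof -
  \<comment> \<open>A sum of two functions is treated as a series with two nonzero terms.\<close>
  let ?h = "\<lambda>n::nat. if n = 0 then f else if n = 1 then g else (\<lambda>_. 0)"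
  let ?B = "\<lambda>n::nat. if n = 0 then K else if n = 1 then L else 0"
  have B: "?B sums (K + L)"
    using sums_finite[of "{0,1}" ?B] by simp
  have h: "(\<lambda>n. ?h n y) sums (f y + g y)" for y
    using sums_finite[of "{0,1}" "\<lambda>n. ?h n y"] by simp
  have "has_ps_bound r (suminf ?B) (\<lambda>y. \<Sum>n. ?h n y)"
    by (rule has_ps_bound_series) (use f g r B has_ps_bound_const[OF r, of 0] in \<open>auto simp: sums_iff\<close>)
  then show ?thesis using B h by (simp add: sums_iff)
qed

text \<open>Multiplication by a coordinate shifts the multi-indices: the new coefficient at
  \<open>up \<alpha>\<close> is \<open>c \<alpha>\<close>, and indices with zero entry at
  \<open>b\<close> get coefficient 0. The degree rises by one, whence the factor
  \<open>r\<close>.\<close>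

lemma has_ps_bound_coord:
  fixes f :: "'a::euclidean_space \<Rightarrow> 'b::banach"
  assumes f: "has_ps_bound r K f" and r: "r > 0" and b: "b \<in> Basis"
  shows "has_ps_bound r (r * K) (\<lambda>y. (y \<bullet> b) *\<^sub>R f y)"
proof -
  obtain c S where c: "((\<lambda>\<alpha>. norm (c \<alpha>) * r ^ multi_deg \<alpha>) has_sum S) multi_indices" "S \<le> K"
      "\<And>y. y \<in> ball 0 r \<Longrightarrow> ((\<lambda>\<alpha>. monomial_value y \<alpha> *\<^sub>R c \<alpha>) has_sum f y) multi_indices"
    using f unfolding has_ps_bound_def by blast
  define up where "up = (\<lambda>\<alpha>::'a \<Rightarrow> nat. \<alpha>(b := Suc (\<alpha> b)))"
  define dn where "dn = (\<lambda>\<alpha>::'a \<Rightarrow> nat. \<alpha>(b := \<alpha> b - 1))"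
  have dnup: "dn (up \<alpha>) = \<alpha>" for \<alpha> by (simp add: dn_def up_def)
  have inj: "inj_on up X" for X by (metis dnup inj_onI)
  have upin: "up ` multi_indices \<subseteq> multi_indices" using b by (auto simp: up_def PiE_iff extensional_def)
  have upim: "\<alpha> \<in> up ` multi_indices" if "\<alpha> \<in> multi_indices" "\<alpha> b \<noteq> 0" for \<alpha>
  proof (rule image_eqI[of _ _ "dn \<alpha>"])
    show "\<alpha> = up (dn \<alpha>)" using that by (auto simp: up_def dn_def)
    show "dn \<alpha> \<in> multi_indices" using that b by (auto simp: dn_def PiE_iff extensional_def)
  qed
  have deg: "multi_deg (up \<alpha>) = Suc (multi_deg \<alpha>)" for \<alpha>
    using b by (simp add: multi_deg_def up_def sum.remove[of _ b])
  have mon: "monomial_value y (up \<alpha>) = (y \<bullet> b) * monomial_value y \<alpha>" for y \<alpha>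
    using b by (simp add: monomial_value_def up_def prod.remove[of _ b])
  define d where "d = (\<lambda>\<alpha>. if \<alpha> b = 0 then 0 else c (dn \<alpha>))"
  have d_up: "d (up \<alpha>) = c \<alpha>" for \<alpha> by (simp add: d_def dnup) (simp add: up_def)
  have d_out: "d \<alpha> = 0" if "\<alpha> \<in> multi_indices - up ` multi_indices" for \<alpha>
    using that upim by (auto simp: d_def)
  have 1: "((\<lambda>\<alpha>. norm (d \<alpha>) * r ^ multi_deg \<alpha>) has_sum (r * S)) multi_indices"
  proof -
    have "((\<lambda>\<alpha>. r * (norm (c \<alpha>) * r ^ multi_deg \<alpha>)) has_sum (r * S)) multi_indices"
      using c(1) by (rule has_sum_cmult_right)
    then have "((\<lambda>\<alpha>. norm (d \<alpha>) * r ^ multi_deg \<alpha>) has_sum (r * S)) (up ` multi_indices)"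
      by (subst has_sum_reindex[OF inj]) (simp add: o_def d_up deg mult_ac)
    moreover have "?this \<longleftrightarrow> ?thesis"
      by (rule has_sum_cong_neutral) (use d_out in simp, use upin in blast, simp)
    ultimately show ?thesis by blast
  qed
  have 2: "((\<lambda>\<alpha>. monomial_value y \<alpha> *\<^sub>R d \<alpha>) has_sum ((y \<bullet> b) *\<^sub>R f y)) multi_indices"
    if "y \<in> ball 0 r" for y
  proof -
    have "((\<lambda>\<alpha>. (y \<bullet> b) *\<^sub>R (monomial_value y \<alpha> *\<^sub>R c \<alpha>)) has_sum ((y \<bullet> b) *\<^sub>R f y)) multi_indices"
      by (rule has_sum_scaleR[OF c(3)[OF that], of "y \<bullet> b"])
    then have "((\<lambda>\<alpha>. monomial_value y \<alpha> *\<^sub>R d \<alpha>) has_sum ((y \<bullet> b) *\<^sub>R f y)) (up ` multi_indices)"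
      by (subst has_sum_reindex[OF inj]) (simp add: o_def d_up mon)
    moreover have "?this \<longleftrightarrow> ?thesis"
      by (rule has_sum_cong_neutral) (use d_out in simp, use upin in blast, simp)
    ultimately show ?thesis by blast
  qed
  have "r * S \<le> r * K" using c(2) r by simp
  with 1 2 show ?thesis unfolding has_ps_bound_def by blast
qed

lemma has_ps_bound_sum:
  assumes "finite I" "\<And>i. i \<in> I \<Longrightarrow> has_ps_bound r (K i) (f i)" "r > 0"
  shows "has_ps_bound r (\<Sum>i\<in>I. K i) (\<lambda>y. \<Sum>i\<in>I. f i y)"
  using assms(1,2)
proof (induction I rule: finite_induct)
  case empty
  then show ?case using has_ps_bound_const[OF assms(3), of 0] by simp
next
  case (insert i I)
  have "has_ps_bound r (K i + sum K I) (\<lambda>y. f i y + (\<Sum>i\<in>I. f i y))"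
    by (rule has_ps_bound_add[OF _ _ assms(3)]) (use insert in auto)
  then show ?case using insert by simp
qed

lemma has_ps_bound_linear_mult:
  fixes f :: "'a::euclidean_space \<Rightarrow> complex" and l :: "'a \<Rightarrow> complex"
  assumes f: "has_ps_bound r K f" and r: "r > 0" and l: "linear l"
  shows "has_ps_bound r ((\<Sum>b\<in>Basis. norm (l b)) * r * K) (\<lambda>y. l y * f y)"
proof -
  have "has_ps_bound r (norm (l b) * (r * K)) (\<lambda>y. l b * ((y \<bullet> b) *\<^sub>R f y))" if "b \<in> Basis" for b
    using has_ps_bound_bounded_linear[OF has_ps_bound_coord[OF f r that] bounded_linear_mult_right[of "l b"], of "norm (l b)"] r
    by (simp add: norm_mult)
  then have "has_ps_bound r (\<Sum>b\<in>Basis. norm (l b) * (r * K)) (\<lambda>y. \<Sum>b\<in>Basis. l b * ((y \<bullet> b) *\<^sub>R f y))"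
    by (intro has_ps_bound_sum r) auto
  moreover have "(\<Sum>b\<in>Basis. l b * ((y \<bullet> b) *\<^sub>R f y)) = l y * f y" for y
  proof -
    have "l y = (\<Sum>b\<in>Basis. (y \<bullet> b) *\<^sub>R l b)"
      using arg_cong[OF euclidean_representation[of y], of l] by (simp add: linear_sum[OF l] linear_scale[OF l])
    then show ?thesis by (simp add: sum_distrib_right sum_distrib_left scaleR_conv_of_real mult_ac)
  qed
  ultimately show ?thesis by (simp add: sum_distrib_right mult.assoc)
qed

lemma has_ps_bound_linear_power:
  fixes l :: "'a::euclidean_space \<Rightarrow> complex"
  assumes r: "r > 0" and l: "linear l"
  shows "has_ps_bound r (((\<Sum>b\<in>Basis. norm (l b)) * r) ^ n) (\<lambda>y. l y ^ n)"
proof (induction n)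
  case 0
  then show ?case using has_ps_bound_const[OF r, of "1::complex"] by simp
next
  case (Suc n)
  from has_ps_bound_linear_mult[OF this r l] show ?case by (simp add: mult.assoc)
qed

text \<open>Insert \<open>l y\<close> into the Taylor series of \<open>G\<close> at
  \<open>z0\<close>. The term of degree \<open>n\<close> has bound
  \<open>norm (a n) * (S * r) ^ n\<close>, where \<open>S\<close> is the sum of the norms of the
  images of the basis; \<open>r\<close> is chosen with \<open>S * r < e\<close>, so these bounds are
  summable.\<close>

lemma has_ps_bound_holomorphic_linear:
  fixes l :: "'a::euclidean_space \<Rightarrow> complex"
  assumes l: "linear l" and G: "G holomorphic_on ball z0 e" and e: "e > 0"
  obtains r K where "r > 0" "has_ps_bound r K (\<lambda>y. G (z0 + l y))"
proof -
  define S where "S = (\<Sum>b\<in>Basis. norm (l b))"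
  have S0: "S \<ge> 0" unfolding S_def by (simp add: sum_nonneg)
  define r where "r = e / (2 * (S + 1))"
  have r: "r > 0" using e S0 by (simp add: r_def)
  have Sr: "S * r < e" 
  proof -
    have "S * r = e * (S / (2 * (S + 1)))" by (simp add: r_def)
    also have "\<dots> < e * 1" using e S0 by (intro mult_strict_left_mono) (auto simp: field_simps)
    finally show ?thesis by simp
  qed
  define a where "a = (\<lambda>n. (deriv ^^ n) G z0 / fact n)"
  have G_sums: "(\<lambda>n. a n * (w - z0) ^ n) sums G w" if "w \<in> ball z0 e" for w
    unfolding a_def using holomorphic_power_series[OF G that] .
  have abs: "summable (\<lambda>n. norm (a n) * (S * r) ^ n)"
  proof -
    obtain s where s: "S * r < s" "s < e" using Sr dense by blast
    have sp: "0 \<le> S * r" using S0 r by simp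
    have "summable (\<lambda>n. a n * of_real s ^ n)"
      using G_sums[of "z0 + of_real s"] s sp by (auto simp: dist_norm sums_iff)
    from powser_insidea[OF this, of "of_real (S * r)"] s sp
    show ?thesis using S0 r by (simp add: norm_mult norm_power abs_mult)
  qed
  have ps: "has_ps_bound r (norm (a n) * (S * r) ^ n) (\<lambda>y. a n * l y ^ n)" for n
    using has_ps_bound_bounded_linear[OF has_ps_bound_linear_power[OF r l, of n] bounded_linear_mult_right[of "a n"], of "norm (a n)"] r
    by (simp add: norm_mult S_def)
  have main: "has_ps_bound r (\<Sum>n. norm (a n) * (S * r) ^ n) (\<lambda>y. \<Sum>n. a n * l y ^ n)"
    by (rule has_ps_bound_series[OF ps abs r])
  have eq: "(\<Sum>n. a n * l y ^ n) = G (z0 + l y)" if y: "y \<in> ball 0 r" for y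
  proof -
    have "norm (l y) \<le> S * norm y"
    proof -
      have "l y = (\<Sum>b\<in>Basis. (y \<bullet> b) *\<^sub>R l b)"
        using arg_cong[OF euclidean_representation[of y], of l] by (simp add: linear_sum[OF l] linear_scale[OF l])
      also have "norm \<dots> \<le> (\<Sum>b\<in>Basis. norm y * norm (l b))"
        by (rule sum_norm_le) (auto intro!: mult_right_mono simp: Basis_le_norm)
      finally show ?thesis by (simp add: S_def sum_distrib_left mult.commute)
    qed
    also have "\<dots> \<le> S * r" using y S0 by (intro mult_left_mono) auto
    also have "\<dots> < e" by (rule Sr)
    finally have "z0 + l y \<in> ball z0 e" by (simp add: dist_norm)
    from G_sums[OF this] show ?thesis by (simp add: sums_iff)
  qed
  have "has_ps_bound r (\<Sum>n. norm (a n) * (S * r) ^ n) (\<lambda>y. G (z0 + l y))"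
    using main eq unfolding has_ps_bound_def by simp
  with r that show ?thesis by blast
qed

text \<open>Both the leaf functions and the coordinates of the standard charts have this shape: an
  affine factor times a holomorphic function of another linear form.\<close>

lemma has_ps_bound_affine_times_holomorphic:
  fixes l k :: "'a::euclidean_space \<Rightarrow> complex"
  assumes l: "linear l" and k: "linear k" and G: "G holomorphic_on ball z0 e" and e: "e > 0"
  obtains r K where "r > 0" "has_ps_bound r K (\<lambda>y. (a + k y) * G (z0 + l y))"
proof -
  obtain r K where r: "r > 0" and ps: "has_ps_bound r K (\<lambda>y. G (z0 + l y))"
    using has_ps_bound_holomorphic_linear[OF l G e] .
  have 1: "has_ps_bound r (norm a * K) (\<lambda>y. a * G (z0 + l y))"
    using has_ps_bound_bounded_linear[OF ps bounded_linear_mult_right[of a], of "norm a"] r by (simp add: norm_mult)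
  from has_ps_bound_add[OF this has_ps_bound_linear_mult[OF ps r k] r] r that
  show ?thesis by (auto simp: distrib_right)
qed

section \<open>Consequences of real analyticity: absolute convergence, differentiability,
  restriction to lines\<close>

lemma norm_summable_on_euclidean:
  fixes f :: "'a \<Rightarrow> 'b::euclidean_space"
  assumes "f summable_on A"
  shows "(\<lambda>x. norm (f x)) summable_on A"
proof (rule summable_on_comparison_test)
  show "(\<lambda>x. \<Sum>i\<in>Basis. \<bar>f x \<bullet> i\<bar>) summable_on A"
  proof -
    have coord: "(\<lambda>x. \<bar>f x \<bullet> i\<bar>) summable_on A" for i
    proof -
    have "(\<lambda>x. f x \<bullet> i) summable_on A"
      using assms by (rule summable_on_bounded_linear[OF bounded_linear_inner_left])
    then show ?thesis
      using summable_on_iff_abs_summable_on_real by force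
    qed
    have "(\<lambda>x. \<Sum>i\<in>I. \<bar>f x \<bullet> i\<bar>) summable_on A" if "finite I" for I
      using that
    proof (induction I rule: finite_induct)
      case (insert i I)
      then show ?case using summable_on_add[OF coord[of i] insert.IH] by simp
    qed simp
    then show ?thesis by simp
  qed
qed (auto simp: norm_le_l1)

text \<open>Evaluate the series at the diagonal point \<open>x + s *\<^sub>R w\<close>, with
  \<open>w\<close> the sum of all basis vectors. Every monomial equals
  \<open>s ^ multi_deg \<alpha>\<close> there, and unordered summability in finite dimension is
  absolute.\<close>

lemma real_analytic_atE:
  fixes f :: "'a::euclidean_space \<Rightarrow> 'b::euclidean_space"
  assumes "real_analytic_at f x"
  obtains s c S where "s > 0"
    "((\<lambda>\<alpha>. norm (c \<alpha>) * s ^ multi_deg \<alpha>) has_sum S) multi_indices"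
    "\<And>y. y \<in> ball 0 s \<Longrightarrow> ((\<lambda>\<alpha>. monomial_value y \<alpha> *\<^sub>R c \<alpha>) has_sum f (x + y)) multi_indices"
proof -
  obtain c r where r: "0 < r" and c: "\<And>y. y \<in> ball x r \<Longrightarrow>
      ((\<lambda>\<alpha>. (\<Prod>b\<in>Basis. ((y - x) \<bullet> b) ^ \<alpha> b) *\<^sub>R c \<alpha>) has_sum f y) multi_indices"
    using assms unfolding real_analytic_at_def by blast
  define w where "w = (\<Sum>b\<in>(Basis::'a set). b)"
  define s where "s = r / (norm w + 1)"
  have wp: "norm w + 1 > 0" by (simp add: add_nonneg_pos)
  have s: "s > 0" "s \<le> r" using r wp by (auto simp: s_def divide_simps mult_le_cancel_left)
  have "norm (s *\<^sub>R w) = r * (norm w / (norm w + 1))" using s r wp by (simp add: s_def)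
  also have "\<dots> < r * 1" using r wp by (intro mult_strict_left_mono) (auto simp: field_simps)
  finally have sw: "norm (s *\<^sub>R w) < r" by simp
  have "x + s *\<^sub>R w \<in> ball x r" using sw by (simp add: dist_norm)
  from c[OF this] have hs: "((\<lambda>\<alpha>. (\<Prod>b\<in>Basis. ((s *\<^sub>R w) \<bullet> b) ^ \<alpha> b) *\<^sub>R c \<alpha>) has_sum f (x + s *\<^sub>R w)) multi_indices"
    by simp
  have wb: "w \<bullet> b = 1" if "b \<in> Basis" for b
    using that by (simp add: w_def inner_sum_left inner_Basis if_distrib sum.delta cong: if_cong)
  have "(\<Prod>b\<in>Basis. ((s *\<^sub>R w) \<bullet> b) ^ \<alpha> b) = s ^ multi_deg \<alpha>" for \<alpha>
    by (simp add: wb multi_deg_def power_sum)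
  with hs have "(\<lambda>\<alpha>. s ^ multi_deg \<alpha> *\<^sub>R c \<alpha>) summable_on multi_indices"
    by (auto simp: summable_on_def)
  from norm_summable_on_euclidean[OF this] s
  obtain S where "((\<lambda>\<alpha>. norm (c \<alpha>) * s ^ multi_deg \<alpha>) has_sum S) multi_indices"
    by (auto simp: summable_on_def mult.commute)
  moreover have "((\<lambda>\<alpha>. monomial_value y \<alpha> *\<^sub>R c \<alpha>) has_sum f (x + y)) multi_indices" if "y \<in> ball 0 s" for y
    using c[of "x + y"] that s by (simp add: monomial_value_def dist_norm)
  ultimately show ?thesis using that s by blast
qed

lemma finite_multi_indices_le: "finite {\<alpha> \<in> (multi_indices :: ('a::euclidean_space \<Rightarrow> nat) set). multi_deg \<alpha> \<le> n}"
proof -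
  have "{\<alpha> \<in> (multi_indices :: ('a \<Rightarrow> nat) set). multi_deg \<alpha> \<le> n} \<subseteq> Basis \<rightarrow>\<^sub>E {..n}"
  proof (rule subsetI)
    fix \<alpha> :: "'a \<Rightarrow> nat" assume "\<alpha> \<in> {\<alpha> \<in> multi_indices. multi_deg \<alpha> \<le> n}"
    then have a: "\<alpha> \<in> multi_indices" "multi_deg \<alpha> \<le> n" by auto
    have "\<alpha> b \<le> n" if "b \<in> Basis" for b
      using member_le_sum[of b Basis \<alpha>] that a(2) by (simp add: multi_deg_def)
    then show "\<alpha> \<in> Basis \<rightarrow>\<^sub>E {..n}" using a(1) by (auto simp: PiE_iff)
  qed
  then show ?thesis by (rule finite_subset) (simp add: finite_PiE)
qed

text \<open>Split off the finitely many terms of degree at most 1, which are differentiable. The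
  rest \<open>g\<close> is bounded by a constant times \<open>norm y ^ 2\<close>, so it has
  derivative 0.\<close>

lemma real_analytic_at_imp_differentiable:
  fixes f :: "'a::euclidean_space \<Rightarrow> 'b::euclidean_space"
  assumes "real_analytic_at f x"
  shows "f differentiable (at x)"
proof -
  obtain s c S where s: "s > 0"
    and S: "((\<lambda>\<alpha>. norm (c \<alpha>) * s ^ multi_deg \<alpha>) has_sum S) multi_indices"
    and val: "\<And>y. y \<in> ball 0 s \<Longrightarrow> ((\<lambda>\<alpha>. monomial_value y \<alpha> *\<^sub>R c \<alpha>) has_sum f (x + y)) multi_indices"
    by (rule real_analytic_atE[OF assms], rule that)
  define F where "F = {\<alpha> \<in> (multi_indices :: ('a \<Rightarrow> nat) set). multi_deg \<alpha> \<le> 1}"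
  have F: "finite F" unfolding F_def by (rule finite_multi_indices_le)
  define L where "L = (\<lambda>y. \<Sum>\<alpha>\<in>F. monomial_value y \<alpha> *\<^sub>R c \<alpha>)"
  define g where "g = (\<lambda>y. f (x + y) - L y)"
  have "(\<lambda>y. monomial_value y \<alpha>) differentiable (at 0)" for \<alpha> :: "'a \<Rightarrow> nat"
    unfolding monomial_value_def differentiable_def
    by (rule exI, rule has_derivative_prod, rule has_derivative_power, rule bounded_linear_imp_has_derivative, rule bounded_linear_inner_left)
  then have "L differentiable (at 0)"
    unfolding L_def using F
    by (intro differentiable_sum ballI differentiable_scaleR) auto
  then obtain L' where L': "(L has_derivative L') (at 0)" by (auto simp: differentiable_def)
  have g_le: "norm (g y) \<le> S / s^2 * norm y ^ 2" if y: "norm y < s" for y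
  proof -
    have hs: "((\<lambda>\<alpha>. monomial_value y \<alpha> *\<^sub>R c \<alpha>) has_sum f (x + y)) multi_indices" using val y by simp
    have hF: "((\<lambda>\<alpha>. monomial_value y \<alpha> *\<^sub>R c \<alpha>) has_sum L y) F"
      unfolding L_def by (rule has_sum_finite[OF F])
    have hg: "((\<lambda>\<alpha>. monomial_value y \<alpha> *\<^sub>R c \<alpha>) has_sum g y) (multi_indices - F)"
      unfolding g_def by (rule has_sum_Diff[OF hs hF]) (auto simp: F_def)
    have hS: "((\<lambda>\<alpha>. (norm y / s)^2 * (norm (c \<alpha>) * s ^ multi_deg \<alpha>)) has_sum ((norm y / s)^2 * S)) multi_indices"
      using S by (rule has_sum_cmult_right)
    have le: "norm (monomial_value y \<alpha> *\<^sub>R c \<alpha>) \<le> (norm y / s)^2 * (norm (c \<alpha>) * s ^ multi_deg \<alpha>)"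
      if "\<alpha> \<in> multi_indices - F" for \<alpha>
    proof -
      have d: "multi_deg \<alpha> \<ge> 2" using that by (auto simp: F_def)
      have "\<bar>monomial_value y \<alpha>\<bar> \<le> norm y ^ multi_deg \<alpha>" by (rule abs_monomial_value_le) simp
      also have "\<dots> = (norm y / s) ^ multi_deg \<alpha> * s ^ multi_deg \<alpha>" using s by (simp add: power_divide)
      also have "\<dots> \<le> (norm y / s) ^ 2 * s ^ multi_deg \<alpha>"
        using s y d by (intro mult_right_mono power_decreasing) auto
      finally have "\<bar>monomial_value y \<alpha>\<bar> * norm (c \<alpha>) \<le> (norm y / s) ^ 2 * s ^ multi_deg \<alpha> * norm (c \<alpha>)"
        by (rule mult_right_mono) simp
      then show ?thesis by (simp add: mult_ac)
    qed
    have sm: "(\<lambda>\<alpha>. norm (monomial_value y \<alpha> *\<^sub>R c \<alpha>)) summable_on (multi_indices - F)"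
      by (rule summable_on_comparison_test[OF summable_on_subset[OF has_sum_imp_summable[OF hS]]]) (use le in auto)
    then obtain n where n: "((\<lambda>\<alpha>. norm (monomial_value y \<alpha> *\<^sub>R c \<alpha>)) has_sum n) (multi_indices - F)"
      by (auto simp: summable_on_def)
    have "norm (g y) \<le> n" by (rule norm_has_sum_bound[OF n hg])
    also have "n \<le> (norm y / s)^2 * S"
      by (rule has_sum_mono_neutral[OF n hS]) (use le s in auto)
    finally show ?thesis by (simp add: power_divide mult_ac)
  qed
  have g0: "g 0 = 0" using g_le[of 0] s by simp
  have "(g has_derivative (\<lambda>_. 0)) (at 0)"
    unfolding has_derivative_at
  proof (intro conjI)
    have "((\<lambda>h. S / s^2 * norm h) \<longlongrightarrow> 0) (at (0::'a))"
      by (rule tendsto_eq_intros refl tendsto_norm_zero)+ auto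
    moreover have "\<forall>\<^sub>F h in at 0. norm (norm (g (0 + h) - g 0 - 0) / norm h) \<le> S / s^2 * norm h"
      unfolding eventually_at
    proof (intro exI[of _ s] conjI ballI impI s)
      fix h :: 'a assume h: "h \<noteq> 0 \<and> dist h 0 < s"
      then have "norm (g h) / norm h \<le> S / s^2 * norm h ^ 2 / norm h"
        by (intro divide_right_mono g_le) auto
      then show "norm (norm (g (0 + h) - g 0 - 0) / norm h) \<le> S / s^2 * norm h"
        using h g0 by (simp add: power2_eq_square)
    qed
    ultimately show "(\<lambda>h. norm (g (0 + h) - g 0 - 0) / norm h) \<midarrow>0\<rightarrow> 0"
      by (rule Lim_null_comparison[rotated])
  qed auto
  from has_derivative_add[OF L' this] have "((\<lambda>y. f (x + y)) has_derivative L') (at 0)"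
    by (simp add: g_def)
  then have "(f has_derivative L') (at x)"
    by (simp add: has_derivative_at)
  then show ?thesis by (auto simp: differentiable_def)
qed

text \<open>One-variable real analyticity encoded as a local holomorphic extension, so that the
  identity theorem, composition and the order of a zero come from complex analysis.\<close>

definition complexifiable_at :: "(real \<Rightarrow> real) \<Rightarrow> real \<Rightarrow> bool" where
  "complexifiable_at g x \<longleftrightarrow> (\<exists>F e. e > 0 \<and> F holomorphic_on ball (of_real x) e \<and>
     (\<forall>y. \<bar>y - x\<bar> < e \<longrightarrow> F (of_real y) = of_real (g y)))"

text \<open>Along a line the multi-indices can be grouped by total degree; the resulting
  coefficients \<open>d n\<close> form a one-variable power series, which also converges at complex
  arguments.\<close>

lemma real_analytic_at_imp_complexifiable_on_line:
  fixes f :: "'a::euclidean_space \<Rightarrow> real"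
  assumes f: "real_analytic_at f (p + x *\<^sub>R v)"
  shows "complexifiable_at (\<lambda>t. f (p + t *\<^sub>R v)) x"
proof -
  let ?q = "p + x *\<^sub>R v"
  obtain s c S where s: "s > 0"
    and "((\<lambda>\<alpha>. norm (c \<alpha>) * s ^ multi_deg \<alpha>) has_sum S) multi_indices"
    and val: "\<And>y. y \<in> ball 0 s \<Longrightarrow> ((\<lambda>\<alpha>. monomial_value y \<alpha> *\<^sub>R c \<alpha>) has_sum f (?q + y)) multi_indices"
    by (rule real_analytic_atE[OF f], rule that)
  define D where "D = (\<lambda>n. {\<alpha> \<in> (multi_indices :: ('a \<Rightarrow> nat) set). multi_deg \<alpha> = n})"
  have D: "finite (D n)" for n
    by (rule finite_subset[OF _ finite_multi_indices_le[of n]]) (auto simp: D_def)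
  define d where "d = (\<lambda>n. \<Sum>\<alpha>\<in>D n. monomial_value v \<alpha> * c \<alpha>)"
  define e where "e = s / (norm v + 1)"
  have vp: "norm v + 1 > 0" by (simp add: add_nonneg_pos)
  have e: "e > 0" using s vp by (simp add: e_def)
  have mono_scale: "monomial_value (t *\<^sub>R v) \<alpha> = t ^ multi_deg \<alpha> * monomial_value v \<alpha>" for t \<alpha>
    by (simp add: monomial_value_def multi_deg_def power_mult_distrib prod.distrib power_sum)
  have sums: "(\<lambda>n. d n * t ^ n) sums f (?q + t *\<^sub>R v)" if t: "\<bar>t\<bar> < e" for t
  proof -
    have "norm (t *\<^sub>R v) \<le> \<bar>t\<bar> * (norm v + 1)" by (simp add: mult_left_mono)
    also have "\<dots> < e * (norm v + 1)" using t vp by (intro mult_strict_right_mono)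
    also have "\<dots> = s" using vp by (simp add: e_def)
    finally have "t *\<^sub>R v \<in> ball 0 s" by simp
    note hs = val[OF this]
    have bij: "bij_betw snd (Sigma UNIV D) multi_indices"
      by (rule bij_betwI[of _ _ _ "\<lambda>\<alpha>. (multi_deg \<alpha>, \<alpha>)"]) (auto simp: D_def)
    have "((\<lambda>p. monomial_value (t *\<^sub>R v) (snd p) *\<^sub>R c (snd p)) has_sum f (?q + t *\<^sub>R v)) (Sigma UNIV D)"
      by (subst has_sum_reindex_bij_betw[OF bij]) (rule hs)
    then have "((\<lambda>n. \<Sum>\<alpha>\<in>D n. monomial_value (t *\<^sub>R v) \<alpha> *\<^sub>R c \<alpha>) has_sum f (?q + t *\<^sub>R v)) UNIV"
      by (rule has_sum_SigmaD) (simp add: has_sum_finite D)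
    moreover have "(\<Sum>\<alpha>\<in>D n. monomial_value (t *\<^sub>R v) \<alpha> *\<^sub>R c \<alpha>) = d n * t ^ n" for n
      unfolding d_def sum_distrib_right by (rule sum.cong) (auto simp: mono_scale D_def)
    ultimately show ?thesis by (simp add: has_sum_imp_sums)
  qed
  define \<phi> where "\<phi> = (\<lambda>w. \<Sum>n. of_real (d n) * (w - of_real x) ^ n :: complex)"
  have hol: "\<phi> holomorphic_on ball (of_real x) e"
  proof (rule power_series_holomorphic)
    fix w assume w: "w \<in> ball (complex_of_real x) e"
    then obtain t where t: "norm (w - of_real x) < t" "t < e" 
      using dense by (auto simp: dist_norm norm_minus_commute)
    have t0: "t > 0" using t(1) norm_ge_zero[of "w - of_real x"] by linarith
    have "summable (\<lambda>n. d n * t ^ n)" using sums[of t] t t0 by (auto simp: sums_iff)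
    then have "summable (\<lambda>n. complex_of_real (d n) * of_real t ^ n)"
      using summable_of_real[of "\<lambda>n. d n * t ^ n", where 'a=complex] by simp
    then have "summable (\<lambda>n. of_real (d n) * (w - of_real x) ^ n)"
      by (rule powser_inside) (use t t0 in auto)
    then show "(\<lambda>n. of_real (d n) * (w - of_real x) ^ n) sums \<phi> w"
      by (simp add: \<phi>_def summable_sums)
  qed
  have "\<phi> (of_real y) = of_real (f (p + y *\<^sub>R v))" if "\<bar>y - x\<bar> < e" for y
  proof -
    have "(\<lambda>n. complex_of_real (d n * (y - x) ^ n)) sums of_real (f (?q + (y - x) *\<^sub>R v))"
      using sums[OF that] by (rule sums_of_real)
    moreover have "?q + (y - x) *\<^sub>R v = p + y *\<^sub>R v" by (simp add: algebra_simps)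
    ultimately show ?thesis by (simp add: \<phi>_def sums_iff)
  qed
  then show ?thesis unfolding complexifiable_at_def using hol e by blast
qed

lemma complexifiable_at_minus:
  assumes "complexifiable_at f x" "complexifiable_at g x"
  shows "complexifiable_at (\<lambda>t. f t - g t) x"
proof -
  from assms obtain F e G e' where "e > 0" "F holomorphic_on ball (of_real x) e" 
    "\<forall>y. \<bar>y - x\<bar> < e \<longrightarrow> F (of_real y) = of_real (f y)"
    "e' > 0" "G holomorphic_on ball (of_real x) e'" 
    "\<forall>y. \<bar>y - x\<bar> < e' \<longrightarrow> G (of_real y) = of_real (g y)" unfolding complexifiable_at_def by metis
  then show ?thesis unfolding complexifiable_at_def
    by (intro exI[of _ "\<lambda>w. F w - G w"] exI[of _ "min e e'"])
       (auto intro!: holomorphic_intros elim: holomorphic_on_subset)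
qed

lemma complexifiable_at_compose:
  assumes g: "complexifiable_at g x" and f: "complexifiable_at f (g x)"
  shows "complexifiable_at (\<lambda>t. f (g t)) x"
proof -
  obtain G e where G: "e > 0" "G holomorphic_on ball (of_real x) e" 
    "\<And>y. \<bar>y - x\<bar> < e \<Longrightarrow> G (of_real y) = of_real (g y)" using g unfolding complexifiable_at_def by metis
  obtain F e' where F: "e' > 0" "F holomorphic_on ball (of_real (g x)) e'" 
    "\<And>y. \<bar>y - g x\<bar> < e' \<Longrightarrow> F (of_real y) = of_real (f y)" using f unfolding complexifiable_at_def by metis
  have "continuous_on (ball (of_real x) e) G" using G(2) by (rule holomorphic_on_imp_continuous_on)
  then have "open (ball (of_real x) e \<inter> G -` ball (of_real (g x)) e')"
    by (rule continuous_open_preimage) auto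
  moreover have "of_real x \<in> ball (of_real x) e \<inter> G -` ball (of_real (g x)) e'" using G(1,3) F(1) by simp
  ultimately obtain d where d: "d > 0" "ball (of_real x) d \<subseteq> ball (of_real x) e \<inter> G -` ball (of_real (g x)) e'"
    using openE by blast
  show ?thesis unfolding complexifiable_at_def
  proof (intro exI[of _ "\<lambda>w. F (G w)"] exI[of _ d] conjI allI impI)
    show "(\<lambda>w. F (G w)) holomorphic_on ball (of_real x) d"
      using holomorphic_on_compose_gen[of G "ball (of_real x) d" F "ball (of_real (g x)) e'"] d G(2) F(2)
      by (auto simp: o_def intro: holomorphic_on_subset)
    fix y assume "\<bar>y - x\<bar> < d"
    then have "complex_of_real y \<in> ball (of_real x) d"
      by (simp add: dist_norm abs_minus_commute flip: of_real_diff)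
    with d(2) have y: "complex_of_real y \<in> ball (of_real x) e" "G (of_real y) \<in> ball (of_real (g x)) e'"
      by blast+
    have "\<bar>y - x\<bar> < e" using y(1) by (simp add: dist_norm abs_minus_commute flip: of_real_diff)
    with y(2) G(3) have *: "G (of_real y) = of_real (g y)" "\<bar>g y - g x\<bar> < e'"
      by (auto simp: dist_norm simp flip: of_real_diff)
    then show "F (G (of_real y)) = of_real (f (g y))" using F(3) by simp
  qed (use d in auto)
qed

lemma complexifiable_zero_near:
  assumes f: "complexifiable_at f x" and ac: "\<And>e. e > 0 \<Longrightarrow> \<exists>y. y \<noteq> x \<and> \<bar>y - x\<bar> < e \<and> f y = 0"
  obtains e where "e > 0" "\<And>y. \<bar>y - x\<bar> < e \<Longrightarrow> f y = 0"
proof -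
  obtain F e where F: "e > 0" "F holomorphic_on ball (of_real x) e" 
    "\<And>y. \<bar>y - x\<bar> < e \<Longrightarrow> F (of_real y) = of_real (f y)" using f unfolding complexifiable_at_def by metis
  define U where "U = complex_of_real ` {y. \<bar>y - x\<bar> < e \<and> f y = 0}"
  have lim: "complex_of_real x islimpt U"
    unfolding islimpt_approachable
  proof safe
    fix d :: real assume "d > 0"
    then obtain y where "y \<noteq> x" "\<bar>y - x\<bar> < min d e" "f y = 0" using ac[of "min d e"] F(1) by auto
    then show "\<exists>x'\<in>U. x' \<noteq> complex_of_real x \<and> dist x' (complex_of_real x) < d"
      by (intro bexI[of _ "of_real y"]) (auto simp: U_def dist_norm simp flip: of_real_diff)
  qed
  have "F w = 0" if "w \<in> ball (of_real x) e" for w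
    by (rule analytic_continuation[OF F(2) _ _ _ _ lim _ that])
       (use F in \<open>auto simp: U_def dist_norm simp flip: of_real_diff\<close>)
  then have "f y = 0" if "\<bar>y - x\<bar> < e" for y
    using F(3)[OF that] that by (force simp: dist_norm simp flip: of_real_diff)
  with F(1) that show ?thesis by blast
qed

lemma complexifiable_identity:
  assumes I: "connected I" "open I" and f: "\<And>x. x \<in> I \<Longrightarrow> complexifiable_at f x"
    and x0: "x0 \<in> I" "e0 > 0" "\<And>y. \<bar>y - x0\<bar> < e0 \<Longrightarrow> f y = (0::real)" and x: "x \<in> I"
  shows "f x = 0"
proof -
  define S where "S = {x \<in> I. \<exists>e>0. \<forall>y. \<bar>y - x\<bar> < e \<longrightarrow> f y = 0}"
  have 1: "open S"
    unfolding open_dist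
  proof
    fix a assume "a \<in> S"
    then obtain e where e: "a \<in> I" "e > 0" "\<And>y. \<bar>y - a\<bar> < e \<Longrightarrow> f y = 0" by (auto simp: S_def)
    obtain d where d: "d > 0" "\<And>y. dist y a < d \<Longrightarrow> y \<in> I" using I(2) e(1) by (auto simp: open_dist)
    show "\<exists>e>0. \<forall>y. dist y a < e \<longrightarrow> y \<in> S"
    proof (intro exI[of _ "min d (e/2)"] conjI allI impI)
      fix y assume y: "dist y a < min d (e/2)"
      have "f z = 0" if "\<bar>z - y\<bar> < e/2" for z
      proof (rule e(3))
        show "\<bar>z - a\<bar> < e" using that y unfolding dist_real_def by linarith
      qed
      then show "y \<in> S" using y d e(2) by (auto simp: S_def intro!: exI[of _ "e/2"])
    qed (use d e in auto)
  qed
  have 2: "open (I - S)"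
    unfolding open_dist
  proof
    fix a assume a: "a \<in> I - S"
    obtain d where d: "d > 0" "\<And>y. dist y a < d \<Longrightarrow> y \<in> I" using I(2) a by (auto simp: open_dist)
    have "\<not> (\<forall>e>0. \<exists>y. y \<noteq> a \<and> \<bar>y - a\<bar> < e \<and> f y = 0)"
    proof
      assume *: "\<forall>e>0. \<exists>y. y \<noteq> a \<and> \<bar>y - a\<bar> < e \<and> f y = 0"
      obtain e where "e > 0" "\<And>y. \<bar>y - a\<bar> < e \<Longrightarrow> f y = 0"
        by (rule complexifiable_zero_near[of f a]) (use a f * in auto)
      with a show False by (auto simp: S_def)
    qed
    then obtain e where e: "e > 0" "\<And>y. y \<noteq> a \<Longrightarrow> \<bar>y - a\<bar> < e \<Longrightarrow> f y \<noteq> 0" by blast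
    show "\<exists>e>0. \<forall>y. dist y a < e \<longrightarrow> y \<in> I - S"
    proof (intro exI[of _ "min d e"] conjI allI impI)
      fix y assume y: "dist y a < min d e"
      have "y \<notin> S"
      proof (cases "y = a")
        case False
        then have "f y \<noteq> 0" using e y by (auto simp: dist_real_def)
        then show ?thesis by (force simp: S_def)
      qed (use a in auto)
      then show "y \<in> I - S" using y d by auto
    qed (use d e in auto)
  qed
  have "x0 \<in> S" using x0 by (auto simp: S_def)
  moreover have "S \<subseteq> I" by (auto simp: S_def)
  ultimately have "I - S = {}"
    using connectedD[OF I(1) 1 2] x0(1) by blast
  with x have "x \<in> S" by auto
  then show ?thesis by (auto simp: S_def)
qed

lemma has_ps_bound_radius_mono:
  assumes f: "has_ps_bound r K f" and s: "0 < s" "s \<le> r"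
  shows "has_ps_bound s K f"
proof -
  obtain c S where c: "((\<lambda>\<alpha>. norm (c \<alpha>) * r ^ multi_deg \<alpha>) has_sum S) multi_indices" "S \<le> K"
      "\<And>y. y \<in> ball 0 r \<Longrightarrow> ((\<lambda>\<alpha>. monomial_value y \<alpha> *\<^sub>R c \<alpha>) has_sum f y) multi_indices"
    using f unfolding has_ps_bound_def by blast
  have le: "norm (c \<alpha>) * s ^ multi_deg \<alpha> \<le> norm (c \<alpha>) * r ^ multi_deg \<alpha>" for \<alpha>
    using s by (intro mult_left_mono power_mono) auto
  have "(\<lambda>\<alpha>. norm (c \<alpha>) * s ^ multi_deg \<alpha>) summable_on multi_indices"
    by (rule summable_on_comparison_test[OF has_sum_imp_summable[OF c(1)] le]) (use s in auto)
  then obtain S' where S': "((\<lambda>\<alpha>. norm (c \<alpha>) * s ^ multi_deg \<alpha>) has_sum S') multi_indices"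
    by (auto simp: summable_on_def)
  have "S' \<le> S" by (rule has_sum_mono[OF S' c(1) le])
  with c(2) have "S' \<le> K" by simp
  with S' c(3) s show ?thesis unfolding has_ps_bound_def by fastforce
qed

lemma bounded_linear_axis: "bounded_linear (axis i :: 'b::real_normed_vector \<Rightarrow> 'b ^ 'n)"
proof (rule bounded_linear_intro[where K = 1])
  show "axis i (x + y) = axis i x + axis i y" for x y :: 'b by (simp add: vec_eq_iff axis_def)
  show "axis i (r *\<^sub>R x) = r *\<^sub>R axis i x" for r and x :: 'b by (simp add: vec_eq_iff axis_def)
  show "norm (axis i x :: 'b ^ 'n) \<le> norm x * 1" for x :: 'b
    by (simp add: norm_vec_def L2_set_def axis_def if_distrib[where f = norm] if_distrib[where f = "\<lambda>x. x ^ 2"] cong: if_cong)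
qed

section \<open>The hypersurface\<close>

text \<open>The proof needs \<open>lam\<close> irrational with \<open>1 < lam < 4 / 3\<close>.\<close>

definition lam :: real where "lam = sqrt 2 - 1 / 8"

lemma lam_bounds: "1 < lam" "lam < 4 / 3"
proof -
  \<comment> \<open>The comparison values are \<open>35/24 = 4/3 + 1/8\<close> here and
    \<open>9/8 = 1 + 1/8\<close> below.\<close>
  have "sqrt 2 < sqrt ((35/24)^2)" by (subst real_sqrt_less_iff) (simp add: power2_eq_square)
  then have "sqrt 2 < 35/24" by simp
  then show "lam < 4 / 3" by (simp add: lam_def)
  have "sqrt ((9/8)^2) < sqrt 2" by (subst real_sqrt_less_iff) (simp add: power2_eq_square)
  then have "9/8 < sqrt 2" by simp
  then show "1 < lam" by (simp add: lam_def)
qed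

lemma lam_pos: "lam > 0" using lam_bounds by simp

lemma lam_irrational: "lam \<notin> \<rat>"
proof
  assume "lam \<in> \<rat>"
  then have "lam + 1 / 8 \<in> \<rat>" by (intro Rats_add Rats_divide) auto
  then have "sqrt (real 2) \<in> \<rat>" by (simp add: lam_def)
  then obtain m n :: nat where mn: "n \<noteq> 0" "\<bar>sqrt (real 2)\<bar> = real m / real n" "coprime m n"
    by (rule Rats_abs_nat_div_natE)
  then have "(real m)\<^sup>2 = (sqrt 2 * real n)\<^sup>2" by (simp add: field_simps)
  then have "real (m\<^sup>2) = real (2 * n\<^sup>2)" by (simp add: power_mult_distrib)
  then have eq: "m\<^sup>2 = 2 * n\<^sup>2" by (simp only: of_nat_eq_iff)
  then have "even (m\<^sup>2)" by simp
  then have m: "even m" by simp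
  then obtain k where "m = 2 * k" by (rule evenE)
  with eq have "n\<^sup>2 = 2 * k\<^sup>2" by (simp add: power2_eq_square)
  then have "even (n\<^sup>2)" by simp
  then have "even n" by simp
  with m mn(3) show False by (metis coprime_common_divisor_nat dvd_refl odd_one not_coprimeI)
qed

text \<open>Angular speeds of the two coordinates under the sweep. Indexing them by the coordinate
  lets both sides, \<open>j = 1\<close> and \<open>j = 2\<close>, be treated by the same
  lemmas.\<close>

definition rate :: "2 \<Rightarrow> real" where "rate i = (if i = 1 then 1 else - lam)"

lemma rate_simps [simp]: "rate 1 = 1" "rate 2 = - lam" by (auto simp: rate_def)

lemma rate_nz: "rate i \<noteq> 0" using lam_pos by (simp add: rate_def)

definition saddle_pt :: "real ^ 2 \<Rightarrow> real \<Rightarrow> complex ^ 2" where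
  "saddle_pt x t = (\<chi> i. complex_of_real (x $ i) * cis (rate i * t))"

lemma saddle_pt_nth [simp]: "saddle_pt x t $ i = complex_of_real (x $ i) * cis (rate i * t)"
  by (simp add: saddle_pt_def)

definition ctr :: "complex ^ 2" where "ctr = (\<chi> i. 1)"

lemma ctr_nth [simp]: "ctr $ i = 1" by (simp add: ctr_def)

text \<open>Before this time both angles \<open>rate i * t\<close> stay within a right angle, so
  \<open>Re (saddle_pt x t $ i)\<close> has the sign of \<open>x $ i\<close>.\<close>

definition time_bound :: real where "time_bound = pi / (2 * lam)"

text \<open>The squared radius lies strictly above 1, the squared distance of \<open>(1, 0)\<close>
  and \<open>(0, 1)\<close>. It is below 2, so a point cannot have both real parts nonpositive, and
  below \<open>3 / 2\<close>, which excludes the points of the real locus beyond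
  \<open>time_bound\<close>.\<close>

definition big_ball :: "(complex ^ 2) set" where "big_ball = ball ctr (sqrt (5 / 4))"

definition saddle_hyp :: "(complex ^ 2) set" where
  "saddle_hyp = big_ball \<inter> {saddle_pt x t |x t. \<bar>t\<bar> < time_bound}"

text \<open>Chosen so that the rotations cancel: under the sweep the power of \<open>p $ j\<close>
  turns at speed \<open>expo i j * rate j = - rate i\<close>. The values are
  \<open>expo 2 1 = lam\<close> and \<open>expo 1 2 = 1 / lam\<close>.\<close>

definition expo :: "2 \<Rightarrow> 2 \<Rightarrow> real" where "expo i j = - rate i / rate j"

text \<open>Only \<open>p $ j\<close> meets the branch cut of \<open>powr\<close>, so the side
  \<open>Re (p $ j) > 0\<close> is the natural domain; \<open>p $ i\<close> may vanish or be
  negative there, which includes a separatrix.\<close>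

definition leaf_fun :: "2 \<Rightarrow> 2 \<Rightarrow> complex ^ 2 \<Rightarrow> complex" where
  "leaf_fun i j p = p $ i * (p $ j) powr complex_of_real (expo i j)"

lemma two_cases: "i \<noteq> j \<Longrightarrow> k = i \<or> k = j" for i j k :: 2
  using exhaust_2[of i] exhaust_2[of j] exhaust_2[of k] by auto

lemma dist_ctr: "(dist p ctr)\<^sup>2 = (cmod (p $ 1 - 1))\<^sup>2 + (cmod (p $ 2 - 1))\<^sup>2"
  by (simp add: dist_norm norm_vec_def L2_set_def sum_2)

lemma dist_ctr':
  assumes "i \<noteq> j"
  shows "(dist p ctr)\<^sup>2 = (cmod (p $ i - 1))\<^sup>2 + (cmod (p $ j - 1))\<^sup>2"
proof -
  have "i = 1 \<and> j = 2 \<or> i = 2 \<and> j = 1" using assms exhaust_2[of i] exhaust_2[of j] by auto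
  then show ?thesis unfolding dist_ctr by (elim disjE conjE) (simp_all only: add.commute)
qed

lemma big_ball_iff: "p \<in> big_ball \<longleftrightarrow> (dist p ctr)\<^sup>2 < 5 / 4"
proof -
  have "p \<in> big_ball \<longleftrightarrow> dist p ctr < sqrt (5 / 4)" by (simp add: big_ball_def dist_commute)
  also have "\<dots> \<longleftrightarrow> (dist p ctr)\<^sup>2 < (sqrt (5 / 4))\<^sup>2"
    using power_strict_mono[of "dist p ctr" "sqrt (5/4)" 2] power2_less_imp_less[of "dist p ctr" "sqrt (5/4)"] by auto
  finally show ?thesis by simp
qed

lemma open_big_ball: "open big_ball" by (simp add: big_ball_def)

lemma cmod_cis_minus_1: "(cmod (complex_of_real x * cis a - 1))\<^sup>2 = (x - cos a)\<^sup>2 + (sin a)\<^sup>2"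
proof -
  have "(cmod (complex_of_real x * cis a - 1))\<^sup>2 = (x * cos a - 1)\<^sup>2 + (x * sin a)\<^sup>2"
    by (simp add: cmod_power2)
  also have "\<dots> = (x - cos a)\<^sup>2 + (sin a)\<^sup>2"
    using sin_cos_squared_add[of a] by algebra
  finally show ?thesis .
qed

text \<open>The squared distance from \<open>ctr\<close> to the rotated real plane at time
  \<open>t\<close>; by \<open>dist_saddle_pt\<close> the nearest point has parameters
  \<open>cos t\<close> and \<open>cos (lam * t)\<close>.\<close>

definition heightsq :: "real \<Rightarrow> real" where "heightsq t = (sin t)\<^sup>2 + (sin (lam * t))\<^sup>2"

lemma dist_saddle_pt:
  "(dist (saddle_pt x t) ctr)\<^sup>2 = (x $ 1 - cos t)\<^sup>2 + (x $ 2 - cos (lam * t))\<^sup>2 + heightsq t"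
proof -
  have "cos (- lam * t) = cos (lam * t)" "(sin (- lam * t))\<^sup>2 = (sin (lam * t))\<^sup>2" by simp_all
  then show ?thesis
    unfolding dist_ctr saddle_pt_nth cmod_cis_minus_1 rate_simps heightsq_def mult_1
    by (simp only: add_ac)
qed

lemma rate_time_bound:
  assumes "\<bar>t\<bar> < time_bound"
  shows "\<bar>rate i * t\<bar> < pi / 2"
proof -
  have "lam * \<bar>t\<bar> < lam * time_bound" using assms lam_pos by (intro mult_strict_left_mono)
  also have "\<dots> = pi / 2" using lam_pos by (simp add: time_bound_def)
  finally have *: "lam * \<bar>t\<bar> < pi / 2" .
  moreover have "\<bar>t\<bar> \<le> lam * \<bar>t\<bar>" using lam_bounds(1) by (simp add: mult_le_cancel_right1)
  ultimately show ?thesis using exhaust_2[of i] lam_pos by (auto simp: abs_mult)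
qed

lemma cos_rate_pos: "\<bar>t\<bar> < time_bound \<Longrightarrow> cos (rate i * t) > 0"
  using rate_time_bound[of t i] by (intro cos_gt_zero_pi) auto

lemma Re_saddle_pt_pos_iff: "\<bar>t\<bar> < time_bound \<Longrightarrow> Re (saddle_pt x t $ i) > 0 \<longleftrightarrow> x $ i > 0"
  using cos_rate_pos[of t i] by (auto simp: zero_less_mult_iff)

lemma saddle_pt_neq0: "\<bar>t\<bar> < time_bound \<Longrightarrow> Re (saddle_pt x t $ i) = 0 \<longleftrightarrow> x $ i = 0"
  using cos_rate_pos[of t i] by auto

text \<open>Each coordinate with nonpositive real part contributes at least 1 to the squared
  distance from \<open>ctr\<close>; two of them would give 2.\<close>

lemma big_ball_Re_pos:
  assumes "p \<in> big_ball" "i \<noteq> j" "Re (p $ i) \<le> 0"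
  shows "Re (p $ j) > 0"
proof (rule ccontr)
  assume neg: "\<not> ?thesis"
  have ge: "(cmod (p $ k - 1))\<^sup>2 \<ge> 1" if "Re (p $ k) \<le> 0" for k
  proof -
    have "1 \<le> \<bar>Re (p $ k - 1)\<bar>" using that by simp
    also have "\<dots> \<le> cmod (p $ k - 1)" by (rule abs_Re_le_cmod)
    finally show ?thesis by (simp add: one_le_power)
  qed
  have "(dist p ctr)\<^sup>2 \<ge> 1 + 1"
    unfolding dist_ctr'[OF assms(2)] using ge[of i] ge[of j] assms(3) neg by (intro add_mono) auto
  then show False using assms(1) by (simp add: big_ball_iff)
qed

lemma Ln_of_real_cis:
  assumes "x > 0" "\<bar>a\<bar> < pi"
  shows "Ln (complex_of_real x * cis a) = Complex (ln x) a"
proof -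
  have "exp (Complex (ln x) a) = complex_of_real x * cis a"
    using assms by (simp add: exp_eq_polar)
  moreover have "Ln (exp (Complex (ln x) a)) = Complex (ln x) a"
    using assms by (intro Ln_exp) auto
  ultimately show ?thesis by metis
qed

lemma powr_of_real_cis:
  assumes "x > 0" "\<bar>a\<bar> < pi"
  shows "(complex_of_real x * cis a) powr complex_of_real \<nu> = complex_of_real (x powr \<nu>) * cis (\<nu> * a)"
proof -
  have "complex_of_real x * cis a \<noteq> 0" using assms by simp
  then have "(complex_of_real x * cis a) powr complex_of_real \<nu> = exp (complex_of_real \<nu> * Complex (ln x) a)"
    using assms by (simp add: powr_def Ln_of_real_cis)
  also have "\<dots> = complex_of_real (x powr \<nu>) * cis (\<nu> * a)"
    using assms by (simp add: exp_eq_polar powr_def)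
  finally show ?thesis .
qed

lemma leaf_fun_saddle_pt:
  assumes t: "\<bar>t\<bar> < time_bound" and x: "x $ j > 0"
  shows "leaf_fun i j (saddle_pt x t) = complex_of_real (x $ i * x $ j powr expo i j)"
proof -
  have "\<bar>rate j * t\<bar> < pi" using rate_time_bound[OF t, of j] by linarith
  moreover have "expo i j * (rate j * t) = - (rate i * t)" using rate_nz[of j] by (simp add: expo_def)
  ultimately show ?thesis
    using x by (simp add: leaf_fun_def powr_of_real_cis cis_mult)
qed

lemma sin_sq_ge:
  assumes "pi / 3 \<le> \<bar>a\<bar>" "\<bar>a\<bar> \<le> 2 * pi / 3"
  shows "(sin a)\<^sup>2 \<ge> 3 / 4"
proof -
  have "cos (\<bar>a\<bar>) \<le> cos (pi / 3)" using assms by (intro cos_monotone_0_pi_le) auto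
  moreover have "cos (2 * pi / 3) \<le> cos (\<bar>a\<bar>)" using assms by (intro cos_monotone_0_pi_le) auto
  moreover have "cos (2 * pi / 3) = - (1 / 2)" using cos_120 by simp
  ultimately have "\<bar>cos a\<bar> \<le> 1 / 2" by (simp add: cos_60)
  then have "\<bar>cos a\<bar>\<^sup>2 \<le> (1 / 2)\<^sup>2" by (intro power_mono) auto
  then have "(cos a)\<^sup>2 \<le> 1 / 4" by (simp add: power2_eq_square)
  then show ?thesis using sin_cos_squared_add[of a] by linarith
qed

lemma time_bound_ge: "time_bound \<ge> 3 * pi / 8" "time_bound > 0" "time_bound < pi / 2" "lam * time_bound = pi / 2"
  using lam_bounds by (auto simp: time_bound_def field_simps)

lemma saddle_hypD:
  assumes "p \<in> saddle_hyp"
  obtains x t where "p = saddle_pt x t" "\<bar>t\<bar> < time_bound" "p \<in> big_ball"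
proof -
  from assms have "p \<in> big_ball" "\<exists>x t. p = saddle_pt x t \<and> \<bar>t\<bar> < time_bound"
    by (simp_all add: saddle_hyp_def)
  then show ?thesis using that by (elim exE conjE)
qed

lemma saddle_hyp_big_ball: "saddle_hyp \<subseteq> big_ball" by (auto simp: saddle_hyp_def)

lemma cis_Im_Ln: "z \<noteq> 0 \<Longrightarrow> z = complex_of_real (cmod z) * cis (Im (Ln z))"
  using exp_Ln[of z] by (simp add: exp_eq_polar)

text \<open>The argument of \<open>p $ j\<close> determines the time \<open>t\<close>, and reality
  of the leaf function says that \<open>p $ i\<close>, rotated back by \<open>rate i * t\<close>, is
  real. What remains is \<open>\<bar>t\<bar> < time_bound\<close>: immediate for
  \<open>j = 2\<close>, where the angle is \<open>- lam * t\<close>, but for \<open>j = 1\<close> it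
  needs the size of the ball.\<close>

lemma saddle_hyp_iff:
  assumes p: "p \<in> big_ball" and ij: "i \<noteq> j" and Re: "Re (p $ j) > 0"
  shows "p \<in> saddle_hyp \<longleftrightarrow> Im (leaf_fun i j p) = 0"
proof
  assume "p \<in> saddle_hyp"
  then obtain x t where xt: "p = saddle_pt x t" "\<bar>t\<bar> < time_bound" by (rule saddle_hypD)
  then have "x $ j > 0" using Re Re_saddle_pt_pos_iff by blast
  from leaf_fun_saddle_pt[OF xt(2) this, of i] show "Im (leaf_fun i j p) = 0" by (simp add: xt(1))
next
  assume real: "Im (leaf_fun i j p) = 0"
  define a where "a = Im (Ln (p $ j))"
  define t where "t = a / rate j"
  define r where "r = cmod (p $ j)"
  have nz: "p $ j \<noteq> 0" using Re by auto
  have r: "r > 0" using nz by (simp add: r_def)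
  have pj: "p $ j = complex_of_real r * cis a" using cis_Im_Ln[OF nz] by (simp add: r_def a_def)
  have a: "\<bar>a\<bar> < pi / 2" using Re Re_Ln_pos_lt[OF nz] by (simp add: a_def)
  have at: "rate j * t = a" using rate_nz[of j] by (simp add: t_def)
  have "expo i j * a = - (rate i * t)" using rate_nz[of j] by (simp add: expo_def t_def)
  then have leaf: "leaf_fun i j p = complex_of_real (r powr expo i j) * (p $ i * cis (- (rate i * t)))"
    using r a by (simp add: leaf_fun_def pj powr_of_real_cis)
  define y where "y = Re (p $ i * cis (- (rate i * t)))"
  have "Im (p $ i * cis (- (rate i * t))) = 0"
    using real r unfolding leaf by (simp del: cis.sel)
  then have y: "p $ i * cis (- (rate i * t)) = complex_of_real y"
    unfolding y_def by (metis complex_is_Real_iff of_real_Re)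
  have pi: "p $ i = complex_of_real y * cis (rate i * t)"
    unfolding y[symmetric] by (simp add: mult.assoc cis_mult)
  define x where "x = (\<chi> k. if k = j then r else y)"
  have px: "p = saddle_pt x t"
    unfolding vec_eq_iff
  proof
    fix k
    show "p $ k = saddle_pt x t $ k"
      using two_cases[OF ij, of k] ij pi pj at by (auto simp: x_def)
  qed
  have "\<bar>t\<bar> < time_bound"
  proof (cases "j = 2")
    case True
    then show ?thesis using a lam_pos by (simp add: t_def time_bound_def field_simps)
  next
    case False
    then have j1: "j = 1" "i = 2" using ij exhaust_2[of i] exhaust_2[of j] by auto
    show ?thesis
    proof (rule ccontr)
      assume "\<not> ?thesis"
      \<comment> \<open>Now \<open>\<bar>t\<bar>\<close> lies between \<open>3 * pi / 8\<close> and
        \<open>pi / 2\<close>, and \<open>lam * \<bar>t\<bar>\<close> between \<open>pi / 2\<close>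
        and \<open>2 * pi / 3\<close>. Both sines then have square at least \<open>3 / 4\<close>, so
        the whole plane at time \<open>t\<close> is too far from \<open>ctr\<close>.\<close>
      then have tb: "\<bar>t\<bar> \<ge> time_bound" by simp
      have t2: "\<bar>t\<bar> < pi / 2" using a at j1 by simp
      have 1: "(sin t)\<^sup>2 \<ge> 3 / 4" using tb time_bound_ge(1) t2 by (intro sin_sq_ge) auto
      have "lam * \<bar>t\<bar> \<ge> pi / 2" using mult_left_mono[OF tb, of lam] lam_pos time_bound_ge(4) by simp
      moreover have "lam * \<bar>t\<bar> \<le> 4 / 3 * (pi / 2)" using lam_bounds t2 by (intro mult_mono) auto
      ultimately have 2: "(sin (lam * t))\<^sup>2 \<ge> 3 / 4"
        using lam_pos pi_gt_zero by (intro sin_sq_ge) (auto simp: abs_mult)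
      have "3 / 4 + 3 / 4 \<le> (dist p ctr)\<^sup>2"
        unfolding px dist_saddle_pt heightsq_def using 1 2 by (smt (verit) zero_le_power2)
      then show False using p by (simp add: big_ball_iff)
    qed
  qed
  then show "p \<in> saddle_hyp" using p px by (auto simp: saddle_hyp_def)
qed

lemma leaf_fun_has_derivative:
  assumes "Re (p $ j) > 0"
  shows "(leaf_fun i j has_derivative (\<lambda>v. v $ i * (p $ j) powr complex_of_real (expo i j) +
     p $ i * (complex_of_real (expo i j) * (p $ j) powr (complex_of_real (expo i j) - 1) * v $ j))) (at p)"
proof -
  have nr: "p $ j \<notin> \<real>\<^sub>\<le>\<^sub>0" using assms complex_nonpos_Reals_iff by auto
  have "((\<lambda>z. z powr complex_of_real (expo i j)) has_derivative
      (\<lambda>h. complex_of_real (expo i j) * (p $ j) powr (complex_of_real (expo i j) - 1) * h)) (at (p $ j))"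
    using has_field_derivative_powr[OF nr, of "complex_of_real (expo i j)"]
    by (simp add: has_field_derivative_def)
  from has_derivative_compose[OF bounded_linear_imp_has_derivative[OF bounded_linear_vec_nth, of j "at p"] this]
  have 1: "((\<lambda>q. (q $ j) powr complex_of_real (expo i j)) has_derivative
      (\<lambda>v. complex_of_real (expo i j) * (p $ j) powr (complex_of_real (expo i j) - 1) * v $ j)) (at p)" .
  have "((\<lambda>q. q $ i * (q $ j) powr complex_of_real (expo i j)) has_derivative
      (\<lambda>v. p $ i * (complex_of_real (expo i j) * (p $ j) powr (complex_of_real (expo i j) - 1) * v $ j) +
           v $ i * (p $ j) powr complex_of_real (expo i j))) (at p)"
    by (rule has_derivative_mult[OF bounded_linear_imp_has_derivative[OF bounded_linear_vec_nth] 1])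
  then show ?thesis unfolding leaf_fun_def by (simp add: add.commute)
qed

lemma continuous_on_leaf_fun:
  assumes "\<And>p. p \<in> S \<Longrightarrow> Re (p $ j) > 0"
  shows "continuous_on S (leaf_fun i j)"
proof (rule continuous_at_imp_continuous_on, rule ballI)
  fix p assume "p \<in> S"
  then show "isCont (leaf_fun i j) p" by (rule has_derivative_continuous[OF leaf_fun_has_derivative[OF assms]])
qed

lemma open_Re_pos: "open {p :: complex ^ 2. Re (p $ j) > 0}"
  by (intro open_Collect_less continuous_intros)

lemma powr_holomorphic_Re_pos:
  assumes "\<And>w. w \<in> S \<Longrightarrow> Re w > 0"
  shows "(\<lambda>w. w powr c) holomorphic_on S"
proof (rule holomorphic_on_powr)
  show "w \<notin> \<real>\<^sub>\<le>\<^sub>0" if "w \<in> S" for w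
    using assms[OF that] by (simp add: complex_nonpos_Reals_iff)
qed (auto intro: holomorphic_intros)

lemma Re_pos_ball:
  assumes "Re w0 > 0" "w \<in> ball w0 (Re w0)"
  shows "Re w > 0"
proof -
  have "\<bar>Re (w0 - w)\<bar> \<le> cmod (w0 - w)" by (rule abs_Re_le_cmod)
  also have "\<dots> < Re w0" using assms by (simp add: dist_norm)
  finally show ?thesis by simp
qed

lemma real_analytic_at_Im_leaf_fun:
  assumes "Re (p $ j) > 0"
  shows "real_analytic_at (\<lambda>q. Im (leaf_fun i j q)) p"
proof -
  let ?G = "\<lambda>w. w powr complex_of_real (expo i j)"
  obtain r K where r: "r > 0" and ps: "has_ps_bound r K (\<lambda>y. (p $ i + y $ i) * ?G (p $ j + y $ j))"
    by (rule has_ps_bound_affine_times_holomorphic[of "\<lambda>y. y $ j" "\<lambda>y. y $ i" ?G "p $ j" "Re (p $ j)" "p $ i"])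
       (use assms Re_pos_ball in \<open>auto intro!: bounded_linear.linear powr_holomorphic_Re_pos\<close>)
  from has_ps_bound_bounded_linear[OF ps bounded_linear_Im, of 1]
  have "has_ps_bound r (1 * K) (\<lambda>y. Im (leaf_fun i j (p + y)))"
    using r by (simp add: leaf_fun_def abs_Im_le_cmod)
  from has_ps_bound_imp_real_analytic_at[OF this r] show ?thesis .
qed

lemma saddle_hyp_side:
  assumes "p \<in> big_ball"
  obtains i j :: 2 where "i \<noteq> j" "Re (p $ j) > 0"
proof (cases "Re (p $ 1) > 0")
  case True
  then show ?thesis using that[of 2 1] by simp
next
  case False
  then have "Re (p $ 2) > 0" using big_ball_Re_pos[OF assms, of 1 2] by simp
  then show ?thesis using that[of 1 2] by simp
qed

lemma real_analytic_hypersurface_saddle_hyp: "real_analytic_hypersurface saddle_hyp"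
  unfolding real_analytic_hypersurface_def
proof
  fix p assume "p \<in> saddle_hyp"
  then have pB: "p \<in> big_ball" using saddle_hyp_big_ball by blast
  obtain i j :: 2 where ij: "i \<noteq> j" "Re (p $ j) > 0" using saddle_hyp_side[OF pB] .
  let ?U = "big_ball \<inter> {q. Re (q $ j) > 0}"
  let ?f = "\<lambda>q. Im (leaf_fun i j q)"
  have "frechet_derivative ?f (at x) \<noteq> (\<lambda>_. 0)" if x: "Re (x $ j) > 0" for x
  proof
    assume z: "frechet_derivative ?f (at x) = (\<lambda>_. 0)"
    let ?c = "(x $ j) powr complex_of_real (expo i j)"
    have c: "?c \<noteq> 0" using x by auto
    have "(?f has_derivative (\<lambda>v. Im (v $ i * ?c + x $ i * (complex_of_real (expo i j) *
        (x $ j) powr (complex_of_real (expo i j) - 1) * v $ j)))) (at x)"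
      by (rule bounded_linear.has_derivative[OF bounded_linear_Im leaf_fun_has_derivative[OF x]])
    from fun_cong[OF trans[OF frechet_derivative_at[OF this] z]] have "Im (v $ i * ?c + x $ i * (complex_of_real (expo i j) *
        (x $ j) powr (complex_of_real (expo i j) - 1) * v $ j)) = 0" for v
      by simp
    \<comment> \<open>The leaf function is linear in coordinate \<open>i\<close> with factor
      \<open>?c\<close>, so this direction moves it exactly by \<open>\<i>\<close>.\<close>
    from this[of "axis i (\<i> / ?c)"] have "Im (\<i> / ?c * ?c) = 0"
      using ij(1) by (simp add: axis_def)
    then show False using c by simp
  qed
  moreover have "saddle_hyp \<inter> ?U = {q \<in> ?U. ?f q = 0}"
    using saddle_hyp_iff[OF _ ij(1)] by auto
  moreover have "open ?U" using open_big_ball open_Re_pos by blast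
  moreover have "\<forall>x\<in>?U. real_analytic_at ?f x \<and> frechet_derivative ?f (at x) \<noteq> (\<lambda>_. 0)"
    using real_analytic_at_Im_leaf_fun calculation(1) by blast
  moreover have "p \<in> ?U" using pB ij(2) by blast
  ultimately show "\<exists>U (\<rho> :: complex ^ 2 \<Rightarrow> real). open U \<and> p \<in> U \<and>
      (\<forall>x\<in>U. real_analytic_at \<rho> x \<and> frechet_derivative \<rho> (at x) \<noteq> (\<lambda>_. 0)) \<and>
      saddle_hyp \<inter> U = {x \<in> U. \<rho> x = 0}"
    by blast
qed

lemma Re_pos_imp_nonzero: "Re z > 0 \<Longrightarrow> z \<noteq> 0"
  by auto

section \<open>Charts and the leaf space\<close>

text \<open>Coordinate \<open>j\<close> serves as the leaf parameter, and coordinate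
  \<open>i\<close> is solved from the equation \<open>leaf_fun i j = t0 + r * t\<close> with
  \<open>t\<close> the second chart variable.\<close>

definition std_chart :: "2 \<Rightarrow> 2 \<Rightarrow> complex \<Rightarrow> real \<Rightarrow> real \<Rightarrow> complex \<times> real \<Rightarrow> complex ^ 2" where
  "std_chart i j w0 t0 r x = axis j (w0 + complex_of_real r * fst x) +
     axis i ((complex_of_real t0 + complex_of_real r * complex_of_real (snd x)) *
       (w0 + complex_of_real r * fst x) powr - complex_of_real (expo i j))"

abbreviation chart_dom :: "(complex \<times> real) set" where
  "chart_dom \<equiv> ball 0 1 \<times> {-1<..<1}"

lemma std_chart_nth:
  assumes "i \<noteq> j"
  shows "std_chart i j w0 t0 r x $ j = w0 + complex_of_real r * fst x"
    and "std_chart i j w0 t0 r x $ i = complex_of_real (t0 + r * snd x) *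
       (w0 + complex_of_real r * fst x) powr - complex_of_real (expo i j)"
  using assms by (auto simp: std_chart_def axis_def)

lemma leaf_fun_std_chart:
  assumes "i \<noteq> j" "Re (w0 + complex_of_real r * fst x) > 0"
  shows "leaf_fun i j (std_chart i j w0 t0 r x) = complex_of_real (t0 + r * snd x)"
proof -
  have nz: "w0 + complex_of_real r * fst x \<noteq> 0" by (rule Re_pos_imp_nonzero[OF assms(2)])
  show ?thesis
    unfolding leaf_fun_def std_chart_nth[OF assms(1)] mult.assoc powr_add[symmetric] using nz by simp
qed

lemma point_eq_of_leaf_fun:
  assumes "i \<noteq> j" "Re (p $ j) > 0"
  shows "p $ i = leaf_fun i j p * (p $ j) powr - complex_of_real (expo i j)"
proof -
  have "p $ j \<noteq> 0" using assms(2) by auto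
  then show ?thesis unfolding leaf_fun_def mult.assoc powr_add[symmetric] by simp
qed

lemma std_chart_leaf_fun:
  assumes ij: "i \<noteq> j" and p: "Re (p $ j) > 0" "Im (leaf_fun i j p) = 0" and r: "r > 0"
  shows "std_chart i j w0 t0 r ((p $ j - w0) / complex_of_real r, (Re (leaf_fun i j p) - t0) / r) = p"
  unfolding vec_eq_iff
proof
  fix k
  have "complex_of_real (Re (leaf_fun i j p)) = leaf_fun i j p" using p(2) by (simp add: complex_eq_iff)
  then show "std_chart i j w0 t0 r ((p $ j - w0) / complex_of_real r, (Re (leaf_fun i j p) - t0) / r) $ k = p $ k"
    using two_cases[OF ij, of k] r point_eq_of_leaf_fun[OF ij p(1)]
    by (auto simp: std_chart_nth[OF ij])
qed

lemma std_chart_real_analytic: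
  assumes ij: "i \<noteq> j" and Re: "Re (w0 + complex_of_real r * fst x) > 0"
  shows "real_analytic_at (std_chart i j w0 t0 r) x"
proof -
  let ?G = "\<lambda>w. w powr - complex_of_real (expo i j)"
  let ?w = "w0 + complex_of_real r * fst x"
  have lin1: "linear (\<lambda>y::complex \<times> real. complex_of_real r * fst y)"
    by (intro linearI) (auto simp: algebra_simps scaleR_conv_of_real)
  have lin2: "linear (\<lambda>y::complex \<times> real. complex_of_real r * complex_of_real (snd y))"
    by (intro linearI) (auto simp: algebra_simps scaleR_conv_of_real)
  have hol: "?G holomorphic_on ball ?w (Re ?w)"
    by (rule powr_holomorphic_Re_pos, rule Re_pos_ball[OF Re])
  obtain r1 K1 where r1: "r1 > 0" and ps1: "has_ps_bound r1 K1 (\<lambda>y::complex \<times> real. 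
      (complex_of_real t0 + complex_of_real r * complex_of_real (snd x) + complex_of_real r * complex_of_real (snd y)) *
      ?G (?w + complex_of_real r * fst y))"
    by (rule has_ps_bound_affine_times_holomorphic[OF lin1 lin2 hol Re], rule that)
  obtain r2 K2 where r2: "r2 > 0" and ps2: "has_ps_bound r2 K2 (\<lambda>y::complex \<times> real. 
      (?w + complex_of_real r * fst y) * (\<lambda>_. 1) (?w + complex_of_real r * fst y))"
    by (rule has_ps_bound_affine_times_holomorphic[OF lin1 lin1, of "\<lambda>_. 1" ?w 1 ?w]) auto
  define R where "R = min r1 r2"
  have R: "R > 0" "R \<le> r1" "R \<le> r2" using r1 r2 by (auto simp: R_def)
  have ax: "norm (axis k z :: complex ^ 2) \<le> 1 * norm z" for k z
    by (simp add: norm_vec_def L2_set_def axis_def if_distrib[where f = norm] if_distrib[where f = "\<lambda>x. x ^ 2"] cong: if_cong)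
  have "has_ps_bound R (1 * K1) (\<lambda>y::complex \<times> real. axis i 
      ((complex_of_real t0 + complex_of_real r * complex_of_real (snd x) + complex_of_real r * complex_of_real (snd y)) *
      ?G (?w + complex_of_real r * fst y)) :: complex ^ 2)"
    by (rule has_ps_bound_bounded_linear[OF has_ps_bound_radius_mono[OF ps1 R(1,2)] bounded_linear_axis ax]) (use R in auto)
  moreover have "has_ps_bound R (1 * K2) (\<lambda>y::complex \<times> real. axis j
      ((?w + complex_of_real r * fst y) * (\<lambda>_. 1) (?w + complex_of_real r * fst y)) :: complex ^ 2)"
    by (rule has_ps_bound_bounded_linear[OF has_ps_bound_radius_mono[OF ps2 R(1,3)] bounded_linear_axis ax]) (use R in auto)
  note has_ps_bound_add[OF this calculation R(1)]
  then have "has_ps_bound R (1 * K2 + 1 * K1) (\<lambda>y. std_chart i j w0 t0 r (x + y))"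
    unfolding std_chart_def by (simp add: distrib_left add.assoc)
  from has_ps_bound_imp_real_analytic_at[OF this R(1)] show ?thesis .
qed

lemma powr_has_derivative_Re_pos:
  assumes "Re w > 0"
  shows "((\<lambda>z. z powr c) has_derivative (\<lambda>h. c * w powr (c - 1) * h)) (at w)"
proof -
  have "w \<notin> \<real>\<^sub>\<le>\<^sub>0" using assms complex_nonpos_Reals_iff by auto
  from has_field_derivative_powr[OF this, of c] show ?thesis by (simp add: has_field_derivative_def)
qed

text \<open>The derivative is triangular: coordinate \<open>j\<close> sees only the disc variable,
  and once that is 0, coordinate \<open>i\<close> sees the real variable times a nonzero
  power.\<close>

lemma std_chart_inj_derivative:
  assumes ij: "i \<noteq> j" and Re: "Re (w0 + complex_of_real r * fst x) > 0" and r: "r > 0"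
  shows "inj (frechet_derivative (std_chart i j w0 t0 r) (at x))"
proof -
  let ?c = "- complex_of_real (expo i j)"
  let ?w = "w0 + complex_of_real r * fst x"
  let ?T = "complex_of_real t0 + complex_of_real r * complex_of_real (snd x)"
  have d1: "((\<lambda>y::complex \<times> real. w0 + complex_of_real r * fst y) has_derivative (\<lambda>h. complex_of_real r * fst h)) (at x)"
    by (auto intro!: derivative_eq_intros)
  have d2: "((\<lambda>y::complex \<times> real. complex_of_real t0 + complex_of_real r * complex_of_real (snd y)) has_derivative (\<lambda>h. complex_of_real r * complex_of_real (snd h))) (at x)"
    by (auto intro!: derivative_eq_intros)
  note d3 = has_derivative_compose[OF d1 powr_has_derivative_Re_pos[OF Re, of ?c]]
  note d4 = has_derivative_mult[OF d2 d3]
  note d5 = has_derivative_add[OF bounded_linear.has_derivative[OF bounded_linear_axis[of j] d1]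
      bounded_linear.has_derivative[OF bounded_linear_axis[of i] d4]]
  define D where "D = (\<lambda>h::complex \<times> real. axis j (complex_of_real r * fst h) + axis i (?T * (?c * ?w powr (?c - 1) * (complex_of_real r * fst h)) +
      complex_of_real r * complex_of_real (snd h) * ?w powr ?c) :: complex ^ 2)"
  have D: "(std_chart i j w0 t0 r has_derivative D) (at x)"
    using d5 unfolding D_def std_chart_def[abs_def] .
  have "linear D" using D by (rule has_derivative_linear)
  then have "inj D"
  proof (rule linear_injective_0[THEN iffD2, rule_format])
    fix h assume h: "D h = 0"
    then have hj: "D h $ j = 0" and hi: "D h $ i = 0" by auto
    from hj have f: "fst h = 0" using ij r by (auto simp: D_def axis_def)
    have "?w \<noteq> 0" by (rule Re_pos_imp_nonzero[OF Re])
    with hi f have "snd h = 0" using ij r by (auto simp: D_def axis_def)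
    with f show "h = 0" by (simp add: prod_eq_iff)
  qed
  then show ?thesis using frechet_derivative_at[OF D] by simp
qed

text \<open>The chart is shrunk into \<open>W\<close>, and its image is all of
  \<open>saddle_hyp\<close> inside an ambient open set \<open>N\<close>. With the last conclusion,
  its plaques are the level sets of the leaf function in \<open>N\<close>, which arbitrary Levi
  charts do not provide directly.\<close>

lemma std_chart_exists:
  assumes p: "p \<in> saddle_hyp" and ij: "i \<noteq> j" and Re: "Re (p $ j) > 0" and W: "open W" "p \<in> W"
  obtains \<Phi> N where "levi_chart saddle_hyp \<Phi>" "\<Phi> (0, 0) = p" "open N" "p \<in> N" "N \<subseteq> W \<inter> {q. Re (q $ j) > 0}"
    "\<Phi> ` chart_dom = saddle_hyp \<inter> N"
    "\<And>x. x \<in> chart_dom \<Longrightarrow> Im (leaf_fun i j (\<Phi> x)) = 0"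
    "\<And>x y. x \<in> chart_dom \<Longrightarrow> y \<in> chart_dom \<Longrightarrow> leaf_fun i j (\<Phi> x) = leaf_fun i j (\<Phi> y) \<longleftrightarrow> snd x = snd y"
proof -
  have pB: "p \<in> big_ball" using p saddle_hyp_big_ball by blast
  define w0 where "w0 = p $ j"
  define t0 where "t0 = Re (leaf_fun i j p)"
  have Im0: "Im (leaf_fun i j p) = 0" using saddle_hyp_iff[OF pB ij Re] p by simp
  define F where "F = std_chart i j w0 t0 1"
  have F0: "F (0, 0) = p"
    using std_chart_leaf_fun[OF ij Re Im0, of 1 w0 t0] by (simp add: F_def w0_def t0_def)
  define W' where "W' = W \<inter> big_ball \<inter> {q. Re (q $ j) > 0}"
  have W': "open W'" "p \<in> W'" using W pB Re open_big_ball open_Re_pos by (auto simp: W'_def)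
  have "isCont F (0, 0)"
    unfolding F_def
    by (rule differentiable_imp_continuous_within[OF real_analytic_at_imp_differentiable[OF std_chart_real_analytic[OF ij]]])
       (use Re in \<open>simp add: w0_def\<close>)
  then obtain e where e: "e > 0" "\<And>x. dist x (0, 0) < e \<Longrightarrow> F x \<in> W'"
    using W' F0 unfolding continuous_at_open eventually_at
    by (metis (no_types, lifting) F0 continuous_at_open eventually_nhds_metric isCont_def topological_tendstoD continuous_within eventually_nhds)
  \<comment> \<open>The rescaled chart variables have norm at most \<open>2 * r\<close>, which must
    be less than \<open>e\<close>.\<close>
  define r where "r = e / 3"
  have r: "r > 0" using e by (simp add: r_def)
  define \<Phi> where "\<Phi> = std_chart i j w0 t0 r"
  have \<Phi>_F: "\<Phi> x = F (complex_of_real r * fst x, r * snd x)" for x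
    by (simp add: \<Phi>_def F_def std_chart_def)
  have \<Phi>_W: "\<Phi> x \<in> W'" if x: "x \<in> chart_dom" for x
    unfolding \<Phi>_F
  proof (rule e(2))
    have "dist (complex_of_real r * fst x, r * snd x) (0, 0) = norm (complex_of_real r * fst x, r * snd x)"
      by (simp add: dist_norm flip: zero_prod_def)
    also have "\<dots> \<le> norm (complex_of_real r * fst x) + norm (r * snd x)" by (rule norm_Pair_le)
    also have "\<dots> \<le> r * 1 + r * 1"
      using x r by (intro add_mono) (auto simp: norm_mult abs_mult intro!: mult_left_mono)
    also have "\<dots> < e" using e by (simp add: r_def)
    finally show "dist (complex_of_real r * fst x, r * snd x) (0, 0) < e" .
  qed
  have nthj: "\<Phi> x $ j = w0 + complex_of_real r * fst x" for x using std_chart_nth[OF ij] by (simp add: \<Phi>_def)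
  have Rex: "Re (w0 + complex_of_real r * fst x) > 0" if "x \<in> chart_dom" for x
    using \<Phi>_W[OF that] unfolding W'_def by (auto simp: nthj)
  have lf: "leaf_fun i j (\<Phi> x) = complex_of_real (t0 + r * snd x)" if "x \<in> chart_dom" for x
    unfolding \<Phi>_def by (rule leaf_fun_std_chart[OF ij Rex[OF that]])
  define N where "N = W' \<inter> {q. Re (q $ j) > 0 \<and> cmod (q $ j - w0) < r \<and> \<bar>Re (leaf_fun i j q) - t0\<bar> < r}"
  have "open N"
  proof -
    let ?P = "{q. Re (q $ j) > 0}"
    have "continuous_on ?P (\<lambda>q. \<bar>Re (leaf_fun i j q) - t0\<bar>)"
      by (intro continuous_intros continuous_on_leaf_fun) auto
    then have 1: "open (?P \<inter> (\<lambda>q. \<bar>Re (leaf_fun i j q) - t0\<bar>) -` {..<r})"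
      by (rule continuous_open_preimage[OF _ open_Re_pos]) simp
    have "continuous_on ?P (\<lambda>q. cmod (q $ j - w0))"
      by (intro continuous_intros)
    then have 2: "open (?P \<inter> (\<lambda>q. cmod (q $ j - w0)) -` {..<r})"
      by (rule continuous_open_preimage[OF _ open_Re_pos]) simp
    have "N = W' \<inter> (?P \<inter> (\<lambda>q. \<bar>Re (leaf_fun i j q) - t0\<bar>) -` {..<r}) \<inter> (?P \<inter> (\<lambda>q. cmod (q $ j - w0)) -` {..<r})"
      by (auto simp: N_def)
    then show ?thesis using 1 2 W'(1) by (metis open_Int)
  qed
  have pN: "p \<in> N" using W'(2) Re r by (simp add: N_def w0_def t0_def)
  let ?\<Psi> = "\<lambda>q. ((q $ j - w0) / complex_of_real r, (Re (leaf_fun i j q) - t0) / r)"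
  have image: "\<Phi> ` chart_dom = saddle_hyp \<inter> N"
  proof safe
    fix a :: complex and b :: real assume ab: "a \<in> ball 0 1" "b \<in> {-1<..<1}"
    then have x: "(a, b) \<in> chart_dom" by simp
    have B: "\<Phi> (a, b) \<in> big_ball" "Re (\<Phi> (a, b) $ j) > 0" using \<Phi>_W[OF x] by (auto simp: W'_def)
    show "\<Phi> (a, b) \<in> saddle_hyp" using saddle_hyp_iff[OF B(1) ij B(2)] lf[OF x] by simp
    show "\<Phi> (a, b) \<in> N" using \<Phi>_W[OF x] B lf[OF x] ab r
      by (auto simp: N_def nthj norm_mult abs_mult)
  next
    fix q assume q: "q \<in> saddle_hyp" "q \<in> N"
    then have qj: "Re (q $ j) > 0" by (simp add: N_def)
    have "q \<in> big_ball" using q saddle_hyp_big_ball by blast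
    then have "Im (leaf_fun i j q) = 0" using saddle_hyp_iff[OF _ ij qj] q by blast
    from std_chart_leaf_fun[OF ij qj this r, of w0 t0] have "q = \<Phi> (?\<Psi> q)" by (simp add: \<Phi>_def)
    moreover have "?\<Psi> q \<in> chart_dom"
      using q(2) r by (auto simp: N_def norm_divide field_simps abs_less_iff)
    ultimately show "q \<in> \<Phi> ` chart_dom" by (rule image_eqI)
  qed
  have cont\<Phi>: "continuous_on chart_dom \<Phi>"
    unfolding \<Phi>_def
    by (intro continuous_at_imp_continuous_on ballI differentiable_imp_continuous_within
        real_analytic_at_imp_differentiable std_chart_real_analytic[OF ij] Rex)
  have cont\<Psi>: "continuous_on (\<Phi> ` chart_dom) ?\<Psi>"
    unfolding image using r
    by (intro continuous_intros continuous_on_subset[OF continuous_on_leaf_fun[of "{q. Re (q $ j) > 0}"]])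
       (auto simp: N_def)
  have inv: "?\<Psi> (\<Phi> x) = x" if "x \<in> chart_dom" for x
    using r by (simp add: lf[OF that] nthj)
  have "levi_chart saddle_hyp \<Phi>"
    unfolding levi_chart_def Let_def
  proof (intro conjI ballI allI)
    fix x assume x: "x \<in> chart_dom"
    show "real_analytic_at \<Phi> x" unfolding \<Phi>_def by (rule std_chart_real_analytic[OF ij Rex[OF x]])
    show "inj (frechet_derivative \<Phi> (at x))" unfolding \<Phi>_def by (rule std_chart_inj_derivative[OF ij Rex[OF x] r])
  next
    show "\<exists>\<Psi>. homeomorphism chart_dom (\<Phi> ` chart_dom) \<Phi> \<Psi>"
      by (rule exI[of _ ?\<Psi>], rule homeomorphismI[OF cont\<Phi> cont\<Psi>]) (use inv in \<open>auto simp del: split_paired_All\<close>)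
    show "openin (top_of_set saddle_hyp) (\<Phi> ` chart_dom)" unfolding image using \<open>open N\<close> by blast
    fix t k assume t: "t \<in> {-1<..<1::real}"
    show "(\<lambda>\<zeta>. \<Phi> (\<zeta>, t) $ k) holomorphic_on ball 0 1"
    proof (cases "k = j")
      case True
      then show ?thesis by (auto simp: nthj intro!: holomorphic_intros)
    next
      case False
      then have k: "k = i" using two_cases[OF ij] by blast
      have "w0 + complex_of_real r * z \<notin> \<real>\<^sub>\<le>\<^sub>0" if "z \<in> ball 0 1" for z
        using Rex[of "(z, t)"] that t by (auto simp: complex_nonpos_Reals_iff)
      then have "(\<lambda>\<zeta>. complex_of_real (t0 + r * t) * (w0 + complex_of_real r * \<zeta>) powr - complex_of_real (expo i j)) holomorphic_on ball 0 1"
        by (intro holomorphic_intros) auto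
      then show ?thesis by (simp add: k \<Phi>_def std_chart_nth[OF ij])
    qed
  qed
  moreover have "\<Phi> (0, 0) = p" by (simp add: \<Phi>_F F0)
  moreover have "N \<subseteq> W \<inter> {q. Re (q $ j) > 0}" by (auto simp: N_def W'_def)
  moreover have "leaf_fun i j (\<Phi> x) = leaf_fun i j (\<Phi> y) \<longleftrightarrow> snd x = snd y" if "x \<in> chart_dom" "y \<in> chart_dom" for x y
    using lf[OF that(1)] lf[OF that(2)] r by (simp del: of_real_add of_real_mult)
  moreover have "Im (leaf_fun i j (\<Phi> x)) = 0" if "x \<in> chart_dom" for x
    using lf[OF that] by (simp del: of_real_add of_real_mult)
  ultimately show ?thesis using that[of \<Phi> N] \<open>open N\<close> pN image by blast
qed

lemma levi_flat_saddle_hyp: "levi_flat saddle_hyp"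
  unfolding levi_flat_def
proof
  fix p assume p: "p \<in> saddle_hyp"
  then have pB: "p \<in> big_ball" using saddle_hyp_big_ball by blast
  obtain i j :: 2 where ij: "i \<noteq> j" "Re (p $ j) > 0" using saddle_hyp_side[OF pB] .
  obtain \<Phi> N where "levi_chart saddle_hyp \<Phi>" "p \<in> N" "\<Phi> ` chart_dom = saddle_hyp \<inter> N"
    by (rule std_chart_exists[OF p ij open_UNIV UNIV_I])
  with p show "\<exists>\<Phi>. levi_chart saddle_hyp \<Phi> \<and> p \<in> \<Phi> ` chart_dom" by blast
qed

section \<open>The leaf function in an arbitrary Levi chart\<close>

lemma holomorphic_real_valued_constant:
  assumes f: "f holomorphic_on S" and S: "open S" "connected S" and im: "\<And>z. z \<in> S \<Longrightarrow> Im (f z) = 0"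
  shows "f constant_on S"
proof (rule ccontr)
  assume nc: "\<not> f constant_on S"
  have op: "open (f ` S)" by (rule open_mapping_thm[OF f S S(1) subset_refl nc])
  have "S \<noteq> {}" using nc by (auto simp: constant_on_def)
  then obtain z where "z \<in> S" by blast
  then obtain e where e: "e > 0" "ball (f z) e \<subseteq> f ` S" using op openE by blast
  have "f z + \<i> * complex_of_real (e / 2) \<in> ball (f z) e" using e by (simp add: dist_norm norm_mult)
  then obtain w where "w \<in> S" "f w = f z + \<i> * complex_of_real (e / 2)" using e(2) by (metis (no_types, lifting) imageE subsetD)
  then show False using im[of w] im[OF \<open>z \<in> S\<close>] e(1) by simp
qed

lemma levi_chartD:
  assumes "levi_chart M \<Phi>"
  shows "\<And>x. x \<in> chart_dom \<Longrightarrow> real_analytic_at \<Phi> x"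
    "\<And>x. x \<in> chart_dom \<Longrightarrow> inj (frechet_derivative \<Phi> (at x))"
    "\<exists>\<Psi>. homeomorphism chart_dom (\<Phi> ` chart_dom) \<Phi> \<Psi>"
    "openin (top_of_set M) (\<Phi> ` chart_dom)"
    "\<And>t k. t \<in> {-1<..<1} \<Longrightarrow> (\<lambda>\<zeta>. \<Phi> (\<zeta>, t) $ k) holomorphic_on ball 0 1"
    "\<And>x. x \<in> chart_dom \<Longrightarrow> \<Phi> x \<in> M"
proof -
  have *: "(\<forall>x\<in>chart_dom. real_analytic_at \<Phi> x \<and> inj (frechet_derivative \<Phi> (at x))) \<and>
      (\<exists>\<Psi>. homeomorphism chart_dom (\<Phi> ` chart_dom) \<Phi> \<Psi>) \<and>
      openin (top_of_set M) (\<Phi> ` chart_dom) \<and>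
      (\<forall>t\<in>{-1<..<1}. \<forall>j. (\<lambda>\<zeta>. \<Phi> (\<zeta>, t) $ j) holomorphic_on ball 0 1)"
    using assms unfolding levi_chart_def Let_def .
  then show "\<And>x. x \<in> chart_dom \<Longrightarrow> real_analytic_at \<Phi> x"
    "\<And>x. x \<in> chart_dom \<Longrightarrow> inj (frechet_derivative \<Phi> (at x))"
    "\<exists>\<Psi>. homeomorphism chart_dom (\<Phi> ` chart_dom) \<Phi> \<Psi>"
    "\<And>t k. t \<in> {-1<..<1} \<Longrightarrow> (\<lambda>\<zeta>. \<Phi> (\<zeta>, t) $ k) holomorphic_on ball 0 1"
    by blast+
  show o: "openin (top_of_set M) (\<Phi> ` chart_dom)" using * by blast
  show "\<And>x. x \<in> chart_dom \<Longrightarrow> \<Phi> x \<in> M" using openin_imp_subset[OF o] by blast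
qed

lemma inj_linear_DIM_le:
  fixes f :: "'a::euclidean_space \<Rightarrow> 'b::euclidean_space"
  assumes "linear f" "inj f"
  shows "DIM('a) \<le> DIM('b)"
proof -
  have "dim (f ` UNIV) = dim (UNIV :: 'a set)"
    by (rule dim_image_eq[OF assms(1)]) (use assms(2) in simp)
  moreover have "dim (f ` UNIV) \<le> DIM('b)" by (rule dim_subset_UNIV)
  ultimately show ?thesis by simp
qed

text \<open>On a plaque the leaf function is holomorphic and real, hence constant; this defines
  \<open>k\<close>. Its derivative never vanishes because the chart is an immersion of a
  three-dimensional domain, and Rolle's theorem turns this into injectivity.\<close>

lemma chart_transverse:
  assumes \<Phi>: "levi_chart saddle_hyp \<Phi>" and x0: "(\<zeta>0, t0) \<in> chart_dom" and ij: "i \<noteq> j"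
    and Re0: "Re (\<Phi> (\<zeta>0, t0) $ j) > 0"
  obtains e k where "e > 0" "ball \<zeta>0 e \<times> ball t0 e \<subseteq> chart_dom"
    "\<And>\<zeta> t. \<zeta> \<in> ball \<zeta>0 e \<Longrightarrow> t \<in> ball t0 e \<Longrightarrow> Re (\<Phi> (\<zeta>, t) $ j) > 0 \<and> leaf_fun i j (\<Phi> (\<zeta>, t)) = complex_of_real (k t)"
    "inj_on k (ball t0 e)"
proof -
  note ch = levi_chartD[OF \<Phi>]
  have opV: "open chart_dom" by (intro open_Times) auto
  have dif: "\<Phi> differentiable (at x)" if "x \<in> chart_dom" for x
    by (rule real_analytic_at_imp_differentiable[OF ch(1)[OF that]])
  have contV: "continuous_on chart_dom \<Phi>"
    by (intro continuous_at_imp_continuous_on ballI differentiable_imp_continuous_within dif)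
  have o: "open (chart_dom \<inter> \<Phi> -` {q. Re (q $ j) > 0})"
    by (rule continuous_open_preimage[OF contV opV open_Re_pos])
  have m: "(\<zeta>0, t0) \<in> chart_dom \<inter> \<Phi> -` {q. Re (q $ j) > 0}" using x0 Re0 by simp
  obtain X Y where "open X" "open Y" "(\<zeta>0, t0) \<in> X \<times> Y" "X \<times> Y \<subseteq> chart_dom \<inter> \<Phi> -` {q. Re (q $ j) > 0}"
    by (rule open_prod_elim[OF o m])
  then have XY: "open X" "open Y" "\<zeta>0 \<in> X" "t0 \<in> Y" "X \<times> Y \<subseteq> chart_dom \<inter> \<Phi> -` {q. Re (q $ j) > 0}"
    by auto
  obtain e1 where e1: "e1 > 0" "ball \<zeta>0 e1 \<subseteq> X" using XY openE by blast
  obtain e2 where e2: "e2 > 0" "ball t0 e2 \<subseteq> Y" using XY openE by blast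
  define e where "e = min e1 e2"
  have e: "e > 0" using e1 e2 by (simp add: e_def)
  have box: "(\<zeta>, t) \<in> chart_dom \<and> Re (\<Phi> (\<zeta>, t) $ j) > 0" if "\<zeta> \<in> ball \<zeta>0 e" "t \<in> ball t0 e" for \<zeta> t
  proof -
    have "(\<zeta>, t) \<in> X \<times> Y" using that e1(2) e2(2) by (auto simp: e_def)
    then show ?thesis using XY(5) by auto
  qed
  have im0: "Im (leaf_fun i j (\<Phi> x)) = 0" if "x \<in> chart_dom" "Re (\<Phi> x $ j) > 0" for x
    using saddle_hyp_iff[OF _ ij that(2)] ch(6)[OF that(1)] saddle_hyp_big_ball by blast
  define k where "k = (\<lambda>t. Re (leaf_fun i j (\<Phi> (\<zeta>0, t))))"
  have cen: "\<zeta>0 \<in> ball \<zeta>0 e" using e by simp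
  have const: "leaf_fun i j (\<Phi> (\<zeta>, t)) = complex_of_real (k t)" if z: "\<zeta> \<in> ball \<zeta>0 e" and t: "t \<in> ball t0 e" for \<zeta> t
  proof -
    have t1: "t \<in> {-1<..<1}" using box[OF cen t] by simp
    have sub: "ball \<zeta>0 e \<subseteq> ball 0 1" using box[OF _ t] by auto
    have coord: "(\<lambda>z. \<Phi> (z, t) $ k) holomorphic_on ball \<zeta>0 e" for k
      using ch(5)[OF t1] sub by (rule holomorphic_on_subset)
    have "(\<lambda>z. leaf_fun i j (\<Phi> (z, t))) holomorphic_on ball \<zeta>0 e"
      unfolding leaf_fun_def
    proof (intro holomorphic_on_mult holomorphic_on_powr holomorphic_on_const coord)
      show "\<Phi> (z, t) $ j \<notin> \<real>\<^sub>\<le>\<^sub>0" if "z \<in> ball \<zeta>0 e" for z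
        using box[OF that t] by (simp add: complex_nonpos_Reals_iff)
    qed
    then have "(\<lambda>z. leaf_fun i j (\<Phi> (z, t))) constant_on ball \<zeta>0 e"
      by (rule holomorphic_real_valued_constant) (use box[OF _ t] im0 in auto)
    then have "leaf_fun i j (\<Phi> (\<zeta>, t)) = leaf_fun i j (\<Phi> (\<zeta>0, t))"
      using z cen unfolding constant_on_def by metis
    also have "\<dots> = complex_of_real (k t)"
      using im0 box[OF cen t] by (simp add: k_def complex_eq_iff)
    finally show ?thesis .
  qed
  have deriv: "\<exists>d. d \<noteq> 0 \<and> (k has_real_derivative d) (at t)" if t: "t \<in> ball t0 e" for t
  proof -
    let ?x = "(\<zeta>0, t)"
    have x: "?x \<in> chart_dom" and Rex: "Re (\<Phi> ?x $ j) > 0" using box[OF cen t] by auto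
    define D1 where "D1 = frechet_derivative \<Phi> (at ?x)"
    have D1: "(\<Phi> has_derivative D1) (at ?x)" unfolding D1_def using dif[OF x] by (simp add: frechet_derivative_works)
    define c where "c = (\<Phi> ?x $ j) powr complex_of_real (expo i j)"
    define b where "b = \<Phi> ?x $ i * (complex_of_real (expo i j) * (\<Phi> ?x $ j) powr (complex_of_real (expo i j) - 1))"
    have c: "c \<noteq> 0" using Re_pos_imp_nonzero[OF Rex] by (simp add: c_def)
    define D2 where "D2 = (\<lambda>v::complex^2. v $ i * c + b * v $ j)"
    have D2: "(leaf_fun i j has_derivative D2) (at (\<Phi> ?x))"
      using leaf_fun_has_derivative[OF Rex, of i] unfolding D2_def c_def b_def by (simp add: mult.assoc)
    have G: "((\<lambda>y. leaf_fun i j (\<Phi> y)) has_derivative (\<lambda>v. D2 (D1 v))) (at ?x)"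
      by (rule has_derivative_compose[OF D1 D2])
    have lin: "linear (\<lambda>v. D2 (D1 v))" using G by (rule has_derivative_linear)
    have along: "((\<lambda>s. leaf_fun i j (\<Phi> (?x + s *\<^sub>R v))) has_vector_derivative D2 (D1 v)) (at 0)" for v
    proof -
      have "((\<lambda>s. ?x + s *\<^sub>R v) has_derivative (\<lambda>s. s *\<^sub>R v)) (at (0::real))"
        by (auto intro!: derivative_eq_intros)
      from has_derivative_compose[OF this, of "\<lambda>y. leaf_fun i j (\<Phi> y)" "\<lambda>v. D2 (D1 v)"] G
      show ?thesis by (simp add: has_vector_derivative_def linear_scale[OF lin])
    qed
    have horiz: "D2 (D1 (a, 0)) = 0" for a
    proof -
      have "((\<lambda>s. leaf_fun i j (\<Phi> (?x + s *\<^sub>R (a, 0)))) has_vector_derivative 0) (at 0)"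
      proof (rule has_vector_derivative_transform_within_open[OF has_vector_derivative_const])
        show "open {s::real. norm (s *\<^sub>R a) < e}" by (intro open_Collect_less continuous_intros)
        show "0 \<in> {s::real. norm (s *\<^sub>R a) < e}" using e by simp
        fix s :: real assume "s \<in> {s. norm (s *\<^sub>R a) < e}"
        then have "\<zeta>0 + s *\<^sub>R a \<in> ball \<zeta>0 e" by (simp add: dist_norm)
        from const[OF this t] show "complex_of_real (k t) = leaf_fun i j (\<Phi> (?x + s *\<^sub>R (a, 0)))" by simp
      qed
      from vector_derivative_unique_at[OF along[of "(a,0)"] this] show ?thesis .
    qed
    let ?d = "Re (D2 (D1 (0, 1)))"
    have vert: "((\<lambda>s. leaf_fun i j (\<Phi> (\<zeta>0, s))) has_vector_derivative D2 (D1 (0, 1))) (at t)"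
    proof -
      have "((\<lambda>s. (\<zeta>0, s)) has_derivative (\<lambda>s. (0, s))) (at t)"
        by (auto intro!: derivative_eq_intros)
      from has_derivative_compose[OF this, of "\<lambda>y. leaf_fun i j (\<Phi> y)" "\<lambda>v. D2 (D1 v)"] G
      have "((\<lambda>s. leaf_fun i j (\<Phi> (\<zeta>0, s))) has_derivative (\<lambda>s. D2 (D1 (0, s)))) (at t)" by simp
      moreover have "(\<lambda>s. D2 (D1 (0, s))) = (\<lambda>s. s *\<^sub>R D2 (D1 (0, 1)))"
      proof
        fix s
        have e: "(0, s) = s *\<^sub>R (0::complex, 1::real)" by simp
        show "D2 (D1 (0, s)) = s *\<^sub>R D2 (D1 (0, 1))" unfolding e by (rule linear_scale[OF lin])
      qed
      ultimately show ?thesis unfolding has_vector_derivative_def by metis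
    qed
    have kd: "(k has_real_derivative ?d) (at t)"
      using bounded_linear.has_vector_derivative[OF bounded_linear_Re vert]
      unfolding k_def by (simp add: has_real_derivative_iff_has_vector_derivative)
    have imd: "Im (D2 (D1 (0, 1))) = 0"
    proof -
      have "((\<lambda>s. Im (leaf_fun i j (\<Phi> (\<zeta>0, s)))) has_vector_derivative Im (D2 (D1 (0, 1)))) (at t)"
        by (rule bounded_linear.has_vector_derivative[OF bounded_linear_Im vert])
      moreover have "((\<lambda>s. Im (leaf_fun i j (\<Phi> (\<zeta>0, s)))) has_vector_derivative 0) (at t)"
      proof (rule has_vector_derivative_transform_within_open[OF has_vector_derivative_const[of 0] open_ball[of t0 e] t])
        show "0 = Im (leaf_fun i j (\<Phi> (\<zeta>0, y)))" if "y \<in> ball t0 e" for y using const[OF cen that] by simp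
      qed
      ultimately show ?thesis by (rule vector_derivative_unique_at)
    qed
    \<comment> \<open>Otherwise the derivative of the leaf function kills the whole image of
      \<open>D1\<close>, so \<open>D1 v $ i\<close> is determined by \<open>D1 v $ j\<close>. Then
      \<open>D1 v $ j\<close> alone would embed a real three-dimensional space into the complex
      numbers.\<close>
    have "?d \<noteq> 0"
    proof
      assume "?d = 0"
      then have z1: "D2 (D1 (0, 1)) = 0" using imd by (simp add: complex_eq_iff)
      have zero: "D2 (D1 v) = 0" for v
      proof -
        have "v = (fst v, 0) + snd v *\<^sub>R (0, 1)" by (simp add: prod_eq_iff)
        then have "D2 (D1 v) = D2 (D1 (fst v, 0)) + snd v *\<^sub>R D2 (D1 (0, 1))"
          by (metis linear_add[OF lin] linear_scale[OF lin])
        then show ?thesis using horiz z1 by simp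
      qed
      have lD1: "linear D1" using D1 by (rule has_derivative_linear)
      have injD1: "inj D1" unfolding D1_def by (rule ch(2)[OF x])
      have l: "linear (\<lambda>v. D1 v $ j)"
        by (rule linear_compose[OF lD1 bounded_linear.linear[OF bounded_linear_vec_nth], unfolded o_def])
      have "inj (\<lambda>v. D1 v $ j)"
      proof (rule linear_injective_0[OF l, THEN iffD2, rule_format])
        fix v assume vj: "D1 v $ j = 0"
        then have "D1 v $ i = 0" using zero[of v] c by (simp add: D2_def)
        have "D1 v = 0"
          unfolding vec_eq_iff
        proof
          fix k
          show "D1 v $ k = 0 $ k" using two_cases[OF ij, of k] vj \<open>D1 v $ i = 0\<close> by auto
        qed
        then have "D1 v = D1 0" using linear_0[OF lD1] by simp
        then show "v = 0" by (rule injD[OF injD1])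
      qed
      from inj_linear_DIM_le[OF l this] show False by simp
    qed
    with kd show ?thesis by blast
  qed
  have "inj_on k (ball t0 e)"
  proof (rule inj_onI, rule ccontr)
    have main: False if ab: "a \<in> ball t0 e" "b \<in> ball t0 e" "k a = k b" "a < b" for a b
    proof -
      have sub: "{a..b} \<subseteq> ball t0 e" using ab by (auto simp: dist_real_def)
      have "\<exists>z. a < z \<and> z < b \<and> (k has_real_derivative 0) (at z)"
      proof (rule Rolle[OF ab(4,3)])
        show "continuous_on {a..b} k"
          using deriv sub by (intro continuous_at_imp_continuous_on ballI) (meson DERIV_isCont subsetD)
        show "k differentiable at x" if "a < x" "x < b" for x
        proof -
          have "x \<in> ball t0 e" by (rule subsetD[OF sub]) (use that in simp)
          from deriv[OF this] show ?thesis by (auto simp: real_differentiable_def)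
        qed
      qed
      then obtain z where z: "a < z" "z < b" "(k has_real_derivative 0) (at z)" by blast
      moreover have "z \<in> ball t0 e" by (rule subsetD[OF sub]) (use z in simp)
      ultimately show False using deriv[of z] DERIV_unique by blast
    qed
    fix a b assume "a \<in> ball t0 e" "b \<in> ball t0 e" "k a = k b" "a \<noteq> b"
    then show False using main[of a b] main[of b a] by (metis linorder_neqE_linordered_idom)
  qed
  moreover have "ball \<zeta>0 e \<times> ball t0 e \<subseteq> chart_dom" using box by blast
  ultimately show ?thesis using that[OF e] box const by blast
qed

section \<open>A complete invariant of the leaves, and holonomy\<close>

text \<open>
  The leaf space is not Hausdorff: a positive invariant \<open>leaf_fun 1 2 = t\<close> belongs to the same leaf as
  \<open>leaf_fun 2 1 = t powr lam\<close>, but nonpositive invariants belong to one leaf on the side \<open>Re (p $ 1) > 0\<close>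
  and to another one on the side \<open>Re (p $ 2) > 0\<close>. The second component tells these apart.
\<close>

definition leaf_code :: "complex ^ 2 \<Rightarrow> real \<times> nat" where
  "leaf_code p = (if Re (p $ 1) > 0
     then (Re (leaf_fun 2 1 p), if Re (leaf_fun 2 1 p) > 0 then 0 else 1)
     else (Re (leaf_fun 1 2 p), 2))"

text \<open>On one side the code carries the same information as the local invariant: where both
  parameters are positive, the invariant for \<open>2 1\<close> is the power \<open>lam\<close> of
  the one for \<open>1 2\<close>. Injectivity of \<open>K\<close> allows passing back from equal
  codes to equal invariants.\<close>

lemma leaf_code_eq:
  assumes ij: "i \<noteq> j"
  obtains K :: "real \<Rightarrow> real \<times> nat" where "inj K"
    "\<And>p. p \<in> saddle_hyp \<Longrightarrow> Re (p $ j) > 0 \<Longrightarrow> leaf_code p = K (Re (leaf_fun i j p))"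
proof -
  consider "i = 2" "j = 1" | "i = 1" "j = 2" using ij exhaust_2[of i] exhaust_2[of j] by auto
  then show ?thesis
  proof cases
    case 1
    show ?thesis
      by (rule that[of "\<lambda>s. (s, if s > 0 then 0 else 1)"]) (auto simp: inj_def leaf_code_def 1)
  next
    case 2
    define K :: "real \<Rightarrow> real \<times> nat" where "K = (\<lambda>t. if t > 0 then (t powr lam, 0) else (t, 2))"
    have "inj K"
    proof (rule injI)
      fix s t assume "K s = K t"
      then show "s = t"
      proof (cases "s > 0 \<and> t > 0")
        case True
        then have "(s powr lam) powr (1 / lam) = (t powr lam) powr (1 / lam)"
          using \<open>K s = K t\<close> by (simp add: K_def)
        then show ?thesis using True lam_pos by (simp add: powr_powr)
      qed (use \<open>K s = K t\<close> in \<open>auto simp: K_def split: if_splits\<close>)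
    qed
    moreover have "leaf_code p = K (Re (leaf_fun i j p))" if p: "p \<in> saddle_hyp" "Re (p $ j) > 0" for p
    proof -
      obtain x t where xt: "p = saddle_pt x t" "\<bar>t\<bar> < time_bound" using p(1) by (rule saddle_hypD)
      have x2: "x $ 2 > 0" using p(2) Re_saddle_pt_pos_iff[OF xt(2)] unfolding 2 xt(1) by blast
      have e: "expo 1 2 = 1 / lam" "expo 2 1 = lam" by (simp_all add: expo_def)
      have l12: "leaf_fun 1 2 p = complex_of_real (x $ 1 * x $ 2 powr (1 / lam))"
        using leaf_fun_saddle_pt[OF xt(2) x2, of 1] by (simp only: xt(1) e)
      show ?thesis
      proof (cases "x $ 1 > 0")
        case True
        have l21: "leaf_fun 2 1 p = complex_of_real (x $ 2 * x $ 1 powr lam)"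
          using leaf_fun_saddle_pt[OF xt(2) True, of 2] by (simp only: xt(1) e)
        have Re1: "Re (p $ 1) > 0" unfolding xt(1) using Re_saddle_pt_pos_iff[OF xt(2)] True by blast
        have "(x $ 1 * x $ 2 powr (1 / lam)) powr lam = x $ 1 powr lam * x $ 2"
          using True x2 lam_pos by (simp add: powr_mult powr_powr)
        then show ?thesis
          using Re1 True x2 unfolding leaf_code_def K_def 2 l12 l21 Re_complex_of_real by (simp add: mult.commute)
      next
        case False
        have Re1: "\<not> Re (p $ 1) > 0" unfolding xt(1) using Re_saddle_pt_pos_iff[OF xt(2)] False by blast
        have "\<not> x $ 1 * x $ 2 powr (1 / lam) > 0" using False x2 by (simp add: zero_less_mult_iff)
        then show ?thesis using Re1 unfolding leaf_code_def K_def 2 l12 Re_complex_of_real by simp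
      qed
    qed
    ultimately show ?thesis by (rule that)
  qed
qed

section \<open>Plaques and the leaf topology\<close>

definition plaques :: "(complex ^ 2) set \<Rightarrow> (complex ^ 2) set set" where
  "plaques M = {\<Phi> ` (ball 0 1 \<times> {t}) |\<Phi> t. levi_chart M \<Phi> \<and> t \<in> {-1<..<1}}"

lemma leaf_topology_eq: "leaf_topology M = topology_generated_by (plaques M)"
  by (simp add: leaf_topology_def plaques_def)

lemma plaqueI: "levi_chart M \<Phi> \<Longrightarrow> t \<in> {-1<..<1} \<Longrightarrow> \<Phi> ` (ball 0 1 \<times> {t}) \<in> plaques M"
  unfolding plaques_def by blast

lemma topspace_leaf_topology_subset: "topspace (leaf_topology M) \<subseteq> M"
proof
  fix p assume "p \<in> topspace (leaf_topology M)"
  then obtain \<Phi> t where *: "levi_chart M \<Phi>" "t \<in> {-1<..<1}" "p \<in> \<Phi> ` (ball 0 1 \<times> {t})"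
    by (auto simp: leaf_topology_eq plaques_def)
  then obtain z where "z \<in> ball 0 1" "p = \<Phi> (z, t)" by blast
  then show "p \<in> M" using levi_chartD(6)[OF *(1), of "(z, t)"] *(2) by simp
qed

lemma openin_leaf_topology_plaque:
  "levi_chart M \<Phi> \<Longrightarrow> t \<in> {-1<..<1} \<Longrightarrow> openin (leaf_topology M) (\<Phi> ` (ball 0 1 \<times> {t}))"
  unfolding leaf_topology_eq by (rule topology_generated_by_Basis[OF plaqueI])

text \<open>The central plaque of a standard chart at \<open>p\<close> is open in the leaf topology
  and the invariant is constant on it. So the code is locally constant, and therefore constant along
  leafwise paths.\<close>

lemma leaf_code_continuous: "continuous_map (leaf_topology saddle_hyp) (discrete_topology UNIV) leaf_code"
  unfolding continuous_map_def
proof (intro conjI allI impI)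
  fix S :: "(real \<times> nat) set"
  let ?L = "leaf_topology saddle_hyp"
  show "openin ?L {p \<in> topspace ?L. leaf_code p \<in> S}"
  proof (subst openin_subopen, rule ballI)
    fix p assume p: "p \<in> {p \<in> topspace ?L. leaf_code p \<in> S}"
    then have pM: "p \<in> saddle_hyp" using topspace_leaf_topology_subset by blast
    then have pB: "p \<in> big_ball" using saddle_hyp_big_ball by blast
    obtain i j :: 2 where ij: "i \<noteq> j" "Re (p $ j) > 0" using saddle_hyp_side[OF pB] .
    obtain K :: "real \<Rightarrow> real \<times> nat" where "inj K" and K: "\<And>p. p \<in> saddle_hyp \<Longrightarrow> Re (p $ j) > 0 \<Longrightarrow> leaf_code p = K (Re (leaf_fun i j p))"
      by (rule leaf_code_eq[OF ij(1)], rule that)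
    obtain \<Phi> N where ch: "levi_chart saddle_hyp \<Phi>" "\<Phi> (0, 0) = p" "open N" "p \<in> N" "N \<subseteq> UNIV \<inter> {q. Re (q $ j) > 0}"
      "\<Phi> ` chart_dom = saddle_hyp \<inter> N" "\<And>x. x \<in> chart_dom \<Longrightarrow> Im (leaf_fun i j (\<Phi> x)) = 0"
      "\<And>x y. x \<in> chart_dom \<Longrightarrow> y \<in> chart_dom \<Longrightarrow> leaf_fun i j (\<Phi> x) = leaf_fun i j (\<Phi> y) \<longleftrightarrow> snd x = snd y"
      by (rule std_chart_exists[OF pM ij open_UNIV UNIV_I], rule that)
    let ?P = "\<Phi> ` (ball 0 1 \<times> {0})"
    have op: "openin ?L ?P" by (rule openin_leaf_topology_plaque[OF ch(1)]) simp
    have eq: "leaf_code q = leaf_code p" if q: "q \<in> ?P" for q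
    proof -
      obtain z where z: "z \<in> ball 0 1" "q = \<Phi> (z, 0)" using q by blast
      have zd: "(z, 0) \<in> chart_dom" "(0, 0) \<in> chart_dom" using z by simp_all
      have "q \<in> saddle_hyp \<inter> N" using ch(6) zd(1) z(2) by blast
      then have qM: "q \<in> saddle_hyp" "Re (q $ j) > 0" using ch(5) by auto
      have "leaf_fun i j q = leaf_fun i j p" using ch(8)[OF zd] by (simp only: z(2) ch(2) snd_conv)
      then show ?thesis using K[OF qM] K[OF pM ij(2)] by simp
    qed
    have pP: "p \<in> ?P" by (rule image_eqI[of _ _ "(0, 0)"]) (simp_all add: ch(2))
    have pS: "leaf_code p \<in> S" using p by simp
    have "?P \<subseteq> {p \<in> topspace ?L. leaf_code p \<in> S}"
    proof (rule subsetI, rule CollectI, rule conjI)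
      fix q assume q: "q \<in> ?P"
      show "q \<in> topspace ?L" by (rule subsetD[OF openin_subset[OF op] q])
      show "leaf_code q \<in> S" unfolding eq[OF q] by (rule pS)
    qed
    with op pP show "\<exists>T. openin ?L T \<and> p \<in> T \<and> T \<subseteq> {p \<in> topspace ?L. leaf_code p \<in> S}"
      by blast
  qed
qed auto

lemma leaf_code_pathin:
  assumes "pathin (leaf_topology saddle_hyp) g" "s \<in> {0..1}" "t \<in> {0..1}"
  shows "leaf_code (g s) = leaf_code (g t)"
proof -
  have "continuous_map (subtopology euclideanreal {0..1}) (discrete_topology UNIV) (leaf_code \<circ> g)"
    using assms(1) leaf_code_continuous unfolding pathin_def by (rule continuous_map_compose)
  moreover have "connectedin (subtopology euclideanreal {0..1::real}) {0..1}"
    by (simp add: connectedin_subtopology)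
  ultimately have "connectedin (discrete_topology UNIV) ((leaf_code \<circ> g) ` {0..1})"
    by (rule connectedin_continuous_map_image)
  then obtain a where "(leaf_code \<circ> g) ` {0..1} \<subseteq> {a}"
    unfolding connectedin_discrete_topology by blast
  then show ?thesis using assms(2,3) by (auto simp: image_subset_iff)
qed

text \<open>The path \<open>H (_, t)\<close> preserves the code, so the transversal points at
  \<open>t\<close> and \<open>h t\<close> have the same invariant; by
  \<open>chart_transverse\<close> the invariant is injective on the transversal near 0.\<close>

lemma trivial_holonomy_saddle_hyp: "trivial_holonomy saddle_hyp"
  unfolding trivial_holonomy_def
proof (intro allI impI)
  fix \<gamma> \<Phi> h assume hol: "holonomy_of_loop saddle_hyp \<gamma> \<Phi> h"
  then have \<gamma>: "pathin (leaf_topology saddle_hyp) \<gamma>" "\<gamma> 1 = \<gamma> 0" "levi_chart saddle_hyp \<Phi>" "\<Phi> (0, 0) = \<gamma> 0"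
    unfolding holonomy_of_loop_def by blast+
  from hol obtain e H where e: "0 < e" "e \<le> 1" and cH: "continuous_on ({0..1} \<times> {-e<..<e}) H"
    and H0: "\<forall>s\<in>{0..1}. H (s, 0) = \<gamma> s"
    and H: "\<And>t. t\<in>{-e<..<e} \<Longrightarrow> pathin (leaf_topology saddle_hyp) (\<lambda>s. H (s, t)) \<and>
        H (0, t) = \<Phi> (0, t) \<and> h t \<in> {-1<..<1} \<and> H (1, t) = \<Phi> (0, h t)"
    unfolding holonomy_of_loop_def by blast
  note ch = levi_chartD[OF \<gamma>(3)]
  have o: "(0, 0) \<in> chart_dom" by simp
  let ?p = "\<Phi> (0, 0)"
  have pM: "?p \<in> saddle_hyp" by (rule ch(6)[OF o])
  have pB: "?p \<in> big_ball" using pM saddle_hyp_big_ball by blast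
  obtain i j :: 2 where ij: "i \<noteq> j" "Re (?p $ j) > 0" using saddle_hyp_side[OF pB] .
  obtain d k where d: "d > 0" "ball 0 d \<times> ball 0 d \<subseteq> chart_dom"
    and k: "\<And>\<zeta> t. \<zeta> \<in> ball 0 d \<Longrightarrow> t \<in> ball 0 d \<Longrightarrow> Re (\<Phi> (\<zeta>, t) $ j) > 0 \<and> leaf_fun i j (\<Phi> (\<zeta>, t)) = complex_of_real (k t)"
    and injk: "inj_on k (ball 0 d)"
    by (rule chart_transverse[OF \<gamma>(3) o ij], rule that)
  obtain K :: "real \<Rightarrow> real \<times> nat" where injK: "inj K" and K: "\<And>p. p \<in> saddle_hyp \<Longrightarrow> Re (p $ j) > 0 \<Longrightarrow> leaf_code p = K (Re (leaf_fun i j p))"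
    by (rule leaf_code_eq[OF ij(1)], rule that)
  obtain \<Psi> where \<Psi>: "homeomorphism chart_dom (\<Phi> ` chart_dom) \<Phi> \<Psi>" using ch(3) by blast
  have inv: "\<Psi> (\<Phi> x) = x" if "x \<in> chart_dom" for x using \<Psi> that unfolding homeomorphism_def by blast
  have ht: "(0, h t) \<in> chart_dom" if "t \<in> {-e<..<e}" for t using H[OF that] by simp
  have hH: "snd (\<Psi> (H (1, t))) = h t" if "t \<in> {-e<..<e}" for t
    using H[OF that] inv[OF ht[OF that]] by simp
  have c1: "continuous_on {-e<..<e} (\<lambda>t. H (1, t))"
    by (rule continuous_on_compose2[OF cH]) (auto intro!: continuous_intros)
  \<comment> \<open>No regularity of \<open>h\<close> is assumed. It is continuous as the transverse
    chart coordinate of the end point of the path, which keeps \<open>h t\<close> in the range where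
    \<open>k\<close> is injective.\<close>
  have "continuous_on {-e<..<e} (\<lambda>t. snd (\<Psi> (H (1, t))))"
  proof (intro continuous_on_snd continuous_on_compose2[OF _ c1])
    show "continuous_on (\<Phi> ` chart_dom) \<Psi>" using \<Psi> unfolding homeomorphism_def by blast
    show "(\<lambda>t. H (1, t)) ` {-e<..<e} \<subseteq> \<Phi> ` chart_dom" using H ht by fastforce
  qed
  then have ch': "continuous_on {-e<..<e} h"
    by (rule continuous_on_eq) (use hH in auto)
  have z: "0 \<in> {-e<..<e}" using e by simp
  have "\<Phi> (0, h 0) = \<Phi> (0, 0)" using H[OF z] H0 \<gamma> by simp
  then have h0: "h 0 = 0" using inv[OF ht[OF z]] inv[OF o] by simp
  have "isCont h 0" using ch' z by (simp add: continuous_on_eq_continuous_at)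
  then have "(h \<longlongrightarrow> 0) (at 0)" using h0 by (simp add: isCont_def)
  then have "\<forall>\<^sub>F t in at 0. h t \<in> ball 0 d" using d(1) by (auto simp: tendsto_iff dist_commute)
  then have 1: "\<forall>\<^sub>F t in nhds 0. h t \<in> ball 0 d" using h0 d(1) by (simp add: eventually_nhds_conv_at)
  have 2: "\<forall>\<^sub>F t in nhds (0::real). t \<in> ball 0 d \<inter> {-e<..<e}"
    by (rule eventually_nhds_in_open) (use d e in auto)
  from 1 2 show "\<forall>\<^sub>F t in nhds 0. h t = t"
  proof eventually_elim
    case (elim t)
    then have t: "t \<in> ball 0 d" "t \<in> {-e<..<e}" "h t \<in> ball 0 d" by auto
    have "leaf_code (H (0, t)) = leaf_code (H (1, t))"
      by (rule leaf_code_pathin[of "\<lambda>s. H (s, t)"]) (use H[OF t(2)] in auto)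
    then have eq: "leaf_code (\<Phi> (0, t)) = leaf_code (\<Phi> (0, h t))" using H[OF t(2)] by simp
    have lc: "leaf_code (\<Phi> (0, s)) = K (k s)" if "s \<in> ball 0 d" for s
    proof -
      have "0 \<in> ball (0::complex) d" using d by simp
      note k' = k[OF this that]
      have "(0, s) \<in> chart_dom" by (rule subsetD[OF d(2)]) (use that d(1) in simp)
      from K[OF ch(6)[OF this]] k' show ?thesis by simp
    qed
    have "k t = k (h t)" using eq lc t injK by (metis injD)
    then show "h t = t" using injk t by (metis inj_onD)
  qed
qed

text \<open>The subbasis consists of the plaques of all Levi charts, so this plaque must meet any
  foreign plaque in an open set. Near a common point \<open>chart_transverse\<close> describes the
  foreign plaque as a level set of the leaf function, which is constant on the given plaque.\<close>

lemma plaque_continuous: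
  assumes \<Phi>: "levi_chart saddle_hyp \<Phi>" and t: "t \<in> {-1<..<1}" and ij: "i \<noteq> j"
    and Re: "\<And>x. x \<in> chart_dom \<Longrightarrow> Re (\<Phi> x $ j) > 0"
    and const: "\<And>x y. x \<in> chart_dom \<Longrightarrow> y \<in> chart_dom \<Longrightarrow> snd x = snd y \<Longrightarrow> leaf_fun i j (\<Phi> x) = leaf_fun i j (\<Phi> y)"
  shows "continuous_map (top_of_set (ball 0 1)) (leaf_topology saddle_hyp) (\<lambda>\<zeta>. \<Phi> (\<zeta>, t))"
  unfolding leaf_topology_eq
proof (rule continuous_on_generated_topo)
  show "(\<lambda>\<zeta>. \<Phi> (\<zeta>, t)) ` topspace (top_of_set (ball 0 1)) \<subseteq> \<Union> (plaques saddle_hyp)"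
    using plaqueI[OF \<Phi> t] by auto
  fix U assume "U \<in> plaques saddle_hyp"
  then obtain \<Phi>' t' where \<Phi>': "levi_chart saddle_hyp \<Phi>'" "t' \<in> {-1<..<1}" and U: "U = \<Phi>' ` (ball 0 1 \<times> {t'})"
    unfolding plaques_def by blast
  note ch = levi_chartD[OF \<Phi>] note ch' = levi_chartD[OF \<Phi>'(1)]
  obtain \<Psi> where \<Psi>: "homeomorphism chart_dom (\<Phi>' ` chart_dom) \<Phi>' \<Psi>" using ch'(3) by blast
  have inv: "\<Psi> (\<Phi>' x) = x" if "x \<in> chart_dom" for x using \<Psi> that unfolding homeomorphism_def by blast
  have inv': "\<Phi>' (\<Psi> q) = q" if "q \<in> \<Phi>' ` chart_dom" for q using \<Psi> that unfolding homeomorphism_def by blast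
  obtain W where W: "open W" "\<Phi>' ` chart_dom = saddle_hyp \<inter> W" using ch'(4) by (auto simp: openin_open)
  have cf: "continuous_on (ball 0 1) (\<lambda>\<zeta>. \<Phi> (\<zeta>, t))"
  proof -
    have "continuous_on chart_dom \<Phi>" 
      by (intro continuous_at_imp_continuous_on ballI differentiable_imp_continuous_within real_analytic_at_imp_differentiable ch(1))
    then show ?thesis by (rule continuous_on_compose2) (use t in \<open>auto intro!: continuous_intros\<close>)
  qed
  have "open ((\<lambda>\<zeta>. \<Phi> (\<zeta>, t)) -` U \<inter> ball 0 1)"
  proof (subst open_subopen, rule ballI)
    fix \<zeta>0 assume z0: "\<zeta>0 \<in> (\<lambda>\<zeta>. \<Phi> (\<zeta>, t)) -` U \<inter> ball 0 1"
    then obtain \<zeta>1 where z1: "\<zeta>1 \<in> ball 0 1" "\<Phi> (\<zeta>0, t) = \<Phi>' (\<zeta>1, t')" unfolding U by blast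
    have x0: "(\<zeta>0, t) \<in> chart_dom" and x1: "(\<zeta>1, t') \<in> chart_dom" using z0 z1 t \<Phi>'(2) by auto
    have Re1: "Re (\<Phi>' (\<zeta>1, t') $ j) > 0" using Re[OF x0] z1(2) by simp
    obtain d k where d: "d > 0" "ball \<zeta>1 d \<times> ball t' d \<subseteq> chart_dom"
      and k: "\<And>\<zeta> t. \<zeta> \<in> ball \<zeta>1 d \<Longrightarrow> t \<in> ball t' d \<Longrightarrow> Re (\<Phi>' (\<zeta>, t) $ j) > 0 \<and> leaf_fun i j (\<Phi>' (\<zeta>, t)) = complex_of_real (k t)"
      and injk: "inj_on k (ball t' d)"
      by (rule chart_transverse[OF \<Phi>'(1) x1 ij Re1], rule that)
    define X where "X = ball 0 1 \<inter> (\<lambda>\<zeta>. \<Phi> (\<zeta>, t)) -` W"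
    have X: "open X" unfolding X_def by (rule continuous_open_preimage[OF cf open_ball W(1)])
    have XV: "\<Phi> (\<zeta>, t) \<in> \<Phi>' ` chart_dom" if "\<zeta> \<in> X" for \<zeta>
      using that ch(6)[of "(\<zeta>, t)"] t W(2) unfolding X_def by auto
    have c2: "continuous_on X (\<lambda>\<zeta>. \<Psi> (\<Phi> (\<zeta>, t)))"
    proof (rule continuous_on_compose2[of "\<Phi>' ` chart_dom" \<Psi> X "\<lambda>\<zeta>. \<Phi> (\<zeta>, t)"])
      show "continuous_on (\<Phi>' ` chart_dom) \<Psi>" using \<Psi> unfolding homeomorphism_def by blast
      show "continuous_on X (\<lambda>\<zeta>. \<Phi> (\<zeta>, t))" using cf by (rule continuous_on_subset) (auto simp: X_def)
    qed (use XV in blast)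
    define Y where "Y = X \<inter> (\<lambda>\<zeta>. \<Psi> (\<Phi> (\<zeta>, t))) -` (ball \<zeta>1 d \<times> ball t' d)"
    have Y: "open Y" unfolding Y_def by (rule continuous_open_preimage[OF c2 X]) (intro open_Times open_ball)
    have z0Y: "\<zeta>0 \<in> Y"
    proof -
      have "\<Phi> (\<zeta>0, t) \<in> W" using W(2) x1 z1(2) by (metis IntD2 imageI)
      then show ?thesis using z0 z1(2) inv[OF x1] d(1) by (simp add: Y_def X_def)
    qed
    have "Y \<subseteq> (\<lambda>\<zeta>. \<Phi> (\<zeta>, t)) -` U \<inter> ball 0 1"
    proof
      fix \<zeta> assume "\<zeta> \<in> Y"
      then have zX: "\<zeta> \<in> X" and pr: "\<Psi> (\<Phi> (\<zeta>, t)) \<in> ball \<zeta>1 d \<times> ball t' d" by (auto simp: Y_def)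
      obtain a b where ab: "\<Psi> (\<Phi> (\<zeta>, t)) = (a, b)" by (cases "\<Psi> (\<Phi> (\<zeta>, t))")
      have eq: "\<Phi> (\<zeta>, t) = \<Phi>' (a, b)" using inv'[OF XV[OF zX]] ab by simp
      have a: "a \<in> ball \<zeta>1 d" and b: "b \<in> ball t' d" using pr ab by auto
      have zb: "\<zeta> \<in> ball 0 1" using zX by (simp add: X_def)
      then have x: "(\<zeta>, t) \<in> chart_dom" using t by simp
      have "complex_of_real (k b) = leaf_fun i j (\<Phi> (\<zeta>, t))" using k[OF a b] eq by simp
      also have "\<dots> = leaf_fun i j (\<Phi> (\<zeta>0, t))" by (rule const[OF x x0]) simp
      also have "\<dots> = complex_of_real (k t')" using k[of \<zeta>1 t'] d(1) z1(2) by simp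
      finally have "k b = k t'" by simp
      then have "b = t'" using injk b d(1) by (metis centre_in_ball inj_onD)
      moreover have "(a, b) \<in> chart_dom" using d(2) a b by (intro subsetD[OF d(2)]) simp
      then have "a \<in> ball 0 1" by simp
      ultimately have "\<Phi> (\<zeta>, t) \<in> U" using eq unfolding U by blast
      then show "\<zeta> \<in> (\<lambda>\<zeta>. \<Phi> (\<zeta>, t)) -` U \<inter> ball 0 1" using zb by blast
    qed
    with Y z0Y show "\<exists>T. open T \<and> \<zeta>0 \<in> T \<and> T \<subseteq> (\<lambda>\<zeta>. \<Phi> (\<zeta>, t)) -` U \<inter> ball 0 1" by blast
  qed
  then show "openin (top_of_set (ball 0 1)) ((\<lambda>\<zeta>. \<Phi> (\<zeta>, t)) -` U \<inter> topspace (top_of_set (ball 0 1)))"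
    by (simp add: openin_open_eq)
qed

lemma subset_restricted_leaf:
  assumes P: "connectedin (leaf_topology M) P" "P \<subseteq> A" "P \<noteq> {}"
  obtains L where "L \<in> restricted_leaves M A" "P \<subseteq> L"
proof -
  let ?T = "leaf_topology M"
  have sub: "P \<subseteq> topspace ?T" using P(1) by (rule connectedin_subset_topspace)
  then have "?T \<noteq> trivial_topology" using P(3) by auto
  then obtain L0 where L0: "L0 \<in> levi_leaves M" "P \<subseteq> L0"
    unfolding levi_leaves_def using exists_connected_component_of_superset[OF P(1)] by blast
  let ?S = "subtopology ?T (L0 \<inter> A)"
  have cS: "connectedin ?S P" using P L0(2) by (simp add: connectedin_subtopology)
  have "P \<subseteq> topspace ?S" using sub P L0(2) by auto
  then have "?S \<noteq> trivial_topology" using P(3) by force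
  then obtain L where "L \<in> connected_components_of ?S" "P \<subseteq> L"
    using exists_connected_component_of_superset[OF cS] by blast
  then show ?thesis using that L0(1) unfolding restricted_leaves_def by blast
qed

text \<open>This replaces the global notion of restricted leaves by a local one: a leafwise constant
  function depends locally only on the leaf function. The arguments for (ii) use the leaves only in
  this form.\<close>

lemma leaf_constant_near:
  assumes B: "open B" and p: "p \<in> saddle_hyp \<inter> B" and ij: "i \<noteq> j" and Re: "Re (p $ j) > 0"
    and u: "\<And>L. L \<in> restricted_leaves saddle_hyp (saddle_hyp \<inter> B) \<Longrightarrow> u constant_on L"
  obtains N where "open N" "p \<in> N" "N \<subseteq> B"
    "\<And>q q'. q \<in> saddle_hyp \<inter> N \<Longrightarrow> q' \<in> saddle_hyp \<inter> N \<Longrightarrow> leaf_fun i j q = leaf_fun i j q' \<Longrightarrow> u q = u q'"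
proof -
  have pM: "p \<in> saddle_hyp" and pB: "p \<in> B" using p by auto
  obtain \<Phi> N where ch: "levi_chart saddle_hyp \<Phi>" "\<Phi> (0, 0) = p" "open N" "p \<in> N" "N \<subseteq> B \<inter> {q. Re (q $ j) > 0}"
      "\<Phi> ` chart_dom = saddle_hyp \<inter> N" "\<And>x. x \<in> chart_dom \<Longrightarrow> Im (leaf_fun i j (\<Phi> x)) = 0"
      "\<And>x y. x \<in> chart_dom \<Longrightarrow> y \<in> chart_dom \<Longrightarrow> leaf_fun i j (\<Phi> x) = leaf_fun i j (\<Phi> y) \<longleftrightarrow> snd x = snd y"
      by (rule std_chart_exists[OF pM ij Re B pB], rule that)
  have "u q = u q'" if q: "q \<in> saddle_hyp \<inter> N" "q' \<in> saddle_hyp \<inter> N" "leaf_fun i j q = leaf_fun i j q'" for q q'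
  proof -
    obtain x y where x: "x \<in> chart_dom" "q = \<Phi> x" and y: "y \<in> chart_dom" "q' = \<Phi> y"
      using q(1,2) unfolding ch(6)[symmetric] by blast
    have snd: "snd x = snd y" using ch(8)[OF x(1) y(1)] q(3) x y by simp
    define t where "t = snd x"
    have t: "t \<in> {-1<..<1}" using x(1) by (auto simp: t_def)
    let ?P = "(\<lambda>\<zeta>. \<Phi> (\<zeta>, t)) ` ball 0 1"
    have "Re (\<Phi> x $ j) > 0" if "x \<in> chart_dom" for x using ch(5,6) that by blast
    then have "continuous_map (top_of_set (ball 0 1)) (leaf_topology saddle_hyp) (\<lambda>\<zeta>. \<Phi> (\<zeta>, t))"
      using ch(8) by (intro plaque_continuous[OF ch(1) t ij]) auto
    then have "connectedin (leaf_topology saddle_hyp) ?P"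
      by (rule connectedin_continuous_map_image) (simp add: connectedin_subtopology)
    moreover have "?P \<subseteq> saddle_hyp \<inter> B" using ch(5,6) t by blast
    ultimately obtain L where L: "L \<in> restricted_leaves saddle_hyp (saddle_hyp \<inter> B)" "?P \<subseteq> L"
      by (rule subset_restricted_leaf) auto
    have "q \<in> ?P" using x by (cases x) (auto simp: t_def)
    moreover have "q' \<in> ?P" using y snd by (cases y) (auto simp: t_def)
    ultimately show ?thesis using u[OF L(1)] L(2) unfolding constant_on_def by (metis subsetD)
  qed
  then show ?thesis using that[of N] ch(3,4,5) by blast
qed

section \<open>Stein neighborhoods\<close>

lemma holomorphic_on_C2_subset: "holomorphic_on_C2 f U \<Longrightarrow> V \<subseteq> U \<Longrightarrow> holomorphic_on_C2 f V"
  unfolding holomorphic_on_C2_def by blast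

lemma holomorphic_on_C2_isCont: "holomorphic_on_C2 f U \<Longrightarrow> x \<in> U \<Longrightarrow> isCont f x"
  unfolding holomorphic_on_C2_def using has_derivative_continuous by blast

lemma holomorphic_on_C2_continuous_on: "holomorphic_on_C2 f U \<Longrightarrow> continuous_on U f"
  using holomorphic_on_C2_isCont continuous_at_imp_continuous_on by blast

lemma holomorphic_on_C2_compose:
  assumes f: "holomorphic_on_C2 f U" and g: "g holomorphic_on D" "open D" and sub: "f ` U \<subseteq> D"
  shows "holomorphic_on_C2 (\<lambda>x. g (f x)) U"
  unfolding holomorphic_on_C2_def
proof
  fix x assume x: "x \<in> U"
  then obtain E where E: "(f has_derivative E) (at x)" "\<And>c v. E (c *s v) = c * E v"
    using f unfolding holomorphic_on_C2_def by blast
  have "f x \<in> D" using sub x by blast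
  then have "(g has_field_derivative deriv g (f x)) (at (f x))"
    using holomorphic_derivI[OF g] by blast
  then have "(g has_derivative (*) (deriv g (f x))) (at (f x))" by (simp add: has_field_derivative_def)
  from has_derivative_compose[OF E(1) this] E(2)
  show "\<exists>E. ((\<lambda>x. g (f x)) has_derivative E) (at x) \<and> (\<forall>c v. E (c *s v) = c * E v)"
    by (intro exI[of _ "\<lambda>v. deriv g (f x) * E v"]) (simp add: mult_ac)
qed

lemma holomorphic_on_C2_nth: "holomorphic_on_C2 (\<lambda>p. p $ i) U"
  unfolding holomorphic_on_C2_def
  by (intro ballI exI[of _ "\<lambda>p. p $ i"]) (simp add: bounded_linear_imp_has_derivative bounded_linear_vec_nth)

lemma holomorphic_on_C2_mult:
  assumes "holomorphic_on_C2 f U" "holomorphic_on_C2 g U"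
  shows "holomorphic_on_C2 (\<lambda>p. f p * g p) U"
  unfolding holomorphic_on_C2_def
proof
  fix x assume x: "x \<in> U"
  obtain E where E: "(f has_derivative E) (at x)" "\<And>c v. E (c *s v) = c * E v"
    using assms(1) x unfolding holomorphic_on_C2_def by blast
  obtain F where F: "(g has_derivative F) (at x)" "\<And>c v. F (c *s v) = c * F v"
    using assms(2) x unfolding holomorphic_on_C2_def by blast
  from has_derivative_mult[OF E(1) F(1)] E(2) F(2)
  show "\<exists>E. ((\<lambda>p. f p * g p) has_derivative E) (at x) \<and> (\<forall>c v. E (c *s v) = c * E v)"
    by (intro exI[of _ "\<lambda>v. f x * F v + E v * g x"]) (simp add: algebra_simps)
qed

lemma holomorphic_on_C2_add:
  assumes "holomorphic_on_C2 f U" "holomorphic_on_C2 g U"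
  shows "holomorphic_on_C2 (\<lambda>p. f p + g p) U"
  unfolding holomorphic_on_C2_def
proof
  fix x assume x: "x \<in> U"
  obtain E where E: "(f has_derivative E) (at x)" "\<And>c v. E (c *s v) = c * E v"
    using assms(1) x unfolding holomorphic_on_C2_def by blast
  obtain F where F: "(g has_derivative F) (at x)" "\<And>c v. F (c *s v) = c * F v"
    using assms(2) x unfolding holomorphic_on_C2_def by blast
  from has_derivative_add[OF E(1) F(1)] E(2) F(2)
  show "\<exists>E. ((\<lambda>p. f p + g p) has_derivative E) (at x) \<and> (\<forall>c v. E (c *s v) = c * E v)"
    by (intro exI[of _ "\<lambda>v. E v + F v"]) (simp add: algebra_simps)
qed

lemma holomorphic_on_C2_const: "holomorphic_on_C2 (\<lambda>p. c) U"
  unfolding holomorphic_on_C2_def by (intro ballI exI[of _ "\<lambda>_. 0"]) simp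

lemma holomorphic_hull_antimono:
  assumes "V \<subseteq> U"
  shows "holomorphic_hull V K \<subseteq> holomorphic_hull U K"
  using assms holomorphic_on_C2_subset[OF _ assms] unfolding holomorphic_hull_def by blast

lemma holomorphic_hullD:
  assumes "x \<in> holomorphic_hull U K" "holomorphic_on_C2 f U" "\<And>y. y \<in> K \<Longrightarrow> norm (f y) \<le> c"
  shows "norm (f x) \<le> c"
  using assms unfolding holomorphic_hull_def by blast

text \<open>A hull is always relatively closed in \<open>U\<close>. Compactness therefore reduces to
  a compact superset and to limits of hull points not escaping through the boundary of
  \<open>U\<close>.\<close>

lemma compact_holomorphic_hull:
  assumes C: "compact C" "holomorphic_hull U K \<subseteq> C"
    and lim: "\<And>X l. (\<And>n. X n \<in> holomorphic_hull U K) \<Longrightarrow> X \<longlonglongrightarrow> l \<Longrightarrow> l \<in> C \<Longrightarrow> l \<in> U"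
  shows "compact (holomorphic_hull U K)"
proof -
  have "closed (holomorphic_hull U K)"
    unfolding closed_sequential_limits
  proof (intro allI impI, elim conjE)
    fix X l assume X: "\<forall>n. X n \<in> holomorphic_hull U K" and l: "X \<longlonglongrightarrow> l"
    have "l \<in> C" using compact_imp_closed[OF C(1)] C(2) X l unfolding closed_sequential_limits by blast
    then have lU: "l \<in> U" using lim[of X l] X l by blast
    show "l \<in> holomorphic_hull U K"
      unfolding holomorphic_hull_def
    proof (intro CollectI conjI allI impI lU)
      fix f c assume f: "holomorphic_on_C2 f U" and c: "\<forall>y\<in>K. norm (f y) \<le> c"
      have "(\<lambda>n. norm (f (X n))) \<longlonglongrightarrow> norm (f l)"
        using isCont_tendsto_compose[OF holomorphic_on_C2_isCont[OF f lU] l] by (rule tendsto_norm)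
      moreover have "norm (f (X n)) \<le> c" for n
        using X f c unfolding holomorphic_hull_def by blast
      ultimately show "norm (f l) \<le> c" using LIMSEQ_le_const2 by blast
    qed
  qed
  then have "compact (C \<inter> holomorphic_hull U K)" using C(1) by (rule compact_Int_closed[rotated])
  then show ?thesis using C(2) by (simp add: Int_absorb1)
qed

lemma stein_open_separates_coords:
  assumes "x \<noteq> (y :: complex ^ 2)"
  shows "\<exists>f. holomorphic_on_C2 f U \<and> f x \<noteq> f y"
proof -
  obtain i where "x $ i \<noteq> y $ i" using assms by (auto simp: vec_eq_iff)
  then show ?thesis using holomorphic_on_C2_nth[of i U] by blast
qed

lemma stein_openI:
  assumes "open U" "\<And>K. compact K \<Longrightarrow> K \<subseteq> U \<Longrightarrow> compact (holomorphic_hull U K)"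
  shows "stein_open U"
  using assms stein_open_separates_coords unfolding stein_open_def by blast

lemma stein_open_imp_open: "stein_open U \<Longrightarrow> open U"
  by (simp add: stein_open_def)

lemma stein_open_hull: "stein_open U \<Longrightarrow> compact K \<Longrightarrow> K \<subseteq> U \<Longrightarrow> compact (holomorphic_hull U K)"
  by (simp add: stein_open_def)

text \<open>The holomorphic hull lies in the convex hull: a separating real functional is the real
  part of a complex linear one, and the exponential of that is a holomorphic function of larger
  modulus at the separated point.\<close>

lemma stein_open_convex:
  assumes "open U" "convex U"
  shows "stein_open U"
proof (rule stein_openI[OF assms(1)])
  fix K assume K: "compact K" "K \<subseteq> U"
  define C where "C = convex hull K"
  have C: "compact C" "C \<subseteq> U" "convex C" "closed C"
    using K assms by (auto simp: C_def compact_convex_hull hull_minimal compact_imp_closed)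
  have sub: "holomorphic_hull U K \<subseteq> C"
  proof (rule ccontr)
    assume "\<not> ?thesis"
    then obtain x where x: "x \<in> holomorphic_hull U K" "x \<notin> C" by blast
    obtain a b where ab: "a \<bullet> x < b" "\<And>y. y \<in> C \<Longrightarrow> b < a \<bullet> y"
      using separating_hyperplane_closed_point[OF C(3,4) x(2)] by blast
    define l where "l = (\<lambda>p :: complex ^ 2. - (cnj (a $ 1) * p $ 1 + cnj (a $ 2) * p $ 2))"
    have Re: "Re (l p) = - (a \<bullet> p)" for p
      by (simp add: l_def inner_vec_def sum_2 inner_complex_def)
    have "holomorphic_on_C2 (\<lambda>p. exp ((-1) * (cnj (a $ 1) * p $ 1 + cnj (a $ 2) * p $ 2))) U"
      by (intro holomorphic_on_C2_compose[of _ _ exp UNIV] holomorphic_on_C2_mult holomorphic_on_C2_add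
          holomorphic_on_C2_const holomorphic_on_C2_nth holomorphic_on_exp holomorphic_on_ident open_UNIV subset_UNIV)
    then have hol: "holomorphic_on_C2 (\<lambda>p. exp (l p)) U" by (simp add: l_def)
    have bd: "norm (exp (l y)) \<le> exp (- b)" if "y \<in> K" for y
    proof -
      have "y \<in> C" using that by (simp add: C_def hull_inc)
      then show ?thesis using ab(2)[of y] unfolding norm_exp_eq_Re Re by simp
    qed
    have "norm (exp (l x)) \<le> exp (- b)"
      by (rule holomorphic_hullD[OF x(1) hol bd])
    then have "b \<le> a \<bullet> x" unfolding norm_exp_eq_Re Re by simp
    then show False using ab(1) by simp
  qed
  show "compact (holomorphic_hull U K)"
    by (rule compact_holomorphic_hull[OF C(1) sub]) (rule subsetD[OF C(2)])
qed

lemma stein_open_Int: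
  assumes U: "stein_open U" and V: "stein_open V"
  shows "stein_open (U \<inter> V)"
proof (rule stein_openI)
  show "open (U \<inter> V)" using U V by (intro open_Int stein_open_imp_open)
  fix K assume K: "compact K" "K \<subseteq> U \<inter> V"
  have c: "compact (holomorphic_hull U K)" "compact (holomorphic_hull V K)"
    using stein_open_hull[OF U K(1)] stein_open_hull[OF V K(1)] K(2) by simp_all
  show "compact (holomorphic_hull (U \<inter> V) K)"
  proof (rule compact_holomorphic_hull)
    show "compact (holomorphic_hull U K \<inter> holomorphic_hull V K)" using c by (rule compact_Int)
    show "holomorphic_hull (U \<inter> V) K \<subseteq> holomorphic_hull U K \<inter> holomorphic_hull V K"
      using holomorphic_hull_antimono by blast
  qed (auto simp: holomorphic_hull_def)
qed

text \<open>Hull points approaching \<open>l\<close> in \<open>U\<close> with \<open>f l\<close>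
  outside \<open>N\<close> are impossible: the reciprocal of \<open>f p - f l\<close> is holomorphic
  on the preimage and bounded on \<open>K\<close>, hence on the hull, yet it would blow up along the
  sequence.\<close>

lemma stein_open_preimage:
  assumes U: "stein_open U" and f: "holomorphic_on_C2 f U" and N: "open N"
  shows "stein_open (U \<inter> f -` N)"
proof (rule stein_openI)
  have oU: "open U" by (rule stein_open_imp_open[OF U])
  show "open (U \<inter> f -` N)"
    by (rule continuous_open_preimage[OF holomorphic_on_C2_continuous_on[OF f] oU N])
  fix K assume K: "compact K" "K \<subseteq> U \<inter> f -` N"
  have c: "compact (holomorphic_hull U K)" using stein_open_hull[OF U K(1)] K(2) by simp
  show "compact (holomorphic_hull (U \<inter> f -` N) K)"
  proof (rule compact_holomorphic_hull[OF c])
    show "holomorphic_hull (U \<inter> f -` N) K \<subseteq> holomorphic_hull U K"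
      by (rule holomorphic_hull_antimono) blast
    fix X l assume X: "\<And>n. X n \<in> holomorphic_hull (U \<inter> f -` N) K" and l: "X \<longlonglongrightarrow> l" "l \<in> holomorphic_hull U K"
    have lU: "l \<in> U" using l(2) by (simp add: holomorphic_hull_def)
    have XV: "X n \<in> U \<inter> f -` N" for n using X[of n] by (simp add: holomorphic_hull_def)
    have "f l \<in> N"
    proof (rule ccontr)
      assume fl: "f l \<notin> N"
      have g: "holomorphic_on_C2 (\<lambda>p. inverse (f p - f l)) (U \<inter> f -` N)"
      proof (rule holomorphic_on_C2_compose[of f _ "\<lambda>w. inverse (w - f l)" N])
        show "holomorphic_on_C2 f (U \<inter> f -` N)" using f by (rule holomorphic_on_C2_subset) blast
        show "(\<lambda>w. inverse (w - f l)) holomorphic_on N" using fl by (intro holomorphic_intros) auto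
      qed (use N in auto)
      have "compact ((\<lambda>p. inverse (f p - f l)) ` K)"
        by (rule compact_continuous_image[OF continuous_on_subset[OF holomorphic_on_C2_continuous_on[OF g] K(2)] K(1)])
      then obtain c where c: "c > 0" "\<forall>y\<in>K. norm (inverse (f y - f l)) \<le> c"
        using compact_imp_bounded bounded_pos by (metis (no_types, lifting) image_eqI)
      have le: "norm (inverse (f (X n) - f l)) \<le> c" for n
        using X[of n] g c(2) unfolding holomorphic_hull_def by blast
      have ge: "norm (f (X n) - f l) \<ge> 1 / c" for n
      proof -
        have nz: "f (X n) - f l \<noteq> 0" using XV[of n] fl by auto
        then have pos: "norm (f (X n) - f l) > 0" by simp
        have "inverse (norm (f (X n) - f l)) * norm (f (X n) - f l) \<le> c * norm (f (X n) - f l)"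
          using le[of n] pos unfolding norm_inverse by (intro mult_right_mono) auto
        then show ?thesis using pos c(1) by (simp add: divide_le_eq mult.commute)
      qed
      have "(\<lambda>n. norm (f (X n) - f l)) \<longlonglongrightarrow> norm (f l - f l)"
        by (intro tendsto_intros isCont_tendsto_compose[OF holomorphic_on_C2_isCont[OF f lU] l(1)])
      then have "1 / c \<le> norm (f l - f l)" by (rule LIMSEQ_le_const) (use ge in blast)
      then show False using c(1) by simp
    qed
    then show "l \<in> U \<inter> f -` N" using lU by blast
  qed
qed

text \<open>Separation is demanded from \<open>closure V\<close>, so that the complements of the
  closures are open and finitely many of them cover the compact part of a large ball outside
  \<open>U\<close>.\<close>

lemma has_stein_neighborhood_basisI:
  assumes K: "compact K" and sep: "\<And>x. x \<notin> K \<Longrightarrow> \<exists>V. stein_open V \<and> K \<subseteq> V \<and> x \<notin> closure V"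
  shows "has_stein_neighborhood_basis K"
  unfolding has_stein_neighborhood_basis_def
proof (intro allI impI, elim conjE)
  fix U assume U: "open U" "K \<subseteq> U"
  obtain R where R: "K \<subseteq> ball 0 R" using compact_imp_bounded[OF K] bounded_subset_ballD by metis
  define C where "C = cball 0 R - U"
  have C: "compact C" unfolding C_def using U(1) by (simp add: compact_diff)
  obtain V where V: "\<And>x. x \<notin> K \<Longrightarrow> stein_open (V x) \<and> K \<subseteq> V x \<and> x \<notin> closure (V x)" using sep by metis
  have CK: "x \<notin> K" if "x \<in> C" for x using that U(2) by (auto simp: C_def)
  have "C \<subseteq> (\<Union>x\<in>C. - closure (V x))" using V CK by blast
  then obtain F where F: "F \<subseteq> C" "finite F" "C \<subseteq> (\<Union>x\<in>F. - closure (V x))"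
    using compactE_image[OF C, of C "\<lambda>x. - closure (V x)"] by (metis closed_closure open_Compl)
  have "stein_open (ball 0 R \<inter> (\<Inter>x\<in>F. V x)) \<and> K \<subseteq> ball 0 R \<inter> (\<Inter>x\<in>F. V x)"
    using F(2,1)
  proof (induction F rule: finite_induct)
    case empty
    then show ?case using stein_open_convex[of "ball 0 R"] R by simp
  next
    case (insert x F)
    have "ball 0 R \<inter> (\<Inter>y\<in>insert x F. V y) = (ball 0 R \<inter> (\<Inter>y\<in>F. V y)) \<inter> V x" by auto
    moreover have "x \<notin> K" using insert CK by auto
    ultimately show ?case using insert V[of x] stein_open_Int by auto
  qed
  moreover have "ball 0 R \<inter> (\<Inter>x\<in>F. V x) \<subseteq> U"
  proof
    fix y assume y: "y \<in> ball 0 R \<inter> (\<Inter>x\<in>F. V x)"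
    show "y \<in> U"
    proof (rule ccontr)
      assume "y \<notin> U"
      then have "y \<in> C" using y by (auto simp: C_def)
      then obtain x where "x \<in> F" "y \<notin> closure (V x)" using F(3) by blast
      then show False using y closure_subset by blast
    qed
  qed
  ultimately show "\<exists>V. stein_open V \<and> K \<subseteq> V \<and> V \<subseteq> U" by blast
qed

text \<open>As \<open>\<eta> \<rightarrow> 0\<close> this tends to \<open>w\<close> for \<open>Re w > 0\<close> and to \<open>0\<close> for \<open>Re w < 0\<close>, while its values avoid the branch
  cut of \<open>powr\<close>: it extends the leaf function approximately beyond the half-space.\<close>

definition soft_pos :: "real \<Rightarrow> complex \<Rightarrow> complex" where
  "soft_pos \<eta> w = (w + csqrt (w\<^sup>2 + complex_of_real (\<eta>\<^sup>2))) / 2"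

text \<open>For \<open>\<eta> > 0\<close> this omits only the imaginary numbers of modulus at least
  \<open>\<eta>\<close>. By \<open>saddle_hyp_Re_zero\<close> the coordinates of points of the
  hypersurface are never among them, however small \<open>\<eta>\<close> is.\<close>

definition soft_dom :: "real \<Rightarrow> complex set" where
  "soft_dom \<eta> = (\<lambda>w. w\<^sup>2 + complex_of_real (\<eta>\<^sup>2)) -` (- \<real>\<^sub>\<le>\<^sub>0)"

lemma open_soft_dom: "open (soft_dom \<eta>)"
  unfolding soft_dom_def
  by (intro open_vimage continuous_intros open_Compl closed_nonpos_Reals_complex)

lemma soft_domI:
  assumes "\<eta> > 0" "Re w \<noteq> 0 \<or> w = 0"
  shows "w \<in> soft_dom \<eta>"
proof -
  have "w\<^sup>2 + complex_of_real (\<eta>\<^sup>2) \<notin> \<real>\<^sub>\<le>\<^sub>0"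
  proof
    assume "w\<^sup>2 + complex_of_real (\<eta>\<^sup>2) \<in> \<real>\<^sub>\<le>\<^sub>0"
    then have *: "(Re w)\<^sup>2 - (Im w)\<^sup>2 + \<eta>\<^sup>2 \<le> 0" "Re w * Im w = 0"
      by (auto simp: complex_nonpos_Reals_iff Re_power2 Im_power2)
    from *(2) assms(2) have "Im w = 0" by auto
    then have "(Re w)\<^sup>2 + \<eta>\<^sup>2 \<le> 0" using *(1) by simp
    moreover have "\<eta>\<^sup>2 > 0" using assms(1) by simp
    ultimately show False using zero_le_power2[of "Re w"] by linarith
  qed
  then show ?thesis by (simp add: soft_dom_def)
qed

text \<open>If the value were a real \<open>a \<le> 0\<close>, then \<open>w = 2 * a - q\<close>
  with \<open>q\<close> the square root in the definition. Squaring gives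
  \<open>4 * a * q = 4 * a\<^sup>2 + \<eta>\<^sup>2 > 0\<close>, contrary to
  \<open>Re q \<ge> 0\<close>.\<close>

lemma soft_pos_not_nonpos:
  assumes "\<eta> > 0"
  shows "soft_pos \<eta> w \<notin> \<real>\<^sub>\<le>\<^sub>0"
proof
  assume "soft_pos \<eta> w \<in> \<real>\<^sub>\<le>\<^sub>0"
  then obtain a where a: "a \<le> 0" "soft_pos \<eta> w = complex_of_real a" by (auto elim: nonpos_Reals_cases)
  define q where "q = csqrt (w\<^sup>2 + complex_of_real (\<eta>\<^sup>2))"
  have q2: "q\<^sup>2 = w\<^sup>2 + complex_of_real (\<eta>\<^sup>2)" by (simp add: q_def)
  have Req: "Re q \<ge> 0" using csqrt_principal[of "w\<^sup>2 + complex_of_real (\<eta>\<^sup>2)"] unfolding q_def[symmetric] by linarith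
  have s: "w = complex_of_real (2 * a) - q" using a(2) by (simp add: soft_pos_def q_def field_simps)
  have "complex_of_real (4 * a) * q = complex_of_real (4 * a\<^sup>2 + \<eta>\<^sup>2)"
    using q2 unfolding s by (simp add: power2_eq_square algebra_simps)
  then have "Re (complex_of_real (4 * a) * q) = 4 * a\<^sup>2 + \<eta>\<^sup>2" by (metis Re_complex_of_real)
  then have "4 * a * Re q = 4 * a\<^sup>2 + \<eta>\<^sup>2" by simp
  moreover have "4 * a * Re q \<le> 0" using a(1) Req by (simp add: mult_nonpos_nonneg)
  moreover have "4 * a\<^sup>2 + \<eta>\<^sup>2 > 0" using assms by (simp add: add_nonneg_pos)
  ultimately show False by linarith
qed

lemma soft_pos_holomorphic: "soft_pos \<eta> holomorphic_on soft_dom \<eta>"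
  unfolding soft_pos_def[abs_def] by (intro holomorphic_intros) (auto simp: soft_dom_def)

lemma cmod_csqrt: "cmod (csqrt z) = sqrt (cmod z)"
proof (rule real_sqrt_unique[symmetric])
  show "(cmod (csqrt z))\<^sup>2 = cmod z" by (metis norm_power power2_csqrt)
qed simp

lemma soft_pos_tendsto:
  assumes w: "W \<longlonglongrightarrow> w" and e: "E \<longlonglongrightarrow> 0" and cond: "Re w \<noteq> 0 \<or> w = 0"
  shows "(\<lambda>n. soft_pos (E n) (W n)) \<longlonglongrightarrow> (if Re w > 0 then w else 0)"
proof -
  have arg: "(\<lambda>n. (W n)\<^sup>2 + complex_of_real ((E n)\<^sup>2)) \<longlonglongrightarrow> w\<^sup>2"
    by (rule tendsto_eq_intros w e refl)+ simp
  have "(\<lambda>n. csqrt ((W n)\<^sup>2 + complex_of_real ((E n)\<^sup>2))) \<longlonglongrightarrow> csqrt (w\<^sup>2)"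
  \<comment> \<open>At 0, a point of its cut, continuity of \<open>csqrt\<close> is obtained from
    the modulus alone.\<close>
  proof (cases "w = 0")
    case True
    have "(\<lambda>n. sqrt (cmod ((W n)\<^sup>2 + complex_of_real ((E n)\<^sup>2)))) \<longlonglongrightarrow> sqrt (cmod (w\<^sup>2))"
      by (intro tendsto_real_sqrt tendsto_norm arg)
    then have "(\<lambda>n. cmod (csqrt ((W n)\<^sup>2 + complex_of_real ((E n)\<^sup>2)))) \<longlonglongrightarrow> 0"
      unfolding cmod_csqrt True by simp
    then show ?thesis unfolding tendsto_norm_zero_iff True by simp
  next
    case False
    have "w\<^sup>2 \<notin> \<real>\<^sub>\<le>\<^sub>0"
    proof
      assume "w\<^sup>2 \<in> \<real>\<^sub>\<le>\<^sub>0"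
      then have *: "(Re w)\<^sup>2 - (Im w)\<^sup>2 \<le> 0" "Re w * Im w = 0"
        by (auto simp: complex_nonpos_Reals_iff Re_power2 Im_power2)
      with False cond show False by auto
    qed
    then show ?thesis by (intro isCont_tendsto_compose[OF _ arg] continuous_at_csqrt)
  qed
  then have lim: "(\<lambda>n. soft_pos (E n) (W n)) \<longlonglongrightarrow> (w + csqrt (w\<^sup>2)) / 2"
    unfolding soft_pos_def by (intro tendsto_intros w) auto
  have "(w + csqrt (w\<^sup>2)) / 2 = (if Re w > 0 then w else 0)"
  proof (cases "Re w > 0")
    case True
    then have "csqrt (w\<^sup>2) = w" by (intro csqrt_square) auto
    then show ?thesis using True by simp
  next
    case False
    have "csqrt ((- w)\<^sup>2) = - w" 
      by (rule csqrt_square) (use cond False in auto)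
    then show ?thesis using False by simp
  qed
  with lim show ?thesis by simp
qed

lemma expo_pos: "i \<noteq> j \<Longrightarrow> expo i j > 0"
  using exhaust_2[of i] exhaust_2[of j] lam_pos by (auto simp: expo_def)

text \<open>The point moves together with the parameter, because the compactness argument below
  produces points that depend on \<open>\<eta>\<close>. Where \<open>Re (y $ j) \<le> 0\<close> the
  limit is 0, which is real like the values of the leaf function on the hypersurface.\<close>

lemma soft_leaf_tendsto:
  assumes ij: "i \<noteq> j" and y: "Y \<longlonglongrightarrow> y" and e: "E \<longlonglongrightarrow> 0" and cond: "Re (y $ j) \<noteq> 0 \<or> y $ j = 0"
  shows "(\<lambda>n. Y n $ i * soft_pos (E n) (Y n $ j) powr complex_of_real (expo i j)) \<longlonglongrightarrow>
    (if Re (y $ j) > 0 then leaf_fun i j y else 0)"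
proof -
  have yk: "(\<lambda>n. Y n $ k) \<longlonglongrightarrow> y $ k" for k by (rule tendsto_vec_nth[OF y])
  note s = soft_pos_tendsto[OF yk e cond]
  show ?thesis
  proof (cases "Re (y $ j) > 0")
    case True
    then have nr: "y $ j \<notin> \<real>\<^sub>\<le>\<^sub>0" by (simp add: complex_nonpos_Reals_iff)
    have "(\<lambda>n. soft_pos (E n) (Y n $ j) powr complex_of_real (expo i j)) \<longlonglongrightarrow> (y $ j) powr complex_of_real (expo i j)"
      using s True nr by (intro tendsto_powr_complex) auto
    then show ?thesis using True unfolding leaf_fun_def by (auto intro!: tendsto_mult yk)
  next
    case False
    then have "(\<lambda>n. cmod (soft_pos (E n) (Y n $ j))) \<longlonglongrightarrow> 0" using s by (simp add: tendsto_norm_zero)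
    then have "(\<lambda>n. cmod (soft_pos (E n) (Y n $ j)) powr expo i j) \<longlonglongrightarrow> 0"
      using expo_pos[OF ij] by (intro tendsto_zero_powrI[where b = "expo i j"]) auto
    then have "(\<lambda>n. soft_pos (E n) (Y n $ j) powr complex_of_real (expo i j)) \<longlonglongrightarrow> 0"
      by (subst tendsto_norm_zero_iff[symmetric]) (simp add: norm_powr_real_powr')
    from tendsto_mult[OF yk[of i] this] False show ?thesis by simp
  qed
qed

lemma saddle_hyp_Re_zero:
  assumes "p \<in> saddle_hyp"
  shows "Re (p $ j) \<noteq> 0 \<or> p $ j = 0"
proof -
  obtain x t where xt: "p = saddle_pt x t" "\<bar>t\<bar> < time_bound" using assms by (rule saddle_hypD)
  show ?thesis using saddle_pt_neq0[OF xt(2), of x j] by (auto simp: xt(1) complex_eq_iff)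
qed

lemma stein_basis_saddle_hyp:
  assumes K: "compact K" "K = saddle_hyp \<inter> cball ctr r" and r: "0 < r" "r < sqrt (5 / 4)"
  shows "has_stein_neighborhood_basis K"
proof (rule has_stein_neighborhood_basisI[OF K(1)])
  fix x assume xK: "x \<notin> K"
  show "\<exists>V. stein_open V \<and> K \<subseteq> V \<and> x \<notin> closure V"
  proof (cases "x \<in> cball ctr r")
    case False
    define s where "s = (r + dist ctr x) / 2"
    have s: "r < s" "s < dist ctr x" using False by (auto simp: s_def)
    have "stein_open (ball ctr s)" by (rule stein_open_convex) auto
    moreover have "K \<subseteq> ball ctr s" using s K(2) by auto
    moreover have "x \<notin> closure (ball ctr s)" using s r by simp
    ultimately show ?thesis by blast
  next
    case True
    then have xM: "x \<notin> saddle_hyp" using xK K(2) by blast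
    have xB: "x \<in> big_ball" using True r by (simp add: big_ball_def)
    obtain i j :: 2 where ij: "i \<noteq> j" "Re (x $ j) > 0" using saddle_hyp_side[OF xB] .
    have imx: "Im (leaf_fun i j x) \<noteq> 0" using saddle_hyp_iff[OF xB ij] xM by blast
    define P where "P = (\<lambda>\<eta> p. p $ i * soft_pos \<eta> (p $ j) powr complex_of_real (expo i j))"
    have KM: "K \<subseteq> saddle_hyp" using K(2) by blast
    \<comment> \<open>If the approximations took the value at \<open>x\<close> somewhere on
      \<open>K\<close> for every \<open>n\<close>, a limit point \<open>y\<close> in
      \<open>K\<close> of these places would make \<open>leaf_fun i j x\<close> equal to
      \<open>leaf_fun i j y\<close> or 0, both real, whereas \<open>x\<close> is off the
      hypersurface.\<close>
    have "\<exists>n. P (1 / real (Suc n)) x \<notin> P (1 / real (Suc n)) ` K"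
    proof (rule ccontr)
      assume "\<not> ?thesis"
      then have "\<forall>n. \<exists>y\<in>K. P (1 / real (Suc n)) x = P (1 / real (Suc n)) y" by blast
      then obtain Y where Y: "\<And>n. Y n \<in> K" "\<And>n. P (1 / real (Suc n)) x = P (1 / real (Suc n)) (Y n)" by metis
      obtain y \<sigma> where y: "y \<in> K" "strict_mono \<sigma>" "(Y \<circ> \<sigma>) \<longlonglongrightarrow> y"
        using K(1) Y(1) unfolding compact_def by blast
      define E where "E = (\<lambda>n. 1 / real (Suc (\<sigma> n)))"
      have E: "E \<longlonglongrightarrow> 0"
        using LIMSEQ_subseq_LIMSEQ[OF LIMSEQ_Suc[OF lim_1_over_n] y(2)] unfolding E_def o_def by (simp del: of_nat_Suc)
      have 1: "(\<lambda>n. P (E n) ((Y \<circ> \<sigma>) n)) \<longlonglongrightarrow> (if Re (y $ j) > 0 then leaf_fun i j y else 0)"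
        unfolding P_def by (rule soft_leaf_tendsto[OF ij(1) y(3) E saddle_hyp_Re_zero]) (use y(1) KM in blast)
      have 2: "(\<lambda>n. P (E n) x) \<longlonglongrightarrow> leaf_fun i j x"
        using soft_leaf_tendsto[OF ij(1) tendsto_const[of x] E] ij(2) unfolding P_def by auto
      have "P (E n) x = P (E n) ((Y \<circ> \<sigma>) n)" for n using Y(2)[of "\<sigma> n"] by (simp add: E_def)
      then have "(\<lambda>n. P (E n) x) = (\<lambda>n. P (E n) ((Y \<circ> \<sigma>) n))" by (rule ext)
      then have "leaf_fun i j x = (if Re (y $ j) > 0 then leaf_fun i j y else 0)"
        using LIMSEQ_unique[OF 2] 1 by simp
      moreover have "Im (if Re (y $ j) > 0 then leaf_fun i j y else 0) = 0"
        using saddle_hyp_iff[OF _ ij(1), of y] y(1) KM saddle_hyp_big_ball by auto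
      ultimately show False using imx by metis
    qed
    then obtain n where n: "P (1 / real (Suc n)) x \<notin> P (1 / real (Suc n)) ` K" by blast
    define \<eta> where "\<eta> = 1 / real (Suc n)"
    have \<eta>: "\<eta> > 0" by (simp add: \<eta>_def)
    define W where "W = big_ball \<inter> (\<lambda>p. p $ j) -` soft_dom \<eta>"
    have bb: "stein_open big_ball" unfolding big_ball_def by (rule stein_open_convex) auto
    have W: "stein_open W" unfolding W_def
      by (rule stein_open_preimage[OF bb holomorphic_on_C2_nth open_soft_dom])
    have PW: "holomorphic_on_C2 (P \<eta>) W"
      unfolding P_def
    proof (rule holomorphic_on_C2_mult[OF holomorphic_on_C2_nth])
      show "holomorphic_on_C2 (\<lambda>p. soft_pos \<eta> (p $ j) powr complex_of_real (expo i j)) W"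
      proof (rule holomorphic_on_C2_compose[OF holomorphic_on_C2_nth, of _ "soft_dom \<eta>"])
        show "(\<lambda>w. soft_pos \<eta> w powr complex_of_real (expo i j)) holomorphic_on soft_dom \<eta>"
          using soft_pos_not_nonpos[OF \<eta>] by (intro holomorphic_on_powr soft_pos_holomorphic holomorphic_on_const) auto
      qed (auto simp: W_def open_soft_dom)
    qed
    have KW: "K \<subseteq> W"
      using KM saddle_hyp_big_ball soft_domI[OF \<eta> saddle_hyp_Re_zero] by (auto simp: W_def)
    have xW: "x \<in> W" using xB soft_domI[OF \<eta>] ij(2) by (auto simp: W_def)
    have "compact (P \<eta> ` K)"
      by (rule compact_continuous_image[OF continuous_on_subset[OF holomorphic_on_C2_continuous_on[OF PW] KW] K(1)])
    then obtain \<rho> where \<rho>: "\<rho> > 0" "\<And>z. z \<in> P \<eta> ` K \<Longrightarrow> \<rho> \<le> dist (P \<eta> x) z"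
      using separate_point_closed[of "P \<eta> ` K" "P \<eta> x"] n compact_imp_closed unfolding \<eta>_def by blast
    \<comment> \<open>Removing a closed disc of half the separating distance leaves \<open>K\<close>
      untouched and makes a whole neighborhood of \<open>x\<close> disjoint from
      \<open>V\<close>.\<close>
    define V where "V = W \<inter> P \<eta> -` (- cball (P \<eta> x) (\<rho> / 2))"
    have "stein_open V" unfolding V_def by (rule stein_open_preimage[OF W PW]) auto
    moreover have "K \<subseteq> V"
    proof
      fix y assume y: "y \<in> K"
      then have "\<rho> \<le> dist (P \<eta> x) (P \<eta> y)" using \<rho>(2) by blast
      then show "y \<in> V" using y KW \<rho>(1) by (auto simp: V_def)
    qed
    moreover have "x \<notin> closure V"
    proof -
      have oW: "open W" by (rule stein_open_imp_open[OF W])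
      have "open (W \<inter> P \<eta> -` ball (P \<eta> x) (\<rho> / 2))"
        by (rule continuous_open_preimage[OF holomorphic_on_C2_continuous_on[OF PW] oW open_ball])
      moreover have "x \<in> W \<inter> P \<eta> -` ball (P \<eta> x) (\<rho> / 2)" using xW \<rho>(1) by simp
      moreover have "W \<inter> P \<eta> -` ball (P \<eta> x) (\<rho> / 2) \<inter> V = {}" by (auto simp: V_def)
      ultimately show ?thesis by (metis IntI closure_iff_nhds_not_empty empty_iff open_Int_closure_eq_empty)
    qed
    ultimately show ?thesis by blast
  qed
qed

section \<open>Leafwise constant functions\<close>

lemma complexifiable_atI:
  assumes "open S" "complex_of_real x \<in> S" "F holomorphic_on S" "\<And>y. complex_of_real y \<in> S \<Longrightarrow> F (of_real y) = of_real (g y)"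
  shows "complexifiable_at g x"
proof -
  obtain e where e: "e > 0" "ball (complex_of_real x) e \<subseteq> S" using assms(1,2) openE by blast
  show ?thesis
    unfolding complexifiable_at_def
  proof (intro exI[of _ F] exI[of _ e] conjI allI impI)
    show "F holomorphic_on ball (complex_of_real x) e" using assms(3) e(2) by (rule holomorphic_on_subset)
    fix y assume "\<bar>y - x\<bar> < e"
    then have "complex_of_real y \<in> ball (of_real x) e" by (simp add: dist_norm abs_minus_commute flip: of_real_diff)
    then show "F (of_real y) = of_real (g y)" using assms(4) e(2) by blast
  qed (rule e(1))
qed

lemma complexifiable_at_const: "complexifiable_at (\<lambda>_. c) x"
  by (rule complexifiable_atI[of UNIV _ "\<lambda>_. of_real c"]) auto

lemma complexifiable_at_id: "complexifiable_at (\<lambda>y. y) x"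
  by (rule complexifiable_atI[of UNIV _ "\<lambda>w. w"]) auto

lemma complexifiable_at_mult:
  assumes "complexifiable_at f x" "complexifiable_at g x"
  shows "complexifiable_at (\<lambda>t. f t * g t) x"
proof -
  from assms obtain F e G e' where "e > 0" "F holomorphic_on ball (of_real x) e" 
    "\<forall>y. \<bar>y - x\<bar> < e \<longrightarrow> F (of_real y) = of_real (f y)"
    "e' > 0" "G holomorphic_on ball (of_real x) e'" 
    "\<forall>y. \<bar>y - x\<bar> < e' \<longrightarrow> G (of_real y) = of_real (g y)" unfolding complexifiable_at_def by metis
  then show ?thesis unfolding complexifiable_at_def
    by (intro exI[of _ "\<lambda>w. F w * G w"] exI[of _ "min e e'"])
       (auto intro!: holomorphic_intros elim: holomorphic_on_subset)
qed

lemma complexifiable_at_inverse: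
  assumes "x \<noteq> 0"
  shows "complexifiable_at inverse x"
  by (rule complexifiable_atI[of "- {0}" _ inverse]) (use assms in \<open>auto intro!: holomorphic_intros\<close>)

lemma complexifiable_at_divide:
  assumes "complexifiable_at f x" "complexifiable_at g x" "g x \<noteq> 0"
  shows "complexifiable_at (\<lambda>t. f t / g t) x"
  using complexifiable_at_mult[OF assms(1) complexifiable_at_compose[OF assms(2) complexifiable_at_inverse[OF assms(3)]]]
  by (simp add: divide_inverse)

lemma complexifiable_at_powr:
  assumes "x > 0"
  shows "complexifiable_at (\<lambda>t. t powr a) x"
proof (rule complexifiable_atI[of "{w. Re w > 0}" _ "\<lambda>w. w powr of_real a"])
  show "open {w. Re w > 0}" by (rule open_halfspace_Re_gt)
  show "(\<lambda>w. w powr of_real a) holomorphic_on {w. Re w > 0}" by (rule powr_holomorphic_Re_pos) simp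
qed (use assms in \<open>auto simp: powr_of_real\<close>)

lemma complexifiable_at_isCont:
  assumes "complexifiable_at f x"
  shows "isCont f x"
proof -
  obtain F e where F: "e > 0" "F holomorphic_on ball (of_real x) e" 
    "\<And>y. \<bar>y - x\<bar> < e \<Longrightarrow> F (of_real y) = of_real (f y)" using assms unfolding complexifiable_at_def by metis
  have "isCont F (of_real x)"
    using holomorphic_on_imp_continuous_on[OF F(2)] F(1) by (simp add: continuous_on_eq_continuous_at)
  then have "isCont (\<lambda>y. F (complex_of_real y)) x"
    by (rule isCont_o2[rotated]) (intro continuous_intros)
  then have "isCont (\<lambda>y. Re (F (of_real y))) x" by (rule continuous_Re)
  moreover have "\<forall>\<^sub>F y in nhds x. Re (F (of_real y)) = f y"
    unfolding eventually_nhds_metric using F(1,3) by (intro exI[of _ e]) (auto simp: dist_real_def)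
  ultimately show ?thesis by (subst (asm) isCont_cong) auto
qed

lemma complexifiable_at_order:
  assumes f: "complexifiable_at f x" and nc: "\<not> (\<exists>e>0. \<forall>y. \<bar>y - x\<bar> < e \<longrightarrow> f y = f x)"
  obtains k :: nat and c :: real where "k > 0" "c \<noteq> 0" "((\<lambda>y. (f y - f x) / (y - x) ^ k) \<longlongrightarrow> c) (at x)"
proof -
  obtain F e where F: "e > 0" "F holomorphic_on ball (of_real x) e" 
    "\<And>y. \<bar>y - x\<bar> < e \<Longrightarrow> F (of_real y) = of_real (f y)" using f unfolding complexifiable_at_def by metis
  define G where "G = (\<lambda>w. F w - of_real (f x))"
  let ?B = "ball (complex_of_real x) e"
  have G: "G holomorphic_on ?B" unfolding G_def by (intro holomorphic_intros F)
  have G0: "G (of_real x) = 0" using F(1,3) by (simp add: G_def)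
  have Gf: "G (of_real y) = of_real (f y - f x)" if "\<bar>y - x\<bar> < e" for y
    using F(3)[OF that] by (simp add: G_def)
  have inB: "complex_of_real y \<in> ?B \<longleftrightarrow> \<bar>y - x\<bar> < e" for y
    by (simp add: dist_norm abs_minus_commute flip: of_real_diff)
  have "\<not> G constant_on ?B"
  proof
    assume "G constant_on ?B"
    then have z: "G w = 0" if "w \<in> ?B" for w
      using G0 F(1) that unfolding constant_on_def by (metis centre_in_ball)
    have "f y = f x" if "\<bar>y - x\<bar> < e" for y
      using z[of "of_real y"] Gf[OF that] inB[of y] that by simp
    with nc F(1) show False by blast
  qed
  then obtain g r n where n: "0 < n" and r: "0 < r" "ball (of_real x) r \<subseteq> ?B" and g: "g holomorphic_on ball (of_real x) r"
    and gG: "\<And>w. w \<in> ball (of_real x) r \<Longrightarrow> G w = (w - of_real x) ^ n * g w"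
    and gnz: "\<And>w. w \<in> ball (of_real x) r \<Longrightarrow> g w \<noteq> 0"
    using holomorphic_factor_zero_nonconstant[OF G open_ball connected_ball _ G0] F(1) by (metis centre_in_ball)
  have "isCont g (of_real x)"
    using holomorphic_on_imp_continuous_on[OF g] r(1) by (simp add: continuous_on_eq_continuous_at)
  then have ct: "isCont (\<lambda>y. g (complex_of_real y)) x"
    by (intro isCont_o2[of x of_real g]) auto
  then have lim: "((\<lambda>y. g (complex_of_real y)) \<longlongrightarrow> g (of_real x)) (at x)" by (simp add: isCont_def)
  have ev: "\<forall>\<^sub>F y in at x. g (complex_of_real y) = of_real ((f y - f x) / (y - x) ^ n)"
    unfolding eventually_at
  proof (intro exI[of _ r] conjI ballI impI r)
    fix y assume y: "y \<noteq> x \<and> dist y x < r"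
    then have yr: "complex_of_real y \<in> ball (of_real x) r"
      by (simp add: dist_norm abs_minus_commute flip: of_real_diff)
    then have "\<bar>y - x\<bar> < e" using r(2) inB by blast
    then have "of_real (f y - f x) = (complex_of_real y - of_real x) ^ n * g (of_real y)"
      using Gf gG[OF yr] by simp
    moreover have "(complex_of_real y - of_real x) ^ n = of_real ((y - x) ^ n)" by simp
    ultimately have e: "of_real (f y - f x) = of_real ((y - x) ^ n) * g (complex_of_real y)" by (simp only:)
    have "complex_of_real ((y - x) ^ n) \<noteq> 0" using y by simp
    then show "g (complex_of_real y) = of_real ((f y - f x) / (y - x) ^ n)"
      unfolding of_real_divide e by (rule nonzero_mult_div_cancel_left[symmetric])
  qed
  have lim2: "((\<lambda>y. complex_of_real ((f y - f x) / (y - x) ^ n)) \<longlongrightarrow> g (of_real x)) (at x)"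
    using lim by (rule Lim_transform_eventually) (rule ev)
  have lim3: "((\<lambda>y. (f y - f x) / (y - x) ^ n) \<longlongrightarrow> Re (g (of_real x))) (at x)"
    using tendsto_Re[OF lim2] by simp
  have "((\<lambda>y. 0) \<longlongrightarrow> Im (g (of_real x))) (at x)"
    using tendsto_Im[OF lim2] by simp
  then have "Im (g (of_real x)) = 0" by (metis tendsto_const_iff trivial_limit_at)
  moreover have "g (of_real x) \<noteq> 0" using gnz r(1) by simp
  ultimately have "Re (g (of_real x)) \<noteq> 0" by (simp add: complex_eq_iff)
  with that n lim3 show ?thesis by blast
qed

section \<open>Pairs of points where a leaf meets a chord\<close>

text \<open>The points \<open>s\<close> and \<open>\<rho> s\<close> of the chord \<open>{(s, m - s)}\<close> have the same value of \<open>s powr lam * (m - s)\<close> exactly for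
  \<open>s = chord_pt m \<rho>\<close>.\<close>

definition chord_pt :: "real \<Rightarrow> real \<Rightarrow> real" where
  "chord_pt m \<rho> = m * (\<rho> powr lam - 1) / (\<rho> powr (lam + 1) - 1)"

lemma chord_pt_props:
  assumes m: "m > 0" and \<rho>: "\<rho> > 1"
  shows "0 < chord_pt m \<rho>" "\<rho> * chord_pt m \<rho> < m" "chord_pt m \<rho> < \<rho> * chord_pt m \<rho>"
    "m - \<rho> * chord_pt m \<rho> = m * (\<rho> - 1) / (\<rho> powr (lam + 1) - 1)"
    "m - chord_pt m \<rho> = \<rho> powr lam * (m - \<rho> * chord_pt m \<rho>)"
    "\<rho> powr (lam + 1) > 1" "\<rho> powr lam > 1"
proof -
  have p1: "\<rho> powr lam > 1" using \<rho> lam_pos by simp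
  have p2: "\<rho> powr (lam + 1) > 1" using \<rho> lam_pos by simp
  have pp: "\<rho> powr (lam + 1) = \<rho> * \<rho> powr lam" using \<rho> by (simp add: powr_add)
  show "\<rho> powr (lam + 1) > 1" "\<rho> powr lam > 1" by (fact p2, fact p1)
  show 1: "0 < chord_pt m \<rho>" using p1 p2 m by (simp add: chord_pt_def)
  then show "chord_pt m \<rho> < \<rho> * chord_pt m \<rho>" using \<rho> by simp
  show 2: "m - \<rho> * chord_pt m \<rho> = m * (\<rho> - 1) / (\<rho> powr (lam + 1) - 1)"
    using p2 unfolding chord_pt_def pp by (simp add: field_simps)
  have "m * (\<rho> - 1) / (\<rho> powr (lam + 1) - 1) > 0" using p2 m \<rho> by simp
  then show "\<rho> * chord_pt m \<rho> < m" using 2 by linarith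
  show "m - chord_pt m \<rho> = \<rho> powr lam * (m - \<rho> * chord_pt m \<rho>)"
    using p2 unfolding 2 unfolding chord_pt_def pp by (simp add: field_simps)
qed

text \<open>For large \<open>\<rho>\<close> the first point is asymptotic to
  \<open>m / \<rho>\<close>, and the second is at distance asymptotic to
  \<open>m * \<rho> powr (- lam)\<close> from the other end. The factor \<open>lam\<close> between
  these exponents drives the contradiction below.\<close>

lemma chord_pt_limits:
  assumes m: "m > 0"
  shows "((\<lambda>\<rho>. \<rho> * chord_pt m \<rho>) \<longlongrightarrow> m) at_top"
    "((\<lambda>\<rho>. \<rho> powr lam * (m - \<rho> * chord_pt m \<rho>)) \<longlongrightarrow> m) at_top"
    "(chord_pt m \<longlongrightarrow> 0) at_top"
proof -
  have neg: "((\<lambda>\<rho>::real. \<rho> powr - a) \<longlongrightarrow> 0) at_top" if "a > 0" for a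
    using that by (intro tendsto_neg_powr filterlim_ident) auto
  have "((\<lambda>\<rho>. m * (1 - \<rho> powr - lam) / (1 - \<rho> powr - (lam + 1))) \<longlongrightarrow> m * (1 - 0) / (1 - 0)) at_top"
    by (intro tendsto_intros neg) (use lam_pos in auto)
  then have "((\<lambda>\<rho>. m * (1 - \<rho> powr - lam) / (1 - \<rho> powr - (lam + 1))) \<longlongrightarrow> m) at_top" by simp
  moreover have "\<forall>\<^sub>F \<rho> in at_top. m * (1 - \<rho> powr - lam) / (1 - \<rho> powr - (lam + 1)) = \<rho> * chord_pt m \<rho>"
    using eventually_gt_at_top[of 1]
  proof eventually_elim
    case (elim \<rho>)
    note p = chord_pt_props(6,7)[OF m elim]
    have pp: "\<rho> powr (lam + 1) = \<rho> * \<rho> powr lam" using elim by (simp add: powr_add)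
    have e1: "1 - \<rho> powr - (lam + 1) = (\<rho> * \<rho> powr lam - 1) / (\<rho> * \<rho> powr lam)"
      using elim unfolding powr_minus pp by (simp add: field_simps)
    have e2: "1 - \<rho> powr - lam = (\<rho> powr lam - 1) / \<rho> powr lam"
      using elim unfolding powr_minus by (simp add: field_simps)
    have alg: "m * ((P - 1) / P) / ((\<rho> * P - 1) / (\<rho> * P)) = \<rho> * (m * (P - 1) / (\<rho> * P - 1))"
      if "P > 1" "\<rho> * P > 1" for P using that elim by (simp add: field_simps)
    show ?case using p unfolding chord_pt_def e1 e2 pp by (intro alg)
  qed
  ultimately show 1: "((\<lambda>\<rho>. \<rho> * chord_pt m \<rho>) \<longlongrightarrow> m) at_top" by (rule Lim_transform_eventually)
  have "((\<lambda>\<rho>. m * (1 - \<rho> powr - 1) / (1 - \<rho> powr - (lam + 1))) \<longlongrightarrow> m * (1 - 0) / (1 - 0)) at_top"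
    by (intro tendsto_intros neg) (use lam_pos in auto)
  then have "((\<lambda>\<rho>. m * (1 - \<rho> powr - 1) / (1 - \<rho> powr - (lam + 1))) \<longlongrightarrow> m) at_top" by simp
  moreover have "\<forall>\<^sub>F \<rho> in at_top. m * (1 - \<rho> powr - 1) / (1 - \<rho> powr - (lam + 1)) = \<rho> powr lam * (m - \<rho> * chord_pt m \<rho>)"
    using eventually_gt_at_top[of 1]
  proof eventually_elim
    case (elim \<rho>)
    note p = chord_pt_props(6,7)[OF m elim]
    have pp: "\<rho> powr (lam + 1) = \<rho> * \<rho> powr lam" using elim by (simp add: powr_add)
    have e1: "1 - \<rho> powr - (lam + 1) = (\<rho> * \<rho> powr lam - 1) / (\<rho> * \<rho> powr lam)"
      using elim unfolding powr_minus pp by (simp add: field_simps)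
    have e2: "1 - \<rho> powr - 1 = (\<rho> - 1) / \<rho>"
      using elim unfolding powr_minus by (simp add: field_simps)
    have alg: "m * ((\<rho> - 1) / \<rho>) / ((\<rho> * P - 1) / (\<rho> * P)) = P * (m * (\<rho> - 1) / (\<rho> * P - 1))"
      if "P > 1" "\<rho> * P > 1" for P using that elim by (simp add: field_simps)
    show ?case using p unfolding chord_pt_props(4)[OF m elim] e1 e2 pp by (intro alg)
  qed
  ultimately show "((\<lambda>\<rho>. \<rho> powr lam * (m - \<rho> * chord_pt m \<rho>)) \<longlongrightarrow> m) at_top" by (rule Lim_transform_eventually)
  have "((\<lambda>\<rho>. \<rho> * chord_pt m \<rho> * inverse \<rho>) \<longlongrightarrow> m * 0) at_top"
    by (intro tendsto_mult 1 tendsto_inverse_0_at_top filterlim_ident)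
  then have "((\<lambda>\<rho>. \<rho> * chord_pt m \<rho> * inverse \<rho>) \<longlongrightarrow> 0) at_top" by simp
  then show "(chord_pt m \<longlongrightarrow> 0) at_top"
  proof (rule Lim_transform_eventually)
    show "\<forall>\<^sub>F \<rho> in at_top. \<rho> * chord_pt m \<rho> * inverse \<rho> = chord_pt m \<rho>"
      using eventually_gt_at_top[of 0] by eventually_elim simp
  qed
qed

text \<open>The two ends of the chord have leaf coordinates related by the irrational power \<open>lam\<close>; the orders
  of vanishing \<open>k\<close> and \<open>l\<close> of a nonconstant first integral there would satisfy \<open>k = lam * l\<close>.\<close>

lemma first_integral_on_chord_constant:
  assumes m: "m > 0" and ab: "a < 0" "m < b"
    and f: "\<And>x. x \<in> {a<..<b} \<Longrightarrow> complexifiable_at f x"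
    and e: "e > 0" "\<And>\<rho>. 1 < \<rho> \<Longrightarrow> \<rho> < 1 + e \<Longrightarrow> f (chord_pt m \<rho>) = f (\<rho> * chord_pt m \<rho>)"
    and x: "x \<in> {a<..<b}"
  shows "f x = f 0"
proof -
  have in_ab: "chord_pt m \<rho> \<in> {a<..<b}" "\<rho> * chord_pt m \<rho> \<in> {a<..<b}" if "\<rho> > 1" for \<rho>
    using chord_pt_props(1-3)[OF m that] ab unfolding greaterThanLessThan_iff by linarith+
  have cp: "complexifiable_at (chord_pt m) \<rho>" if "\<rho> > 1" for \<rho>
    unfolding chord_pt_def[abs_def]
    by (intro complexifiable_at_divide complexifiable_at_mult complexifiable_at_minus complexifiable_at_const complexifiable_at_powr)
       (use that chord_pt_props(6)[OF m that] in auto)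
  \<comment> \<open>Both points remain in the interval for every \<open>\<rho> > 1\<close>, so the
    difference of the values is analytic on the whole half-line and its vanishing near 1 propagates
    to infinity.\<close>
  have eq: "f (chord_pt m \<rho>) = f (\<rho> * chord_pt m \<rho>)" if \<rho>: "\<rho> > 1" for \<rho>
  proof -
    have "f (chord_pt m \<rho>) - f (\<rho> * chord_pt m \<rho>) = 0"
    proof (rule complexifiable_identity[of "{1<..}" "\<lambda>\<rho>. f (chord_pt m \<rho>) - f (\<rho> * chord_pt m \<rho>)" "1 + e / 2" "e / 2"])
      show "complexifiable_at (\<lambda>\<rho>. f (chord_pt m \<rho>) - f (\<rho> * chord_pt m \<rho>)) x" if "x \<in> {1<..}" for x
        using that in_ab[of x]
        by (intro complexifiable_at_minus complexifiable_at_compose[OF cp] 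
            complexifiable_at_compose[OF complexifiable_at_mult[OF complexifiable_at_id cp]] f) auto
      show "f (chord_pt m y) - f (y * chord_pt m y) = 0" if "\<bar>y - (1 + e / 2)\<bar> < e / 2" for y
      proof -
        have "1 < y" "y < 1 + e" using that unfolding abs_less_iff by linarith+
        from e(2)[OF this] show ?thesis by simp
      qed
    qed (use \<rho> e(1) in auto)
    then show ?thesis by simp
  qed
  \<comment> \<open>Local constancy at either end would spread to the whole interval; so for
    nonconstant \<open>f\<close> the orders of contact at both 0 and \<open>m\<close> are
    finite.\<close>
  have lc: "f x = f c" if c: "c \<in> {a<..<b}" and loc: "\<exists>e>0. \<forall>y. \<bar>y - c\<bar> < e \<longrightarrow> f y = f c" and x: "x \<in> {a<..<b}" for c x
  proof -
    obtain d where d: "d > 0" "\<forall>y. \<bar>y - c\<bar> < d \<longrightarrow> f y = f c" using loc by blast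
    have "f x - f c = 0"
    proof (rule complexifiable_identity[of "{a<..<b}" "\<lambda>x. f x - f c" c d])
      show "complexifiable_at (\<lambda>x. f x - f c) y" if "y \<in> {a<..<b}" for y
        by (rule complexifiable_at_minus[OF f[OF that] complexifiable_at_const])
      show "f y - f c = 0" if "\<bar>y - c\<bar> < d" for y
        using d(2)[rule_format, OF that] by (simp only: right_minus_eq)
    qed (use c x d(1) in simp_all)
    then show ?thesis by simp
  qed
  have z: "0 \<in> {a<..<b}" and mI: "m \<in> {a<..<b}" using m ab by auto
  show ?thesis
  proof (rule ccontr)
    assume neq: "f x \<noteq> f 0"
    have nc0: "\<not> (\<exists>e>0. \<forall>y. \<bar>y - 0\<bar> < e \<longrightarrow> f y = f 0)" using lc[OF z _ x] neq by blast
    have ncm: "\<not> (\<exists>e>0. \<forall>y. \<bar>y - m\<bar> < e \<longrightarrow> f y = f m)" using lc[OF mI _ x] lc[OF mI _ z] neq by metis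
    obtain k c where k: "k > 0" "c \<noteq> 0" "((\<lambda>y. (f y - f 0) / (y - 0) ^ k) \<longlongrightarrow> c) (at 0)"
      by (rule complexifiable_at_order[OF f[OF z] nc0], rule that)
    obtain l d where l: "l > 0" "d \<noteq> 0" "((\<lambda>y. (f y - f m) / (y - m) ^ l) \<longlongrightarrow> d) (at m)"
      by (rule complexifiable_at_order[OF f[OF mI] ncm], rule that)
    note lims = chord_pt_limits[OF m]
    have gt1: "\<forall>\<^sub>F \<rho> in at_top. (\<rho>::real) > 1" by (rule eventually_gt_at_top)
    have fl0: "filterlim (chord_pt m) (at 0) at_top"
      unfolding filterlim_at
    proof
      show "\<forall>\<^sub>F \<rho> in at_top. chord_pt m \<rho> \<in> UNIV \<and> chord_pt m \<rho> \<noteq> 0"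
        using gt1
      proof eventually_elim
        case (elim \<rho>)
        then show ?case using chord_pt_props(1)[OF m elim] by simp
      qed
    qed (rule lims(3))
    have flm: "filterlim (\<lambda>\<rho>. \<rho> * chord_pt m \<rho>) (at m) at_top"
      unfolding filterlim_at
    proof
      show "\<forall>\<^sub>F \<rho> in at_top. \<rho> * chord_pt m \<rho> \<in> UNIV \<and> \<rho> * chord_pt m \<rho> \<noteq> m"
        using gt1
      proof eventually_elim
        case (elim \<rho>)
        then show ?case using chord_pt_props(2)[OF m elim] by simp
      qed
    qed (rule lims(1))
    have f0m: "f 0 = f m"
    proof (rule tendsto_unique)
      show "((\<lambda>\<rho>. f (chord_pt m \<rho>)) \<longlongrightarrow> f 0) at_top"
        by (rule isCont_tendsto_compose[OF complexifiable_at_isCont[OF f[OF z]] lims(3)])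
      have "((\<lambda>\<rho>. f (\<rho> * chord_pt m \<rho>)) \<longlongrightarrow> f m) at_top"
        by (rule isCont_tendsto_compose[OF complexifiable_at_isCont[OF f[OF mI]] lims(1)])
      then show "((\<lambda>\<rho>. f (chord_pt m \<rho>)) \<longlongrightarrow> f m) at_top"
      proof (rule Lim_transform_eventually)
        show "\<forall>\<^sub>F \<rho> in at_top. f (\<rho> * chord_pt m \<rho>) = f (chord_pt m \<rho>)"
          using gt1 by eventually_elim (rule eq[symmetric])
      qed
    qed simp
    let ?x = "chord_pt m" and ?y = "\<lambda>\<rho>. m - \<rho> * chord_pt m \<rho>"
    let ?A = "\<lambda>\<rho>. f (chord_pt m \<rho>) - f 0"
    have A1: "((\<lambda>\<rho>. \<bar>?A \<rho>\<bar> / ?x \<rho> ^ k) \<longlongrightarrow> \<bar>c\<bar>) at_top"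
    proof -
      have "((\<lambda>\<rho>. \<bar>?A \<rho> / (?x \<rho> - 0) ^ k\<bar>) \<longlongrightarrow> \<bar>c\<bar>) at_top"
        by (intro tendsto_rabs filterlim_compose[OF k(3) fl0])
      then show ?thesis
      proof (rule Lim_transform_eventually)
        show "\<forall>\<^sub>F \<rho> in at_top. \<bar>?A \<rho> / (?x \<rho> - 0) ^ k\<bar> = \<bar>?A \<rho>\<bar> / ?x \<rho> ^ k"
          using gt1
        proof eventually_elim
          case (elim \<rho>)
          then show ?case using chord_pt_props(1)[OF m elim] by simp
        qed
      qed
    qed
    have A2: "((\<lambda>\<rho>. \<bar>?A \<rho>\<bar> / ?y \<rho> ^ l) \<longlongrightarrow> \<bar>d\<bar>) at_top"
    proof -
      have "((\<lambda>\<rho>. \<bar>(f (\<rho> * ?x \<rho>) - f m) / (\<rho> * ?x \<rho> - m) ^ l\<bar>) \<longlongrightarrow> \<bar>d\<bar>) at_top"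
        by (intro tendsto_rabs filterlim_compose[OF l(3) flm])
      then show ?thesis
      proof (rule Lim_transform_eventually)
        show "\<forall>\<^sub>F \<rho> in at_top. \<bar>(f (\<rho> * ?x \<rho>) - f m) / (\<rho> * ?x \<rho> - m) ^ l\<bar> = \<bar>?A \<rho>\<bar> / ?y \<rho> ^ l"
          using gt1
        proof eventually_elim
          case (elim \<rho>)
          have "\<bar>\<rho> * ?x \<rho> - m\<bar> = ?y \<rho>" using chord_pt_props(2)[OF m elim] by simp
          then show ?case using eq[OF elim] f0m by (simp add: power_abs)
        qed
      qed
    qed
    have X: "((\<lambda>\<rho>. (\<rho> * ?x \<rho>) ^ k) \<longlongrightarrow> m ^ k) at_top" by (intro tendsto_power lims)
    have Y: "((\<lambda>\<rho>. (\<rho> powr lam * ?y \<rho>) ^ l) \<longlongrightarrow> m ^ l) at_top" by (intro tendsto_power lims)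
    \<comment> \<open>The same quantity \<open>\<bar>?A \<rho>\<bar>\<close> is asymptotic to
      \<open>\<bar>c\<bar> * m ^ k * \<rho> powr (- k)\<close> and to
      \<open>\<bar>d\<bar> * m ^ l * \<rho> powr (- lam * l)\<close>. Dividing out leaves a pure
      power of \<open>\<rho>\<close> with the finite positive limit \<open>C\<close>.\<close>
    define C where "C = (\<bar>d\<bar> * m ^ l) / (\<bar>c\<bar> * m ^ k)"
    have C: "C > 0" using l(2) k(2) m by (simp add: C_def)
    have "((\<lambda>\<rho>. (\<bar>?A \<rho>\<bar> / ?y \<rho> ^ l * (\<rho> powr lam * ?y \<rho>) ^ l) / (\<bar>?A \<rho>\<bar> / ?x \<rho> ^ k * (\<rho> * ?x \<rho>) ^ k)) \<longlongrightarrow> C) at_top"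
      unfolding C_def by (intro tendsto_divide tendsto_mult A1 A2 X Y) (use k(2) m in simp)
    moreover have "\<forall>\<^sub>F \<rho> in at_top. (\<bar>?A \<rho>\<bar> / ?y \<rho> ^ l * (\<rho> powr lam * ?y \<rho>) ^ l) / (\<bar>?A \<rho>\<bar> / ?x \<rho> ^ k * (\<rho> * ?x \<rho>) ^ k)
        = \<rho> powr (lam * real l - real k)"
    proof -
      have "\<forall>\<^sub>F \<rho> in at_top. \<bar>?A \<rho>\<bar> / ?x \<rho> ^ k > 0"
        using order_tendstoD(1)[OF A1, of 0] k(2) by simp
      with gt1 show ?thesis
      proof eventually_elim
        case (elim \<rho>)
        have xp: "?x \<rho> > 0" and yp: "?y \<rho> > 0" using chord_pt_props(1,2)[OF m elim(1)] by auto
        have Ap: "\<bar>?A \<rho>\<bar> > 0" using elim(2) xp by (simp add: zero_less_divide_iff)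
        have "(\<bar>?A \<rho>\<bar> / ?y \<rho> ^ l * (\<rho> powr lam * ?y \<rho>) ^ l) = \<bar>?A \<rho>\<bar> * (\<rho> powr lam) ^ l"
          using yp by (simp add: power_mult_distrib)
        moreover have "(\<bar>?A \<rho>\<bar> / ?x \<rho> ^ k * (\<rho> * ?x \<rho>) ^ k) = \<bar>?A \<rho>\<bar> * \<rho> ^ k"
          using xp by (simp add: power_mult_distrib)
        moreover have "(\<rho> powr lam) ^ l = \<rho> powr (lam * real l)" "\<rho> ^ k = \<rho> powr real k"
          using elim(1) by (simp_all add: powr_powr powr_realpow[symmetric])
        ultimately show ?case using Ap by (simp only: powr_diff) simp
      qed
    qed
    ultimately have P: "((\<lambda>\<rho>. \<rho> powr (lam * real l - real k)) \<longlongrightarrow> C) at_top" by (rule Lim_transform_eventually)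
    \<comment> \<open>A power of \<open>\<rho>\<close> with a positive finite limit at infinity has
      exponent 0; a positive exponent is reduced to a negative one by inversion.\<close>
    have "lam * real l - real k = 0"
    proof (rule ccontr)
      assume nz: "lam * real l - real k \<noteq> 0"
      have neg: False if "s < 0" "((\<lambda>\<rho>. \<rho> powr s) \<longlongrightarrow> D) at_top" "D > 0" for s D :: real
      proof -
        have "((\<lambda>\<rho>::real. \<rho> powr s) \<longlongrightarrow> 0) at_top" by (rule tendsto_neg_powr[OF that(1) filterlim_ident])
        then have "D = 0" using tendsto_unique that(2) by (metis trivial_limit_at_top_linorder)
        then show False using that(3) by simp
      qed
      show False
      proof (cases "lam * real l - real k < 0")
        case True
        then show False using neg P C by blast
      next
        case False
        have "((\<lambda>\<rho>. inverse (\<rho> powr (lam * real l - real k))) \<longlongrightarrow> inverse C) at_top"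
          using P C by (intro tendsto_inverse) auto
        then have "((\<lambda>\<rho>. \<rho> powr (- (lam * real l - real k))) \<longlongrightarrow> inverse C) at_top"
          by (simp only: powr_minus)
        then show False using neg[of "- (lam * real l - real k)" "inverse C"] False nz C by simp
      qed
    qed
    then have "lam = real k / real l" using l(1) by (simp add: field_simps)
    then have "lam \<in> \<rat>" by (metis Rats_divide Rats_of_nat)
    then show False using lam_irrational by contradiction
  qed
qed

text \<open>With this radius \<open>small_ball\<close> meets the slice at time \<open>t\<close> exactly for \<open>\<bar>t\<bar> < pi / 4\<close>.\<close>

definition rad_sq :: real where "rad_sq = heightsq (pi / 4)"

definition small_ball :: "(complex ^ 2) set" where "small_ball = ball ctr (sqrt rad_sq)"

text \<open>The angle \<open>lam * pi / 4\<close> lies between \<open>pi / 4\<close> and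
  \<open>pi / 3\<close>, so the two squared sines add up to a value between
  \<open>1 / 2 + 1 / 2\<close> and \<open>1 / 2 + 3 / 4\<close>. Both bounds on \<open>lam\<close>
  enter here.\<close>

lemma rad_sq_bounds: "1 < rad_sq" "rad_sq < 5 / 4"
proof -
  have "pi / 4 < lam * (pi / 4)" "lam * (pi / 4) < 4 / 3 * (pi / 4)"
    using lam_bounds pi_gt_zero by simp_all
  then have l: "pi / 4 < lam * pi / 4" "lam * pi / 4 < pi / 3" by simp_all
  have s: "sin (pi / 4) < sin (lam * pi / 4)" "sin (lam * pi / 4) < sin (pi / 3)"
    by (rule sin_monotone_2pi; use l pi_gt_zero in linarith)+
  have q: "(sin (pi / 4))\<^sup>2 = 1 / 2" "(sin (pi / 3))\<^sup>2 = 3 / 4"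
    by (simp_all add: sin_45 sin_60 power_divide)
  have "0 < sin (pi / 4)" by (simp add: sin_45)
  then have "(sin (pi / 4))\<^sup>2 < (sin (lam * pi / 4))\<^sup>2" "(sin (lam * pi / 4))\<^sup>2 < (sin (pi / 3))\<^sup>2"
    using s by (intro power_strict_mono; simp)+
  then show "1 < rad_sq" "rad_sq < 5 / 4" using q by (simp_all add: rad_sq_def heightsq_def)
qed

lemma small_ball_iff: "p \<in> small_ball \<longleftrightarrow> (dist p ctr)\<^sup>2 < rad_sq"
proof -
  have "p \<in> small_ball \<longleftrightarrow> dist p ctr < sqrt rad_sq" by (simp add: small_ball_def dist_commute)
  also have "\<dots> \<longleftrightarrow> sqrt ((dist p ctr)\<^sup>2) < sqrt rad_sq" by simp
  also have "\<dots> \<longleftrightarrow> (dist p ctr)\<^sup>2 < rad_sq" by (rule real_sqrt_less_iff)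
  finally show ?thesis .
qed

lemma small_ball_big_ball: "small_ball \<subseteq> big_ball"
  using small_ball_iff big_ball_iff rad_sq_bounds by fastforce

lemma open_small_ball: "open small_ball" by (simp add: small_ball_def)

abbreviation cap :: "(complex ^ 2) set" where "cap \<equiv> saddle_hyp \<inter> small_ball"

text \<open>A round disc, possibly empty, in the real parameters \<open>x\<close>: its centre has
  coordinates \<open>cos t\<close> and \<open>cos (lam * t)\<close>, and its squared radius is
  \<open>rad_sq - heightsq t\<close>.\<close>

definition slice_disc :: "real \<Rightarrow> (real ^ 2) set" where
  "slice_disc t = {x. saddle_pt x t \<in> small_ball}"

lemma saddle_pt_line: "saddle_pt (x + s *\<^sub>R d) t = saddle_pt x t + s *\<^sub>R saddle_pt d t"
  unfolding vec_eq_iff vector_add_component vector_scaleR_component saddle_pt_nth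
  by (simp add: scaleR_conv_of_real algebra_simps)

lemma saddle_pt_in_cap: "\<bar>t\<bar> < time_bound \<Longrightarrow> x \<in> slice_disc t \<Longrightarrow> saddle_pt x t \<in> cap"
  using small_ball_big_ball unfolding slice_disc_def saddle_hyp_def by blast

lemma slice_disc_iff: "x \<in> slice_disc t \<longleftrightarrow> (x $ 1 - cos t)\<^sup>2 + (x $ 2 - cos (lam * t))\<^sup>2 + heightsq t < rad_sq"
  by (simp add: slice_disc_def small_ball_iff dist_saddle_pt)

lemma continuous_on_saddle_pt: "continuous_on UNIV (\<lambda>x. saddle_pt x t)"
  unfolding saddle_pt_def by (intro continuous_intros)

lemma open_slice_disc: "open (slice_disc t)"
proof -
  have "open ((\<lambda>x. saddle_pt x t) -` small_ball)"
    by (rule open_vimage[OF open_small_ball continuous_on_saddle_pt])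
  then show ?thesis by (simp add: slice_disc_def vimage_def)
qed

lemma convex_slice_disc: "convex (slice_disc t)"
proof (rule convexI)
  fix x y :: "real ^ 2" and u v :: real
  assume xy: "x \<in> slice_disc t" "y \<in> slice_disc t" and uv: "0 \<le> u" "0 \<le> v" "u + v = 1"
  have "saddle_pt (u *\<^sub>R x + v *\<^sub>R y) t = u *\<^sub>R saddle_pt x t + v *\<^sub>R saddle_pt y t"
    unfolding vec_eq_iff vector_add_component vector_scaleR_component saddle_pt_nth
    by (simp add: scaleR_conv_of_real algebra_simps)
  moreover have "\<dots> \<in> small_ball"
    using convexD[OF convex_ball] xy uv unfolding slice_disc_def small_ball_def by blast
  ultimately show "u *\<^sub>R x + v *\<^sub>R y \<in> slice_disc t" by (simp add: slice_disc_def)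
qed

lemma complexifiable_at_cong:
  assumes "complexifiable_at f x" "d > 0" "\<And>y. \<bar>y - x\<bar> < d \<Longrightarrow> f y = g y"
  shows "complexifiable_at g x"
proof -
  obtain F e where F: "e > 0" "F holomorphic_on ball (of_real x) e" 
    "\<And>y. \<bar>y - x\<bar> < e \<Longrightarrow> F (of_real y) = of_real (f y)" using assms(1) unfolding complexifiable_at_def by metis
  show ?thesis
    unfolding complexifiable_at_def
  proof (intro exI[of _ F] exI[of _ "min d e"] conjI allI impI)
    show "F holomorphic_on ball (of_real x) (min d e)"
      by (rule holomorphic_on_subset[OF F(2)]) auto
    show "F (of_real y) = of_real (g y)" if "\<bar>y - x\<bar> < min d e" for y
      using F(3)[of y] assms(3)[of y] that by simp
  qed (use F(1) assms(2) in simp)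
qed

lemma complexifiable_on_slice_line:
  fixes u :: "complex ^ 2 \<Rightarrow> real"
  assumes u: "real_analytic_map_on u cap" and t: "\<bar>t\<bar> < time_bound" and s: "x + s *\<^sub>R d \<in> slice_disc t"
  shows "complexifiable_at (\<lambda>s. u (saddle_pt (x + s *\<^sub>R d) t)) s"
proof -
  let ?l = "\<lambda>s. saddle_pt (x + s *\<^sub>R d) t"
  have lc: "?l s \<in> cap" by (rule saddle_pt_in_cap[OF t s])
  obtain U F where UF: "open U" "?l s \<in> U" "\<And>y. y \<in> U \<Longrightarrow> real_analytic_at F y" "\<And>y. y \<in> cap \<inter> U \<Longrightarrow> F y = u y"
    using bspec[OF u[unfolded real_analytic_map_on_def] lc] by blast
  have c: "complexifiable_at (\<lambda>s. F (saddle_pt x t + s *\<^sub>R saddle_pt d t)) s"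
    by (rule real_analytic_at_imp_complexifiable_on_line) (use UF(2,3) in \<open>simp add: saddle_pt_line\<close>)
  have "continuous_on UNIV (\<lambda>s. x + s *\<^sub>R d)" by (intro continuous_intros)
  then have "open ((\<lambda>s. x + s *\<^sub>R d) -` slice_disc t \<inter> (\<lambda>s. saddle_pt x t + s *\<^sub>R saddle_pt d t) -` U)"
    by (intro open_Int open_vimage open_slice_disc UF(1) continuous_intros)
  moreover have "s \<in> (\<lambda>s. x + s *\<^sub>R d) -` slice_disc t \<inter> (\<lambda>s. saddle_pt x t + s *\<^sub>R saddle_pt d t) -` U"
    using s UF(2) by (simp add: saddle_pt_line)
  ultimately obtain e where e: "e > 0" "ball s e \<subseteq> (\<lambda>s. x + s *\<^sub>R d) -` slice_disc t \<inter> (\<lambda>s. saddle_pt x t + s *\<^sub>R saddle_pt d t) -` U"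
    using openE by blast
  show ?thesis
  proof (rule complexifiable_at_cong[OF c e(1)])
    fix y assume "\<bar>y - s\<bar> < e"
    then have "y \<in> ball s e" by (simp add: dist_real_def abs_minus_commute)
    then have y: "x + y *\<^sub>R d \<in> slice_disc t" "?l y \<in> U" using e(2) by (auto simp: saddle_pt_line)
    then show "F (saddle_pt x t + y *\<^sub>R saddle_pt d t) = u (?l y)"
      using UF(4)[of "?l y"] saddle_pt_in_cap[OF t y(1)] by (simp add: saddle_pt_line)
  qed
qed

text \<open>One line suffices: by convexity the line through \<open>x0\<close> and \<open>x\<close>
  meets the disc in an interval, on which \<open>u\<close> is analytic and equal to \<open>C\<close>
  near \<open>x0\<close>.\<close>

lemma constant_on_slice_disc:
  fixes u :: "complex ^ 2 \<Rightarrow> real"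
  assumes u: "real_analytic_map_on u cap" and t: "\<bar>t\<bar> < time_bound"
    and W: "open W" "x0 \<in> W" "W \<subseteq> slice_disc t" "\<And>x. x \<in> W \<Longrightarrow> u (saddle_pt x t) = C"
    and x: "x \<in> slice_disc t"
  shows "u (saddle_pt x t) = C"
proof -
  let ?g = "\<lambda>s. x0 + s *\<^sub>R (x - x0)"
  define I where "I = ?g -` slice_disc t"
  have oI: "open I" unfolding I_def by (intro open_vimage open_slice_disc continuous_intros)
  have "convex I"
  proof (rule convexI)
    fix a b p q :: real assume ab: "a \<in> I" "b \<in> I" and pq: "0 \<le> p" "0 \<le> q" "p + q = 1"
    have "x0 + (p *\<^sub>R a + q *\<^sub>R b) *\<^sub>R (x - x0) = (p + q) *\<^sub>R x0 + (p *\<^sub>R a + q *\<^sub>R b) *\<^sub>R (x - x0)" using pq by simp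
    also have "\<dots> = p *\<^sub>R ?g a + q *\<^sub>R ?g b" by (simp add: algebra_simps)
    also have "\<dots> \<in> slice_disc t" using ab pq convexD[OF convex_slice_disc] by (auto simp: I_def)
    finally show "p *\<^sub>R a + q *\<^sub>R b \<in> I" by (simp add: I_def)
  qed
  then have cI: "connected I" by (rule convex_connected)
  have x0: "0 \<in> I" using W(2,3) by (auto simp: I_def)
  have x1: "1 \<in> I" using x by (simp add: I_def)
  have "open (?g -` W)" by (intro open_vimage W(1) continuous_intros)
  moreover have "0 \<in> ?g -` W" using W(2) by simp
  ultimately obtain e where e: "e > 0" "ball 0 e \<subseteq> ?g -` W" using openE by blast
  have "u (saddle_pt (?g 1) t) - C = 0"
  proof (rule complexifiable_identity[OF cI oI _ x0 e(1) _ x1, of "\<lambda>s. u (saddle_pt (?g s) t) - C"])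
    show "complexifiable_at (\<lambda>s. u (saddle_pt (?g s) t) - C) s" if "s \<in> I" for s
      using that unfolding I_def
      by (intro complexifiable_at_minus complexifiable_at_const complexifiable_on_slice_line[OF u t]) simp
    show "u (saddle_pt (?g y) t) - C = 0" if "\<bar>y - 0\<bar> < e" for y
    proof -
      have "?g y \<in> W" using e(2) that by auto
      from W(4)[OF this] show ?thesis by simp
    qed
  qed
  then show ?thesis by simp
qed

definition vec2 :: "real \<Rightarrow> real \<Rightarrow> real ^ 2" where "vec2 a b = (\<chi> i. if i = 1 then a else b)"

lemma vec2_nth [simp]: "vec2 a b $ 1 = a" "vec2 a b $ 2 = b" by (simp_all add: vec2_def)

lemma vec2_eq: "x = vec2 (x $ 1) (x $ 2)"
  unfolding vec_eq_iff by (metis exhaust_2 vec2_nth)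

lemma continuous_on_vec2 [continuous_intros]:
  assumes "continuous_on S f" "continuous_on S g"
  shows "continuous_on S (\<lambda>x. vec2 (f x) (g x))"
  unfolding vec2_def
proof (rule continuous_on_vec_lambda)
  show "continuous_on S (\<lambda>x. if i = 1 then f x else g x)" for i :: 2
    using assms by (cases "i = 1") simp_all
qed

text \<open>The range of \<open>m\<close> around 1 for which the chord ends \<open>(m, 0)\<close>
  and \<open>(0, m)\<close>, on the two separatrices, lie in the disc: their squared distance from
  the centre is \<open>1 + (m - 1)\<^sup>2\<close>.\<close>

definition chord_width :: real where "chord_width = sqrt (rad_sq - 1)"

lemma chord_width: "chord_width > 0" "chord_width < 1" "\<bar>m - 1\<bar> < chord_width \<Longrightarrow> 1 + (m - 1)\<^sup>2 < rad_sq"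
proof -
  show 0: "chord_width > 0" "chord_width < 1" using rad_sq_bounds by (simp_all add: chord_width_def)
  assume "\<bar>m - 1\<bar> < chord_width"
  then have "\<bar>m - 1\<bar>\<^sup>2 < chord_width\<^sup>2" by (intro power_strict_mono) auto
  then show "1 + (m - 1)\<^sup>2 < rad_sq" using rad_sq_bounds by (simp add: chord_width_def)
qed

lemma chord_in_disc:
  assumes m: "\<bar>m - 1\<bar> < chord_width" and s: "0 \<le> s" "s \<le> m"
  shows "vec2 s (m - s) \<in> slice_disc 0"
proof -
  have mp: "m > 0" using m chord_width(2) by linarith
  have e: "vec2 0 m \<in> slice_disc 0" "vec2 m 0 \<in> slice_disc 0"
    using chord_width(3)[OF m] by (simp_all add: slice_disc_iff heightsq_def add.commute)
  have "vec2 s (m - s) = (1 - s / m) *\<^sub>R vec2 0 m + (s / m) *\<^sub>R vec2 m 0"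
    using mp by (simp add: vec_eq_iff forall_2 field_simps)
  moreover have "\<dots> \<in> slice_disc 0"
    by (rule convexD[OF convex_slice_disc e]) (use mp s in \<open>auto simp: field_simps\<close>)
  ultimately show ?thesis by simp
qed

lemma chord_interval:
  assumes m: "\<bar>m - 1\<bar> < chord_width"
  obtains a b where "a < 0" "m < b" "\<And>s. s \<in> {a<..<b} \<Longrightarrow> vec2 s (m - s) \<in> slice_disc 0"
proof -
  have mp: "m > 0" using m chord_width(2) by linarith
  have o: "open ((\<lambda>s. vec2 s (m - s)) -` slice_disc 0)"
    by (intro open_vimage open_slice_disc continuous_intros)
  have "0 \<in> (\<lambda>s. vec2 s (m - s)) -` slice_disc 0" "m \<in> (\<lambda>s. vec2 s (m - s)) -` slice_disc 0"
    using chord_in_disc[OF m, of 0] chord_in_disc[OF m, of m] mp by auto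
  then obtain d1 d2 where d: "d1 > 0" "ball 0 d1 \<subseteq> (\<lambda>s. vec2 s (m - s)) -` slice_disc 0"
    "d2 > 0" "ball m d2 \<subseteq> (\<lambda>s. vec2 s (m - s)) -` slice_disc 0" using o openE by meson
  show ?thesis
  proof (rule that[of "- d1" "m + d2"])
    fix s assume s: "s \<in> {- d1<..<m + d2}"
    consider "s < 0" | "0 \<le> s" "s \<le> m" | "m < s" by linarith
    then show "vec2 s (m - s) \<in> slice_disc 0"
    proof cases
      case 1
      then have "s \<in> ball 0 d1" using s by auto
      then show ?thesis using d(2) by blast
    next
      case 2
      then show ?thesis by (rule chord_in_disc[OF m])
    next
      case 3
      then have "s \<in> ball m d2" using s by (auto simp: dist_real_def)
      then show ?thesis using d(4) by blast
    qed
  qed (use d in auto)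
qed

text \<open>The critical point of \<open>s powr lam * (m - s)\<close>, where the chord is tangent to
  a leaf.\<close>

definition tangency :: "real \<Rightarrow> real" where "tangency m = m * lam / (lam + 1)"

lemma tangency_bounds: "m > 0 \<Longrightarrow> 0 < tangency m \<and> tangency m < m"
  using lam_pos by (simp add: tangency_def field_simps)

lemma chord_pt_tendsto_tangency:
  shows "(chord_pt m \<longlongrightarrow> tangency m) (at_right 1)" "((\<lambda>\<rho>. \<rho> * chord_pt m \<rho>) \<longlongrightarrow> tangency m) (at_right 1)"
proof -
  \<comment> \<open>\<open>chord_pt\<close> is a quotient of two such difference quotients of powers
    at 1, so its limit is \<open>m * lam / (lam + 1)\<close>.\<close>
  have D: "((\<lambda>\<rho>. (\<rho> powr a - 1) / (\<rho> - 1)) \<longlongrightarrow> a) (at_right (1::real))" for a :: real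
  proof -
    have "((\<lambda>\<rho>. \<rho> powr a) has_real_derivative a * 1 powr (a - 1)) (at 1)"
      by (rule has_real_derivative_powr) simp
    then have "((\<lambda>\<rho>. (\<rho> powr a - 1) / (\<rho> - 1)) \<longlongrightarrow> a) (at 1)"
      by (simp add: has_field_derivative_iff)
    then show ?thesis by (rule filterlim_mono) (auto simp: at_within_le_at)
  qed
  have "((\<lambda>\<rho>. m * ((\<rho> powr lam - 1) / (\<rho> - 1)) / ((\<rho> powr (lam + 1) - 1) / (\<rho> - 1))) \<longlongrightarrow> m * lam / (lam + 1)) (at_right 1)"
    by (intro tendsto_intros D) (use lam_pos in auto)
  moreover have "\<forall>\<^sub>F \<rho> in at_right 1. m * ((\<rho> powr lam - 1) / (\<rho> - 1)) / ((\<rho> powr (lam + 1) - 1) / (\<rho> - 1)) = chord_pt m \<rho>"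
    using eventually_at_right_less[of "1::real"]
    by eventually_elim (simp add: chord_pt_def)
  ultimately show 1: "(chord_pt m \<longlongrightarrow> tangency m) (at_right 1)"
    unfolding tangency_def by (rule Lim_transform_eventually)
  have "((\<lambda>\<rho>. \<rho> * chord_pt m \<rho>) \<longlongrightarrow> 1 * tangency m) (at_right 1)"
    by (intro tendsto_mult 1 tendsto_ident_at)
  then show "((\<lambda>\<rho>. \<rho> * chord_pt m \<rho>) \<longlongrightarrow> tangency m) (at_right 1)" by simp
qed

lemma leaf_fun_chord:
  assumes "s > 0"
  shows "leaf_fun 2 1 (saddle_pt (vec2 s y) 0) = complex_of_real (y * s powr lam)"
  using leaf_fun_saddle_pt[of 0 "vec2 s y" 1 2] assms time_bound_ge(2) by (simp add: expo_def)

lemma leaf_fun_chord_eq: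
  assumes m: "m > 0" and \<rho>: "\<rho> > 1"
  shows "(m - chord_pt m \<rho>) * chord_pt m \<rho> powr lam = (m - \<rho> * chord_pt m \<rho>) * (\<rho> * chord_pt m \<rho>) powr lam"
  using chord_pt_props(1,5)[OF m \<rho>] \<rho> by (simp add: powr_mult)

lemma eventually_at_right_1E:
  assumes "\<forall>\<^sub>F \<rho> in at_right (1::real). P \<rho>"
  obtains e where "e > 0" "\<And>\<rho>. 1 < \<rho> \<Longrightarrow> \<rho> < 1 + e \<Longrightarrow> P \<rho>"
proof -
  obtain b where b: "b > 1" "\<And>\<rho>. 1 < \<rho> \<Longrightarrow> \<rho> < b \<Longrightarrow> P \<rho>"
    using assms by (auto simp: eventually_at_right_field)
  show ?thesis by (rule that[of "b - 1"]) (use b in auto)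
qed

lemma isCont_chord: "isCont (\<lambda>s. saddle_pt (vec2 s (m - s)) t) s"
proof -
  have "continuous_on UNIV (\<lambda>s. saddle_pt (vec2 s (m - s)) t)"
    by (intro continuous_on_compose2[OF continuous_on_saddle_pt] continuous_intros) auto
  then show ?thesis by (simp add: continuous_on_eq_continuous_at)
qed

text \<open>For \<open>\<rho>\<close> close to 1 both points of the pair lie in one neighborhood of
  the tangency on which \<open>u\<close> depends only on the leaf function. This gives the equation
  that \<open>first_integral_on_chord_constant\<close> needs near 1.\<close>

lemma leafwise_constant_on_chord:
  fixes u :: "complex ^ 2 \<Rightarrow> real"
  assumes u: "real_analytic_map_on u cap" and leaf: "\<And>L. L \<in> restricted_leaves saddle_hyp cap \<Longrightarrow> u constant_on L"
    and m: "\<bar>m - 1\<bar> < chord_width" and s: "0 \<le> s" "s \<le> m"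
  shows "u (saddle_pt (vec2 s (m - s)) 0) = u (saddle_pt (vec2 0 m) 0)"
proof -
  have mp: "m > 0" using m chord_width(2) by linarith
  have t0: "\<bar>0\<bar> < time_bound" using time_bound_ge(2) by simp
  obtain a b where ab: "a < 0" "m < b" and I: "\<And>s. s \<in> {a<..<b} \<Longrightarrow> vec2 s (m - s) \<in> slice_disc 0"
    by (rule chord_interval[OF m], rule that)
  let ?P = "\<lambda>s. saddle_pt (vec2 s (m - s)) 0"
  let ?f = "\<lambda>s. u (?P s)"
  have cf: "complexifiable_at ?f x" if "x \<in> {a<..<b}" for x
  proof -
    have e: "vec2 s (m - s) = vec2 0 m + s *\<^sub>R vec2 1 (- 1)" for s by (simp add: vec_eq_iff forall_2)
    show ?thesis unfolding e by (rule complexifiable_on_slice_line[OF u t0]) (use I[OF that] in \<open>simp add: e\<close>)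
  qed
  let ?p = "?P (tangency m)"
  note tb = tangency_bounds[OF mp]
  have pc: "?p \<in> cap" by (rule saddle_pt_in_cap[OF t0 chord_in_disc[OF m]]) (use tb in auto)
  have Rep: "Re (?p $ 1) > 0" using tb by simp
  obtain N where N: "open N" "?p \<in> N" "N \<subseteq> small_ball"
    "\<And>q q'. q \<in> saddle_hyp \<inter> N \<Longrightarrow> q' \<in> saddle_hyp \<inter> N \<Longrightarrow> leaf_fun 2 1 q = leaf_fun 2 1 q' \<Longrightarrow> u q = u q'"
    by (rule leaf_constant_near[OF open_small_ball pc _ Rep leaf, of 2], simp, assumption, rule that)
  have evN: "\<forall>\<^sub>F \<rho> in at_right 1. ?P (g \<rho>) \<in> N" if "(g \<longlongrightarrow> tangency m) (at_right 1)" for g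
  proof -
    have "((\<lambda>\<rho>. ?P (g \<rho>)) \<longlongrightarrow> ?p) (at_right 1)" by (rule isCont_tendsto_compose[OF isCont_chord that])
    then show ?thesis using N(1,2) by (rule topological_tendstoD)
  qed
  have evf: "\<forall>\<^sub>F \<rho> in at_right 1. ?f (chord_pt m \<rho>) = ?f (\<rho> * chord_pt m \<rho>)"
    using evN[OF chord_pt_tendsto_tangency(1)] evN[OF chord_pt_tendsto_tangency(2)] eventually_at_right_less[of "1::real"]
  proof eventually_elim
    case (elim \<rho>)
    note cp = chord_pt_props(1-3)[OF mp elim(3)]
    have pos: "0 < chord_pt m \<rho>" "0 < \<rho> * chord_pt m \<rho>" using cp by linarith+
    have "?P (chord_pt m \<rho>) \<in> cap" "?P (\<rho> * chord_pt m \<rho>) \<in> cap"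
      using cp by (intro saddle_pt_in_cap[OF t0 chord_in_disc[OF m]]; linarith)+
    then show ?case
      using elim leaf_fun_chord_eq[OF mp elim(3)] by (intro N(4)) (auto simp: leaf_fun_chord pos)
  qed
  obtain e where e: "e > 0" "\<And>\<rho>. 1 < \<rho> \<Longrightarrow> \<rho> < 1 + e \<Longrightarrow> ?f (chord_pt m \<rho>) = ?f (\<rho> * chord_pt m \<rho>)"
    by (rule eventually_at_right_1E[OF evf], rule that)
  have "?f s = ?f 0"
    by (rule first_integral_on_chord_constant[OF mp ab cf e]) (use s ab in auto)
  then show ?thesis by simp
qed

theorem leafwise_constant_imp_constant:
  fixes u :: "complex ^ 2 \<Rightarrow> real"
  assumes u: "real_analytic_map_on u cap" and leaf: "\<And>L. L \<in> restricted_leaves saddle_hyp cap \<Longrightarrow> u constant_on L"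
  shows "u constant_on cap"
proof -
  have t0: "\<bar>0\<bar> < time_bound" using time_bound_ge(2) by simp
  define C where "C = u (saddle_pt (vec2 1 0) 0)"
  let ?J = "{1 - chord_width<..<1 + chord_width}"
  have J: "m \<in> ?J \<longleftrightarrow> \<bar>m - 1\<bar> < chord_width" for m by (auto simp: abs_less_iff)
  \<comment> \<open>On the separatrix through the points \<open>(m, 0)\<close> the invariant
    \<open>leaf_fun 2 1\<close> is 0 throughout, so \<open>u\<close> is locally constant there. This
    links the constants of different chords.\<close>
  have axis_const: "u (saddle_pt (vec2 m 0) 0) = C" if m: "m \<in> ?J" for m
    unfolding C_def
  proof (rule connected_local_const[of ?J m 1 "\<lambda>m. u (saddle_pt (vec2 m 0) 0)"])
    show "\<forall>a\<in>?J. \<forall>\<^sub>F b in at a within ?J. u (saddle_pt (vec2 a 0) 0) = u (saddle_pt (vec2 b 0) 0)"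
    proof
      fix a assume a: "a \<in> ?J"
      have ap: "b > 0" if "b \<in> ?J" for b using that chord_width by auto
      have inA: "saddle_pt (vec2 b 0) 0 \<in> cap" if "b \<in> ?J" for b
        using chord_in_disc[of b b] that ap[OF that] J by (intro saddle_pt_in_cap[OF t0]) simp
      have Rea: "Re (saddle_pt (vec2 a 0) 0 $ 1) > 0" using ap[OF a] by simp
      obtain N where N: "open N" "saddle_pt (vec2 a 0) 0 \<in> N" "N \<subseteq> small_ball"
        "\<And>q q'. q \<in> saddle_hyp \<inter> N \<Longrightarrow> q' \<in> saddle_hyp \<inter> N \<Longrightarrow> leaf_fun 2 1 q = leaf_fun 2 1 q' \<Longrightarrow> u q = u q'"
        by (rule leaf_constant_near[OF open_small_ball inA[OF a] _ Rea leaf, of 2], simp, assumption, rule that)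
      have "continuous_on UNIV (\<lambda>b. saddle_pt (vec2 b 0) 0)"
        by (intro continuous_on_compose2[OF continuous_on_saddle_pt] continuous_intros) auto
      then have "isCont (\<lambda>b. saddle_pt (vec2 b 0) 0) a" by (simp add: continuous_on_eq_continuous_at)
      then have "((\<lambda>b. saddle_pt (vec2 b 0) 0) \<longlongrightarrow> saddle_pt (vec2 a 0) 0) (at a within ?J)"
        by (metis continuous_at_imp_continuous_at_within continuous_within)
      then have "\<forall>\<^sub>F b in at a within ?J. saddle_pt (vec2 b 0) 0 \<in> N" using N(1,2) by (rule topological_tendstoD)
      moreover have "\<forall>\<^sub>F b in at a within ?J. b \<in> ?J" by (simp add: eventually_at_filter)
      ultimately show "\<forall>\<^sub>F b in at a within ?J. u (saddle_pt (vec2 a 0) 0) = u (saddle_pt (vec2 b 0) 0)"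
      proof eventually_elim
        case (elim b)
        show ?case
          using elim inA[OF elim(2)] inA[OF a] N(2) ap[OF a] ap[OF elim(2)]
          by (intro N(4)) (auto simp: leaf_fun_chord)
      qed
    qed
  qed (use m chord_width in auto)
  \<comment> \<open>Within its chord a point is compared with \<open>(0, m)\<close>, and that end
    with \<open>(m, 0)\<close>, which lies on the common separatrix.\<close>
  have chord_const: "u (saddle_pt (vec2 s (m - s)) 0) = C" if m: "\<bar>m - 1\<bar> < chord_width" and s: "0 \<le> s" "s \<le> m" for m s
  proof -
    have "u (saddle_pt (vec2 s (m - s)) 0) = u (saddle_pt (vec2 0 m) 0)"
      by (rule leafwise_constant_on_chord[OF u leaf m s])
    also have "\<dots> = u (saddle_pt (vec2 m (m - m)) 0)"
      by (rule leafwise_constant_on_chord[OF u leaf m, symmetric]) (use s in auto)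
    also have "\<dots> = C" using axis_const[OF J[THEN iffD2, OF m]] by simp
    finally show ?thesis .
  qed
  define W :: "(real ^ 2) set" where "W = {x. 0 < x $ 1 \<and> 0 < x $ 2 \<and> \<bar>x $ 1 + x $ 2 - 1\<bar> < chord_width}"
  have oW: "open W" unfolding W_def by (intro open_Collect_conj open_Collect_less continuous_intros)
  have Wx: "x = vec2 (x $ 1) ((x $ 1 + x $ 2) - x $ 1)" for x :: "real ^ 2" using vec2_eq[of x] by simp
  have W_in: "x \<in> slice_disc 0" and W_C: "u (saddle_pt x 0) = C" if "x \<in> W" for x
  proof -
    have x: "\<bar>x $ 1 + x $ 2 - 1\<bar> < chord_width" "0 \<le> x $ 1" "x $ 1 \<le> x $ 1 + x $ 2" using that by (auto simp: W_def)
    show "x \<in> slice_disc 0" using chord_in_disc[OF x] Wx[of x] by metis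
    show "u (saddle_pt x 0) = C" using chord_const[OF x] Wx[of x] by metis
  qed
  have half: "vec2 (1 / 2) (1 / 2) \<in> W" using chord_width(1) by (simp add: W_def)
  have disc0: "u (saddle_pt x 0) = C" if "x \<in> slice_disc 0" for x
    by (rule constant_on_slice_disc[OF u t0 oW half _ _ that]) (use W_in W_C in auto)
  have slice: "u (saddle_pt x t) = C" if t: "\<bar>t\<bar> < time_bound" and x: "x \<in> slice_disc t" for x t
  proof -
    \<comment> \<open>With both parameters positive, the path back to time 0 stays in the ball, as
      shown below. The centre of the slice lies in \<open>V\<close>, so \<open>V\<close> is not
      empty, and \<open>constant_on_slice_disc\<close> extends the result to the whole
      slice.\<close>
    define V where "V = slice_disc t \<inter> {x. 0 < x $ 1 \<and> 0 < x $ 2}"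
    have oV: "open V" unfolding V_def by (intro open_Int open_slice_disc open_Collect_conj open_Collect_less continuous_intros)
    define c where "c = vec2 (cos t) (cos (lam * t))"
    have "heightsq t < rad_sq"
      using x zero_le_power2[of "x $ 1 - cos t"] zero_le_power2[of "x $ 2 - cos (lam * t)"]
      unfolding slice_disc_iff by linarith
    then have cV: "c \<in> V"
      using cos_rate_pos[OF t, of 1] cos_rate_pos[OF t, of 2] by (simp add: V_def c_def slice_disc_iff)
    have VC: "u (saddle_pt y t) = C" if y: "y \<in> V" for y
    proof -
      have y12: "0 < y $ 1" "0 < y $ 2" and yt: "y \<in> slice_disc t" using y by (auto simp: V_def)
      let ?S = "{- \<bar>t\<bar>..\<bar>t\<bar>}"
      have tS: "\<bar>s\<bar> < time_bound" if "s \<in> ?S" for s using that t by auto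
      have yS: "y \<in> slice_disc s" if "s \<in> ?S" for s
      proof -
        \<comment> \<open>In this law-of-cosines form the time occurs only in the two cosines, with
          negative coefficients as \<open>y\<close> is positive: the distance does not grow when the
          absolute value of the time decreases.\<close>
        have d2: "(dist (saddle_pt y r) ctr)\<^sup>2 = (y $ 1)\<^sup>2 + (y $ 2)\<^sup>2 + 2 - 2 * y $ 1 * cos r - 2 * y $ 2 * cos (lam * r)" for r
        proof -
          have "(sin r)\<^sup>2 = 1 - (cos r)\<^sup>2" "(sin (lam * r))\<^sup>2 = 1 - (cos (lam * r))\<^sup>2"
            by (simp_all add: sin_squared_eq)
          then show ?thesis unfolding dist_saddle_pt heightsq_def by (simp add: power2_eq_square algebra_simps)
        qed
        have cos_le: "cos (rate i * t) \<le> cos (rate i * s)" for i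
        proof -
          have "\<bar>rate i * s\<bar> \<le> \<bar>rate i * t\<bar>"
            unfolding abs_mult using that by (intro mult_left_mono) auto
          moreover have "\<bar>rate i * t\<bar> \<le> pi"
            using rate_time_bound[OF t, of i] pi_gt_zero by linarith
          ultimately have "cos (\<bar>rate i * t\<bar>) \<le> cos (\<bar>rate i * s\<bar>)"
            by (intro cos_monotone_0_pi_le) auto
          then show ?thesis by simp
        qed
        have "cos t \<le> cos s" "cos (lam * t) \<le> cos (lam * s)" using cos_le[of 1] cos_le[of 2] by simp_all
        then have "y $ 1 * cos t \<le> y $ 1 * cos s" "y $ 2 * cos (lam * t) \<le> y $ 2 * cos (lam * s)"
          using y12 by simp_all
        then have "(dist (saddle_pt y s) ctr)\<^sup>2 \<le> (dist (saddle_pt y t) ctr)\<^sup>2" unfolding d2 by linarith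
        moreover have "(dist (saddle_pt y t) ctr)\<^sup>2 < rad_sq"
          using yt unfolding slice_disc_def small_ball_iff by blast
        ultimately have "(dist (saddle_pt y s) ctr)\<^sup>2 < rad_sq" by (rule le_less_trans)
        then show ?thesis unfolding slice_disc_def small_ball_iff by blast
      qed
      have inA: "saddle_pt y s \<in> cap" if "s \<in> ?S" for s by (rule saddle_pt_in_cap[OF tS[OF that] yS[OF that]])
      have lf: "leaf_fun 2 1 (saddle_pt y s) = complex_of_real (y $ 2 * y $ 1 powr lam)" if "s \<in> ?S" for s
        using leaf_fun_saddle_pt[OF tS[OF that] y12(1), of 2] by (simp add: expo_def)
      have "u (saddle_pt y t) = u (saddle_pt y 0)"
      proof (rule connected_local_const[of ?S t 0 "\<lambda>s. u (saddle_pt y s)"])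
        show "\<forall>a\<in>?S. \<forall>\<^sub>F b in at a within ?S. u (saddle_pt y a) = u (saddle_pt y b)"
        proof
          fix a assume a: "a \<in> ?S"
          have Rea: "Re (saddle_pt y a $ 1) > 0" using Re_saddle_pt_pos_iff[OF tS[OF a]] y12(1) by blast
          obtain N where N: "open N" "saddle_pt y a \<in> N" "N \<subseteq> small_ball"
            "\<And>q q'. q \<in> saddle_hyp \<inter> N \<Longrightarrow> q' \<in> saddle_hyp \<inter> N \<Longrightarrow> leaf_fun 2 1 q = leaf_fun 2 1 q' \<Longrightarrow> u q = u q'"
            by (rule leaf_constant_near[OF open_small_ball inA[OF a] _ Rea leaf, of 2], simp, assumption, rule that)
          have "continuous_on UNIV (saddle_pt y)"
            unfolding saddle_pt_def[abs_def] cis_conv_exp by (intro continuous_intros)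
          then have "isCont (saddle_pt y) a" by (simp add: continuous_on_eq_continuous_at)
          then have "(saddle_pt y \<longlongrightarrow> saddle_pt y a) (at a within ?S)"
            by (metis continuous_at_imp_continuous_at_within continuous_within)
          then have "\<forall>\<^sub>F b in at a within ?S. saddle_pt y b \<in> N" using N(1,2) by (rule topological_tendstoD)
          moreover have "\<forall>\<^sub>F b in at a within ?S. b \<in> ?S" by (simp add: eventually_at_filter)
          ultimately show "\<forall>\<^sub>F b in at a within ?S. u (saddle_pt y a) = u (saddle_pt y b)"
          proof eventually_elim
            case (elim b)
            show ?case using elim inA[OF elim(2)] inA[OF a] N(2) lf[OF a] lf[OF elim(2)] by (intro N(4)) auto
          qed
        qed
      qed auto
      also have "\<dots> = C" by (rule disc0[OF yS]) auto
      finally show ?thesis .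
    qed
    show ?thesis by (rule constant_on_slice_disc[OF u t oV cV _ VC x]) (auto simp: V_def)
  qed
  have "u p = C" if p: "p \<in> cap" for p
  proof -
    obtain x t where xt: "p = saddle_pt x t" "\<bar>t\<bar> < time_bound" using p saddle_hypD by blast
    have "x \<in> slice_disc t" using p xt(1) by (simp add: slice_disc_def)
    from slice[OF xt(2) this] show ?thesis by (simp add: xt(1))
  qed
  then show ?thesis unfolding constant_on_def by blast
qed

section \<open>Pluriharmonic functions\<close>

abbreviation dirderiv :: "('a::euclidean_space \<Rightarrow> real) \<Rightarrow> 'a \<Rightarrow> 'a \<Rightarrow> real" where
  "dirderiv v a x \<equiv> frechet_derivative v (at x) a"

lemma Ck_on_2D:
  assumes "Ck_on 2 v U"
  shows "\<And>x. x \<in> U \<Longrightarrow> (v has_derivative (\<lambda>a. dirderiv v a x)) (at x)"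
    and "\<And>x b. x \<in> U \<Longrightarrow> (dirderiv v b has_derivative (\<lambda>a. dirderiv (dirderiv v b) a x)) (at x)"
    and "\<And>a b. continuous_on U (dirderiv (dirderiv v b) a)"
  using assms by (simp_all add: numeral_2_eq_2 frechet_derivative_works)

text \<open>The mean value theorem twice, first in direction \<open>a\<close>, then in direction
  \<open>b\<close>. The two intermediate parameters are packed into a pair so that
  \<open>choice\<close> can select them for a sequence of step sizes.\<close>

lemma second_difference_mvt:
  fixes v :: "'a::euclidean_space \<Rightarrow> real"
  assumes v: "Ck_on 2 v U" and h: "h > 0"
    and sub: "\<And>s t. 0 \<le> s \<Longrightarrow> s \<le> h \<Longrightarrow> 0 \<le> t \<Longrightarrow> t \<le> h \<Longrightarrow> x + s *\<^sub>R a + t *\<^sub>R b \<in> U"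
  shows "\<exists>st. 0 \<le> fst st \<and> fst st \<le> h \<and> 0 \<le> snd st \<and> snd st \<le> h \<and>
      v (x + h *\<^sub>R a + h *\<^sub>R b) - v (x + h *\<^sub>R a) - v (x + h *\<^sub>R b) + v x =
      h * (h * dirderiv (dirderiv v a) b (x + fst st *\<^sub>R a + snd st *\<^sub>R b))"
proof -
  note D = Ck_on_2D[OF v]
  let ?p = "\<lambda>s. v (x + s *\<^sub>R a + h *\<^sub>R b) - v (x + s *\<^sub>R a)"
  have along: "((\<lambda>s. f (y + s *\<^sub>R d)) has_real_derivative f' d) (at s)"
    if "(f has_derivative f') (at (y + s *\<^sub>R d))" for f :: "'a \<Rightarrow> real" and f' y s d
  proof -
    have "((\<lambda>s. y + s *\<^sub>R d) has_derivative (\<lambda>s. s *\<^sub>R d)) (at s)" by (auto intro!: derivative_eq_intros)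
    from has_derivative_compose[OF this that] have "((\<lambda>s. f (y + s *\<^sub>R d)) has_derivative (\<lambda>s. f' (s *\<^sub>R d))) (at s)" .
    then show ?thesis using has_derivative_linear[OF that]
      by (simp add: has_field_derivative_def linear_scale mult.commute[of "f' d"] fun_eq_iff)
        (simp add: mult_commute_abs linear_scale)
  qed
  have d: "(?p has_real_derivative dirderiv v a (x + s *\<^sub>R a + h *\<^sub>R b) - dirderiv v a (x + s *\<^sub>R a)) (at s)"
    if "0 \<le> s" "s \<le> h" for s
  proof (rule DERIV_diff)
    have e: "x + s *\<^sub>R a + h *\<^sub>R b = (x + h *\<^sub>R b) + s *\<^sub>R a" for s by simp
    have "(x + h *\<^sub>R b) + s *\<^sub>R a \<in> U" using sub[of s h] that h unfolding e by simp
    from along[OF D(1)[OF this]]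
    show "((\<lambda>s. v (x + s *\<^sub>R a + h *\<^sub>R b)) has_real_derivative dirderiv v a (x + s *\<^sub>R a + h *\<^sub>R b)) (at s)"
      unfolding e .
    show "((\<lambda>s. v (x + s *\<^sub>R a)) has_real_derivative dirderiv v a (x + s *\<^sub>R a)) (at s)"
      using along[OF D(1)[of "x + s *\<^sub>R a"]] sub[of s 0] that h by simp
  qed
  obtain s where s: "0 < s" "s < h" "?p h - ?p 0 = (h - 0) * (dirderiv v a (x + s *\<^sub>R a + h *\<^sub>R b) - dirderiv v a (x + s *\<^sub>R a))"
    using MVT2[OF h, of ?p "\<lambda>s. dirderiv v a (x + s *\<^sub>R a + h *\<^sub>R b) - dirderiv v a (x + s *\<^sub>R a)"] d by auto
  have d2: "((\<lambda>t. dirderiv v a (x + s *\<^sub>R a + t *\<^sub>R b)) has_real_derivative dirderiv (dirderiv v a) b (x + s *\<^sub>R a + t *\<^sub>R b)) (at t)"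
    if "0 \<le> t" "t \<le> h" for t
    using along[OF D(2)[of "(x + s *\<^sub>R a) + t *\<^sub>R b" a]] sub[of s t] that s by simp
  obtain t where t: "0 < t" "t < h" "dirderiv v a (x + s *\<^sub>R a + h *\<^sub>R b) - dirderiv v a (x + s *\<^sub>R a + 0 *\<^sub>R b) =
      (h - 0) * dirderiv (dirderiv v a) b (x + s *\<^sub>R a + t *\<^sub>R b)"
    using MVT2[OF h, of "\<lambda>t. dirderiv v a (x + s *\<^sub>R a + t *\<^sub>R b)" "\<lambda>t. dirderiv (dirderiv v a) b (x + s *\<^sub>R a + t *\<^sub>R b)"] d2 by auto
  show ?thesis
    by (rule exI[of _ "(s, t)"]) (use s t in auto)
qed

text \<open>The mixed second difference is symmetric in \<open>a\<close> and \<open>b\<close>, so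
  both mixed derivatives agree up to intermediate points that converge to \<open>x\<close>;
  continuity of the second derivatives does the rest.\<close>

lemma second_derivative_symmetric:
  fixes v :: "'a::euclidean_space \<Rightarrow> real"
  assumes v: "Ck_on 2 v U" and U: "open U" and x: "x \<in> U"
  shows "dirderiv (dirderiv v a) b x = dirderiv (dirderiv v b) a x"
proof -
  obtain r where r: "r > 0" "ball x r \<subseteq> U" using U x openE by blast
  define M where "M = norm a + norm b + 1"
  have M: "M > 0" by (simp add: M_def add_nonneg_pos)
  define h where "h = (\<lambda>n. r / M / real (Suc (Suc n)))"
  have h: "h n > 0" for n using r M by (simp add: h_def)
  have hl: "h \<longlonglongrightarrow> 0"
    unfolding h_def using LIMSEQ_Suc[OF LIMSEQ_Suc[OF lim_const_over_n[of "r / M"]]] by (simp del: of_nat_Suc)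
  have hM: "h n * M < r" for n
  proof -
    have "h n * M = r / real (Suc (Suc n))" using M by (simp add: h_def)
    also have "\<dots> < r / 1" using r by (intro divide_strict_left_mono) auto
    finally show ?thesis by simp
  qed
  have close: "norm (s *\<^sub>R a + t *\<^sub>R b) \<le> h n * M" if "0 \<le> s" "s \<le> h n" "0 \<le> t" "t \<le> h n" for s t n
  proof -
    have "norm (s *\<^sub>R a + t *\<^sub>R b) \<le> s * norm a + t * norm b"
      using norm_triangle_ineq[of "s *\<^sub>R a" "t *\<^sub>R b"] that by simp
    also have "\<dots> \<le> h n * norm a + h n * norm b" using that by (intro add_mono mult_right_mono) auto
    also have "\<dots> \<le> h n * M" using h[of n] by (simp add: M_def distrib_left)
    finally show ?thesis .
  qed
  have inU: "x + s *\<^sub>R a + t *\<^sub>R b \<in> U" if "0 \<le> s" "s \<le> h n" "0 \<le> t" "t \<le> h n" for s t n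
  proof -
    have "dist x (x + s *\<^sub>R a + t *\<^sub>R b) = norm (s *\<^sub>R a + t *\<^sub>R b)"
      by (subst dist_commute) (simp add: dist_norm add.assoc)
    then have "x + s *\<^sub>R a + t *\<^sub>R b \<in> ball x r"
      using close[OF that] hM[of n] by simp
    then show ?thesis using r(2) by blast
  qed
  have lim: "(\<lambda>n. dirderiv (dirderiv v c) d (x + S n *\<^sub>R a + T n *\<^sub>R b)) \<longlonglongrightarrow> dirderiv (dirderiv v c) d x"
    if ST: "\<And>n. 0 \<le> S n \<and> S n \<le> h n \<and> 0 \<le> T n \<and> T n \<le> h n" for c d S T
  proof -
    have "S \<longlonglongrightarrow> 0" "T \<longlonglongrightarrow> 0"
      by (rule tendsto_sandwich[OF _ _ tendsto_const hl]; use ST in simp)+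
    then have "(\<lambda>n. x + S n *\<^sub>R a + T n *\<^sub>R b) \<longlonglongrightarrow> x + 0 *\<^sub>R a + 0 *\<^sub>R b" by (intro tendsto_intros)
    then have l: "(\<lambda>n. x + S n *\<^sub>R a + T n *\<^sub>R b) \<longlonglongrightarrow> x" by simp
    have "continuous_on U (dirderiv (dirderiv v c) d)" by (rule Ck_on_2D(3)[OF v])
    then have "isCont (dirderiv (dirderiv v c) d) x"
      using U x by (simp only: continuous_on_eq_continuous_at)
    from isCont_tendsto_compose[OF this l] show ?thesis .
  qed
  have "\<forall>n. \<exists>st. 0 \<le> fst st \<and> fst st \<le> h n \<and> 0 \<le> snd st \<and> snd st \<le> h n \<and>
      v (x + h n *\<^sub>R a + h n *\<^sub>R b) - v (x + h n *\<^sub>R a) - v (x + h n *\<^sub>R b) + v x =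
      h n * (h n * dirderiv (dirderiv v a) b (x + fst st *\<^sub>R a + snd st *\<^sub>R b))"
  proof
    fix n
    show "\<exists>st. 0 \<le> fst st \<and> fst st \<le> h n \<and> 0 \<le> snd st \<and> snd st \<le> h n \<and>
      v (x + h n *\<^sub>R a + h n *\<^sub>R b) - v (x + h n *\<^sub>R a) - v (x + h n *\<^sub>R b) + v x =
      h n * (h n * dirderiv (dirderiv v a) b (x + fst st *\<^sub>R a + snd st *\<^sub>R b))"
      by (rule second_difference_mvt[OF v h]) (rule inU)
  qed
  from choice[OF this] obtain P where P: "\<And>n. 0 \<le> fst (P n) \<and> fst (P n) \<le> h n \<and> 0 \<le> snd (P n) \<and> snd (P n) \<le> h n"
     "\<And>n. v (x + h n *\<^sub>R a + h n *\<^sub>R b) - v (x + h n *\<^sub>R a) - v (x + h n *\<^sub>R b) + v x =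
      h n * (h n * dirderiv (dirderiv v a) b (x + fst (P n) *\<^sub>R a + snd (P n) *\<^sub>R b))" by blast
  have "\<forall>n. \<exists>st. 0 \<le> fst st \<and> fst st \<le> h n \<and> 0 \<le> snd st \<and> snd st \<le> h n \<and>
      v (x + h n *\<^sub>R b + h n *\<^sub>R a) - v (x + h n *\<^sub>R b) - v (x + h n *\<^sub>R a) + v x =
      h n * (h n * dirderiv (dirderiv v b) a (x + fst st *\<^sub>R b + snd st *\<^sub>R a))"
  proof
    fix n
    have inU': "x + s *\<^sub>R b + t *\<^sub>R a \<in> U" if "0 \<le> s" "s \<le> h n" "0 \<le> t" "t \<le> h n" for s t
      using inU[OF that(3,4,1,2)] by (simp add: algebra_simps)
    show "\<exists>st. 0 \<le> fst st \<and> fst st \<le> h n \<and> 0 \<le> snd st \<and> snd st \<le> h n \<and>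
      v (x + h n *\<^sub>R b + h n *\<^sub>R a) - v (x + h n *\<^sub>R b) - v (x + h n *\<^sub>R a) + v x =
      h n * (h n * dirderiv (dirderiv v b) a (x + fst st *\<^sub>R b + snd st *\<^sub>R a))"
      by (rule second_difference_mvt[OF v h]) (rule inU')
  qed
  from choice[OF this] obtain Q where Q: "\<And>n. 0 \<le> fst (Q n) \<and> fst (Q n) \<le> h n \<and> 0 \<le> snd (Q n) \<and> snd (Q n) \<le> h n"
     "\<And>n. v (x + h n *\<^sub>R b + h n *\<^sub>R a) - v (x + h n *\<^sub>R b) - v (x + h n *\<^sub>R a) + v x =
      h n * (h n * dirderiv (dirderiv v b) a (x + fst (Q n) *\<^sub>R b + snd (Q n) *\<^sub>R a))" by blast
  have "dirderiv (dirderiv v a) b (x + fst (P n) *\<^sub>R a + snd (P n) *\<^sub>R b) = dirderiv (dirderiv v b) a (x + snd (Q n) *\<^sub>R a + fst (Q n) *\<^sub>R b)" for n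
  proof -
    have e: "x + h n *\<^sub>R b + h n *\<^sub>R a = x + h n *\<^sub>R a + h n *\<^sub>R b"
      "x + fst (Q n) *\<^sub>R b + snd (Q n) *\<^sub>R a = x + snd (Q n) *\<^sub>R a + fst (Q n) *\<^sub>R b" by (simp_all add: algebra_simps)
    have "h n * (h n * dirderiv (dirderiv v a) b (x + fst (P n) *\<^sub>R a + snd (P n) *\<^sub>R b)) =
      h n * (h n * dirderiv (dirderiv v b) a (x + snd (Q n) *\<^sub>R a + fst (Q n) *\<^sub>R b))"
      using P(2)[of n] Q(2)[of n] unfolding e by linarith
    then show ?thesis using h[of n] by simp
  qed
  then have "(\<lambda>n. dirderiv (dirderiv v a) b (x + fst (P n) *\<^sub>R a + snd (P n) *\<^sub>R b)) = (\<lambda>n. dirderiv (dirderiv v b) a (x + snd (Q n) *\<^sub>R a + fst (Q n) *\<^sub>R b))"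
    by (rule ext)
  with lim[OF P(1), where c = a and d = b] have "(\<lambda>n. dirderiv (dirderiv v b) a (x + snd (Q n) *\<^sub>R a + fst (Q n) *\<^sub>R b)) \<longlonglongrightarrow> dirderiv (dirderiv v a) b x"
    by (simp only:)
  then show ?thesis by (rule LIMSEQ_unique) (rule lim, use Q(1) in blast)
qed

lemma dirderiv_linear:
  assumes "Ck_on 2 v U" "x \<in> U"
  shows "linear (\<lambda>a. dirderiv v a x)" "linear (\<lambda>a. dirderiv (dirderiv v b) a x)"
  using Ck_on_2D(1,2)[OF assms(1)] assms(2) has_derivative_linear by blast+

lemma second_dirderiv_minus:
  assumes v: "Ck_on 2 v U" and U: "open U" and x: "x \<in> U"
  shows "dirderiv (dirderiv v (- b)) a x = - dirderiv (dirderiv v b) a x"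
proof -
  have "((\<lambda>y. - dirderiv v b y) has_derivative (\<lambda>a. - dirderiv (dirderiv v b) a x)) (at x)"
    by (rule has_derivative_minus[OF Ck_on_2D(2)[OF v x]])
  then have "(dirderiv v (- b) has_derivative (\<lambda>a. - dirderiv (dirderiv v b) a x)) (at x)"
    by (rule has_derivative_transform_within_open[OF _ U x])
       (simp add: linear_neg[OF dirderiv_linear(1)[OF v]])
  from frechet_derivative_at[OF this] show ?thesis by metis
qed

text \<open>The first relation is the vanishing of \<open>ddc_form\<close>; the others follow from
  it by the symmetry of second derivatives and by multiplying by \<open>\<i>\<close> twice. The last
  two are the Cauchy-Riemann equations for \<open>hol_grad\<close>.\<close>

lemma pluriharmonic_relations:
  assumes v: "pluriharmonic_on v U" and U: "open U" and x: "x \<in> U"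
  shows "dirderiv (dirderiv v (\<i> *s b)) a x = dirderiv (dirderiv v (\<i> *s a)) b x"
    and "dirderiv (dirderiv v b) (\<i> *s a) x = dirderiv (dirderiv v (\<i> *s b)) a x"
    and "dirderiv (dirderiv v (\<i> *s b)) (\<i> *s a) x = - dirderiv (dirderiv v b) a x"
proof -
  have C: "Ck_on 2 v U" and dd: "\<And>a b. ddc_form v x a b = 0" using v x by (auto simp: pluriharmonic_on_def)
  have fr: "frechet_derivative (\<lambda>y. dc_form v y b) (at x) a = - dirderiv (dirderiv v (\<i> *s b)) a x" for a b
  proof -
    have "((\<lambda>y. - dirderiv v (\<i> *s b) y) has_derivative (\<lambda>a. - dirderiv (dirderiv v (\<i> *s b)) a x)) (at x)"
      by (rule has_derivative_minus[OF Ck_on_2D(2)[OF C x]])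
    from frechet_derivative_at[OF this] show ?thesis unfolding dc_form_def by metis
  qed
  show 1: "dirderiv (dirderiv v (\<i> *s b)) a x = dirderiv (dirderiv v (\<i> *s a)) b x" for a b
    using dd[of a b] unfolding ddc_form_def fr by simp
  show "dirderiv (dirderiv v b) (\<i> *s a) x = dirderiv (dirderiv v (\<i> *s b)) a x"
    using 1[of b a] second_derivative_symmetric[OF C U x, of b "\<i> *s a"] by simp
  have "\<i> *s (\<i> *s a) = - a" by (simp add: vec_eq_iff)
  then have "dirderiv (dirderiv v (\<i> *s b)) (\<i> *s a) x = dirderiv (dirderiv v (- a)) b x"
    using 1[of b "\<i> *s a"] by simp
  also have "\<dots> = - dirderiv (dirderiv v b) a x"
    using second_dirderiv_minus[OF C U x] second_derivative_symmetric[OF C U x] by simp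
  finally show "dirderiv (dirderiv v (\<i> *s b)) (\<i> *s a) x = - dirderiv (dirderiv v b) a x" .
qed

text \<open>Twice the derivative of type \<open>(1, 0)\<close> of \<open>v\<close> in direction
  \<open>b\<close>. It is holomorphic for pluriharmonic \<open>v\<close>, which gives access to the
  identity theorem while avoiding a harmonic conjugate.\<close>

definition hol_grad :: "(complex ^ 2 \<Rightarrow> real) \<Rightarrow> complex ^ 2 \<Rightarrow> complex ^ 2 \<Rightarrow> complex" where
  "hol_grad v b x = Complex (dirderiv v b x) (- dirderiv v (\<i> *s b) x)"

lemma complex_line_has_derivative: "((\<lambda>z. p + z *s a) has_derivative (\<lambda>h. h *s (a :: complex ^ 2))) F"
proof -
  have "bounded_linear (\<lambda>h. h *s a)"
  proof (intro linear_conv_bounded_linear[THEN iffD1] linearI)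
    show "(b + c) *s a = b *s a + c *s a" for b c by (rule vector_sadd_rdistrib)
    show "(r *\<^sub>R b) *s a = r *\<^sub>R (b *s a)" for r b
      unfolding vec_eq_iff vector_scaleR_component vector_smult_component by simp
  qed
  then show ?thesis by (auto intro!: derivative_eq_intros bounded_linear_imp_has_derivative)
qed

lemma hol_grad_holomorphic:
  assumes v: "pluriharmonic_on v U" and U: "open U" and S: "open S" "\<And>z. z \<in> S \<Longrightarrow> p + z *s a \<in> U"
  shows "(\<lambda>z. hol_grad v b (p + z *s a)) holomorphic_on S"
  unfolding holomorphic_on_open[OF S(1)]
proof (intro ballI allI impI)
  fix z assume z: "z \<in> S"
  let ?x = "p + z *s a"
  have x: "?x \<in> U" using S(2) z by blast
  have C: "Ck_on 2 v U" using v by (simp add: pluriharmonic_on_def)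
  define A where "A = dirderiv (dirderiv v b) a ?x"
  define B where "B = dirderiv (dirderiv v (\<i> *s b)) a ?x"
  have dec: "h *s a = Re h *\<^sub>R a + Im h *\<^sub>R (\<i> *s a)" for h
    unfolding vec_eq_iff vector_add_component vector_scaleR_component vector_smult_component
    by (auto simp: scaleR_conv_of_real complex_eq_iff algebra_simps)
  note l = dirderiv_linear(2)[OF C x]
  have lin: "dirderiv (dirderiv v d) (h *s a) ?x = Re h * dirderiv (dirderiv v d) a ?x + Im h * dirderiv (dirderiv v d) (\<i> *s a) ?x" for d h
  proof -
    have "dirderiv (dirderiv v d) (h *s a) ?x = dirderiv (dirderiv v d) (Re h *\<^sub>R a + Im h *\<^sub>R (\<i> *s a)) ?x"
      by (rule arg_cong[where f = "\<lambda>w. dirderiv (dirderiv v d) w ?x", OF dec])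
    also have "\<dots> = Re h * dirderiv (dirderiv v d) a ?x + Im h * dirderiv (dirderiv v d) (\<i> *s a) ?x"
      unfolding linear_add[OF l] linear_scale[OF l] by simp
    finally show ?thesis .
  qed
  have r1: "dirderiv (dirderiv v b) (\<i> *s a) ?x = B" unfolding B_def by (rule pluriharmonic_relations(2)[OF v U x])
  have r2: "dirderiv (dirderiv v (\<i> *s b)) (\<i> *s a) ?x = - A" unfolding A_def by (rule pluriharmonic_relations(3)[OF v U x])
  have d1: "dirderiv (dirderiv v b) (h *s a) ?x = Re h * A + Im h * B" for h
    using lin[of b h] r1 by (simp only: A_def)
  have d2: "dirderiv (dirderiv v (\<i> *s b)) (h *s a) ?x = Re h * B - Im h * A" for h
    using lin[of "\<i> *s b" h] r2 unfolding B_def by simp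
  have h1: "((\<lambda>z. dirderiv v b (p + z *s a)) has_derivative (\<lambda>h. Re h * A + Im h * B)) (at z)"
    using has_derivative_compose[OF complex_line_has_derivative Ck_on_2D(2)[OF C x, of b]] unfolding d1 .
  have h2: "((\<lambda>z. dirderiv v (\<i> *s b) (p + z *s a)) has_derivative (\<lambda>h. Re h * B - Im h * A)) (at z)"
    using has_derivative_compose[OF complex_line_has_derivative Ck_on_2D(2)[OF C x, of "\<i> *s b"]] unfolding d2 .
  have "((\<lambda>z. complex_of_real (dirderiv v b (p + z *s a)) - \<i> * complex_of_real (dirderiv v (\<i> *s b) (p + z *s a))) has_derivative
      (\<lambda>h. complex_of_real (Re h * A + Im h * B) - \<i> * complex_of_real (Re h * B - Im h * A))) (at z)"
    by (intro has_derivative_diff has_derivative_mult_right has_derivative_of_real h1 h2)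
  moreover have "complex_of_real (Re h * A + Im h * B) - \<i> * complex_of_real (Re h * B - Im h * A) = Complex A (- B) * h" for h
    by (simp add: complex_eq_iff)
  ultimately have "((\<lambda>z. complex_of_real (dirderiv v b (p + z *s a)) - \<i> * complex_of_real (dirderiv v (\<i> *s b) (p + z *s a))) has_field_derivative Complex A (- B)) (at z)"
    by (simp add: has_field_derivative_def)
  moreover have "complex_of_real r - \<i> * complex_of_real s = Complex r (- s)" for r s by (simp add: complex_eq_iff)
  ultimately show "\<exists>f'. ((\<lambda>z. hol_grad v b (p + z *s a)) has_field_derivative f') (at z)"
    unfolding hol_grad_def by auto
qed

lemma complex_line_preimage:
  assumes "open C" "convex C"
  shows "open {z. p + z *s a \<in> C}" "convex {z. p + z *s (a :: complex ^ 2) \<in> C}"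
proof -
  have "continuous_on UNIV (\<lambda>z. p + z *s a)"
    by (intro continuous_at_imp_continuous_on ballI has_derivative_continuous[OF complex_line_has_derivative])
  then have "open ((\<lambda>z. p + z *s a) -` C)" by (rule open_vimage[OF assms(1)])
  then show "open {z. p + z *s a \<in> C}" by (simp add: vimage_def)
  show "convex {z. p + z *s a \<in> C}"
  proof (rule convexI)
    fix x y :: complex and s t :: real
    assume xy: "x \<in> {z. p + z *s a \<in> C}" "y \<in> {z. p + z *s a \<in> C}" and st: "0 \<le> s" "0 \<le> t" "s + t = 1"
    have "p + (s *\<^sub>R x + t *\<^sub>R y) *s a = (s + t) *\<^sub>R p + (s *\<^sub>R x + t *\<^sub>R y) *s a" using st by simp
    also have "\<dots> = s *\<^sub>R (p + x *s a) + t *\<^sub>R (p + y *s a)"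
      unfolding vec_eq_iff vector_add_component vector_scaleR_component vector_smult_component
      by (simp add: scaleR_conv_of_real algebra_simps)
    also have "\<dots> \<in> C" using convexD[OF assms(2)] xy st by blast
    finally show "s *\<^sub>R x + t *\<^sub>R y \<in> {z. p + z *s a \<in> C}" by simp
  qed
qed

text \<open>The functions \<open>hol_grad v b\<close> are holomorphic along the complex line and
  vanish on a real segment of it, hence on its connected intersection with \<open>C\<close>. So the
  derivative of \<open>v\<close> is 0 along the line there.\<close>

lemma pluriharmonic_constant_on_line:
  assumes v: "pluriharmonic_on v U" and U: "open U" and C: "open C" "convex C" "C \<subseteq> U"
    and p: "p \<in> C" and e: "e > 0" "\<And>s b. \<bar>s\<bar> < e \<Longrightarrow> dirderiv v b (p + complex_of_real s *s a) = 0"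
    and z: "p + z *s a \<in> C"
  shows "v (p + z *s a) = v p"
proof -
  define S where "S = {z. p + z *s a \<in> C}"
  have S: "open S" "convex S" unfolding S_def by (rule complex_line_preimage[OF C(1,2)])+
  have 0: "0 \<in> S" and zS: "z \<in> S" using p z by (simp_all add: S_def)
  have SU: "p + w *s a \<in> U" if "w \<in> S" for w using that C(3) by (auto simp: S_def)
  have zero: "hol_grad v b (p + w *s a) = 0" if w: "w \<in> S" for b w
  proof -
    have hol: "(\<lambda>w. hol_grad v b (p + w *s a)) holomorphic_on S" by (rule hol_grad_holomorphic[OF v U S(1) SU])
    obtain r where r: "r > 0" "ball 0 r \<subseteq> S" using S(1) 0 openE by blast
    let ?V = "complex_of_real ` {s. \<bar>s\<bar> < min e r}"
    have "0 islimpt ?V"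
      unfolding islimpt_approachable
    proof safe
      fix d :: real assume d: "d > 0"
      define s where "s = min (min e r) d / 2"
      have "0 < s" "s < min e r" "s < d"
        using d e(1) r(1) by (auto simp: s_def min_def)
      then have "complex_of_real s \<in> ?V" "complex_of_real s \<noteq> 0" "dist (complex_of_real s) 0 < d"
        by auto
      then show "\<exists>x'\<in>?V. x' \<noteq> 0 \<and> dist x' 0 < d" by blast
    qed
    moreover have "?V \<subseteq> S" using r(2) by auto
    moreover have "hol_grad v b (p + w *s a) = 0" if "w \<in> ?V" for w
      using that e(2) by (auto simp: hol_grad_def complex_eq_iff)
    ultimately show ?thesis
      by (intro analytic_continuation[OF hol S(1) convex_connected[OF S(2)] _ 0 _ _ w, of ?V]) auto
  qed
  have D: "dirderiv v b (p + w *s a) = 0" if "w \<in> S" for b w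
    using zero[OF that, of b] by (simp add: hol_grad_def complex_eq_iff)
  have Ck: "Ck_on 2 v U" using v by (simp add: pluriharmonic_on_def)
  have "((\<lambda>w. v (p + w *s a)) has_derivative (\<lambda>h. 0)) (at w within S)" if w: "w \<in> S" for w
  proof -
    have "((\<lambda>w. v (p + w *s a)) has_derivative (\<lambda>h. dirderiv v (h *s a) (p + w *s a))) (at w)"
      by (rule has_derivative_compose[OF complex_line_has_derivative Ck_on_2D(1)[OF Ck SU[OF w]]])
    then show ?thesis unfolding D[OF w] by (rule has_derivative_at_withinI)
  qed
  then obtain c where "\<And>w. w \<in> S \<Longrightarrow> v (p + w *s a) = c"
    using has_derivative_zero_constant[OF S(2), of "\<lambda>w. v (p + w *s a)"] by blast
  from this[OF zS] this[OF 0] show ?thesis by simp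
qed

text \<open>The points near which \<open>v\<close> vanishes form an open set. It is closed in
  \<open>U\<close>, since in a ball meeting it any point is joined to one of these points by a
  complex line, to which \<open>pluriharmonic_constant_on_line\<close> applies.\<close>

lemma pluriharmonic_identity:
  assumes v: "pluriharmonic_on v U" and U: "open U" "connected U"
    and p: "p \<in> U" "e > 0" "\<And>q. q \<in> ball p e \<Longrightarrow> v q = 0" and x: "x \<in> U"
  shows "v x = 0"
proof -
  define Z where "Z = {p \<in> U. \<exists>e>0. \<forall>q\<in>ball p e. v q = 0}"
  have conv: "v q = 0" if C: "open C" "convex C" "C \<subseteq> U" and q0: "q0 \<in> C" "q0 \<in> Z" and q: "q \<in> C" for C q0 q
  proof -
    obtain e where e: "e > 0" "\<forall>q\<in>ball q0 e. v q = 0" using q0(2) by (auto simp: Z_def)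
    have D0: "dirderiv v b y = 0" if "y \<in> ball q0 e" for b y
    proof -
      have "(v has_derivative (\<lambda>_. 0)) (at y)"
        by (rule has_derivative_transform_within_open[OF has_derivative_const[of 0] open_ball that]) (use e(2) in simp)
      from frechet_derivative_at[OF this] show ?thesis by metis
    qed
    let ?a = "q - q0"
    define d where "d = e / (norm ?a + 1)"
    have np: "norm ?a + 1 > 0" by (simp add: add_nonneg_pos)
    have d: "d > 0" using e(1) np by (simp add: d_def)
    have smul: "complex_of_real s *s ?a = s *\<^sub>R ?a" for s
      unfolding vec_eq_iff vector_scaleR_component vector_smult_component by (simp add: scaleR_conv_of_real)
    have "v (q0 + 1 *s ?a) = v q0"
    proof (rule pluriharmonic_constant_on_line[OF v U(1) C q0(1) d])
      fix s b assume s: "\<bar>s\<bar> < d"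
      have "norm (s *\<^sub>R ?a) \<le> \<bar>s\<bar> * (norm ?a + 1)" by (simp add: mult_left_mono)
      also have "\<dots> < d * (norm ?a + 1)" using s np by (rule mult_strict_right_mono)
      also have "\<dots> = e" using np by (simp add: d_def)
      finally show "dirderiv v b (q0 + complex_of_real s *s ?a) = 0"
        unfolding smul by (intro D0) (simp add: dist_norm)
    qed (use q in simp)
    moreover have "v q0 = 0" using e by simp
    ultimately show ?thesis by simp
  qed
  have 1: "openin (top_of_set U) Z"
  proof -
    have "open Z"
      unfolding open_contains_ball
    proof
      fix a assume "a \<in> Z"
      then obtain e where e: "a \<in> U" "e > 0" "\<forall>q\<in>ball a e. v q = 0" by (auto simp: Z_def)
      obtain d where d: "d > 0" "ball a d \<subseteq> U" using U(1) e(1) openE by blast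
      have "ball a (min d (e / 2)) \<subseteq> Z"
      proof
        fix y assume y: "y \<in> ball a (min d (e / 2))"
        have "v q = 0" if "q \<in> ball y (e / 2)" for q
        proof -
          have "dist a q < e" using y that dist_triangle[of a q y] by (auto simp: dist_commute)
          then show ?thesis using e(3) by simp
        qed
        moreover have "y \<in> U" using y d(2) by auto
        ultimately show "y \<in> Z" using e(2) by (auto simp: Z_def intro!: exI[of _ "e/2"])
      qed
      then show "\<exists>e>0. ball a e \<subseteq> Z" using d(1) e(2) by (intro exI[of _ "min d (e / 2)"]) auto
    qed
    moreover have "Z \<subseteq> U" by (auto simp: Z_def)
    ultimately show ?thesis by (simp add: openin_open_eq U(1))
  qed
  have 2: "openin (top_of_set U) (U - Z)"
  proof -
    have "open (U - Z)"
      unfolding open_contains_ball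
    proof
      fix a assume a: "a \<in> U - Z"
      obtain d where d: "d > 0" "ball a d \<subseteq> U" using U(1) a openE by blast
      have "ball a d \<inter> Z = {}"
      proof (rule ccontr)
        assume "ball a d \<inter> Z \<noteq> {}"
        then obtain q0 where "q0 \<in> ball a d" "q0 \<in> Z" by blast
        from conv[OF open_ball convex_ball d(2) this] have "\<forall>q\<in>ball a d. v q = 0" by blast
        then show False using a d(1) by (auto simp: Z_def)
      qed
      then show "\<exists>e>0. ball a e \<subseteq> U - Z" using d by blast
    qed
    then show ?thesis by (simp add: openin_open_eq U(1))
  qed
  have "p \<in> Z" using p by (auto simp: Z_def)
  moreover have "Z \<subseteq> U" by (auto simp: Z_def)
  ultimately have "Z = U"
    using U(2) 1 2 unfolding connected_clopen by (metis closedin_def empty_iff topspace_euclidean_subtopology)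
  then obtain e where "e > 0" "\<forall>q\<in>ball x e. v q = 0" using x by (auto simp: Z_def set_eq_iff)
  then show ?thesis by simp
qed

section \<open>Derivatives of a pluriharmonic function on the slice at time 0\<close>

lemma norm_saddle_pt_0: "norm (saddle_pt x 0) = norm x"
  by (simp add: norm_vec_def)

lemma linear_saddle_pt_0: "linear (\<lambda>x. saddle_pt x 0)"
proof (rule linearI)
  show "saddle_pt (x + y) 0 = saddle_pt x 0 + saddle_pt y 0" for x y by (simp add: vec_eq_iff)
  show "saddle_pt (c *\<^sub>R x) 0 = c *\<^sub>R saddle_pt x 0" for c x
    unfolding vec_eq_iff vector_scaleR_component saddle_pt_nth by (simp add: scaleR_conv_of_real)
qed

lemma bounded_linear_saddle_pt_0: "bounded_linear (\<lambda>x. saddle_pt x 0)"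
  using linear_saddle_pt_0 linear_conv_bounded_linear by blast

lemma saddle_pt_0_smult: "complex_of_real s *s saddle_pt d 0 = saddle_pt (s *\<^sub>R d) 0"
  by (simp add: vec_eq_iff)

lemma continuous_on_saddle_pt_time: "continuous_on UNIV (saddle_pt x)"
  unfolding saddle_pt_def[abs_def] cis_conv_exp by (intro continuous_intros)

text \<open>The part of the chords with both parameters positive, where the factors
  \<open>x $ 1\<close> and \<open>x $ 2\<close> can be cancelled from the relations between the
  conormal derivatives.\<close>

definition positive_strip :: "(real ^ 2) set" where
  "positive_strip = {x. 0 < x $ 1 \<and> 0 < x $ 2 \<and> \<bar>x $ 1 + x $ 2 - 1\<bar> < chord_width}"

lemma open_positive_strip: "open positive_strip"
  unfolding positive_strip_def by (intro open_Collect_conj open_Collect_less continuous_intros)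

lemma positive_strip_chord:
  assumes "x \<in> positive_strip"
  obtains m s where "\<bar>m - 1\<bar> < chord_width" "0 < s" "s < m" "x = vec2 s (m - s)"
  by (rule that[of "x $ 1 + x $ 2" "x $ 1"]) (use assms vec2_eq[of x] in \<open>auto simp: positive_strip_def\<close>)

lemma positive_strip_slice: "positive_strip \<subseteq> slice_disc 0"
proof
  fix x assume "x \<in> positive_strip"
  then obtain m s where "\<bar>m - 1\<bar> < chord_width" "0 < s" "s < m" "x = vec2 s (m - s)" by (rule positive_strip_chord)
  then show "x \<in> slice_disc 0" using chord_in_disc[of m s] by simp
qed

lemma time_zero: "\<bar>0\<bar> < time_bound" using time_bound_ge(2) by simp

definition conormal :: "(complex ^ 2 \<Rightarrow> real) \<Rightarrow> 2 \<Rightarrow> real ^ 2 \<Rightarrow> real" where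
  "conormal v j x = dirderiv v (axis j \<i>) (saddle_pt x 0)"

lemma slice_disc_open_time: "open {t. x \<in> slice_disc t}"
proof -
  have "open (saddle_pt x -` small_ball)" by (rule open_vimage[OF open_small_ball continuous_on_saddle_pt_time])
  then show ?thesis by (simp add: slice_disc_def vimage_def)
qed

lemma saddle_pt_has_derivative_time:
  "(saddle_pt x has_derivative (\<lambda>h. h *\<^sub>R (x $ 1 *\<^sub>R axis 1 \<i> + (- lam * x $ 2) *\<^sub>R axis 2 \<i>))) (at 0)"
proof -
  have c: "((\<lambda>t. complex_of_real (x $ i) * cis (rate i * t)) has_derivative (\<lambda>h. complex_of_real (x $ i) * (\<i> * complex_of_real (rate i * h)))) (at 0)" for i
  proof -
    have 1: "((\<lambda>t. \<i> * complex_of_real (rate i * t)) has_derivative (\<lambda>h. \<i> * complex_of_real (rate i * h))) (at 0)"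
      by (intro has_derivative_mult_right has_derivative_of_real has_derivative_ident)
    have 2: "(exp has_derivative (*) (exp (\<i> * complex_of_real (rate i * 0)))) (at (\<i> * complex_of_real (rate i * 0)))"
      using DERIV_exp[of "\<i> * complex_of_real (rate i * 0)"] by (simp only: has_field_derivative_def)
    from has_derivative_mult_right[OF has_derivative_compose[OF 1 2], of "complex_of_real (x $ i)"]
    show ?thesis by (simp add: cis_conv_exp)
  qed
  have "((\<lambda>t. axis 1 (complex_of_real (x $ 1) * cis (rate 1 * t)) + axis 2 (complex_of_real (x $ 2) * cis (rate 2 * t)) :: complex ^ 2)
     has_derivative (\<lambda>h. axis 1 (complex_of_real (x $ 1) * (\<i> * complex_of_real (rate 1 * h))) + axis 2 (complex_of_real (x $ 2) * (\<i> * complex_of_real (rate 2 * h))))) (at 0)"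
    by (intro has_derivative_add bounded_linear.has_derivative[OF bounded_linear_axis] c)
  moreover have "axis 1 (complex_of_real (x $ 1) * cis (rate 1 * t)) + axis 2 (complex_of_real (x $ 2) * cis (rate 2 * t)) = saddle_pt x t" for t
    by (simp add: vec_eq_iff forall_2 axis_def)
  moreover have "axis 1 (complex_of_real (x $ 1) * (\<i> * complex_of_real (rate 1 * h))) + axis 2 (complex_of_real (x $ 2) * (\<i> * complex_of_real (rate 2 * h)))
    = h *\<^sub>R (x $ 1 *\<^sub>R axis 1 \<i> + (- lam * x $ 2) *\<^sub>R axis 2 \<i> :: complex ^ 2)" for h
    unfolding vec_eq_iff forall_2 vector_add_component vector_scaleR_component
    by (simp add: axis_def scaleR_conv_of_real algebra_simps)
  ultimately show ?thesis by simp
qed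

lemma zero_near_imp_derivative_zero:
  fixes f :: "'a::euclidean_space \<Rightarrow> real"
  assumes "(f has_derivative f') (at x)" "open S" "x \<in> S" "\<And>y. y \<in> S \<Longrightarrow> f y = 0"
  shows "f' d = 0"
proof -
  have "(f has_derivative (\<lambda>_. 0)) (at x)"
    by (rule has_derivative_transform_within_open[OF has_derivative_const[of 0] assms(2,3)]) (use assms(4) in simp)
  from has_derivative_unique[OF assms(1) this] show ?thesis by simp
qed

context
  fixes v :: "complex ^ 2 \<Rightarrow> real" and U :: "(complex ^ 2) set"
  assumes v: "pluriharmonic_on v U" and U: "open U" "cap \<subseteq> U" and v0: "\<And>x. x \<in> cap \<Longrightarrow> v x = 0"
begin

lemma Ck: "Ck_on 2 v U" using v by (simp add: pluriharmonic_on_def)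

lemma slice_U: "x \<in> slice_disc 0 \<Longrightarrow> saddle_pt x 0 \<in> U"
  using saddle_pt_in_cap[OF time_zero] U(2) by blast

lemma real_dirderiv_zero:
  assumes x: "x \<in> slice_disc 0"
  shows "dirderiv v (saddle_pt d 0) (saddle_pt x 0) = 0"
proof -
  have "((\<lambda>x. v (saddle_pt x 0)) has_derivative (\<lambda>d. dirderiv v (saddle_pt d 0) (saddle_pt x 0))) (at x)"
    by (rule has_derivative_compose[OF bounded_linear_imp_has_derivative[OF bounded_linear_saddle_pt_0] Ck_on_2D(1)[OF Ck slice_U[OF x]]])
  from zero_near_imp_derivative_zero[OF this open_slice_disc x] show ?thesis
    using v0 saddle_pt_in_cap[OF time_zero] by blast
qed

text \<open>\<open>v\<close> vanishes along the sweep through the point; the velocity of the sweep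
  at time 0 has the components \<open>\<i> * x $ 1\<close> and
  \<open>- \<i> * lam * x $ 2\<close>.\<close>

lemma conormal_relation:
  assumes x: "x \<in> slice_disc 0"
  shows "x $ 1 * conormal v 1 x = lam * (x $ 2 * conormal v 2 x)"
proof -
  let ?w = "x $ 1 *\<^sub>R axis 1 \<i> + (- lam * x $ 2) *\<^sub>R axis 2 \<i>"
  have d: "((\<lambda>t. v (saddle_pt x t)) has_derivative (\<lambda>h. dirderiv v (h *\<^sub>R ?w) (saddle_pt x 0))) (at 0)"
    by (rule has_derivative_compose[OF saddle_pt_has_derivative_time Ck_on_2D(1)[OF Ck slice_U[OF x]]])
  let ?S = "{t. x \<in> slice_disc t} \<inter> {- time_bound<..<time_bound}"
  have S: "open ?S" by (intro open_Int slice_disc_open_time open_greaterThanLessThan)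
  have "0 \<in> ?S" using x time_zero by simp
  from zero_near_imp_derivative_zero[OF d S this, of 1]
  have "dirderiv v (1 *\<^sub>R ?w) (saddle_pt x 0) = 0"
    using v0 saddle_pt_in_cap[of _ x] by (auto simp: abs_less_iff)
  then have "dirderiv v ?w (saddle_pt x 0) = 0" by simp
  then have "x $ 1 * conormal v 1 x + (- lam * x $ 2) * conormal v 2 x = 0"
    unfolding conormal_def linear_add[OF dirderiv_linear(1)[OF Ck slice_U[OF x]]] linear_scale[OF dirderiv_linear(1)[OF Ck slice_U[OF x]]]
    by simp
  then show ?thesis by simp
qed

lemma conormal_has_derivative:
  assumes x: "x \<in> slice_disc 0"
  shows "(conormal v j has_derivative (\<lambda>d. dirderiv (dirderiv v (axis j \<i>)) (saddle_pt d 0) (saddle_pt x 0))) (at x)"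
  unfolding conormal_def[abs_def]
  by (rule has_derivative_compose[OF bounded_linear_imp_has_derivative[OF bounded_linear_saddle_pt_0] Ck_on_2D(2)[OF Ck slice_U[OF x]]])

text \<open>The direction is tangent to the level curves of \<open>x $ 1 powr lam * x $ 2\<close>.
  Differentiating \<open>conormal_relation\<close> in the second coordinate and using the symmetry
  of the first pluriharmonic relation, both terms of the derivative become
  \<open>x $ 1 * x $ 2\<close> times the same second derivative of \<open>v\<close>, with opposite
  signs.\<close>

lemma flux_derivative_along_leaf:
  assumes x: "x \<in> slice_disc 0"
  obtains D where "((\<lambda>x. x $ 2 * conormal v 2 x) has_derivative D) (at x)" "D (vec2 (x $ 1) (- lam * x $ 2)) = 0"
proof -
  let ?E = "\<lambda>j d. dirderiv (dirderiv v (axis j \<i>)) (saddle_pt d 0) (saddle_pt x 0)"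
  define D where "D = (\<lambda>d. x $ 2 * ?E 2 d + d $ 2 * conormal v 2 x)"
  have nth: "((\<lambda>x. x $ j) has_derivative (\<lambda>d. d $ j)) (at x)" for j
    by (rule bounded_linear_imp_has_derivative[OF bounded_linear_vec_nth])
  have D: "((\<lambda>x. x $ 2 * conormal v 2 x) has_derivative D) (at x)"
    unfolding D_def by (rule has_derivative_mult[OF nth conormal_has_derivative[OF x]])
  have "((\<lambda>x. x $ 1 * conormal v 1 x) has_derivative (\<lambda>d. x $ 1 * ?E 1 d + d $ 1 * conormal v 1 x)) (at x)"
    by (rule has_derivative_mult[OF nth conormal_has_derivative[OF x]])
  from has_derivative_diff[OF this has_derivative_mult_right[OF D, of lam]]
  have "((\<lambda>x. x $ 1 * conormal v 1 x - lam * (x $ 2 * conormal v 2 x)) has_derivative (\<lambda>d. (x $ 1 * ?E 1 d + d $ 1 * conormal v 1 x) - lam * D d)) (at x)" .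
  from zero_near_imp_derivative_zero[OF this open_slice_disc x]
  have rel: "x $ 1 * ?E 1 d + d $ 1 * conormal v 1 x = lam * D d" for d using conormal_relation by force
  have "\<i> *s axis j 1 = axis j \<i>" for j :: 2 by (simp add: vec_eq_iff axis_def)
  then have sym: "?E 2 (vec2 1 0) = ?E 1 (vec2 0 1)"
    using pluriharmonic_relations(1)[OF v U(1) slice_U[OF x], of "axis 2 1" "axis 1 1"]
  proof -
    have e: "saddle_pt (vec2 1 0) 0 = axis 1 1" "saddle_pt (vec2 0 1) 0 = axis 2 1"
      by (simp_all add: vec_eq_iff forall_2 axis_def)
    have i: "\<i> *s axis j 1 = axis j \<i>" for j :: 2 by (simp add: vec_eq_iff axis_def)
    show ?thesis
      using pluriharmonic_relations(1)[OF v U(1) slice_U[OF x], of "axis 2 1" "axis 1 1"] unfolding e i .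
  qed
  have D1: "D (vec2 1 0) = x $ 2 * ?E 1 (vec2 0 1)" unfolding D_def sym by simp
  have D2: "lam * D (vec2 0 1) = x $ 1 * ?E 1 (vec2 0 1)" using rel[of "vec2 0 1"] by simp
  have lin: "linear D" using D by (rule has_derivative_linear)
  have "vec2 (x $ 1) (- lam * x $ 2) = x $ 1 *\<^sub>R vec2 1 0 + (- x $ 2 * lam) *\<^sub>R vec2 0 1"
    by (simp add: vec_eq_iff forall_2)
  then have "D (vec2 (x $ 1) (- lam * x $ 2)) = x $ 1 * D (vec2 1 0) - x $ 2 * (lam * D (vec2 0 1))"
  proof -
    assume e: "vec2 (x $ 1) (- lam * x $ 2) = x $ 1 *\<^sub>R vec2 1 0 + (- x $ 2 * lam) *\<^sub>R vec2 0 1"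
    show "D (vec2 (x $ 1) (- lam * x $ 2)) = x $ 1 * D (vec2 1 0) - x $ 2 * (lam * D (vec2 0 1))"
      unfolding e linear_add[OF lin] linear_scale[OF lin] by simp
  qed
  also have "\<dots> = 0" unfolding D1 D2 by simp
  finally show ?thesis using that D by blast
qed

text \<open>The flux \<open>x $ 2 * conormal v 2 x\<close> is a first integral in the sense of
  \<open>first_integral_on_chord_constant\<close>: analytic along the chord through
  \<open>hol_grad\<close>, and equal at paired points near the tangency by integration along the
  leaf arc between them.\<close>

lemma flux_zero_on_chord:
  assumes m: "\<bar>m - 1\<bar> < chord_width" and s: "0 \<le> s" "s \<le> m"
  shows "(m - s) * conormal v 2 (vec2 s (m - s)) = 0"
proof -
  have mp: "m > 0" using m chord_width(2) by linarith
  obtain a b where ab: "a < 0" "m < b" and I: "\<And>s. s \<in> {a<..<b} \<Longrightarrow> vec2 s (m - s) \<in> slice_disc 0"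
    by (rule chord_interval[OF m], rule that)
  let ?k = "\<lambda>x. x $ 2 * conormal v 2 x"
  let ?f = "\<lambda>s. ?k (vec2 s (m - s))"
  have line: "saddle_pt (vec2 0 m) 0 + complex_of_real s *s saddle_pt (vec2 1 (- 1)) 0 = saddle_pt (vec2 s (m - s)) 0" for s
    by (simp add: vec_eq_iff forall_2)
  have cf: "complexifiable_at ?f x" if x: "x \<in> {a<..<b}" for x
  proof -
    let ?l = "\<lambda>z. saddle_pt (vec2 0 m) 0 + z *s saddle_pt (vec2 1 (- 1)) 0"
    define S where "S = ?l -` U \<inter> {z. a < Re z} \<inter> {z. Re z < b}"
    have oS: "open S" unfolding S_def
      by (intro open_Int open_halfspace_Re_gt open_halfspace_Re_lt open_vimage[OF U(1)]
          continuous_at_imp_continuous_on ballI has_derivative_continuous[OF complex_line_has_derivative])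
    have "complexifiable_at (\<lambda>s. conormal v 2 (vec2 s (m - s))) x"
    proof (rule complexifiable_atI[OF oS])
      show "complex_of_real x \<in> S" using x slice_U[OF I[OF x]] by (simp add: S_def line)
      show "(\<lambda>z. hol_grad v (axis 2 \<i>) (?l z)) holomorphic_on S"
        by (rule hol_grad_holomorphic[OF v U(1) oS]) (simp add: S_def)
      fix y assume "complex_of_real y \<in> S"
      then have y: "vec2 y (m - y) \<in> slice_disc 0" by (intro I) (simp add: S_def)
      \<comment> \<open>Multiplying the conormal direction by \<open>\<i>\<close> gives a real
        direction, in which the derivative of \<open>v\<close> is 0 on the slice. So
        \<open>hol_grad\<close> is real there and extends the conormal derivative.\<close>
      have "\<i> *s axis 2 \<i> = saddle_pt (vec2 0 (- 1)) 0" by (simp add: vec_eq_iff forall_2 axis_def)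
      then show "hol_grad v (axis 2 \<i>) (?l (complex_of_real y)) = complex_of_real (conormal v 2 (vec2 y (m - y)))"
        unfolding line using real_dirderiv_zero[OF y, of "vec2 0 (- 1)"]
        by (simp add: hol_grad_def conormal_def complex_eq_iff)
    qed
    from complexifiable_at_mult[OF complexifiable_at_minus[OF complexifiable_at_const complexifiable_at_id] this]
    show ?thesis by simp
  qed
  note tb = tangency_bounds[OF mp]
  let ?p = "vec2 (tangency m) (m - tangency m)"
  have p: "?p \<in> slice_disc 0" by (rule chord_in_disc[OF m]) (use tb in auto)
  have "continuous_on UNIV (\<lambda>z. vec2 (fst z) (snd z))" by (intro continuous_intros)
  then have "open ((\<lambda>z. vec2 (fst z) (snd z)) -` slice_disc 0)" by (rule open_vimage[OF open_slice_disc])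
  then obtain A B where AB: "open A" "open B" "(tangency m, m - tangency m) \<in> A \<times> B" "A \<times> B \<subseteq> (\<lambda>z. vec2 (fst z) (snd z)) -` slice_disc 0"
    by (rule open_prod_elim[of _ "(tangency m, m - tangency m)"]) (use p in simp)
  obtain d1 where d1: "d1 > 0" "ball (tangency m) d1 \<subseteq> A" using AB openE by blast
  obtain d2 where d2: "d2 > 0" "ball (m - tangency m) d2 \<subseteq> B" using AB openE by blast
  define d where "d = min d1 d2"
  have d: "d > 0" using d1 d2 by (simp add: d_def)
  \<comment> \<open>A rectangle around the tangency inside the disc. The leaf arc used below is
    monotone in each coordinate, so it stays in the rectangle as soon as its end points do.\<close>
  have box: "vec2 x y \<in> slice_disc 0" if "\<bar>x - tangency m\<bar> < d" "\<bar>y - (m - tangency m)\<bar> < d" for x y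
  proof -
    have "(x, y) \<in> A \<times> B" using that d1(2) d2(2) by (auto simp: d_def dist_real_def abs_minus_commute)
    then show ?thesis using AB(4) by auto
  qed
  have ev: "\<forall>\<^sub>F \<rho> in at_right 1. \<bar>g \<rho> - tangency m\<bar> < d" if "(g \<longlongrightarrow> tangency m) (at_right 1)" for g
    using tendstoD[OF that d] by (simp add: dist_real_def)
  have evf: "\<forall>\<^sub>F \<rho> in at_right 1. ?f (chord_pt m \<rho>) = ?f (\<rho> * chord_pt m \<rho>)"
    using ev[OF chord_pt_tendsto_tangency(1)] ev[OF chord_pt_tendsto_tangency(2)] eventually_at_right_less[of "1::real"]
  proof eventually_elim
    case (elim \<rho>)
    let ?x = "chord_pt m \<rho>"
    note cp = chord_pt_props[OF mp elim(3)]
    \<comment> \<open>The flow line of the field with components \<open>x $ 1\<close> and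
      \<open>- lam * x $ 2\<close>; it runs from the first chord point at parameter 0 to the second
      one at parameter \<open>ln \<rho>\<close>.\<close>
    let ?c = "\<lambda>\<theta>. vec2 (?x * exp \<theta>) ((m - ?x) * exp (- lam * \<theta>))"
    have end0: "?c 0 = vec2 ?x (m - ?x)" by simp
    have el: "exp (- lam * ln \<rho>) = 1 / \<rho> powr lam" using elim(3) by (simp add: powr_def exp_minus inverse_eq_divide)
    have "(m - ?x) * exp (- lam * ln \<rho>) = m - \<rho> * ?x"
      unfolding el cp(5) using cp(7) elim(3) by simp
    moreover have "exp (ln \<rho>) = \<rho>" using elim(3) by simp
    ultimately have end1: "?c (ln \<rho>) = vec2 (\<rho> * ?x) (m - \<rho> * ?x)" by (simp only: mult.commute)
    have inD: "?c \<theta> \<in> slice_disc 0" if \<theta>: "0 \<le> \<theta>" "\<theta> \<le> ln \<rho>" for \<theta>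
    proof -
      have 1: "?x \<le> ?x * exp \<theta>" using cp(1) \<theta>(1) by simp
      have "exp \<theta> \<le> \<rho>" using \<theta>(2) elim(3) by (metis exp_le_cancel_iff exp_ln less_trans zero_less_one)
      then have 2: "?x * exp \<theta> \<le> \<rho> * ?x" using cp(1) by simp
      have y0: "m - ?x > 0" using cp(1-3) by linarith
      have 3: "(m - ?x) * exp (- lam * \<theta>) \<le> m - ?x" using y0 \<theta>(1) lam_pos by simp
      have "exp (- lam * ln \<rho>) \<le> exp (- lam * \<theta>)" using \<theta>(2) lam_pos by simp
      then have "(m - ?x) * exp (- lam * ln \<rho>) \<le> (m - ?x) * exp (- lam * \<theta>)" using y0 by (intro mult_left_mono) auto
      then have 4: "m - \<rho> * ?x \<le> (m - ?x) * exp (- lam * \<theta>)" using \<open>(m - ?x) * exp (- lam * ln \<rho>) = m - \<rho> * ?x\<close> by simp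
      show ?thesis
        by (rule box) (use 1 2 3 4 elim(1,2) in \<open>unfold abs_less_iff, linarith\<close>)+
    qed
    have "?k (?c (ln \<rho>)) = ?k (?c 0)"
    proof (rule DERIV_isconst_end[of 0 "ln \<rho>" "\<lambda>\<theta>. ?k (?c \<theta>)"])
      show "0 < ln \<rho>" using elim(3) by simp
      have der: "((\<lambda>\<theta>. ?k (?c \<theta>)) has_real_derivative 0) (at \<theta>)" if \<theta>: "0 \<le> \<theta>" "\<theta> \<le> ln \<rho>" for \<theta>
      proof -
        let ?q = "?c \<theta>"
        obtain D where D: "(?k has_derivative D) (at ?q)" "D (vec2 (?q $ 1) (- lam * ?q $ 2)) = 0"
          by (rule flux_derivative_along_leaf[OF inD[OF \<theta>]], rule that)
        have vec2_axis: "vec2 a b = axis 1 a + axis 2 b" for a b by (simp add: vec_eq_iff forall_2 axis_def)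
        have "((\<lambda>\<theta>. axis 1 (?x * exp \<theta>) + axis 2 ((m - ?x) * exp (- lam * \<theta>)) :: real ^ 2) has_derivative
            (\<lambda>h. axis 1 (h * (?x * exp \<theta>)) + axis 2 (h * (- lam * ((m - ?x) * exp (- lam * \<theta>)))))) (at \<theta>)"
          by (intro has_derivative_add bounded_linear.has_derivative[OF bounded_linear_axis])
             (auto intro!: derivative_eq_intros)
        then have "(?c has_derivative (\<lambda>h. h *\<^sub>R vec2 (?q $ 1) (- lam * ?q $ 2))) (at \<theta>)"
          unfolding vec2_axis[symmetric]
          by (rule has_derivative_eq_rhs) (simp add: fun_eq_iff vec_eq_iff forall_2)
        from has_derivative_compose[OF this D(1)]
        have "((\<lambda>\<theta>. ?k (?c \<theta>)) has_derivative (\<lambda>h. D (h *\<^sub>R vec2 (?q $ 1) (- lam * ?q $ 2)))) (at \<theta>)" .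
        moreover have "(\<lambda>h. D (h *\<^sub>R vec2 (?q $ 1) (- lam * ?q $ 2))) = (*) 0"
          unfolding linear_scale[OF has_derivative_linear[OF D(1)]] D(2) by (simp add: fun_eq_iff)
        ultimately show ?thesis unfolding has_field_derivative_def by (rule has_derivative_eq_rhs)
      qed
      show "continuous_on {0..ln \<rho>} (\<lambda>\<theta>. ?k (?c \<theta>))"
        using DERIV_isCont[OF der] by (intro continuous_at_imp_continuous_on) auto
      show "DERIV (\<lambda>\<theta>. ?k (?c \<theta>)) x :> 0" if "0 < x" "x < ln \<rho>" for x
        using der[of x] that by simp
    qed
    then show ?case unfolding end0 end1 by simp
  qed
  obtain e where e: "e > 0" "\<And>\<rho>. 1 < \<rho> \<Longrightarrow> \<rho> < 1 + e \<Longrightarrow> ?f (chord_pt m \<rho>) = ?f (\<rho> * chord_pt m \<rho>)"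
    by (rule eventually_at_right_1E[OF evf], rule that)
  have c: "?f s = ?f 0" if "s \<in> {a<..<b}" for s
    by (rule first_integral_on_chord_constant[OF mp ab cf e that])
  \<comment> \<open>The flux is constant along the chord, and at \<open>s = m\<close> its factor
    \<open>m - s\<close> is 0.\<close>
  have "?f s = ?f m" using c[of s] c[of m] s ab mp by simp
  then show ?thesis by simp
qed

lemma dirderiv_zero_on_strip:
  assumes x: "x \<in> positive_strip"
  shows "dirderiv v b (saddle_pt x 0) = 0"
proof -
  obtain m s where ms: "\<bar>m - 1\<bar> < chord_width" "0 < s" "s < m" "x = vec2 s (m - s)" using x by (rule positive_strip_chord)
  have xd: "x \<in> slice_disc 0" using x positive_strip_slice by blast
  have c2: "conormal v 2 x = 0" using flux_zero_on_chord[OF ms(1), of s] ms by simp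
  have c1: "conormal v 1 x = 0" using conormal_relation[OF xd] c2 ms by simp
  have "b = saddle_pt (vec2 (Re (b $ 1)) (Re (b $ 2))) 0 + Im (b $ 1) *\<^sub>R axis 1 \<i> + Im (b $ 2) *\<^sub>R axis 2 \<i>"
    unfolding vec_eq_iff forall_2 vector_add_component vector_scaleR_component
    by (simp add: axis_def complex_eq_iff)
  then have "dirderiv v b (saddle_pt x 0) = dirderiv v (saddle_pt (vec2 (Re (b $ 1)) (Re (b $ 2))) 0 + Im (b $ 1) *\<^sub>R axis 1 \<i> + Im (b $ 2) *\<^sub>R axis 2 \<i>) (saddle_pt x 0)"
    by (rule arg_cong[where f = "\<lambda>b. dirderiv v b (saddle_pt x 0)"])
  also have "\<dots> = 0"
    unfolding linear_add[OF dirderiv_linear(1)[OF Ck slice_U[OF xd]]] linear_scale[OF dirderiv_linear(1)[OF Ck slice_U[OF xd]]]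
    using c1 c2 real_dirderiv_zero[OF xd] by (simp add: conormal_def)
  finally show ?thesis .
qed

text \<open>A point \<open>q\<close> with real part \<open>x\<close> and imaginary part
  \<open>y\<close> lies on the complex line through \<open>x\<close> in direction \<open>y\<close>,
  at parameter \<open>\<i>\<close>. Near \<open>x\<close> the real points of this line belong to the
  strip, where all derivatives of \<open>v\<close> vanish, so \<open>v q\<close> equals the value at
  \<open>x\<close>, which is 0.\<close>

lemma zero_near_strip_centre:
  obtains r where "r > 0" "saddle_pt (vec2 (1/2) (1/2)) 0 \<in> U" "\<And>q. q \<in> ball (saddle_pt (vec2 (1/2) (1/2)) 0) r \<Longrightarrow> v q = 0"
proof -
  let ?h = "vec2 (1/2) (1/2)"
  have hW: "?h \<in> positive_strip" using chord_width(1) by (simp add: positive_strip_def)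
  have hU: "saddle_pt ?h 0 \<in> U" using slice_U positive_strip_slice hW by blast
  obtain r1 where r1: "r1 > 0" "ball (saddle_pt ?h 0) r1 \<subseteq> U" using U(1) hU openE by blast
  obtain r2 where r2: "r2 > 0" "ball ?h r2 \<subseteq> positive_strip" using open_positive_strip hW openE by blast
  define r where "r = min r1 r2"
  have r: "r > 0" "ball (saddle_pt ?h 0) r \<subseteq> U" using r1 r2 by (auto simp: r_def)
  have "v q = 0" if q: "q \<in> ball (saddle_pt ?h 0) r" for q
  proof -
    define x where "x = (\<chi> i. Re (q $ i))"
    define y where "y = (\<chi> i. Im (q $ i))"
    have qxy: "q = saddle_pt x 0 + \<i> *s saddle_pt y 0"
      by (simp add: vec_eq_iff x_def y_def complex_eq_iff)
    have "norm (x - ?h) \<le> norm (q - saddle_pt ?h 0)"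
      unfolding norm_vec_def
    proof (rule L2_set_mono)
      fix i :: 2
      have "(x - ?h) $ i = Re ((q - saddle_pt ?h 0) $ i)" by (simp add: x_def)
      then show "norm ((x - ?h) $ i) \<le> norm ((q - saddle_pt ?h 0) $ i)"
        unfolding real_norm_def by (simp only: abs_Re_le_cmod)
    qed simp
    then have xh: "norm (x - ?h) < r" using q by (simp add: dist_norm norm_minus_commute)
    have inW: "x + s *\<^sub>R y \<in> positive_strip" if "\<bar>s\<bar> * (norm y + 1) < r - norm (x - ?h)" for s
    proof -
      have "norm (x + s *\<^sub>R y - ?h) \<le> norm (x - ?h) + \<bar>s\<bar> * norm y"
        using norm_triangle_ineq[of "x - ?h" "s *\<^sub>R y"] by (simp add: algebra_simps)
      also have "\<dots> \<le> norm (x - ?h) + \<bar>s\<bar> * (norm y + 1)" by (intro add_left_mono mult_left_mono) auto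
      also have "\<dots> < r" using that by simp
      finally have "x + s *\<^sub>R y \<in> ball ?h r2" by (simp add: dist_norm norm_minus_commute r_def)
      then show ?thesis using r2(2) by blast
    qed
    define e where "e = (r - norm (x - ?h)) / (norm y + 1)"
    have yp: "norm y + 1 > 0" by (simp add: add_nonneg_pos)
    have e: "e > 0" using xh yp by (simp add: e_def)
    have xW: "x \<in> positive_strip" using inW[of 0] xh by simp
    have xB: "saddle_pt x 0 \<in> ball (saddle_pt ?h 0) r"
    proof -
      have "saddle_pt x 0 - saddle_pt ?h 0 = saddle_pt (x - ?h) 0" by (rule linear_diff[OF linear_saddle_pt_0, symmetric])
      then have "norm (saddle_pt x 0 - saddle_pt ?h 0) = norm (x - ?h)" by (simp only: norm_saddle_pt_0)
      then show ?thesis using xh by (simp add: dist_norm norm_minus_commute)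
    qed
    have "v (saddle_pt x 0 + \<i> *s saddle_pt y 0) = v (saddle_pt x 0)"
    proof (rule pluriharmonic_constant_on_line[OF v U(1) open_ball convex_ball r(2) xB e])
      fix s b assume s: "\<bar>s\<bar> < e"
      have "\<bar>s\<bar> * (norm y + 1) < r - norm (x - ?h)"
        using mult_strict_right_mono[OF s yp] yp by (simp add: e_def)
      from dirderiv_zero_on_strip[OF inW[OF this]]
      show "dirderiv v b (saddle_pt x 0 + complex_of_real s *s saddle_pt y 0) = 0"
        unfolding saddle_pt_0_smult linear_add[OF linear_saddle_pt_0, symmetric] .
    qed (use q qxy in simp)
    moreover have "v (saddle_pt x 0) = 0"
      using v0 saddle_pt_in_cap[OF time_zero] xW positive_strip_slice by blast
    ultimately show ?thesis using qxy by simp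
  qed
  with that r(1) hU show ?thesis by blast
qed

end

theorem pluriharmonic_vanishing_on_cap:
  assumes v: "pluriharmonic_on v U" and U: "open U" "connected U" "cap \<subseteq> U"
    and v0: "\<And>x. x \<in> cap \<Longrightarrow> v x = 0" and x: "x \<in> U"
  shows "v x = 0"
proof -
  obtain r where r: "r > 0" "saddle_pt (vec2 (1/2) (1/2)) 0 \<in> U" "\<And>q. q \<in> ball (saddle_pt (vec2 (1/2) (1/2)) 0) r \<Longrightarrow> v q = 0"
    by (rule zero_near_strip_centre[OF v U(1,3) v0], assumption, rule that)
  show ?thesis by (rule pluriharmonic_identity[OF v U(1,2) r(2,1,3) x])
qed

section \<open>Smooth maps and the closed cap\<close>

lemma frechet_derivative_cong_open:
  assumes "open U" "x \<in> U" "\<And>y. y \<in> U \<Longrightarrow> f y = g y"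
  shows "frechet_derivative f (at x) = frechet_derivative g (at x)"
proof -
  have "(f has_derivative D) (at x) \<longleftrightarrow> (g has_derivative D) (at x)" for D
    using has_derivative_transform_within_open[of f D x UNIV U g] has_derivative_transform_within_open[of g D x UNIV U f] assms
    by (metis)
  then show ?thesis unfolding frechet_derivative_def by simp
qed

lemma Ck_on_cong:
  assumes "open U" "\<And>y. y \<in> U \<Longrightarrow> f y = g y" "Ck_on k f U"
  shows "Ck_on k g U"
  using assms(2,3)
proof (induction k arbitrary: f g)
  case 0
  then show ?case using continuous_on_cong[of U U f g] by simp
next
  case (Suc k)
  have "g differentiable (at x)" if x: "x \<in> U" for x
  proof -
    obtain D where "(f has_derivative D) (at x)" using Suc.prems(2) x by (auto simp: differentiable_def)
    then have "(g has_derivative D) (at x)"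
      by (rule has_derivative_transform_within_open[OF _ assms(1) x]) (use Suc.prems(1) in simp)
    then show ?thesis by (auto simp: differentiable_def)
  qed
  moreover have "Ck_on k (\<lambda>x. frechet_derivative g (at x) v) U" for v
  proof (rule Suc.IH)
    show "Ck_on k (\<lambda>x. frechet_derivative f (at x) v) U" using Suc.prems(2) by simp
    show "frechet_derivative f (at y) v = frechet_derivative g (at y) v" if "y \<in> U" for y
      using frechet_derivative_cong_open[OF assms(1) that Suc.prems(1)] by simp
  qed
  ultimately show ?case by simp
qed

lemma Ck_on_Suc_imp: "Ck_on (Suc k) f U \<Longrightarrow> Ck_on k f U"
proof (induction k arbitrary: f)
  case 0
  then show ?case by (auto intro!: continuous_at_imp_continuous_on differentiable_imp_continuous_within)
next
  case (Suc k)
  then show ?case by simp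
qed

lemma Ck_on_SucI:
  assumes U: "open U" and D: "\<And>x. x \<in> U \<Longrightarrow> (f has_derivative D x) (at x)" and C: "\<And>v. Ck_on k (\<lambda>x. D x v) U"
  shows "Ck_on (Suc k) f U"
proof -
  have "D x = frechet_derivative f (at x)" if "x \<in> U" for x by (rule frechet_derivative_at[OF D[OF that]])
  then have "Ck_on k (\<lambda>x. frechet_derivative f (at x) v) U" for v
    by (intro Ck_on_cong[OF U _ C[of v]]) simp
  then show ?thesis using D by (auto simp: differentiable_def)
qed

lemma Ck_on_SucD:
  assumes "Ck_on (Suc k) f U"
  shows "\<And>x. x \<in> U \<Longrightarrow> (f has_derivative frechet_derivative f (at x)) (at x)"
    "\<And>v. Ck_on k (\<lambda>x. frechet_derivative f (at x) v) U"
  using assms by (simp_all add: frechet_derivative_works)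

lemma Ck_on_const: "Ck_on k (\<lambda>_. c) U"
proof (induction k arbitrary: c)
  case (Suc k)
  have "frechet_derivative (\<lambda>_. c) (at x) = (\<lambda>_. 0)" for x :: 'a
    using frechet_derivative_at[OF has_derivative_const[of c "at x"]] by simp
  then show ?case using Suc[of 0] by simp
qed simp

lemma Ck_on_bounded_linear_compose:
  assumes U: "open U" and L: "bounded_linear L"
  shows "Ck_on k f U \<Longrightarrow> Ck_on k (\<lambda>x. L (f x)) U"
proof (induction k arbitrary: f)
  case 0
  then show ?case using bounded_linear.continuous_on[OF L] by simp
next
  case (Suc k)
  note D = Ck_on_SucD[OF Suc.prems]
  show ?case
    by (rule Ck_on_SucI[OF U bounded_linear.has_derivative[OF L D(1)]]) (auto intro: Suc.IH D(2))
qed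

lemma Ck_on_add:
  assumes U: "open U"
  shows "Ck_on k f U \<Longrightarrow> Ck_on k g U \<Longrightarrow> Ck_on k (\<lambda>x. f x + g x) U"
proof (induction k arbitrary: f g)
  case 0
  then show ?case by (auto intro: continuous_intros)
next
  case (Suc k)
  note D = Ck_on_SucD[OF Suc.prems(1)] Ck_on_SucD[OF Suc.prems(2)]
  show ?case
    by (rule Ck_on_SucI[OF U has_derivative_add[OF D(1) D(3)]]) (auto intro: Suc.IH D(2,4))
qed

lemma Ck_on_sum:
  assumes U: "open U" and "finite I" "\<And>i. i \<in> I \<Longrightarrow> Ck_on k (f i) U"
  shows "Ck_on k (\<lambda>x. \<Sum>i\<in>I. f i x) U"
  using assms(2,3)
  by (induction I rule: finite_induct) (auto intro: Ck_on_const Ck_on_add[OF U])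

lemma Ck_on_bilinear:
  assumes U: "open U" and B: "bounded_bilinear B"
  shows "Ck_on k f U \<Longrightarrow> Ck_on k g U \<Longrightarrow> Ck_on k (\<lambda>x. B (f x) (g x)) U"
proof (induction k arbitrary: f g)
  case 0
  then show ?case using bounded_bilinear.continuous_on[OF B] by simp
next
  case (Suc k)
  note D = Ck_on_SucD[OF Suc.prems(1)] Ck_on_SucD[OF Suc.prems(2)]
  show ?case
  proof (rule Ck_on_SucI[OF U bounded_bilinear.FDERIV[OF B D(1) D(3)]])
    show "Ck_on k (\<lambda>x. B (f x) (frechet_derivative g (at x) v) + B (frechet_derivative f (at x) v) (g x)) U" for v
      by (intro Ck_on_add[OF U] Suc.IH D(2,4) Ck_on_Suc_imp[OF Suc.prems(1)] Ck_on_Suc_imp[OF Suc.prems(2)])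
  qed
qed

text \<open>\<open>Ck_on\<close> controls derivatives in fixed directions only. The chain rule is
  therefore expanded over \<open>Basis\<close>, so that each summand is a product to which the
  induction hypothesis applies.\<close>

lemma Ck_on_compose:
  fixes f :: "'a::euclidean_space \<Rightarrow> 'b::euclidean_space" and g :: "'b \<Rightarrow> 'c::real_normed_vector"
  assumes U: "open U" and sub: "f ` U \<subseteq> V"
  shows "Ck_on k f U \<Longrightarrow> Ck_on k g V \<Longrightarrow> Ck_on k (\<lambda>x. g (f x)) U"
proof (induction k arbitrary: g)
  case 0
  then show ?case using continuous_on_compose2[of V g U f] sub by simp
next
  case (Suc k)
  note D = Ck_on_SucD[OF Suc.prems(1)] Ck_on_SucD[OF Suc.prems(2)]
  have fV: "f x \<in> V" if "x \<in> U" for x using that sub by blast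
  show ?case
  proof (rule Ck_on_SucI[OF U])
    fix x assume x: "x \<in> U"
    show "((\<lambda>x. g (f x)) has_derivative (\<lambda>v. \<Sum>b\<in>Basis. (frechet_derivative f (at x) v \<bullet> b) *\<^sub>R frechet_derivative g (at (f x)) b)) (at x)"
    proof (rule has_derivative_eq_rhs[OF has_derivative_compose[OF D(1)[OF x] D(3)[OF fV[OF x]]]], rule ext)
      fix v
      let ?w = "frechet_derivative f (at x) v"
      have lin: "linear (frechet_derivative g (at (f x)))" using D(3)[OF fV[OF x]] by (rule has_derivative_linear)
      have "frechet_derivative g (at (f x)) (\<Sum>b\<in>Basis. (?w \<bullet> b) *\<^sub>R b) = (\<Sum>b\<in>Basis. (?w \<bullet> b) *\<^sub>R frechet_derivative g (at (f x)) b)"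
        by (simp add: linear_sum[OF lin] linear_scale[OF lin])
      then show "frechet_derivative g (at (f x)) ?w = (\<Sum>b\<in>Basis. (?w \<bullet> b) *\<^sub>R frechet_derivative g (at (f x)) b)"
        by (simp only: euclidean_representation)
    qed
  next
    fix v
    show "Ck_on k (\<lambda>x. \<Sum>b\<in>Basis. (frechet_derivative f (at x) v \<bullet> b) *\<^sub>R frechet_derivative g (at (f x)) b) U"
    proof (rule Ck_on_sum[OF U finite_Basis], rule Ck_on_bilinear[OF U bounded_bilinear_scaleR])
      fix b :: 'b
      show "Ck_on k (\<lambda>x. frechet_derivative f (at x) v \<bullet> b) U"
        by (rule Ck_on_bounded_linear_compose[OF U bounded_linear_inner_left D(2)])
      show "Ck_on k (\<lambda>x. frechet_derivative g (at (f x)) b) U"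
        by (rule Suc.IH[OF Ck_on_Suc_imp[OF Suc.prems(1)] D(4)])
    qed
  qed
qed

text \<open>The source of all nonlinear smoothness below: cosine, square root, inverse,
  \<open>rsinc\<close> and the argument of a coordinate are obtained from holomorphic
  functions.\<close>

lemma Ck_on_holomorphic:
  assumes S: "open S"
  shows "F holomorphic_on S \<Longrightarrow> Ck_on k F S"
proof (induction k arbitrary: F)
  case 0
  then show ?case by (simp add: holomorphic_on_imp_continuous_on)
next
  case (Suc k)
  have "(F has_derivative (*) (deriv F x)) (at x)" if "x \<in> S" for x
    using holomorphic_derivI[OF Suc.prems S that, of UNIV] by (simp add: has_field_derivative_def)
  then show ?case
    by (rule Ck_on_SucI[OF S])
       (assumption, rule Ck_on_bounded_linear_compose[OF S bounded_linear_mult_left Suc.IH[OF holomorphic_deriv[OF Suc.prems S]]])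
qed

lemma Ck_on_linear:
  assumes U: "open U" and L: "bounded_linear L"
  shows "Ck_on k L U"
proof (cases k)
  case 0
  then show ?thesis using linear_continuous_on[OF L] by simp
next
  case (Suc n)
  show ?thesis unfolding Suc
    by (rule Ck_on_SucI[OF U bounded_linear_imp_has_derivative[OF L]]) (rule Ck_on_const)
qed

definition smooth_on :: "('a::euclidean_space \<Rightarrow> 'b::real_normed_vector) \<Rightarrow> 'a set \<Rightarrow> bool" where
  "smooth_on f U \<longleftrightarrow> open U \<and> (\<forall>k. Ck_on k f U)"

lemma smooth_on_const: "open U \<Longrightarrow> smooth_on (\<lambda>_. c) U"
  by (simp add: smooth_on_def Ck_on_const)

lemma smooth_on_linear: "open U \<Longrightarrow> bounded_linear L \<Longrightarrow> smooth_on L U"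
  by (simp add: smooth_on_def Ck_on_linear)

lemma smooth_on_linear_compose: "smooth_on f U \<Longrightarrow> bounded_linear L \<Longrightarrow> smooth_on (\<lambda>x. L (f x)) U"
  by (simp add: smooth_on_def Ck_on_bounded_linear_compose)

lemma smooth_on_add: "smooth_on f U \<Longrightarrow> smooth_on g U \<Longrightarrow> smooth_on (\<lambda>x. f x + g x) U"
  by (simp add: smooth_on_def Ck_on_add)

lemma smooth_on_minus: "smooth_on f U \<Longrightarrow> smooth_on (\<lambda>x. - f x) U"
  by (rule smooth_on_linear_compose[OF _ bounded_linear_minus[OF bounded_linear_ident]])

lemma smooth_on_diff: "smooth_on f U \<Longrightarrow> smooth_on g U \<Longrightarrow> smooth_on (\<lambda>x. f x - g x) U"
  using smooth_on_add[OF _ smooth_on_minus] by fastforce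

lemma smooth_on_mult:
  fixes f g :: "'a::euclidean_space \<Rightarrow> 'b::real_normed_algebra"
  shows "smooth_on f U \<Longrightarrow> smooth_on g U \<Longrightarrow> smooth_on (\<lambda>x. f x * g x) U"
  by (simp add: smooth_on_def Ck_on_bilinear[OF _ bounded_bilinear_mult])

lemma smooth_on_holomorphic:
  assumes "smooth_on f U" "F holomorphic_on S" "open S" "\<And>x. x \<in> U \<Longrightarrow> f x \<in> S"
  shows "smooth_on (\<lambda>x. F (f x)) U"
  using assms Ck_on_compose[of U f S _ F] Ck_on_holomorphic[of S F] unfolding smooth_on_def by blast

lemma smooth_on_imp_continuous_on: "smooth_on f U \<Longrightarrow> continuous_on U f"
  unfolding smooth_on_def by (metis Ck_on.simps(1))

lemma smooth_on_imp_differentiable: "smooth_on f U \<Longrightarrow> x \<in> U \<Longrightarrow> f differentiable (at x)"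
  unfolding smooth_on_def by (metis Ck_on.simps(2))

lemma smooth_on_of_real: "smooth_on f U \<Longrightarrow> smooth_on (\<lambda>x. complex_of_real (f x)) U"
  by (rule smooth_on_linear_compose[OF _ bounded_linear_of_real])

lemma smooth_on_Re: "smooth_on f U \<Longrightarrow> smooth_on (\<lambda>x. Re (f x)) U"
  by (rule smooth_on_linear_compose[OF _ bounded_linear_Re])

lemma smooth_on_cis:
  assumes "smooth_on f U"
  shows "smooth_on (\<lambda>x. cis (f x)) U"
proof -
  have "smooth_on (\<lambda>x. exp (\<i> * complex_of_real (f x))) U"
    by (rule smooth_on_holomorphic[OF smooth_on_linear_compose[OF smooth_on_of_real[OF assms] bounded_linear_mult_right], of exp UNIV])
       (auto intro: holomorphic_intros)
  then show ?thesis by (simp add: cis_conv_exp)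
qed

lemma smooth_on_cos:
  fixes f :: "'a::euclidean_space \<Rightarrow> real"
  assumes "smooth_on f U"
  shows "smooth_on (\<lambda>x. cos (f x)) U"
  using smooth_on_Re[OF smooth_on_cis[OF assms]] by simp

lemma smooth_on_sqrt:
  assumes f: "smooth_on f U" and pos: "\<And>x. x \<in> U \<Longrightarrow> f x > 0"
  shows "smooth_on (\<lambda>x. sqrt (f x)) U"
proof -
  have "smooth_on (\<lambda>x. Re (csqrt (complex_of_real (f x)))) U"
    by (rule smooth_on_Re, rule smooth_on_holomorphic[OF smooth_on_of_real[OF f] holomorphic_on_csqrt])
       (use pos in \<open>auto intro: open_Compl simp: complex_nonpos_Reals_iff not_le\<close>)
  moreover have "Re (csqrt (complex_of_real (f x))) = sqrt (f x)" if "x \<in> U" for x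
    using pos[OF that] by (simp add: of_real_sqrt[symmetric] less_imp_le)
  ultimately show ?thesis
    unfolding smooth_on_def using Ck_on_cong[of U "\<lambda>x. Re (csqrt (complex_of_real (f x)))" "\<lambda>x. sqrt (f x)"] by blast
qed

lemma smooth_on_inverse:
  fixes f :: "'a::euclidean_space \<Rightarrow> real"
  assumes f: "smooth_on f U" and nz: "\<And>x. x \<in> U \<Longrightarrow> f x \<noteq> 0"
  shows "smooth_on (\<lambda>x. inverse (f x)) U"
proof -
  have "smooth_on (\<lambda>x. Re (inverse (complex_of_real (f x)))) U"
    by (rule smooth_on_Re, rule smooth_on_holomorphic[OF smooth_on_of_real[OF f], of inverse "- {0}"])
       (use nz in \<open>auto intro!: holomorphic_intros\<close>)
  then show ?thesis by (simp flip: of_real_inverse)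
qed

section \<open>The function sin t / t and the radii of the slices\<close>

definition csinc :: "complex \<Rightarrow> complex" where "csinc z = (if z = 0 then 1 else sin z / z)"

lemma csinc_holomorphic: "csinc holomorphic_on UNIV"
proof (rule no_isolated_singularity[of UNIV _ "{0}"])
  have away: "isCont csinc z" if "z \<noteq> 0" for z
  proof -
    have "isCont (\<lambda>z. sin z / z) z" using that by (intro continuous_intros)
    moreover have "\<forall>\<^sub>F w in nhds z. sin w / w = csinc w"
      using t1_space_nhds[OF that] by (auto simp: csinc_def elim!: eventually_mono)
    ultimately show ?thesis by (subst (asm) isCont_cong) auto
  qed
  have "((\<lambda>z. sin z / z) \<longlongrightarrow> 1) (at (0::complex))"
    using DERIV_sin[of "0::complex"] by (simp add: has_field_derivative_iff)
  then have "(csinc \<longlongrightarrow> 1) (at 0)"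
    by (rule Lim_transform_eventually) (simp add: csinc_def eventually_at_filter)
  then have "isCont csinc 0" by (simp add: isCont_def csinc_def)
  then show "continuous_on UNIV csinc" using away by (intro continuous_at_imp_continuous_on) metis
  have "(\<lambda>z. sin z / z) holomorphic_on UNIV - {0}" by (intro holomorphic_intros) auto
  then show "csinc holomorphic_on UNIV - {0}"
    by (rule holomorphic_transform) (auto simp: csinc_def)
qed auto

definition rsinc :: "real \<Rightarrow> real" where "rsinc t = (if t = 0 then 1 else sin t / t)"

lemma csinc_of_real: "csinc (complex_of_real t) = complex_of_real (rsinc t)"
  by (simp add: csinc_def rsinc_def sin_of_real)

lemma smooth_on_rsinc:
  assumes "smooth_on f U"
  shows "smooth_on (\<lambda>x. rsinc (f x)) U"
  using smooth_on_Re[OF smooth_on_holomorphic[OF smooth_on_of_real[OF assms] csinc_holomorphic]]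
  by (simp add: csinc_of_real)

lemma sin_eq_rsinc: "sin t = t * rsinc t"
  by (simp add: rsinc_def)

lemma rsinc_pos:
  assumes "\<bar>t\<bar> < pi"
  shows "rsinc t > 0"
proof (cases "t = 0")
  case False
  have "sin \<bar>t\<bar> > 0" using assms False by (intro sin_gt_zero) auto
  then show ?thesis using False by (cases "t > 0") (auto simp: rsinc_def zero_less_divide_iff)
qed (simp add: rsinc_def)

text \<open>The quotient of \<open>rad_sq - heightsq t\<close> by \<open>(pi / 4)\<^sup>2 - t\<^sup>2\<close>, in a form that is smooth and positive at
  \<open>t = \<plusminus> pi / 4\<close> as well; after rescaling by it the cap becomes a round ball.\<close>

definition aspect :: "real \<Rightarrow> real" where
  "aspect t = rsinc (pi / 4 - t) * rsinc (pi / 4 + t) + lam\<^sup>2 * (rsinc (lam * (pi / 4 - t)) * rsinc (lam * (pi / 4 + t)))"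

lemma sin_sq_diff: "(sin a)\<^sup>2 - (sin b)\<^sup>2 = sin (a - b) * sin (a + b)" for a b :: real
proof -
  have "sin (a - b) * sin (a + b) = (sin a)\<^sup>2 * (cos b)\<^sup>2 - (cos a)\<^sup>2 * (sin b)\<^sup>2"
    by (simp add: sin_add sin_diff power2_eq_square algebra_simps)
  also have "\<dots> = (sin a)\<^sup>2 - (sin b)\<^sup>2"
    by (simp only: cos_squared_eq) (simp add: algebra_simps)
  finally show ?thesis by simp
qed

lemma aspect_identity: "rad_sq - heightsq t = ((pi / 4)\<^sup>2 - t\<^sup>2) * aspect t"
proof -
  have "rad_sq - heightsq t = ((sin (pi / 4))\<^sup>2 - (sin t)\<^sup>2) + ((sin (lam * (pi / 4)))\<^sup>2 - (sin (lam * t))\<^sup>2)"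
    by (simp add: rad_sq_def heightsq_def)
  also have "\<dots> = sin (pi / 4 - t) * sin (pi / 4 + t) + sin (lam * (pi / 4 - t)) * sin (lam * (pi / 4 + t))"
    unfolding sin_sq_diff by (simp add: right_diff_distrib distrib_left)
  \<comment> \<open>Each product of sines vanishes at \<open>t = pi / 4\<close> and
    \<open>t = - pi / 4\<close>; writing \<open>sin\<close> as argument times \<open>rsinc\<close>
    extracts these two zeros as a common factor.\<close>
  also have "\<dots> = ((pi / 4)\<^sup>2 - t\<^sup>2) * aspect t"
    unfolding sin_eq_rsinc aspect_def by (simp add: power2_eq_square algebra_simps)
  finally show ?thesis .
qed

text \<open>The arguments are below \<open>3 * pi / 4\<close> in absolute value, and
  \<open>lam < 4 / 3\<close> keeps them below \<open>pi\<close> after scaling. The range of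
  \<open>t\<close> is wider than that of the closed cap, which leaves room for smooth
  extensions.\<close>

lemma aspect_pos:
  assumes "\<bar>t\<bar> < pi / 2"
  shows "aspect t > 0"
proof -
  have l: "lam * \<bar>x\<bar> < pi" if "\<bar>x\<bar> < 3 * pi / 4" for x
  proof -
    have "lam * \<bar>x\<bar> \<le> 4 / 3 * \<bar>x\<bar>" using lam_bounds by (intro mult_right_mono) auto
    also have "\<dots> < 4 / 3 * (3 * pi / 4)" using that by simp
    finally show ?thesis by simp
  qed
  have b: "\<bar>pi / 4 - t\<bar> < 3 * pi / 4" "\<bar>pi / 4 + t\<bar> < 3 * pi / 4" using assms unfolding abs_less_iff by linarith+
  have b': "\<bar>pi / 4 - t\<bar> < pi" "\<bar>pi / 4 + t\<bar> < pi" using b pi_gt_zero by linarith+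
  have b'': "\<bar>lam * (pi / 4 - t)\<bar> < pi" "\<bar>lam * (pi / 4 + t)\<bar> < pi"
    using l[OF b(1)] l[OF b(2)] lam_pos by (simp_all add: abs_mult)
  show ?thesis
    unfolding aspect_def
    by (intro add_pos_pos mult_pos_pos rsinc_pos b' b'') (use lam_pos in simp)
qed

text \<open>By \<open>aspect_identity\<close>, the radius of the slice at time \<open>t\<close>
  times this factor is the square root of \<open>1 - (4 * t / pi)\<^sup>2\<close>, the radius of the
  unit ball's slice at height \<open>4 * t / pi\<close>.\<close>

definition inv_width :: "real \<Rightarrow> real" where "inv_width t = inverse (pi / 4 * sqrt (aspect t))"

section \<open>The diffeomorphism between the closed cap and the three-ball\<close>

definition vec3 :: "real \<Rightarrow> real \<Rightarrow> real \<Rightarrow> real ^ 3" where "vec3 a b c = axis 1 a + axis 2 b + axis 3 c"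

lemma vec3_nth [simp]: "vec3 a b c $ 1 = a" "vec3 a b c $ 2 = b" "vec3 a b c $ 3 = c"
  by (simp_all add: vec3_def axis_def)

lemma cball_3_iff: "y \<in> cball (0 :: real ^ 3) 1 \<longleftrightarrow> (y $ 1)\<^sup>2 + (y $ 2)\<^sup>2 + (y $ 3)\<^sup>2 \<le> 1"
  by (simp add: norm_vec_def L2_set_def sum_3 real_sqrt_le_1_iff)

lemma ball_3_iff: "y \<in> ball (0 :: real ^ 3) 1 \<longleftrightarrow> (y $ 1)\<^sup>2 + (y $ 2)\<^sup>2 + (y $ 3)\<^sup>2 < 1"
  by (simp add: norm_vec_def L2_set_def sum_3 real_sqrt_lt_1_iff)

definition ball_to_cap :: "real ^ 3 \<Rightarrow> complex ^ 2" where
  "ball_to_cap y = (let t = pi / 4 * y $ 3; w = pi / 4 * sqrt (aspect t) in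
     saddle_pt (vec2 (cos t + w * y $ 1) (cos (lam * t) + w * y $ 2)) t)"

text \<open>On the hypersurface this recovers the time from the argument of \<open>p $ j\<close>.
  The formula makes sense on the open half-space \<open>Re (p $ j) > 0\<close>, and so it provides
  the ambient extension that \<open>smooth_map_on\<close> asks for.\<close>

definition side_time :: "2 \<Rightarrow> complex ^ 2 \<Rightarrow> real" where
  "side_time j p = Im (Ln (p $ j)) / rate j"

definition side_coord :: "2 \<Rightarrow> 2 \<Rightarrow> complex ^ 2 \<Rightarrow> real" where
  "side_coord j i p = (Re (p $ i * cis (- (rate i * side_time j p))) - cos (rate i * side_time j p)) * inv_width (side_time j p)"

definition side_map :: "2 \<Rightarrow> complex ^ 2 \<Rightarrow> real ^ 3" where
  "side_map j p = vec3 (side_coord j 1 p) (side_coord j 2 p) (side_time j p * (4 / pi))"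

definition cap_to_ball :: "complex ^ 2 \<Rightarrow> real ^ 3" where
  "cap_to_ball p = (if Re (p $ 1) > 0 then side_map 1 p else side_map 2 p)"

abbreviation closed_cap :: "(complex ^ 2) set" where
  "closed_cap \<equiv> saddle_hyp \<inter> cball ctr (sqrt rad_sq)"

lemma cball_ctr_iff: "p \<in> cball ctr (sqrt rad_sq) \<longleftrightarrow> (dist p ctr)\<^sup>2 \<le> rad_sq"
proof -
  have "p \<in> cball ctr (sqrt rad_sq) \<longleftrightarrow> sqrt ((dist p ctr)\<^sup>2) \<le> sqrt rad_sq" by (simp add: dist_commute)
  also have "\<dots> \<longleftrightarrow> (dist p ctr)\<^sup>2 \<le> rad_sq" by (rule real_sqrt_le_iff)
  finally show ?thesis .
qed

lemma side_map_saddle_pt: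
  assumes t: "\<bar>t\<bar> < time_bound" and x: "x $ j > 0"
  shows "side_map j (saddle_pt x t) = vec3 ((x $ 1 - cos t) * inv_width t) ((x $ 2 - cos (lam * t)) * inv_width t) (t * (4 / pi))"
proof -
  have b: "\<bar>rate j * t\<bar> < pi" using rate_time_bound[OF t, of j] by linarith
  have "Ln (saddle_pt x t $ j) = Complex (ln (x $ j)) (rate j * t)"
    unfolding saddle_pt_nth by (rule Ln_of_real_cis[OF x b])
  then have st: "side_time j (saddle_pt x t) = t" using rate_nz[of j] by (simp add: side_time_def)
  have "saddle_pt x t $ i * cis (- (rate i * t)) = complex_of_real (x $ i)" for i
    unfolding saddle_pt_nth by (simp only: mult.assoc cis_mult) simp
  then have "side_coord j i (saddle_pt x t) = (x $ i - cos (rate i * t)) * inv_width t" for i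
    unfolding side_coord_def st by (simp only: Re_complex_of_real)
  then show ?thesis by (simp add: side_map_def st)
qed

text \<open>On the hypersurface both side maps read off the same \<open>x\<close> and
  \<open>t\<close> wherever they apply. So either one is a valid smooth extension, and the case
  split in \<open>cap_to_ball\<close> creates no break.\<close>

lemma cap_to_ball_side:
  assumes p: "p \<in> saddle_hyp" and Re: "Re (p $ j) > 0"
  shows "cap_to_ball p = side_map j p"
proof -
  obtain x t where xt: "p = saddle_pt x t" "\<bar>t\<bar> < time_bound" using p by (rule saddle_hypD)
  note iff = Re_saddle_pt_pos_iff[OF xt(2), of x]
  have xj: "x $ j > 0" using Re iff[of j] by (simp only: xt(1))
  have eq: "side_map k p = side_map j p" if "x $ k > 0" for k
    unfolding xt(1) side_map_saddle_pt[OF xt(2) that] side_map_saddle_pt[OF xt(2) xj] ..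
  show ?thesis
  proof (cases "Re (p $ 1) > 0")
    case True
    then have "x $ 1 > 0" using iff[of 1] by (simp only: xt(1))
    from eq[OF this] True show ?thesis by (simp only: cap_to_ball_def if_True)
  next
    case False
    moreover have "j = 2" using False Re exhaust_2[of j] by auto
    ultimately show ?thesis by (simp only: cap_to_ball_def if_False)
  qed
qed

lemma cap_to_ball_saddle_pt:
  assumes "saddle_pt x t \<in> saddle_hyp" and t: "\<bar>t\<bar> < time_bound"
  shows "cap_to_ball (saddle_pt x t) = vec3 ((x $ 1 - cos t) * inv_width t) ((x $ 2 - cos (lam * t)) * inv_width t) (t * (4 / pi))"
proof -
  obtain i j :: 2 where ij: "i \<noteq> j" "Re (saddle_pt x t $ j) > 0"
    using saddle_hyp_side assms(1) saddle_hyp_big_ball by blast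
  then have "x $ j > 0" using Re_saddle_pt_pos_iff[OF t] by blast
  from side_map_saddle_pt[OF t this] cap_to_ball_side[OF assms(1) ij(2)] show ?thesis by simp
qed

text \<open>The defect from the radius is a positive multiple of
  \<open>1 - (norm y)\<^sup>2\<close>; hence the unit ball, its sphere and its exterior in the slab
  correspond to the inside, the boundary and the outside of the ball around
  \<open>ctr\<close>.\<close>

lemma ball_to_cap_dist:
  assumes "\<bar>y $ 3\<bar> < 2"
  shows "rad_sq - (dist (ball_to_cap y) ctr)\<^sup>2 =
    (pi / 4)\<^sup>2 * aspect (pi / 4 * y $ 3) * (1 - ((y $ 1)\<^sup>2 + (y $ 2)\<^sup>2 + (y $ 3)\<^sup>2))"
proof -
  define t where "t = pi / 4 * y $ 3"
  have "\<bar>t\<bar> < pi / 2" using assms by (simp add: t_def abs_mult)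
  then have q: "(sqrt (aspect t))\<^sup>2 = aspect t" using aspect_pos[of t] by simp
  have "(dist (ball_to_cap y) ctr)\<^sup>2 = (pi / 4 * sqrt (aspect t) * y $ 1)\<^sup>2 + (pi / 4 * sqrt (aspect t) * y $ 2)\<^sup>2 + heightsq t"
    unfolding ball_to_cap_def Let_def dist_saddle_pt t_def by simp
  also have "\<dots> = (pi / 4)\<^sup>2 * aspect t * ((y $ 1)\<^sup>2 + (y $ 2)\<^sup>2) + heightsq t"
    unfolding power_mult_distrib q by (simp add: algebra_simps)
  finally have d: "(dist (ball_to_cap y) ctr)\<^sup>2 = (pi / 4)\<^sup>2 * aspect t * ((y $ 1)\<^sup>2 + (y $ 2)\<^sup>2) + heightsq t" .
  have "heightsq t = rad_sq - ((pi / 4)\<^sup>2 - t\<^sup>2) * aspect t" using aspect_identity[of t] by simp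
  moreover have "t\<^sup>2 = (pi / 4)\<^sup>2 * (y $ 3)\<^sup>2" by (simp add: t_def power_mult_distrib power_divide)
  ultimately show ?thesis unfolding d t_def[symmetric] by (simp add: algebra_simps)
qed

lemma ball_to_cap_in:
  assumes y: "y \<in> cball 0 1"
  shows "ball_to_cap y \<in> closed_cap" and "cap_to_ball (ball_to_cap y) = y"
    and "y \<in> ball 0 1 \<Longrightarrow> ball_to_cap y \<in> cap"
proof -
  have y3: "(y $ 3)\<^sup>2 \<le> 1" using y zero_le_power2[of "y $ 1"] zero_le_power2[of "y $ 2"] unfolding cball_3_iff by linarith
  then have y3': "\<bar>y $ 3\<bar> \<le> 1" by (simp add: abs_square_le_1)
  define t where "t = pi / 4 * y $ 3"
  have t4: "\<bar>t\<bar> \<le> pi / 4" using y3' by (simp add: t_def abs_mult)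
  have t: "\<bar>t\<bar> < time_bound" using t4 time_bound_ge(1) pi_gt_zero by linarith
  have q: "aspect t > 0" using t4 pi_gt_zero by (intro aspect_pos) linarith
  have D: "rad_sq - (dist (ball_to_cap y) ctr)\<^sup>2 = (pi / 4)\<^sup>2 * aspect t * (1 - ((y $ 1)\<^sup>2 + (y $ 2)\<^sup>2 + (y $ 3)\<^sup>2))"
    using ball_to_cap_dist[of y] y3' by (simp add: t_def)
  have "(pi / 4)\<^sup>2 * aspect t * (1 - ((y $ 1)\<^sup>2 + (y $ 2)\<^sup>2 + (y $ 3)\<^sup>2)) \<ge> 0"
    using y q unfolding cball_3_iff by (intro mult_nonneg_nonneg) auto
  then have le: "(dist (ball_to_cap y) ctr)\<^sup>2 \<le> rad_sq" using D by linarith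
  let ?w = "pi / 4 * sqrt (aspect t)"
  have e: "ball_to_cap y = saddle_pt (vec2 (cos t + ?w * y $ 1) (cos (lam * t) + ?w * y $ 2)) t"
    by (simp add: ball_to_cap_def t_def Let_def)
  have "ball_to_cap y \<in> big_ball" using le rad_sq_bounds(2) by (simp add: big_ball_iff)
  then have M: "ball_to_cap y \<in> saddle_hyp" using e t unfolding saddle_hyp_def by blast
  then show "ball_to_cap y \<in> closed_cap" using le cball_ctr_iff by blast
  have w: "?w * inv_width t = 1" using q by (simp add: inv_width_def)
  have "cap_to_ball (ball_to_cap y) = vec3 (?w * y $ 1 * inv_width t) (?w * y $ 2 * inv_width t) (t * (4 / pi))"
    using cap_to_ball_saddle_pt[OF M[unfolded e] t] unfolding e by simp
  also have "\<dots> = y"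
  proof -
    have "?w * a * inv_width t = a" for a using w by (metis mult.assoc mult.commute mult_1)
    then show ?thesis by (simp add: vec_eq_iff forall_3 t_def)
  qed
  finally show "cap_to_ball (ball_to_cap y) = y" .
  assume "y \<in> ball 0 1"
  then have "(pi / 4)\<^sup>2 * aspect t * (1 - ((y $ 1)\<^sup>2 + (y $ 2)\<^sup>2 + (y $ 3)\<^sup>2)) > 0"
    using q unfolding ball_3_iff by (intro mult_pos_pos) auto
  then have "(dist (ball_to_cap y) ctr)\<^sup>2 < rad_sq" using D by linarith
  then show "ball_to_cap y \<in> cap" using M small_ball_iff by blast
qed

lemma cap_to_ball_in:
  assumes p: "p \<in> closed_cap"
  shows "cap_to_ball p \<in> cball 0 1" "ball_to_cap (cap_to_ball p) = p"
proof -
  have M: "p \<in> saddle_hyp" and d: "(dist p ctr)\<^sup>2 \<le> rad_sq" using p cball_ctr_iff by auto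
  obtain x t where xt: "p = saddle_pt x t" "\<bar>t\<bar> < time_bound" using M by (rule saddle_hypD)
  have "\<bar>t\<bar> < pi / 2" using xt(2) time_bound_ge(3) by linarith
  then have q: "aspect t > 0" by (rule aspect_pos)
  let ?w = "pi / 4 * sqrt (aspect t)"
  have w: "?w * inv_width t = 1" using q by (simp add: inv_width_def)
  have w2: "(pi / 4)\<^sup>2 * aspect t * (inv_width t)\<^sup>2 = 1"
  proof -
    have "(?w * inv_width t)\<^sup>2 = (pi / 4)\<^sup>2 * aspect t * (inv_width t)\<^sup>2"
      unfolding power_mult_distrib using q by simp
    then show ?thesis using w by simp
  qed
  have c: "cap_to_ball p = vec3 ((x $ 1 - cos t) * inv_width t) ((x $ 2 - cos (lam * t)) * inv_width t) (t * (4 / pi))"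
    using cap_to_ball_saddle_pt[OF M[unfolded xt(1)] xt(2)] by (simp only: xt(1))
  have e: "pi / 4 * (t * (4 / pi)) = t" by simp
  have ww: "?w * (a * inv_width t) = a" for a using w by (metis mult.assoc mult.commute mult_1)
  show inv: "ball_to_cap (cap_to_ball p) = p"
    unfolding c ball_to_cap_def Let_def vec3_nth e ww using vec2_eq[of x] xt(1) by simp
  have N: "(x $ 1 - cos t)\<^sup>2 + (x $ 2 - cos (lam * t))\<^sup>2 \<le> ((pi / 4)\<^sup>2 - t\<^sup>2) * aspect t"
    using d unfolding xt(1) dist_saddle_pt aspect_identity[symmetric] by linarith
  have "((x $ 1 - cos t)\<^sup>2 + (x $ 2 - cos (lam * t))\<^sup>2) * (inv_width t)\<^sup>2 \<le> ((pi / 4)\<^sup>2 - t\<^sup>2) * aspect t * (inv_width t)\<^sup>2"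
    by (rule mult_right_mono[OF N]) simp
  also have "\<dots> = (1 - (t * (4 / pi))\<^sup>2) * ((pi / 4)\<^sup>2 * aspect t * (inv_width t)\<^sup>2)"
    by (simp add: power2_eq_square field_simps)
  also have "\<dots> = 1 - (t * (4 / pi))\<^sup>2" unfolding w2 by simp
  finally show "cap_to_ball p \<in> cball 0 1"
    unfolding c cball_3_iff vec3_nth power_mult_distrib[of _ "inv_width t"] distrib_right by linarith
qed

lemma smooth_on_aspect:
  assumes "smooth_on f U"
  shows "smooth_on (\<lambda>x. aspect (f x)) U"
proof -
  have U: "open U" using assms by (simp add: smooth_on_def)
  note c = smooth_on_const[OF U]
  show ?thesis unfolding aspect_def
    by (intro smooth_on_add smooth_on_mult smooth_on_rsinc smooth_on_diff c assms)
qed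

lemma smooth_on_vec_component: "open U \<Longrightarrow> smooth_on (\<lambda>p. p $ i) U"
  by (rule smooth_on_linear[OF _ bounded_linear_vec_nth])

lemma smooth_on_side_map: "smooth_on (side_map j) {p. Re (p $ j) > 0}"
proof -
  let ?U = "{p :: complex ^ 2. Re (p $ j) > 0}"
  have U: "open ?U" by (rule open_Re_pos)
  have "smooth_on (\<lambda>p. Ln (p $ j)) ?U"
    by (rule smooth_on_holomorphic[OF smooth_on_vec_component[OF U], of Ln "{z. Re z > 0}"])
       (auto intro!: holomorphic_intros open_halfspace_Re_gt simp: complex_nonpos_Reals_iff)
  then have st: "smooth_on (side_time j) ?U"
    unfolding side_time_def[abs_def] divide_inverse
    by (intro smooth_on_mult smooth_on_const U smooth_on_linear_compose[OF _ bounded_linear_Im])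
  have pos: "aspect (side_time j p) > 0" if "p \<in> ?U" for p
  proof (rule aspect_pos)
    have "\<bar>Im (Ln (p $ j))\<bar> < pi / 2" using that Re_Ln_pos_lt[of "p $ j"] by fastforce
    moreover have "\<bar>side_time j p\<bar> \<le> \<bar>Im (Ln (p $ j))\<bar>"
      using exhaust_2[of j] lam_bounds by (auto simp: side_time_def divide_le_eq mult_le_cancel_left1)
    ultimately show "\<bar>side_time j p\<bar> < pi / 2" by linarith
  qed
  have w: "smooth_on (\<lambda>p. inv_width (side_time j p)) ?U"
    unfolding inv_width_def
  proof (rule smooth_on_inverse)
    show "smooth_on (\<lambda>p. pi / 4 * sqrt (aspect (side_time j p))) ?U"
      by (intro smooth_on_mult smooth_on_const U smooth_on_sqrt smooth_on_aspect st) (use pos in blast)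
    show "pi / 4 * sqrt (aspect (side_time j p)) \<noteq> 0" if "p \<in> ?U" for p using pos[OF that] by simp
  qed
  have sc: "smooth_on (side_coord j i) ?U" for i
    unfolding side_coord_def[abs_def]
    by (intro smooth_on_mult smooth_on_diff smooth_on_Re smooth_on_vec_component smooth_on_cis smooth_on_cos smooth_on_minus smooth_on_const U st w)
  show ?thesis
    unfolding side_map_def[abs_def] vec3_def
    by (intro smooth_on_add smooth_on_linear_compose[OF _ bounded_linear_axis] smooth_on_mult sc st smooth_on_const U)
qed

text \<open>The slab corresponds to \<open>\<bar>t\<bar> < pi / 2\<close>: an open neighborhood of
  the closed ball on which \<open>aspect\<close> is still positive, so that its square root is
  smooth.\<close>

lemma smooth_on_ball_to_cap: "smooth_on ball_to_cap {y. \<bar>y $ 3\<bar> < 2}"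
proof -
  let ?U = "{y :: real ^ 3. \<bar>y $ 3\<bar> < 2}"
  have U: "open ?U" by (intro open_Collect_less continuous_intros)
  have t: "smooth_on (\<lambda>y. pi / 4 * y $ 3) ?U" by (intro smooth_on_mult smooth_on_const smooth_on_vec_component U)
  have pos: "aspect (pi / 4 * y $ 3) > 0" if "y \<in> ?U" for y
    using that by (intro aspect_pos) (simp add: abs_mult)
  have w: "smooth_on (\<lambda>y. pi / 4 * sqrt (aspect (pi / 4 * y $ 3))) ?U"
    by (intro smooth_on_mult smooth_on_const U smooth_on_sqrt smooth_on_aspect t) (use pos in blast)
  have e: "ball_to_cap = (\<lambda>y. axis 1 (complex_of_real (cos (pi / 4 * y $ 3) + pi / 4 * sqrt (aspect (pi / 4 * y $ 3)) * y $ 1) * cis (rate 1 * (pi / 4 * y $ 3))) +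
      axis 2 (complex_of_real (cos (lam * (pi / 4 * y $ 3)) + pi / 4 * sqrt (aspect (pi / 4 * y $ 3)) * y $ 2) * cis (rate 2 * (pi / 4 * y $ 3))))"
    by (rule ext) (simp add: ball_to_cap_def Let_def vec_eq_iff forall_2 axis_def)
  show ?thesis
    unfolding e
    by (intro smooth_on_add smooth_on_linear_compose[OF _ bounded_linear_axis] smooth_on_mult[where 'b = complex] smooth_on_of_real
        smooth_on_cos smooth_on_cis smooth_on_mult[where 'b = real] smooth_on_const U w t smooth_on_vec_component)
qed

lemma cball_subset_slab: "cball (0 :: real ^ 3) 1 \<subseteq> {y. \<bar>y $ 3\<bar> < 2}"
proof
  fix y :: "real ^ 3" assume "y \<in> cball 0 1"
  then have "norm y \<le> 1" by simp
  then have "\<bar>y $ 3\<bar> \<le> 1" using component_le_norm_cart[of y 3] by linarith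
  then show "y \<in> {y. \<bar>y $ 3\<bar> < 2}" by simp
qed

lemma image_ball_to_cap: "ball_to_cap ` cball 0 1 = closed_cap"
proof
  show "ball_to_cap ` cball 0 1 \<subseteq> closed_cap" using ball_to_cap_in(1) by blast
  show "closed_cap \<subseteq> ball_to_cap ` cball 0 1" using cap_to_ball_in by (metis image_eqI subsetI)
qed

lemma image_cap_to_ball: "cap_to_ball ` closed_cap = cball 0 1"
proof
  show "cap_to_ball ` closed_cap \<subseteq> cball 0 1" using cap_to_ball_in(1) by blast
  show "cball 0 1 \<subseteq> cap_to_ball ` closed_cap" using ball_to_cap_in(1,2) by (metis image_eqI subsetI)
qed

lemma continuous_on_ball_to_cap: "continuous_on (cball 0 1) ball_to_cap"
  using smooth_on_imp_continuous_on[OF smooth_on_ball_to_cap] cball_subset_slab by (rule continuous_on_subset)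

lemma compact_closed_cap: "compact closed_cap"
  using compact_continuous_image[OF continuous_on_ball_to_cap compact_cball] unfolding image_ball_to_cap .

text \<open>That every point of the closed cap is a limit of the cap is not clear for a general
  intersection. Here density of the open ball in the closed one is carried over by
  \<open>ball_to_cap\<close>.\<close>

lemma closure_cap: "closure cap = closed_cap"
proof
  have "cap \<subseteq> closed_cap" unfolding small_ball_def using ball_subset_cball by blast
  then show "closure cap \<subseteq> closed_cap" by (rule closure_minimal[OF _ compact_imp_closed[OF compact_closed_cap]])
  have "ball_to_cap ` ball 0 1 \<subseteq> closure cap"
    using ball_to_cap_in(3) ball_subset_cball closure_subset by blast
  then have "ball_to_cap ` closure (ball 0 1) \<subseteq> closure cap"
    using continuous_on_ball_to_cap by (intro image_closure_subset) auto
  then show "closed_cap \<subseteq> closure cap" by (simp add: image_ball_to_cap)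
qed

lemma diffeomorphic_closed_cap: "diffeomorphic closed_cap (cball (0 :: real ^ 3) 1)"
  unfolding diffeomorphic_def
proof (intro exI[of _ cap_to_ball] exI[of _ ball_to_cap] conjI ballI)
  show "smooth_map_on cap_to_ball closed_cap"
    unfolding smooth_map_on_def
  proof
    fix p assume p: "p \<in> closed_cap"
    then obtain i j :: 2 where ij: "i \<noteq> j" "Re (p $ j) > 0" using saddle_hyp_side saddle_hyp_big_ball by blast
    show "\<exists>U F. open U \<and> p \<in> U \<and> (\<forall>k. Ck_on k F U) \<and> (\<forall>y\<in>closed_cap \<inter> U. F y = cap_to_ball y)"
    proof (intro exI[of _ "{p. Re (p $ j) > 0}"] exI[of _ "side_map j"] conjI ballI)
      show "\<forall>k. Ck_on k (side_map j) {p. Re (p $ j) > 0}" using smooth_on_side_map by (simp add: smooth_on_def)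
      show "side_map j y = cap_to_ball y" if "y \<in> closed_cap \<inter> {p. Re (p $ j) > 0}" for y
        using cap_to_ball_side[of y j] that by simp
    qed (use ij open_Re_pos in auto)
  qed
  show "smooth_map_on ball_to_cap (cball 0 1)"
    unfolding smooth_map_on_def
  proof
    fix y :: "real ^ 3" assume y: "y \<in> cball 0 1"
    show "\<exists>U F. open U \<and> y \<in> U \<and> (\<forall>k. Ck_on k F U) \<and> (\<forall>z\<in>cball 0 1 \<inter> U. F z = ball_to_cap z)"
      using smooth_on_ball_to_cap cball_subset_slab y unfolding smooth_on_def by blast
  qed
  show "cap_to_ball ` closed_cap = cball 0 1" by (rule image_cap_to_ball)
  show "ball_to_cap ` cball 0 1 = closed_cap" by (rule image_ball_to_cap)
qed (use cap_to_ball_in(2) ball_to_cap_in(2) in auto)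

lemma has_stein_neighborhood_basis_closed_cap: "has_stein_neighborhood_basis closed_cap"
  by (rule stein_basis_saddle_hyp[OF compact_closed_cap refl]) (use rad_sq_bounds in auto)

lemma open_ellipsoid_small_ball: "open_ellipsoid small_ball"
  unfolding open_ellipsoid_def
proof (intro exI conjI)
  let ?r = "sqrt rad_sq"
  have r: "?r > 0" using rad_sq_bounds by simp
  show "linear (\<lambda>x. ?r *\<^sub>R x)" by (rule linear_scaleR)
  have "bij (\<lambda>x :: complex ^ 2. r *\<^sub>R x)" if "r \<noteq> 0" for r :: real
    by (rule bij_betwI[of _ _ _ "\<lambda>x. inverse r *\<^sub>R x"]) (use that in auto)
  from this[of ?r] r show "bij (\<lambda>x :: complex ^ 2. ?r *\<^sub>R x)" by simp
  have "(\<lambda>x. ctr + ?r *\<^sub>R x) ` ball 0 1 = (+) ctr ` ((*\<^sub>R) ?r ` ball 0 1)" by (simp add: image_image)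
  also have "\<dots> = small_ball"
    using ball_scale[of ?r "0 :: complex ^ 2" 1] r by (simp add: small_ball_def)
  finally show "small_ball = (\<lambda>x. ctr + ?r *\<^sub>R x) ` ball 0 1" by simp
qed

section \<open>Transversality\<close>

lemma tangent_space_scaleR:
  assumes "v \<in> tangent_space S p"
  shows "a *\<^sub>R v \<in> tangent_space S p"
proof -
  obtain \<gamma> e where g: "0 < (e::real)" "\<gamma> 0 = p" "\<forall>t\<in>{-e<..<e}. \<gamma> t \<in> S" "(\<gamma> has_vector_derivative v) (at 0)"
    using assms unfolding tangent_space_def by blast
  \<comment> \<open>For \<open>a = 0\<close> the quotient \<open>e / \<bar>a\<bar>\<close> would be
    0 by convention and the interval empty; hence the denominator
    \<open>\<bar>a\<bar> + 1\<close>.\<close>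
  have ap: "\<bar>a\<bar> + 1 > 0" by simp
  have "((\<gamma> \<circ> (\<lambda>t. a * t)) has_vector_derivative a *\<^sub>R v) (at 0)"
    by (rule vector_diff_chain_at) (use g(4) in \<open>auto intro!: derivative_eq_intros\<close>)
  moreover have "\<gamma> (a * t) \<in> S" if t: "t \<in> {-(e / (\<bar>a\<bar> + 1))<..<e / (\<bar>a\<bar> + 1)}" for t
  proof -
    have "\<bar>t\<bar> < e / (\<bar>a\<bar> + 1)" using t by (simp add: abs_less_iff)
    then have "\<bar>t\<bar> * (\<bar>a\<bar> + 1) < e" by (simp add: less_divide_eq)
    moreover have "\<bar>a * t\<bar> \<le> \<bar>t\<bar> * (\<bar>a\<bar> + 1)" by (simp add: abs_mult algebra_simps)
    ultimately have "\<bar>a * t\<bar> < e" by linarith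
    then show ?thesis using g(3) by (simp add: abs_less_iff)
  qed
  ultimately show ?thesis
    unfolding tangent_space_def using g(1,2) ap
    by (intro CollectI exI[of _ "\<gamma> \<circ> (\<lambda>t. a * t)"] exI[of _ "e / (\<bar>a\<bar> + 1)"]) simp
qed

text \<open>The straight line through \<open>p\<close> in direction \<open>v\<close> is pushed back
  radially to the sphere. As \<open>v\<close> is orthogonal to the radius, the scaling factor
  \<open>f\<close> has derivative 0 at 0, so the velocity remains \<open>v\<close>.\<close>

lemma tangent_space_sphere:
  fixes p :: "'a::euclidean_space"
  assumes p: "p \<in> sphere c r" and r: "r > 0" and v: "v \<bullet> (p - c) = 0"
  shows "v \<in> tangent_space (sphere c r) p"
proof -
  let ?n = "p - c"
  have n: "norm ?n = r" using p by (simp add: dist_norm norm_minus_commute)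
  define f where "f = (\<lambda>s::real. inverse (sqrt (1 + (s * (norm v / r))\<^sup>2)))"
  define \<gamma> where "\<gamma> = (\<lambda>s. c + f s *\<^sub>R (?n + s *\<^sub>R v))"
  have pos: "1 + (s * (norm v / r))\<^sup>2 > 0" for s by (simp add: add_pos_nonneg)
  have nsq: "(norm (?n + s *\<^sub>R v))\<^sup>2 = r\<^sup>2 * (1 + (s * (norm v / r))\<^sup>2)" for s
  proof -
    have "(norm (n + s *\<^sub>R v))\<^sup>2 = (norm n)\<^sup>2 + 2 * s * (v \<bullet> n) + s\<^sup>2 * (norm v)\<^sup>2" for n :: 'a
      unfolding power2_norm_eq_inner inner_add_left inner_add_right
      by (simp add: inner_commute power2_eq_square algebra_simps)
    from this[of ?n] show ?thesis unfolding v n using r by (simp add: power_mult_distrib power_divide field_simps)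
  qed
  have on: "\<gamma> s \<in> sphere c r" for s
  proof -
    have "(norm (f s *\<^sub>R (?n + s *\<^sub>R v)))\<^sup>2 = (f s)\<^sup>2 * (r\<^sup>2 * (1 + (s * (norm v / r))\<^sup>2))"
      by (simp add: power_mult_distrib nsq)
    also have "\<dots> = r\<^sup>2" using pos[of s] by (simp add: f_def power_inverse)
    finally have "norm (f s *\<^sub>R (?n + s *\<^sub>R v)) = r" using r by (simp add: power2_eq_iff_nonneg)
    then show ?thesis by (simp add: \<gamma>_def dist_norm)
  qed
  have "(f has_real_derivative 0) (at 0)"
    unfolding f_def using r by (auto intro!: derivative_eq_intros)
  have lv: "((\<lambda>s. ?n + s *\<^sub>R v) has_vector_derivative v) (at 0)"
    by (auto intro!: derivative_eq_intros)
  have "((\<lambda>s. c + f s *\<^sub>R (?n + s *\<^sub>R v)) has_vector_derivative (0 + (f 0 *\<^sub>R v + 0 *\<^sub>R (?n + 0 *\<^sub>R v)))) (at 0)"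
    by (intro has_vector_derivative_add has_vector_derivative_const has_vector_derivative_scaleR[OF _ lv])
       (use \<open>(f has_real_derivative 0) (at 0)\<close> in simp)
  moreover have "f 0 = 1" by (simp add: f_def)
  ultimately have "(\<gamma> has_vector_derivative v) (at 0)" by (simp add: \<gamma>_def)
  moreover have "\<gamma> 0 = p" by (simp add: \<gamma>_def \<open>f 0 = 1\<close>)
  ultimately show ?thesis unfolding tangent_space_def using on by (intro CollectI exI[of _ \<gamma>] exI[of _ 1]) simp
qed

lemma smooth_on_saddle_pt_time: "smooth_on (saddle_pt x) UNIV"
proof -
  have e: "saddle_pt x = (\<lambda>t. axis 1 (complex_of_real (x $ 1) * cis (rate 1 * t)) + axis 2 (complex_of_real (x $ 2) * cis (rate 2 * t)))"
    by (rule ext) (simp add: vec_eq_iff forall_2 axis_def)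
  show ?thesis
    unfolding e
    by (intro smooth_on_add smooth_on_linear_compose[OF _ bounded_linear_axis] smooth_on_mult[where 'b = complex]
        smooth_on_cis smooth_on_mult[where 'b = real] smooth_on_const smooth_on_linear bounded_linear_ident open_UNIV)
qed

text \<open>Away from the centre of its slice, the point can move radially within the slice. At the
  centre the distance is stationary in the slice, but then it changes in time, because
  \<open>heightsq\<close> has nonzero derivative for \<open>t \<noteq> 0\<close>.\<close>

lemma transverse_direction:
  assumes p: "p \<in> saddle_hyp" and d: "(dist p ctr)\<^sup>2 = rad_sq"
  obtains u where "u \<in> tangent_space saddle_hyp p" "u \<bullet> (p - ctr) \<noteq> 0"
proof -
  obtain x t where xt: "p = saddle_pt x t" "\<bar>t\<bar> < time_bound" and pB: "p \<in> big_ball" using p by (rule saddle_hypD)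
  have curve: "\<exists>e>0. \<forall>s\<in>{-e<..<e}. \<gamma> s \<in> big_ball"
    if cont: "continuous_on UNIV \<gamma>" and start: "\<gamma> (0::real) \<in> big_ball" for \<gamma>
  proof -
    have "open (\<gamma> -` big_ball)" by (rule open_vimage[OF open_big_ball cont])
    then obtain e where "e > 0" "ball 0 e \<subseteq> \<gamma> -` big_ball" using start by (metis openE vimageI)
    then show ?thesis by (intro exI[of _ e]) (auto simp: ball_eq_greaterThanLessThan subset_iff)
  qed
  define c where "c = vec2 (cos t) (cos (lam * t))"
  show ?thesis
  proof (cases "x = c")
    case False
    define u where "u = saddle_pt (x - c) t"
    have line: "saddle_pt (x + s *\<^sub>R (x - c)) t = p + s *\<^sub>R u" for s by (simp add: saddle_pt_line u_def xt(1))
    have "continuous_on UNIV (\<lambda>s. p + s *\<^sub>R u)" by (intro continuous_intros)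
    from curve[OF this] pB obtain e where e: "e > 0" "\<forall>s\<in>{-e<..<e}. p + s *\<^sub>R u \<in> big_ball" by auto
    have "u \<in> tangent_space saddle_hyp p"
      unfolding tangent_space_def
    proof (intro CollectI exI conjI)
      show "0 < e" by (rule e)
      show "p + 0 *\<^sub>R u = p" by simp
      show "\<forall>s\<in>{-e<..<e}. p + s *\<^sub>R u \<in> saddle_hyp" using e(2) line xt(2) unfolding saddle_hyp_def by (metis (mono_tags, lifting) IntI mem_Collect_eq)
      show "((\<lambda>s. p + s *\<^sub>R u) has_vector_derivative u) (at 0)" by (auto intro!: derivative_eq_intros)
    qed
    moreover have "u \<bullet> (p - ctr) \<noteq> 0"
    proof -
      have N: "(norm (p + s *\<^sub>R u - ctr))\<^sup>2 = (1 + s)\<^sup>2 * ((x $ 1 - c $ 1)\<^sup>2 + (x $ 2 - c $ 2)\<^sup>2) + heightsq t" for s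
      proof -
        have "(norm (p + s *\<^sub>R u - ctr))\<^sup>2 = (dist (saddle_pt (x + s *\<^sub>R (x - c)) t) ctr)\<^sup>2" by (simp add: line dist_norm)
        also have "\<dots> = (1 + s)\<^sup>2 * ((x $ 1 - c $ 1)\<^sup>2 + (x $ 2 - c $ 2)\<^sup>2) + heightsq t"
          unfolding dist_saddle_pt by (simp add: c_def power2_eq_square algebra_simps)
        finally show ?thesis .
      qed
      \<comment> \<open>Polarisation: comparing the quadratic \<open>N\<close> at
        \<open>s = 1\<close> and \<open>s = - 1\<close> isolates its linear coefficient, which is
        twice the inner product.\<close>
      have "(norm (p + 1 *\<^sub>R u - ctr))\<^sup>2 - (norm (p + (-1) *\<^sub>R u - ctr))\<^sup>2 = 4 * (u \<bullet> (p - ctr))"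
        by (simp add: power2_norm_eq_inner inner_simps inner_commute algebra_simps)
      then have "u \<bullet> (p - ctr) = (x $ 1 - c $ 1)\<^sup>2 + (x $ 2 - c $ 2)\<^sup>2" unfolding N by simp
      moreover have "(x $ 1 - c $ 1)\<^sup>2 + (x $ 2 - c $ 2)\<^sup>2 \<noteq> 0"
        using False by (simp add: vec_eq_iff forall_2 sum_power2_eq_zero_iff)
      ultimately show ?thesis by simp
    qed
    ultimately show ?thesis by (rule that)
  next
    case True
    have "saddle_pt x differentiable (at t)" by (rule smooth_on_imp_differentiable[OF smooth_on_saddle_pt_time UNIV_I])
    then obtain u where u: "(saddle_pt x has_vector_derivative u) (at t)"
      using vector_derivative_works by blast
    have sh: "((\<lambda>s. saddle_pt x (t + s)) has_vector_derivative u) (at 0)"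
    proof -
      have "((saddle_pt x \<circ> (\<lambda>s. t + s)) has_vector_derivative 1 *\<^sub>R u) (at 0)"
        by (rule vector_diff_chain_at) (use u in \<open>auto intro!: derivative_eq_intros\<close>)
      then show ?thesis by (simp add: o_def)
    qed
    have "continuous_on UNIV (\<lambda>s. saddle_pt x (t + s))"
      by (intro continuous_on_compose2[OF continuous_on_saddle_pt_time] continuous_intros) auto
    from curve[OF this] pB xt(1) obtain e where e: "e > 0" "\<forall>s\<in>{-e<..<e}. saddle_pt x (t + s) \<in> big_ball" by auto
    define e' where "e' = min e (time_bound - \<bar>t\<bar>)"
    have e': "e' > 0" using e(1) xt(2) by (simp add: e'_def)
    have "u \<in> tangent_space saddle_hyp p"
      unfolding tangent_space_def
    proof (intro CollectI exI conjI)
      show "0 < e'" by (rule e')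
      show "saddle_pt x (t + 0) = p" by (simp add: xt(1))
      show "\<forall>s\<in>{-e'<..<e'}. saddle_pt x (t + s) \<in> saddle_hyp"
      proof
        fix s assume s: "s \<in> {-e'<..<e'}"
        then have "\<bar>t + s\<bar> < time_bound" by (auto simp: e'_def abs_less_iff)
        moreover have "saddle_pt x (t + s) \<in> big_ball" using s e(2) by (auto simp: e'_def)
        ultimately show "saddle_pt x (t + s) \<in> saddle_hyp" unfolding saddle_hyp_def by blast
      qed
      show "((\<lambda>s. saddle_pt x (t + s)) has_vector_derivative u) (at 0)" by (rule sh)
    qed
    moreover have "u \<bullet> (p - ctr) \<noteq> 0"
    proof -
      let ?N = "\<lambda>s. (x $ 1 - cos s)\<^sup>2 + (x $ 2 - cos (lam * s))\<^sup>2 + ((sin s)\<^sup>2 + (sin (lam * s))\<^sup>2)"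
      have xc: "x $ 1 = cos t" "x $ 2 = cos (lam * t)" using True by (simp_all add: c_def)
      have d1: "(?N has_real_derivative 2 * (sin t * cos t) + 2 * lam * (sin (lam * t) * cos (lam * t))) (at t)"
        by (auto intro!: derivative_eq_intros simp: xc power2_eq_square)
      have "((\<lambda>s. (saddle_pt x s - ctr) \<bullet> (saddle_pt x s - ctr)) has_derivative
          (\<lambda>h. (saddle_pt x t - ctr) \<bullet> (h *\<^sub>R u) + (h *\<^sub>R u) \<bullet> (saddle_pt x t - ctr))) (at t)"
        using u unfolding has_vector_derivative_def
        by (intro has_derivative_inner) (auto intro!: derivative_eq_intros)
      moreover have "(saddle_pt x s - ctr) \<bullet> (saddle_pt x s - ctr) = ?N s" for s
        using dist_saddle_pt[of x s] unfolding dist_norm power2_norm_eq_inner heightsq_def .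
      ultimately have "(?N has_derivative (\<lambda>h. h * (2 * (u \<bullet> (p - ctr))))) (at t)"
        by (simp add: xt(1) inner_commute algebra_simps)
      then have d2: "(?N has_real_derivative 2 * (u \<bullet> (p - ctr))) (at t)"
        by (simp add: has_field_derivative_def mult.commute[of "2 * (u \<bullet> (p - ctr))"] mult_commute_abs)
      have eq: "2 * (u \<bullet> (p - ctr)) = 2 * (sin t * cos t) + 2 * lam * (sin (lam * t) * cos (lam * t))"
        by (rule DERIV_unique[OF d2 d1])
      have c: "cos t > 0" "cos (lam * t) > 0" using cos_rate_pos[OF xt(2), of 1] cos_rate_pos[OF xt(2), of 2] by simp_all
      have b: "\<bar>t\<bar> < pi" "\<bar>lam * t\<bar> < pi" using rate_time_bound[OF xt(2), of 1] rate_time_bound[OF xt(2), of 2] pi_gt_zero by auto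
      have t0: "t \<noteq> 0"
      proof
        assume "t = 0"
        then have "(dist p ctr)\<^sup>2 = 0" unfolding xt(1) dist_saddle_pt xc heightsq_def by simp
        then show False using d rad_sq_bounds by simp
      qed
      have sq: "a * r * a > 0" if "r > 0" "a \<noteq> 0" for a r :: real
      proof -
        have "r * a\<^sup>2 > 0" using that by simp
        then show ?thesis by (simp add: power2_eq_square ac_simps)
      qed
      \<comment> \<open>Multiplying the derivative by \<open>t\<close> makes every term positive,
        whichever sign \<open>t\<close> has.\<close>
      have s: "sin t * t > 0" "sin (lam * t) * (lam * t) > 0"
          using rsinc_pos[OF b(1)] rsinc_pos[OF b(2)] t0 lam_pos
          unfolding sin_eq_rsinc[of t] sin_eq_rsinc[of "lam * t"] by (auto intro!: sq)
      have "0 < lam * (sin (lam * t) * t)" using s(2) by (simp add: ac_simps)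
      then have "sin (lam * t) * t > 0" by (rule zero_less_mult_pos[OF _ lam_pos])
      then have "sin (lam * t) * t * cos (lam * t) > 0" "sin t * t * cos t > 0" using s(1) c by simp_all
      then have "sin (lam * t) * cos (lam * t) * t > 0" "sin t * cos t * t > 0" by (simp_all add: ac_simps)
      then have "sin t * cos t * t + lam * (sin (lam * t) * cos (lam * t) * t) > 0"
        using mult_pos_pos[OF lam_pos] add_pos_pos by blast
      then have "2 * (u \<bullet> (p - ctr)) * t > 0" unfolding eq by (simp add: algebra_simps)
      then show ?thesis by auto
    qed
    ultimately show ?thesis by (rule that)
  qed
qed

text \<open>The tangent space of the sphere contains the whole hyperplane orthogonal to the radius,
  so a single tangent vector of the hypersurface off that hyperplane spans the rest.\<close>

lemma intersects_transversely_saddle_hyp: "intersects_transversely saddle_hyp (frontier small_ball)"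
  unfolding intersects_transversely_def
proof
  let ?r = "sqrt rad_sq"
  have r: "?r > 0" using rad_sq_bounds by simp
  have fr: "frontier small_ball = sphere ctr ?r" unfolding small_ball_def using r by simp
  fix p assume "p \<in> saddle_hyp \<inter> frontier small_ball"
  then have p: "p \<in> saddle_hyp" and ps: "p \<in> sphere ctr ?r" using fr by auto
  have "dist p ctr = ?r" using ps by (simp add: dist_commute)
  then have "(dist p ctr)\<^sup>2 = rad_sq" using rad_sq_bounds by simp
  then obtain u where u: "u \<in> tangent_space saddle_hyp p" "u \<bullet> (p - ctr) \<noteq> 0" using transverse_direction[OF p] by blast
  show "{u + v |u v. u \<in> tangent_space saddle_hyp p \<and> v \<in> tangent_space (frontier small_ball) p} = UNIV"
  proof (rule UNIV_eq_I[symmetric])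
    fix w :: "complex ^ 2"
    define a where "a = (w \<bullet> (p - ctr)) / (u \<bullet> (p - ctr))"
    have "(w - a *\<^sub>R u) \<bullet> (p - ctr) = 0" using u(2) by (simp add: a_def inner_diff_left)
    then have "w - a *\<^sub>R u \<in> tangent_space (frontier small_ball) p" unfolding fr by (rule tangent_space_sphere[OF ps r])
    moreover have "w = a *\<^sub>R u + (w - a *\<^sub>R u)" by simp
    ultimately show "w \<in> {u + v |u v. u \<in> tangent_space saddle_hyp p \<and> v \<in> tangent_space (frontier small_ball) p}"
      using tangent_space_scaleR[OF u(1), of a] by blast
  qed
qed

theorem theorem1p1:
  shows "\<exists>(B :: (complex ^ 2) set) (M :: (complex ^ 2) set).
    open_ellipsoid B \<and>
    real_analytic_hypersurface M \<and> levi_flat M \<and>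
    intersects_transversely M (frontier B) \<and>
    trivial_holonomy M \<and>
    (let A = M \<inter> B in
      closure A \<subseteq> M \<and>
      diffeomorphic (closure A) (cball (0 :: real ^ 3) 1) \<and>
      has_stein_neighborhood_basis (closure A) \<and>
      (\<forall>u :: complex ^ 2 \<Rightarrow> real.
        real_analytic_map_on u A \<and> (\<forall>L\<in>restricted_leaves M A. u constant_on L) \<longrightarrow>
        u constant_on A) \<and>
      (\<forall>U (v :: complex ^ 2 \<Rightarrow> real).
        open U \<and> connected U \<and> A \<subseteq> U \<and> pluriharmonic_on v U \<and> (\<forall>x\<in>A. v x = 0) \<longrightarrow>
        (\<forall>x\<in>U. v x = 0)))"
proof (rule exI[of _ small_ball], rule exI[of _ saddle_hyp], intro conjI)
  show "let A = cap in
      closure A \<subseteq> saddle_hyp \<and>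
      diffeomorphic (closure A) (cball (0 :: real ^ 3) 1) \<and>
      has_stein_neighborhood_basis (closure A) \<and>
      (\<forall>u :: complex ^ 2 \<Rightarrow> real.
        real_analytic_map_on u A \<and> (\<forall>L\<in>restricted_leaves saddle_hyp A. u constant_on L) \<longrightarrow>
        u constant_on A) \<and>
      (\<forall>U (v :: complex ^ 2 \<Rightarrow> real).
        open U \<and> connected U \<and> A \<subseteq> U \<and> pluriharmonic_on v U \<and> (\<forall>x\<in>A. v x = 0) \<longrightarrow>
        (\<forall>x\<in>U. v x = 0))"
    unfolding Let_def closure_cap
    using diffeomorphic_closed_cap has_stein_neighborhood_basis_closed_cap
      leafwise_constant_imp_constant pluriharmonic_vanishing_on_cap
    by (intro conjI allI impI ballI) (blast+)
qed (rule open_ellipsoid_small_ball real_analytic_hypersurface_saddle_hyp levi_flat_saddle_hyp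
    intersects_transversely_saddle_hyp trivial_holonomy_saddle_hyp)+

end
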